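(* Let $G=(G,S,g)$ be a free DD-graph monoid, let $\mathcal F_s(G)$ be the free symmetric (strict) monoidal category of isomorphism classes of anchored diagrams in $G$, and let $\mathbf S_M$ be the monoidal congruence relation on $\mathcal F_s(G)$ given by Markov surgeries. Then the quotient category $\mathcal F_s(G)/\mathbf S_M$, with the duplicates $\delta_a$ and discards $\epsilon_a$ and the graph monoid homomorphism $i_m:G\to\mathcal F_s(G)/\mathbf S_M$ described in the context, is the free Markov category over $G$. That is, $\mathcal F_s(G)/\mathbf S_M$ is a Markov category, $i_m$ matches duplicates and discards, and for every Markov category $\mathcal D$ and every graph monoid homomorphism $f:G\to\mathcal D$ matching duplicates and discards there is a Markov functor $F:\mathcal F_s(G)/\mathbf S_M\to\mathcal D$ with $f=F\circ i_m$, and $F$ is unique up to a unique monoidal natural isomorphism.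
   Context: **Markov categories.** A Markov category is a symmetric monoidal category $\mathcal C$ (unit $\mathbf I$, symmetry $\sigma$) in which every object $A$ has distinguished morphisms $\delta_A:A\to A\otimes A$ (duplicate) and $\epsilon_A:A\to\mathbf I$ (discard) such that (up to coherence isomorphisms): $(\delta_A\otimes 1_A)\delta_A=(1_A\otimes\delta_A)\delta_A$; $(1_A\otimes\epsilon_A)\delta_A=1_A=(\epsilon_A\otimes 1_A)\delta_A$; $\sigma_{AA}\delta_A=\delta_A$; $\delta_{A\otimes B}=(1_A\otimes\sigma_{A B}\otimes 1_B)(\delta_A\otimes\delta_B)$, where here $\sigma_{AB}$ denotes the symmetry $A\otimes B\to B\otimes A$; $\epsilon_{A\otimes B}=\epsilon_A\otimes\epsilon_B$; and $\epsilon_B\circ f=\epsilon_A$ for all $f:A\to B$. A Markov functor is a strong symmetric monoidal functor $F$ preserving duplicates and discards: $F\delta_A$ equals $\delta_{FA}$ followed by the structure isomorphism $FA\otimes FA\cong F(A\otimes A)$, and $F\epsilon_A$ equals $\epsilon_{FA}$ followed by $\mathbf I\cong F\mathbf I$. **Graph monoids.** A graph monoid is a directed graph whose vertex set is a monoid; a homomorphism is a graph homomorphism that is a monoid homomorphism on vertices. A free graph monoid $(G,S,g)$ is a graph monoid whose vertex monoid is the free monoid $W(S)$ of words on $S$ (via the injection $g:S\to V(G)$; $\emptyset$ is the empty word). It is a free DD-graph monoid if for every $a\in S$ there are distinguished arrows $a\to aa$ (the duplicate on $a$) and $a\to\emptyset$ (the discard on $a$). $A(G)$ is the set of arrows. A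 graph monoid homomorphism $f:G\to\mathcal D$ to a monoidal category sends letters to objects, words to the corresponding monoidal products (left-bracketed if $\mathcal D$ is not strict), and arrows to morphisms between these. It matches duplicates and discards if it sends the duplicate and discard on $a$ to $\delta_{f(a)},\epsilon_{f(a)}$ for each $a\in S$. For a strong monoidal functor $F$ and such a homomorphism $i$, $F\circ i$ is the homomorphism with $a\mapsto F(i(a))$ for $a\in S$ and sending an arrow $k$ to $F(i(k))$ composed with the structure isomorphisms of $F$ so as to go between monoidal products of the objects $F(i(a))$. "Unique up to a unique monoidal natural isomorphism" means: for any two such $F,F'$ there is a unique monoidal natural isomorphism $F\cong F'$ whose components at the objects $i(a)$, $a\in S$, are identities. **Graphs.** A graph $\Gamma$ (finite, acyclic, polarized) has a finite set $\Gamma_0$ of (inner) nodes and a finite set $\Gamma_1$ of oriented edges, each a copy of an open interval. The source $e(0)$ and target $e(1)$ of an edge $e$ are each either an inner node or an outer node (a free end, not belonging to $\Gamma$; each outer node is an end of exactly one edge). There are no directed circuits. For each $x\in\Gamma_0$ the sets $\mathrm{in}(x)$ of edges with target $x$ and $\mathrm{out}(x)$ of edges with source $x$ are totally ordered. An edge is pinned, half-loose, or loose if two, one, or none of its ends are inner nodes. $\mathrm{dom}(\Gamma)$ is the set of edges whose source is outer, $\mathrm{cod}(\Gamma)$ that of edges whose target is outer. $\Gamma$ is anchored if these two sets are totally ordered. Isomorphisms preserve all the structure (including anchoring for anchored graphs). A subgraph $\Gamma'$ consists of some nodes and some edges of $\Gamma$; ends of its edges not in $\Gamma'_0$ become outer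 nodes of $\Gamma'$. **Diagrams.** A diagram $(\Gamma,v)$ in $G$ is a graph with a valuation $v$: edges are mapped to letters in $S$ and each node $x$ with $\mathrm{in}(x)=(a_1,\dots,a_n)$, $\mathrm{out}(x)=(b_1,\dots,b_m)$ to an arrow $v(a_1)\cdots v(a_n)\to v(b_1)\cdots v(b_m)$ in $A(G)$. If $\Gamma$ is anchored, $\mathrm{dom}(\Gamma,v)$ and $\mathrm{cod}(\Gamma,v)$ are the words read off along $\mathrm{dom}(\Gamma)$ and $\mathrm{cod}(\Gamma)$. Isomorphisms of diagrams are isomorphisms of graphs compatible with valuations. $\mathcal F_s(G)$ has objects $W(S)$ and morphisms the isomorphism classes $[\Gamma,v]:\mathrm{dom}(\Gamma,v)\to\mathrm{cod}(\Gamma,v)$ of anchored diagrams; composition is gluing codomain to domain edges in order, $\otimes$ is disjoint union, and identities and symmetries are given by diagrams without nodes. $i_s:G\to\mathcal F_s(G)$ is the identity on words and sends an arrow to the diagram with one node having that value. **Surgery.** A subgraph $\Gamma'\subseteq\Gamma$ is normal if (i) no directed path in $\Gamma$ contains two distinct edges of $\Gamma'$ one of which is loose in $\Gamma'$; (ii) all edges of $\Gamma$ at a node of $\Gamma'$ are in $\Gamma'$; (iii) every directed path in $\Gamma$ from a node of $\Gamma'$ to a node of $\Gamma'$ lies in $\Gamma'$. A template $((\Omega,u)/(\Lambda,w),\alpha,\beta)$ consists of two (not anchored) diagrams in $G$ and value-preserving bijections $\alpha:\mathrm{dom}(\Lambda)\to\mathrm{dom}(\Omega)$, $\beta:\mathrm{cod}(\Lambda)\to\mathrm{cod}(\Omega)$.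 Given an anchored diagram $(\Gamma,v)$, a normal subgraph $\Gamma'$ and an isomorphism of diagrams $\phi:(\Omega,u)\to(\Gamma',v|_{\Gamma'})$, the surgery on $(\Gamma,v)$ replaces $\Gamma'$ by $\Lambda$: each $e\in\mathrm{dom}(\Lambda)$ takes over the source (and the position in the relevant ordering) in $\Gamma$ of $\phi(\alpha(e))$, each $e\in\mathrm{cod}(\Lambda)$ takes over the target (and position) in $\Gamma$ of $\phi(\beta(e))$, where loose edges of $\Gamma'$ are first duplicated, one copy counting as in $\mathrm{dom}(\Gamma')$ and one in $\mathrm{cod}(\Gamma')$; everything else of $\Gamma'$ is deleted. **Markov templates.** For each $a\in S$ (all edges valued $a$; $d$-nodes carry the duplicate on $a$, $e$-nodes the discard on $a$) and each $f\in A(G)$: - coassociativity: $\Lambda$ is a $d$-node whose first output edge enters a second $d$-node; $\Omega$ is a $d$-node whose second output edge enters a second $d$-node; $\alpha$ matches the input edges, $\beta$ matches the three output edges in left-to-right order; - left (right) counitality: $\Lambda$ is a single loose edge; $\Omega$ is a $d$-node whose second (resp. first) output edge ends in an $e$-node; $\alpha,\beta$ are the unique bijections; - cocommutativity: $\Lambda$ and $\Omega$ are both a single $d$-node, $\alpha$ matches inputs, $\beta$ matches the first output of one with the second output of the other and vice versa; - naturality of discard, for $f:x_1\cdots x_k\to y_1\cdots y_m$: $\Omega$ is a node valued $f$ each of whose $m$ output edges ends in a node valued with the discard on $y_j$; $\Lambda$ consists of $k$ disjoint input edges ending in discards on $x_1,\dots,x_k$; $\alpha$ matches the $i$-th inputs;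 together with all templates obtained by exchanging $\Lambda$ and $\Omega$ (and inverting $\alpha,\beta$), and the empty template. Surgeries with these templates are Markov surgeries. $\mathbf S_M$ is the relation on morphisms of $\mathcal F_s(G)$: $[\Gamma]\sim[\Upsilon]$ iff there is a finite sequence of anchored diagrams from $\Gamma$ to $\Upsilon$ in which each term is isomorphic to the result of a Markov surgery on the preceding one. It is a monoidal congruence. **Structure on the quotient.** $i_m$ is $i_s$ followed by the quotient map. For a word $a=a_1\cdots a_n$, $\delta_a:a\to aa$ is the class of the diagram obtained from the disjoint duplicates on $a_1,\dots,a_n$ by connecting, for each $i$, the two outputs of the $i$-th duplicate to the $i$-th letters of the two copies of $a$ in the codomain (the class is independent of the order in which the two outputs are connected), and $\epsilon_a=\bigotimes_i\epsilon_{a_i}$. *)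

theory Defs
  imports Main
begin

section \<open>Markov categories\<close>

record ('o, 'm) cat =
  Obj :: "'o set"
  Arr :: "'m set"
  Dom :: "'m \<Rightarrow> 'o"
  Cod :: "'m \<Rightarrow> 'o"
  Idn :: "'o \<Rightarrow> 'm"
  Cmp :: "'m \<Rightarrow> 'm \<Rightarrow> 'm"  (infixr "\<cdot>\<index>" 65)

text \<open>\<open>g \<cdot> f\<close> is \<open>g\<close> after \<open>f\<close>.\<close>

record ('o, 'm) mon_cat = "('o, 'm) cat" +
  TObj :: "'o \<Rightarrow> 'o \<Rightarrow> 'o"  (infixr "\<otimes>\<index>" 75)
  TArr :: "'m \<Rightarrow> 'm \<Rightarrow> 'm"  (infixr "\<odot>\<index>" 70)
  Unit :: 'o  ("\<one>\<index>")
  Assoc :: "'o \<Rightarrow> 'o \<Rightarrow> 'o \<Rightarrow> 'm"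
  LUnit :: "'o \<Rightarrow> 'm"
  RUnit :: "'o \<Rightarrow> 'm"

record ('o, 'm) sym_cat = "('o, 'm) mon_cat" +
  Sym :: "'o \<Rightarrow> 'o \<Rightarrow> 'm"

record ('o, 'm) markov_cat = "('o, 'm) sym_cat" +
  Dup :: "'o \<Rightarrow> 'm"
  Disc :: "'o \<Rightarrow> 'm"

definition Hom :: "('o, 'm, 'z) cat_scheme \<Rightarrow> 'o \<Rightarrow> 'o \<Rightarrow> 'm set" where
  "Hom C X Y = {f \<in> Arr C. Dom C f = X \<and> Cod C f = Y}"

definition is_inverse :: "('o, 'm, 'z) cat_scheme \<Rightarrow> 'm \<Rightarrow> 'm \<Rightarrow> bool" where
  "is_inverse C f g \<longleftrightarrow> f \<in> Arr C \<and> g \<in> Hom C (Cod C f) (Dom C f) \<and>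
     g \<cdot>\<^bsub>C\<^esub> f = Idn C (Dom C f) \<and> f \<cdot>\<^bsub>C\<^esub> g = Idn C (Cod C f)"

definition is_iso :: "('o, 'm, 'z) cat_scheme \<Rightarrow> 'm \<Rightarrow> bool" where
  "is_iso C f \<longleftrightarrow> (\<exists>g. is_inverse C f g)"

definition Inv :: "('o, 'm, 'z) cat_scheme \<Rightarrow> 'm \<Rightarrow> 'm" where
  "Inv C f = (THE g. is_inverse C f g)"

locale category =
  fixes C :: "('o, 'm, 'z) cat_scheme" (structure)
  assumes dom_obj: "f \<in> Arr C \<Longrightarrow> Dom C f \<in> Obj C"
    and cod_obj: "f \<in> Arr C \<Longrightarrow> Cod C f \<in> Obj C"
    and id_hom: "X \<in> Obj C \<Longrightarrow> Idn C X \<in> Hom C X X"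
    and comp_hom: "f \<in> Hom C X Y \<Longrightarrow> g \<in> Hom C Y Z \<Longrightarrow> g \<cdot> f \<in> Hom C X Z"
    and comp_id_left: "f \<in> Hom C X Y \<Longrightarrow> Idn C Y \<cdot> f = f"
    and comp_id_right: "f \<in> Hom C X Y \<Longrightarrow> f \<cdot> Idn C X = f"
    and comp_assoc: "f \<in> Hom C W X \<Longrightarrow> g \<in> Hom C X Y \<Longrightarrow> h \<in> Hom C Y Z \<Longrightarrow>
      (h \<cdot> g) \<cdot> f = h \<cdot> (g \<cdot> f)"

locale monoidal_category = category C
  for C :: "('o, 'm, 'z) mon_cat_scheme" (structure) +
  assumes unit_obj: "\<one> \<in> Obj C"
    and tensor_obj: "X \<in> Obj C \<Longrightarrow> Y \<in> Obj C \<Longrightarrow> X \<otimes> Y \<in> Obj C"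
    and tensor_hom: "f \<in> Hom C X Y \<Longrightarrow> f' \<in> Hom C X' Y' \<Longrightarrow> f \<odot> f' \<in> Hom C (X \<otimes> X') (Y \<otimes> Y')"
    and tensor_id: "X \<in> Obj C \<Longrightarrow> Y \<in> Obj C \<Longrightarrow> Idn C X \<odot> Idn C Y = Idn C (X \<otimes> Y)"
    and tensor_comp: "f \<in> Hom C X Y \<Longrightarrow> g \<in> Hom C Y Z \<Longrightarrow>
      f' \<in> Hom C X' Y' \<Longrightarrow> g' \<in> Hom C Y' Z' \<Longrightarrow>
      (g \<cdot> f) \<odot> (g' \<cdot> f') = (g \<odot> g') \<cdot> (f \<odot> f')"
    and assoc_hom: "X \<in> Obj C \<Longrightarrow> Y \<in> Obj C \<Longrightarrow> Z \<in> Obj C \<Longrightarrow>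
      Assoc C X Y Z \<in> Hom C ((X \<otimes> Y) \<otimes> Z) (X \<otimes> (Y \<otimes> Z))"
    and assoc_iso: "X \<in> Obj C \<Longrightarrow> Y \<in> Obj C \<Longrightarrow> Z \<in> Obj C \<Longrightarrow> is_iso C (Assoc C X Y Z)"
    and assoc_natural: "f \<in> Hom C X X' \<Longrightarrow> g \<in> Hom C Y Y' \<Longrightarrow> h \<in> Hom C Z Z' \<Longrightarrow>
      Assoc C X' Y' Z' \<cdot> ((f \<odot> g) \<odot> h) = (f \<odot> (g \<odot> h)) \<cdot> Assoc C X Y Z"
    and lunit_hom: "X \<in> Obj C \<Longrightarrow> LUnit C X \<in> Hom C (\<one> \<otimes> X) X"
    and lunit_iso: "X \<in> Obj C \<Longrightarrow> is_iso C (LUnit C X)"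
    and lunit_natural: "f \<in> Hom C X Y \<Longrightarrow> LUnit C Y \<cdot> (Idn C \<one> \<odot> f) = f \<cdot> LUnit C X"
    and runit_hom: "X \<in> Obj C \<Longrightarrow> RUnit C X \<in> Hom C (X \<otimes> \<one>) X"
    and runit_iso: "X \<in> Obj C \<Longrightarrow> is_iso C (RUnit C X)"
    and runit_natural: "f \<in> Hom C X Y \<Longrightarrow> RUnit C Y \<cdot> (f \<odot> Idn C \<one>) = f \<cdot> RUnit C X"
    and pentagon: "W \<in> Obj C \<Longrightarrow> X \<in> Obj C \<Longrightarrow> Y \<in> Obj C \<Longrightarrow> Z \<in> Obj C \<Longrightarrow>
      Assoc C W X (Y \<otimes> Z) \<cdot> Assoc C (W \<otimes> X) Y Z =
      (Idn C W \<odot> Assoc C X Y Z) \<cdot> Assoc C W (X \<otimes> Y) Z \<cdot> (Assoc C W X Y \<odot> Idn C Z)"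
    and triangle: "X \<in> Obj C \<Longrightarrow> Y \<in> Obj C \<Longrightarrow>
      (Idn C X \<odot> LUnit C Y) \<cdot> Assoc C X \<one> Y = RUnit C X \<odot> Idn C Y"

locale symmetric_monoidal_category = monoidal_category C
  for C :: "('o, 'm, 'z) sym_cat_scheme" (structure) +
  assumes sym_hom: "X \<in> Obj C \<Longrightarrow> Y \<in> Obj C \<Longrightarrow> Sym C X Y \<in> Hom C (X \<otimes> Y) (Y \<otimes> X)"
    and sym_natural: "f \<in> Hom C X X' \<Longrightarrow> g \<in> Hom C Y Y' \<Longrightarrow>
      Sym C X' Y' \<cdot> (f \<odot> g) = (g \<odot> f) \<cdot> Sym C X Y"
    and sym_sym: "X \<in> Obj C \<Longrightarrow> Y \<in> Obj C \<Longrightarrow> Sym C Y X \<cdot> Sym C X Y = Idn C (X \<otimes> Y)"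
    and hexagon: "X \<in> Obj C \<Longrightarrow> Y \<in> Obj C \<Longrightarrow> Z \<in> Obj C \<Longrightarrow>
      Assoc C Y Z X \<cdot> Sym C X (Y \<otimes> Z) \<cdot> Assoc C X Y Z =
      (Idn C Y \<odot> Sym C X Z) \<cdot> Assoc C Y X Z \<cdot> (Sym C X Y \<odot> Idn C Z)"

text \<open>\<open>1 \<otimes> \<sigma> \<otimes> 1 : (X \<otimes> X) \<otimes> (Y \<otimes> Y) \<rightarrow> (X \<otimes> Y) \<otimes> (X \<otimes> Y)\<close> with the associators written out.\<close>

definition mid_swap :: "('o, 'm, 'z) sym_cat_scheme \<Rightarrow> 'o \<Rightarrow> 'o \<Rightarrow> 'm" where
  "mid_swap C X Y =
     Inv C (Assoc C X Y (X \<otimes>\<^bsub>C\<^esub> Y)) \<cdot>\<^bsub>C\<^esub>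
     (Idn C X \<odot>\<^bsub>C\<^esub> Assoc C Y X Y) \<cdot>\<^bsub>C\<^esub>
     (Idn C X \<odot>\<^bsub>C\<^esub> (Sym C X Y \<odot>\<^bsub>C\<^esub> Idn C Y)) \<cdot>\<^bsub>C\<^esub>
     (Idn C X \<odot>\<^bsub>C\<^esub> Inv C (Assoc C X Y Y)) \<cdot>\<^bsub>C\<^esub>
     Assoc C X X (Y \<otimes>\<^bsub>C\<^esub> Y)"

locale markov_category = symmetric_monoidal_category C
  for C :: "('o, 'm, 'z) markov_cat_scheme" (structure) +
  assumes dup_hom: "X \<in> Obj C \<Longrightarrow> Dup C X \<in> Hom C X (X \<otimes> X)"
    and disc_hom: "X \<in> Obj C \<Longrightarrow> Disc C X \<in> Hom C X \<one>"
    and coassoc: "X \<in> Obj C \<Longrightarrow>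
      Assoc C X X X \<cdot> (Dup C X \<odot> Idn C X) \<cdot> Dup C X = (Idn C X \<odot> Dup C X) \<cdot> Dup C X"
    and counit_right: "X \<in> Obj C \<Longrightarrow> RUnit C X \<cdot> (Idn C X \<odot> Disc C X) \<cdot> Dup C X = Idn C X"
    and counit_left: "X \<in> Obj C \<Longrightarrow> LUnit C X \<cdot> (Disc C X \<odot> Idn C X) \<cdot> Dup C X = Idn C X"
    and cocomm: "X \<in> Obj C \<Longrightarrow> Sym C X X \<cdot> Dup C X = Dup C X"
    and dup_tensor: "X \<in> Obj C \<Longrightarrow> Y \<in> Obj C \<Longrightarrow>
      Dup C (X \<otimes> Y) = mid_swap C X Y \<cdot> (Dup C X \<odot> Dup C Y)"
    and disc_tensor: "X \<in> Obj C \<Longrightarrow> Y \<in> Obj C \<Longrightarrow>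
      Disc C (X \<otimes> Y) = LUnit C \<one> \<cdot> (Disc C X \<odot> Disc C Y)"
    and disc_natural: "f \<in> Hom C X Y \<Longrightarrow> Disc C Y \<cdot> f = Disc C X"

record ('o1, 'm1, 'o2, 'm2) mon_functor =
  FObj :: "'o1 \<Rightarrow> 'o2"
  FArr :: "'m1 \<Rightarrow> 'm2"
  FTens :: "'o1 \<Rightarrow> 'o1 \<Rightarrow> 'm2"
  FUnit :: 'm2

text \<open>The structure isomorphisms are \<open>FTens F X Y : F X \<otimes> F Y \<rightarrow> F (X \<otimes> Y)\<close> and \<open>FUnit F : \<one> \<rightarrow> F \<one>\<close>.\<close>

locale monoidal_functor =
  fixes C :: "('o1, 'm1, 'y) mon_cat_scheme" and D :: "('o2, 'm2, 'z) mon_cat_scheme"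
    and F :: "('o1, 'm1, 'o2, 'm2) mon_functor"
  assumes obj: "X \<in> Obj C \<Longrightarrow> FObj F X \<in> Obj D"
    and hom: "f \<in> Hom C X Y \<Longrightarrow> FArr F f \<in> Hom D (FObj F X) (FObj F Y)"
    and ident: "X \<in> Obj C \<Longrightarrow> FArr F (Idn C X) = Idn D (FObj F X)"
    and comp: "f \<in> Hom C X Y \<Longrightarrow> g \<in> Hom C Y Z \<Longrightarrow> FArr F (g \<cdot>\<^bsub>C\<^esub> f) = FArr F g \<cdot>\<^bsub>D\<^esub> FArr F f"
    and tens_hom: "X \<in> Obj C \<Longrightarrow> Y \<in> Obj C \<Longrightarrow>
      FTens F X Y \<in> Hom D (FObj F X \<otimes>\<^bsub>D\<^esub> FObj F Y) (FObj F (X \<otimes>\<^bsub>C\<^esub> Y))"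
    and tens_iso: "X \<in> Obj C \<Longrightarrow> Y \<in> Obj C \<Longrightarrow> is_iso D (FTens F X Y)"
    and tens_natural: "f \<in> Hom C X X' \<Longrightarrow> g \<in> Hom C Y Y' \<Longrightarrow>
      FTens F X' Y' \<cdot>\<^bsub>D\<^esub> (FArr F f \<odot>\<^bsub>D\<^esub> FArr F g) = FArr F (f \<odot>\<^bsub>C\<^esub> g) \<cdot>\<^bsub>D\<^esub> FTens F X Y"
    and unit_hom: "FUnit F \<in> Hom D \<one>\<^bsub>D\<^esub> (FObj F \<one>\<^bsub>C\<^esub>)"
    and unit_iso: "is_iso D (FUnit F)"
    and assoc: "X \<in> Obj C \<Longrightarrow> Y \<in> Obj C \<Longrightarrow> Z \<in> Obj C \<Longrightarrow>
      FArr F (Assoc C X Y Z) \<cdot>\<^bsub>D\<^esub> FTens F (X \<otimes>\<^bsub>C\<^esub> Y) Z \<cdot>\<^bsub>D\<^esub> (FTens F X Y \<odot>\<^bsub>D\<^esub> Idn D (FObj F Z)) =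
      FTens F X (Y \<otimes>\<^bsub>C\<^esub> Z) \<cdot>\<^bsub>D\<^esub> (Idn D (FObj F X) \<odot>\<^bsub>D\<^esub> FTens F Y Z)
        \<cdot>\<^bsub>D\<^esub> Assoc D (FObj F X) (FObj F Y) (FObj F Z)"
    and lunit: "X \<in> Obj C \<Longrightarrow>
      FArr F (LUnit C X) \<cdot>\<^bsub>D\<^esub> FTens F \<one>\<^bsub>C\<^esub> X \<cdot>\<^bsub>D\<^esub> (FUnit F \<odot>\<^bsub>D\<^esub> Idn D (FObj F X)) = LUnit D (FObj F X)"
    and runit: "X \<in> Obj C \<Longrightarrow>
      FArr F (RUnit C X) \<cdot>\<^bsub>D\<^esub> FTens F X \<one>\<^bsub>C\<^esub> \<cdot>\<^bsub>D\<^esub> (Idn D (FObj F X) \<odot>\<^bsub>D\<^esub> FUnit F) = RUnit D (FObj F X)"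

locale markov_functor = monoidal_functor C D F
  for C :: "('o1, 'm1, 'y) markov_cat_scheme" and D :: "('o2, 'm2, 'z) markov_cat_scheme"
    and F :: "('o1, 'm1, 'o2, 'm2) mon_functor" +
  assumes sym: "X \<in> Obj C \<Longrightarrow> Y \<in> Obj C \<Longrightarrow>
      FArr F (Sym C X Y) \<cdot>\<^bsub>D\<^esub> FTens F X Y = FTens F Y X \<cdot>\<^bsub>D\<^esub> Sym D (FObj F X) (FObj F Y)"
    and dup: "X \<in> Obj C \<Longrightarrow> FArr F (Dup C X) = FTens F X X \<cdot>\<^bsub>D\<^esub> Dup D (FObj F X)"
    and disc: "X \<in> Obj C \<Longrightarrow> FArr F (Disc C X) = FUnit F \<cdot>\<^bsub>D\<^esub> Disc D (FObj F X)"

locale monoidal_natural_iso =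
  fixes C :: "('o1, 'm1, 'y) mon_cat_scheme" and D :: "('o2, 'm2, 'z) mon_cat_scheme"
    and F F' :: "('o1, 'm1, 'o2, 'm2) mon_functor"
    and \<theta> :: "'o1 \<Rightarrow> 'm2"
  assumes hom: "X \<in> Obj C \<Longrightarrow> \<theta> X \<in> Hom D (FObj F X) (FObj F' X)"
    and iso: "X \<in> Obj C \<Longrightarrow> is_iso D (\<theta> X)"
    and natural: "f \<in> Hom C X Y \<Longrightarrow> \<theta> Y \<cdot>\<^bsub>D\<^esub> FArr F f = FArr F' f \<cdot>\<^bsub>D\<^esub> \<theta> X"
    and tens: "X \<in> Obj C \<Longrightarrow> Y \<in> Obj C \<Longrightarrow>
      \<theta> (X \<otimes>\<^bsub>C\<^esub> Y) \<cdot>\<^bsub>D\<^esub> FTens F X Y = FTens F' X Y \<cdot>\<^bsub>D\<^esub> (\<theta> X \<odot>\<^bsub>D\<^esub> \<theta> Y)"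
    and unit: "\<theta> \<one>\<^bsub>C\<^esub> \<cdot>\<^bsub>D\<^esub> FUnit F = FUnit F'"


section \<open>Graph monoids\<close>

text \<open>A free graph monoid on a set \<open>S = Letters G\<close>: its vertices are the words on \<open>S\<close>, i.e. the elements
  of \<open>lists S\<close>, with concatenation, and \<open>g\<close> sends \<open>a\<close> to \<open>[a]\<close>.\<close>

record ('s, 'a) graph_monoid =
  Letters :: "'s set"
  Arrows :: "'a set"
  ASrc :: "'a \<Rightarrow> 's list"
  ATgt :: "'a \<Rightarrow> 's list"

record ('s, 'a) dd_graph_monoid = "('s, 'a) graph_monoid" +
  ADup :: "'s \<Rightarrow> 'a"
  ADisc :: "'s \<Rightarrow> 'a"

definition free_graph_monoid :: "('s, 'a, 'z) graph_monoid_scheme \<Rightarrow> bool" where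
  "free_graph_monoid G \<longleftrightarrow>
     (\<forall>k \<in> Arrows G. ASrc G k \<in> lists (Letters G) \<and> ATgt G k \<in> lists (Letters G))"

definition free_dd_graph_monoid :: "('s, 'a, 'z) dd_graph_monoid_scheme \<Rightarrow> bool" where
  "free_dd_graph_monoid G \<longleftrightarrow> free_graph_monoid G \<and>
     (\<forall>a \<in> Letters G.
        ADup G a \<in> Arrows G \<and> ASrc G (ADup G a) = [a] \<and> ATgt G (ADup G a) = [a, a] \<and>
        ADisc G a \<in> Arrows G \<and> ASrc G (ADisc G a) = [a] \<and> ATgt G (ADisc G a) = [])"

record ('s, 'a, 'o, 'm) gm_hom =
  HLetter :: "'s \<Rightarrow> 'o"
  HArrow :: "'a \<Rightarrow> 'm"

text \<open>The left-bracketed product \<open>((x\<^sub>1 \<otimes> x\<^sub>2) \<otimes> \<dots>) \<otimes> x\<^sub>n\<close> of the images of the letters of a word;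
  the auxiliary function takes the word in reverse.\<close>

fun rev_word_obj :: "('o, 'm, 'z) mon_cat_scheme \<Rightarrow> ('s \<Rightarrow> 'o) \<Rightarrow> 's list \<Rightarrow> 'o" where
  "rev_word_obj D h [] = \<one>\<^bsub>D\<^esub>"
| "rev_word_obj D h [a] = h a"
| "rev_word_obj D h (a # b # w) = rev_word_obj D h (b # w) \<otimes>\<^bsub>D\<^esub> h a"

definition word_obj :: "('o, 'm, 'z) mon_cat_scheme \<Rightarrow> ('s \<Rightarrow> 'o) \<Rightarrow> 's list \<Rightarrow> 'o" where
  "word_obj D h w = rev_word_obj D h (rev w)"

definition is_gm_hom ::
  "('s, 'a, 'y) graph_monoid_scheme \<Rightarrow> ('o, 'm, 'z) mon_cat_scheme \<Rightarrow> ('s, 'a, 'o, 'm) gm_hom \<Rightarrow> bool" where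
  "is_gm_hom G D f \<longleftrightarrow>
     (\<forall>a \<in> Letters G. HLetter f a \<in> Obj D) \<and>
     (\<forall>k \<in> Arrows G. HArrow f k \<in>
        Hom D (word_obj D (HLetter f) (ASrc G k)) (word_obj D (HLetter f) (ATgt G k)))"

definition matches_dd ::
  "('s, 'a, 'y) dd_graph_monoid_scheme \<Rightarrow> ('o, 'm, 'z) markov_cat_scheme \<Rightarrow>
   ('s, 'a, 'o, 'm) gm_hom \<Rightarrow> bool" where
  "matches_dd G D f \<longleftrightarrow>
     (\<forall>a \<in> Letters G. HArrow f (ADup G a) = Dup D (HLetter f a) \<and>
                     HArrow f (ADisc G a) = Disc D (HLetter f a))"

definition gm_hom_eq ::
  "('s, 'a, 'z) graph_monoid_scheme \<Rightarrow> ('s, 'a, 'o, 'm) gm_hom \<Rightarrow> ('s, 'a, 'o, 'm) gm_hom \<Rightarrow> bool" where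
  "gm_hom_eq G f f' \<longleftrightarrow> (\<forall>a \<in> Letters G. HLetter f a = HLetter f' a) \<and>
                         (\<forall>k \<in> Arrows G. HArrow f k = HArrow f' k)"

text \<open>The isomorphism \<open>F (h a\<^sub>1) \<otimes> \<dots> \<otimes> F (h a\<^sub>n) \<rightarrow> F (h a\<^sub>1 \<otimes> \<dots> \<otimes> h a\<^sub>n)\<close> built from the structure
  isomorphisms of \<open>F\<close>.\<close>

fun rev_word_iso ::
  "('o1, 'm1, 'y) mon_cat_scheme \<Rightarrow> ('o2, 'm2, 'z) mon_cat_scheme \<Rightarrow>
   ('o1, 'm1, 'o2, 'm2) mon_functor \<Rightarrow> ('s \<Rightarrow> 'o1) \<Rightarrow> 's list \<Rightarrow> 'm2" where
  "rev_word_iso C D F h [] = FUnit F"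
| "rev_word_iso C D F h [a] = Idn D (FObj F (h a))"
| "rev_word_iso C D F h (a # b # w) =
     FTens F (rev_word_obj C h (b # w)) (h a) \<cdot>\<^bsub>D\<^esub>
     (rev_word_iso C D F h (b # w) \<odot>\<^bsub>D\<^esub> Idn D (FObj F (h a)))"

definition word_iso ::
  "('o1, 'm1, 'y) mon_cat_scheme \<Rightarrow> ('o2, 'm2, 'z) mon_cat_scheme \<Rightarrow>
   ('o1, 'm1, 'o2, 'm2) mon_functor \<Rightarrow> ('s \<Rightarrow> 'o1) \<Rightarrow> 's list \<Rightarrow> 'm2" where
  "word_iso C D F h w = rev_word_iso C D F h (rev w)"

definition functor_gm_hom ::
  "('s, 'a, 'x) graph_monoid_scheme \<Rightarrow> ('o1, 'm1, 'y) mon_cat_scheme \<Rightarrow> ('o2, 'm2, 'z) mon_cat_scheme \<Rightarrow>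
   ('o1, 'm1, 'o2, 'm2) mon_functor \<Rightarrow> ('s, 'a, 'o1, 'm1) gm_hom \<Rightarrow> ('s, 'a, 'o2, 'm2) gm_hom" where
  "functor_gm_hom G C D F i =
     \<lparr> HLetter = (\<lambda>a. FObj F (HLetter i a)),
       HArrow = (\<lambda>k. Inv D (word_iso C D F (HLetter i) (ATgt G k)) \<cdot>\<^bsub>D\<^esub>
                     FArr F (HArrow i k) \<cdot>\<^bsub>D\<^esub>
                     word_iso C D F (HLetter i) (ASrc G k)) \<rparr>"


section \<open>Graphs and diagrams\<close>

text \<open>Only inner nodes are represented; an end of an edge is \<open>None\<close> if it is outer. The total orders
  on \<open>in(x)\<close>, \<open>out(x)\<close> and, for anchored diagrams, on \<open>dom\<close> and \<open>cod\<close> are given by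
  duplicate-free lists.\<close>

record ('n, 'e) graph =
  Nodes :: "'n set"
  Edges :: "'e set"
  Src :: "'e \<Rightarrow> 'n option"
  Tgt :: "'e \<Rightarrow> 'n option"
  Ins :: "'n \<Rightarrow> 'e list"
  Outs :: "'n \<Rightarrow> 'e list"

record ('n, 'e, 's, 'a) diagram = "('n, 'e) graph" +
  EVal :: "'e \<Rightarrow> 's"
  NVal :: "'n \<Rightarrow> 'a"

record ('n, 'e, 's, 'a) adiagram = "('n, 'e, 's, 'a) diagram" +
  DomL :: "'e list"
  CodL :: "'e list"

definition is_graph :: "('n, 'e, 'z) graph_scheme \<Rightarrow> bool" where
  "is_graph \<Gamma> \<longleftrightarrow>
     finite (Nodes \<Gamma>) \<and> finite (Edges \<Gamma>) \<and>
     (\<forall>e \<in> Edges \<Gamma>. set_option (Src \<Gamma> e) \<subseteq> Nodes \<Gamma> \<and> set_option (Tgt \<Gamma> e) \<subseteq> Nodes \<Gamma>) \<and>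
     (\<forall>x \<in> Nodes \<Gamma>.
        distinct (Ins \<Gamma> x) \<and> set (Ins \<Gamma> x) = {e \<in> Edges \<Gamma>. Tgt \<Gamma> e = Some x} \<and>
        distinct (Outs \<Gamma> x) \<and> set (Outs \<Gamma> x) = {e \<in> Edges \<Gamma>. Src \<Gamma> e = Some x}) \<and>
     acyclic {(x, y). \<exists>e \<in> Edges \<Gamma>. Src \<Gamma> e = Some x \<and> Tgt \<Gamma> e = Some y}"

definition dom_edges :: "('n, 'e, 'z) graph_scheme \<Rightarrow> 'e set" where
  "dom_edges \<Gamma> = {e \<in> Edges \<Gamma>. Src \<Gamma> e = None}"

definition cod_edges :: "('n, 'e, 'z) graph_scheme \<Rightarrow> 'e set" where
  "cod_edges \<Gamma> = {e \<in> Edges \<Gamma>. Tgt \<Gamma> e = None}"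

definition loose :: "('n, 'e, 'z) graph_scheme \<Rightarrow> 'e \<Rightarrow> bool" where
  "loose \<Gamma> e \<longleftrightarrow> e \<in> Edges \<Gamma> \<and> Src \<Gamma> e = None \<and> Tgt \<Gamma> e = None"

definition is_diagram ::
  "('s, 'a, 'y) graph_monoid_scheme \<Rightarrow> ('n, 'e, 's, 'a, 'z) diagram_scheme \<Rightarrow> bool" where
  "is_diagram G \<Gamma> \<longleftrightarrow> is_graph \<Gamma> \<and>
     (\<forall>e \<in> Edges \<Gamma>. EVal \<Gamma> e \<in> Letters G) \<and>
     (\<forall>x \<in> Nodes \<Gamma>. NVal \<Gamma> x \<in> Arrows G \<and>
        ASrc G (NVal \<Gamma> x) = map (EVal \<Gamma>) (Ins \<Gamma> x) \<and>
        ATgt G (NVal \<Gamma> x) = map (EVal \<Gamma>) (Outs \<Gamma> x))"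

definition is_adiagram ::
  "('s, 'a, 'y) graph_monoid_scheme \<Rightarrow> ('n, 'e, 's, 'a, 'z) adiagram_scheme \<Rightarrow> bool" where
  "is_adiagram G \<Gamma> \<longleftrightarrow> is_diagram G \<Gamma> \<and>
     distinct (DomL \<Gamma>) \<and> set (DomL \<Gamma>) = dom_edges \<Gamma> \<and>
     distinct (CodL \<Gamma>) \<and> set (CodL \<Gamma>) = cod_edges \<Gamma>"

definition dom_word :: "('n, 'e, 's, 'a, 'z) adiagram_scheme \<Rightarrow> 's list" where
  "dom_word \<Gamma> = map (EVal \<Gamma>) (DomL \<Gamma>)"

definition cod_word :: "('n, 'e, 's, 'a, 'z) adiagram_scheme \<Rightarrow> 's list" where
  "cod_word \<Gamma> = map (EVal \<Gamma>) (CodL \<Gamma>)"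

definition diagram_iso ::
  "('n1, 'e1, 's, 'a, 'y) diagram_scheme \<Rightarrow> ('n2, 'e2, 's, 'a, 'z) diagram_scheme \<Rightarrow>
   ('n1 \<Rightarrow> 'n2) \<Rightarrow> ('e1 \<Rightarrow> 'e2) \<Rightarrow> bool" where
  "diagram_iso \<Gamma> \<Upsilon> p q \<longleftrightarrow>
     bij_betw p (Nodes \<Gamma>) (Nodes \<Upsilon>) \<and> bij_betw q (Edges \<Gamma>) (Edges \<Upsilon>) \<and>
     (\<forall>e \<in> Edges \<Gamma>. Src \<Upsilon> (q e) = map_option p (Src \<Gamma> e) \<and> Tgt \<Upsilon> (q e) = map_option p (Tgt \<Gamma> e) \<and>
                    EVal \<Upsilon> (q e) = EVal \<Gamma> e) \<and>
     (\<forall>x \<in> Nodes \<Gamma>. Ins \<Upsilon> (p x) = map q (Ins \<Gamma> x) \<and> Outs \<Upsilon> (p x) = map q (Outs \<Gamma> x) \<and>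
                    NVal \<Upsilon> (p x) = NVal \<Gamma> x)"

definition adiagram_isomorphic ::
  "('n1, 'e1, 's, 'a) adiagram \<Rightarrow> ('n2, 'e2, 's, 'a) adiagram \<Rightarrow> bool" where
  "adiagram_isomorphic \<Gamma> \<Upsilon> \<longleftrightarrow>
     (\<exists>p q. diagram_iso \<Gamma> \<Upsilon> p q \<and> DomL \<Upsilon> = map q (DomL \<Gamma>) \<and> CodL \<Upsilon> = map q (CodL \<Gamma>))"

text \<open>Every finite diagram has an isomorphic copy whose nodes and edges are natural numbers, so these
  copies suffice to represent isomorphism classes.\<close>

type_synonym ('s, 'a) iso_class = "(nat, nat, 's, 'a) adiagram set"

definition iso_class_of :: "('n, 'e, 's, 'a) adiagram \<Rightarrow> ('s, 'a) iso_class" where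
  "iso_class_of \<Gamma> = {\<Upsilon>. adiagram_isomorphic \<Gamma> \<Upsilon>}"

text \<open>The diagram whose \<open>i\<close>-th node has the value, the inputs and the outputs listed in \<open>ns ! i\<close>;
  \<open>find\<close> returns \<open>None\<close> for the ends of edges that are not attached to a node.\<close>

definition mk_diagram ::
  "('a \<times> nat list \<times> nat list) list \<Rightarrow> nat set \<Rightarrow> (nat \<Rightarrow> 's) \<Rightarrow> (nat, nat, 's, 'a) diagram" where
  "mk_diagram ns es v =
     \<lparr> Nodes = {..<length ns}, Edges = es,
       Src = (\<lambda>e. find (\<lambda>x. e \<in> set (snd (snd (ns ! x)))) [0..<length ns]),
       Tgt = (\<lambda>e. find (\<lambda>x. e \<in> set (fst (snd (ns ! x)))) [0..<length ns]),
       Ins = (\<lambda>x. fst (snd (ns ! x))), Outs = (\<lambda>x. snd (snd (ns ! x))),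
       EVal = v, NVal = (\<lambda>x. fst (ns ! x)) \<rparr>"

definition anchor ::
  "('n, 'e, 's, 'a) diagram \<Rightarrow> 'e list \<Rightarrow> 'e list \<Rightarrow> ('n, 'e, 's, 'a) adiagram" where
  "anchor \<Gamma> ds cs = diagram.extend \<Gamma> (adiagram.fields ds cs)"


section \<open>The category of diagrams\<close>

text \<open>Gluing: the \<open>i\<close>-th codomain edge \<open>e\<close> of \<open>\<Gamma>\<close> and the \<open>i\<close>-th domain edge of \<open>\<Upsilon>\<close> become the single
  edge \<open>Inl e\<close>.\<close>

definition glue ::
  "('n1, 'e1, 's, 'a) adiagram \<Rightarrow> ('n2, 'e2, 's, 'a) adiagram \<Rightarrow> ('n1 + 'n2, 'e1 + 'e2, 's, 'a) adiagram" where
  "glue \<Gamma> \<Upsilon> =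
    (let r = (\<lambda>e. case map_of (zip (DomL \<Upsilon>) (CodL \<Gamma>)) e of None \<Rightarrow> Inr e | Some e' \<Rightarrow> Inl e') in
     \<lparr> Nodes = Nodes \<Gamma> <+> Nodes \<Upsilon>,
       Edges = Edges \<Gamma> <+> (Edges \<Upsilon> - set (DomL \<Upsilon>)),
       Src = case_sum (\<lambda>e. map_option Inl (Src \<Gamma> e)) (\<lambda>e. map_option Inr (Src \<Upsilon> e)),
       Tgt = case_sum
               (\<lambda>e. case map_of (zip (CodL \<Gamma>) (DomL \<Upsilon>)) e of
                      None \<Rightarrow> map_option Inl (Tgt \<Gamma> e)
                    | Some e' \<Rightarrow> map_option Inr (Tgt \<Upsilon> e'))
               (\<lambda>e. map_option Inr (Tgt \<Upsilon> e)),
       Ins = case_sum (\<lambda>x. map Inl (Ins \<Gamma> x)) (\<lambda>x. map r (Ins \<Upsilon> x)),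
       Outs = case_sum (\<lambda>x. map Inl (Outs \<Gamma> x)) (\<lambda>x. map Inr (Outs \<Upsilon> x)),
       EVal = case_sum (EVal \<Gamma>) (EVal \<Upsilon>),
       NVal = case_sum (NVal \<Gamma>) (NVal \<Upsilon>),
       DomL = map Inl (DomL \<Gamma>),
       CodL = map r (CodL \<Upsilon>) \<rparr>)"

definition disjoint_union ::
  "('n1, 'e1, 's, 'a) adiagram \<Rightarrow> ('n2, 'e2, 's, 'a) adiagram \<Rightarrow> ('n1 + 'n2, 'e1 + 'e2, 's, 'a) adiagram" where
  "disjoint_union \<Gamma> \<Upsilon> =
     \<lparr> Nodes = Nodes \<Gamma> <+> Nodes \<Upsilon>,
       Edges = Edges \<Gamma> <+> Edges \<Upsilon>,
       Src = case_sum (\<lambda>e. map_option Inl (Src \<Gamma> e)) (\<lambda>e. map_option Inr (Src \<Upsilon> e)),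
       Tgt = case_sum (\<lambda>e. map_option Inl (Tgt \<Gamma> e)) (\<lambda>e. map_option Inr (Tgt \<Upsilon> e)),
       Ins = case_sum (\<lambda>x. map Inl (Ins \<Gamma> x)) (\<lambda>x. map Inr (Ins \<Upsilon> x)),
       Outs = case_sum (\<lambda>x. map Inl (Outs \<Gamma> x)) (\<lambda>x. map Inr (Outs \<Upsilon> x)),
       EVal = case_sum (EVal \<Gamma>) (EVal \<Upsilon>),
       NVal = case_sum (NVal \<Gamma>) (NVal \<Upsilon>),
       DomL = map Inl (DomL \<Gamma>) @ map Inr (DomL \<Upsilon>),
       CodL = map Inl (CodL \<Gamma>) @ map Inr (CodL \<Upsilon>) \<rparr>"

text \<open>The diagram without nodes whose edges \<open>0, 1, \<dots>\<close> are valued in the letters of \<open>w\<close>, in this order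
  in the domain and in the order \<open>cs\<close> in the codomain.\<close>

definition wires :: "'s list \<Rightarrow> nat list \<Rightarrow> (nat, nat, 's, 'a) adiagram" where
  "wires w cs = anchor (mk_diagram [] {..<length w} (\<lambda>e. w ! e)) [0..<length w] cs"

definition sym_diagram :: "'s list \<Rightarrow> 's list \<Rightarrow> (nat, nat, 's, 'a) adiagram" where
  "sym_diagram u w = wires (u @ w) ([length u..<length u + length w] @ [0..<length u])"

definition arrow_diagram ::
  "('s, 'a, 'z) graph_monoid_scheme \<Rightarrow> 'a \<Rightarrow> (nat, nat, 's, 'a) adiagram" where
  "arrow_diagram G k =
    (let n = length (ASrc G k); m = length (ATgt G k) in
     anchor (mk_diagram [(k, [0..<n], [n..<n + m])] {..<n + m} (\<lambda>e. (ASrc G k @ ATgt G k) ! e))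
       [0..<n] [n..<n + m])"

definition diagram_cat ::
  "('s, 'a, 'z) graph_monoid_scheme \<Rightarrow> ('s list, ('s, 'a) iso_class) sym_cat" where
  "diagram_cat G =
     \<lparr> Obj = lists (Letters G),
       Arr = {iso_class_of \<Gamma> | \<Gamma> :: (nat, nat, 's, 'a) adiagram. is_adiagram G \<Gamma>},
       Dom = (\<lambda>A. dom_word (SOME \<Gamma>. \<Gamma> \<in> A)),
       Cod = (\<lambda>A. cod_word (SOME \<Gamma>. \<Gamma> \<in> A)),
       Idn = (\<lambda>w. iso_class_of (wires w [0..<length w])),
       Cmp = (\<lambda>B A. \<Union>\<Gamma> \<in> A. \<Union>\<Upsilon> \<in> B. iso_class_of (glue \<Gamma> \<Upsilon>)),
       TObj = (@),
       TArr = (\<lambda>A B. \<Union>\<Gamma> \<in> A. \<Union>\<Upsilon> \<in> B. iso_class_of (disjoint_union \<Gamma> \<Upsilon>)),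
       Unit = [],
       Assoc = (\<lambda>u v w. iso_class_of (wires (u @ v @ w) [0..<length (u @ v @ w)])),
       LUnit = (\<lambda>w. iso_class_of (wires w [0..<length w])),
       RUnit = (\<lambda>w. iso_class_of (wires w [0..<length w])),
       Sym = (\<lambda>u w. iso_class_of (sym_diagram u w)) \<rparr>"


section \<open>Surgery\<close>

definition subdiagram ::
  "('n, 'e, 's, 'a, 'z) diagram_scheme \<Rightarrow> 'n set \<Rightarrow> 'e set \<Rightarrow> ('n, 'e, 's, 'a) diagram" where
  "subdiagram \<Gamma> N E =
     \<lparr> Nodes = N, Edges = E,
       Src = (\<lambda>e. case Src \<Gamma> e of None \<Rightarrow> None | Some x \<Rightarrow> if x \<in> N then Some x else None),
       Tgt = (\<lambda>e. case Tgt \<Gamma> e of None \<Rightarrow> None | Some x \<Rightarrow> if x \<in> N then Some x else None),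
       Ins = (\<lambda>x. filter (\<lambda>e. e \<in> E) (Ins \<Gamma> x)),
       Outs = (\<lambda>x. filter (\<lambda>e. e \<in> E) (Outs \<Gamma> x)),
       EVal = EVal \<Gamma>, NVal = NVal \<Gamma> \<rparr>"

definition directed_path :: "('n, 'e, 'z) graph_scheme \<Rightarrow> 'e list \<Rightarrow> bool" where
  "directed_path \<Gamma> p \<longleftrightarrow> p \<noteq> [] \<and> set p \<subseteq> Edges \<Gamma> \<and>
     successively (\<lambda>e e'. Tgt \<Gamma> e \<noteq> None \<and> Tgt \<Gamma> e = Src \<Gamma> e') p"

definition normal_subgraph ::
  "('n, 'e, 's, 'a, 'z) diagram_scheme \<Rightarrow> 'n set \<Rightarrow> 'e set \<Rightarrow> bool" where
  "normal_subgraph \<Gamma> N E \<longleftrightarrow> N \<subseteq> Nodes \<Gamma> \<and> E \<subseteq> Edges \<Gamma> \<and>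
     \<not> (\<exists>p e e'. directed_path \<Gamma> p \<and> e \<in> set p \<inter> E \<and> e' \<in> set p \<inter> E \<and> e \<noteq> e' \<and>
                 loose (subdiagram \<Gamma> N E) e) \<and>
     (\<forall>e \<in> Edges \<Gamma>. set_option (Src \<Gamma> e) \<inter> N \<noteq> {} \<or> set_option (Tgt \<Gamma> e) \<inter> N \<noteq> {} \<longrightarrow> e \<in> E) \<and>
     (\<forall>p x y. directed_path \<Gamma> p \<and> Src \<Gamma> (hd p) = Some x \<and> x \<in> N \<and> Tgt \<Gamma> (last p) = Some y \<and> y \<in> N \<longrightarrow>
        set p \<subseteq> E \<and> (\<forall>e \<in> set p. set_option (Tgt \<Gamma> e) \<subseteq> N))"

text \<open>\<open>(\<Omega>, \<Lambda>, \<alpha>, \<beta>)\<close> stands for the template \<open>(\<Omega>/\<Lambda>, \<alpha>, \<beta>)\<close>, in which \<open>\<Omega>\<close> gets replaced by \<open>\<Lambda>\<close>.\<close>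

type_synonym ('s, 'a) template =
  "(nat, nat, 's, 'a) diagram \<times> (nat, nat, 's, 'a) diagram \<times> (nat \<Rightarrow> nat) \<times> (nat \<Rightarrow> nat)"

definition is_template ::
  "('s, 'a, 'z) graph_monoid_scheme \<Rightarrow> ('s, 'a) template \<Rightarrow> bool" where
  "is_template G = (\<lambda>(\<Omega>, \<Lambda>, \<alpha>, \<beta>).
     is_diagram G \<Omega> \<and> is_diagram G \<Lambda> \<and>
     bij_betw \<alpha> (dom_edges \<Lambda>) (dom_edges \<Omega>) \<and> (\<forall>e \<in> dom_edges \<Lambda>. EVal \<Omega> (\<alpha> e) = EVal \<Lambda> e) \<and>
     bij_betw \<beta> (cod_edges \<Lambda>) (cod_edges \<Omega>) \<and> (\<forall>e \<in> cod_edges \<Lambda>. EVal \<Omega> (\<beta> e) = EVal \<Lambda> e))"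

text \<open>The result of replacing the subgraph with nodes \<open>N\<close> and edges \<open>E\<close>, identified with \<open>\<Omega>\<close> by \<open>q\<close> on
  edges, by \<open>\<Lambda>\<close>. The source side of a position (\<open>Outs\<close>, \<open>DomL\<close>) and its target side (\<open>Ins\<close>, \<open>CodL\<close>)
  are updated separately, so a loose edge of the subgraph may be replaced by two different edges.\<close>

definition surgery_result ::
  "('n, 'e, 's, 'a) adiagram \<Rightarrow> 'n set \<Rightarrow> 'e set \<Rightarrow> ('e1 \<Rightarrow> 'e) \<Rightarrow>
   ('n2, 'e2, 's, 'a) diagram \<Rightarrow> ('e2 \<Rightarrow> 'e1) \<Rightarrow> ('e2 \<Rightarrow> 'e1) \<Rightarrow> ('n + 'n2, 'e + 'e2, 's, 'a) adiagram" where
  "surgery_result \<Gamma> N E q \<Lambda> \<alpha> \<beta> =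
    (let rs = (\<lambda>e. if e \<in> E then Inr (inv_into (dom_edges \<Lambda>) (\<lambda>d. q (\<alpha> d)) e) else Inl e);
         rt = (\<lambda>e. if e \<in> E then Inr (inv_into (cod_edges \<Lambda>) (\<lambda>c. q (\<beta> c)) e) else Inl e) in
     \<lparr> Nodes = (Nodes \<Gamma> - N) <+> Nodes \<Lambda>,
       Edges = (Edges \<Gamma> - E) <+> Edges \<Lambda>,
       Src = case_sum (\<lambda>e. map_option Inl (Src \<Gamma> e))
               (\<lambda>e. case Src \<Lambda> e of Some x \<Rightarrow> Some (Inr x) | None \<Rightarrow> map_option Inl (Src \<Gamma> (q (\<alpha> e)))),
       Tgt = case_sum (\<lambda>e. map_option Inl (Tgt \<Gamma> e))
               (\<lambda>e. case Tgt \<Lambda> e of Some x \<Rightarrow> Some (Inr x) | None \<Rightarrow> map_option Inl (Tgt \<Gamma> (q (\<beta> e)))),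
       Ins = case_sum (\<lambda>x. map rt (Ins \<Gamma> x)) (\<lambda>x. map Inr (Ins \<Lambda> x)),
       Outs = case_sum (\<lambda>x. map rs (Outs \<Gamma> x)) (\<lambda>x. map Inr (Outs \<Lambda> x)),
       EVal = case_sum (EVal \<Gamma>) (EVal \<Lambda>),
       NVal = case_sum (NVal \<Gamma>) (NVal \<Lambda>),
       DomL = map rs (DomL \<Gamma>),
       CodL = map rt (CodL \<Gamma>) \<rparr>)"

text \<open>One surgery with a template from \<open>T\<close>, up to isomorphism of the result.\<close>

definition surgery_step ::
  "('s, 'a, 'z) graph_monoid_scheme \<Rightarrow> ('s, 'a) template set \<Rightarrow>
   (nat, nat, 's, 'a) adiagram \<Rightarrow> (nat, nat, 's, 'a) adiagram \<Rightarrow> bool" where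
  "surgery_step G T \<Gamma> \<Upsilon> \<longleftrightarrow> is_adiagram G \<Gamma> \<and> is_adiagram G \<Upsilon> \<and>
     (\<exists>\<Omega> \<Lambda> \<alpha> \<beta> N E p q. (\<Omega>, \<Lambda>, \<alpha>, \<beta>) \<in> T \<and> is_template G (\<Omega>, \<Lambda>, \<alpha>, \<beta>) \<and>
        normal_subgraph \<Gamma> N E \<and> diagram_iso \<Omega> (subdiagram \<Gamma> N E) p q \<and>
        adiagram_isomorphic (surgery_result \<Gamma> N E q \<Lambda> \<alpha> \<beta>) \<Upsilon>)"

definition swap_template :: "('s, 'a) template \<Rightarrow> ('s, 'a) template" where
  "swap_template = (\<lambda>(\<Omega>, \<Lambda>, \<alpha>, \<beta>). (\<Lambda>, \<Omega>, inv_into (dom_edges \<Lambda>) \<alpha>, inv_into (cod_edges \<Lambda>) \<beta>))"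

text \<open>In the generating templates, \<open>d = ADup G a\<close> and \<open>e = ADisc G a\<close>. Edge \<open>0\<close> is always the input edge,
  except in the last clause, where the inputs of \<open>f\<close> are \<open>0, \<dots>, k - 1\<close> and its outputs
  \<open>k, \<dots>, k + m - 1\<close>.\<close>

inductive_set markov_templates :: "('s, 'a, 'z) dd_graph_monoid_scheme \<Rightarrow> ('s, 'a) template set"
  for G :: "('s, 'a, 'z) dd_graph_monoid_scheme" where
  empty: "(mk_diagram [] {} v, mk_diagram [] {} v, id, id) \<in> markov_templates G"
| coassociativity: "a \<in> Letters G \<Longrightarrow> d = ADup G a \<Longrightarrow>
    (mk_diagram [(d, [0], [1, 2]), (d, [2], [3, 4])] {0, 1, 2, 3, 4} (\<lambda>_. a),
     mk_diagram [(d, [0], [1, 2]), (d, [1], [3, 4])] {0, 1, 2, 3, 4} (\<lambda>_. a),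
     id, id(3 := 1, 4 := 3, 2 := 4)) \<in> markov_templates G"
| left_counitality: "a \<in> Letters G \<Longrightarrow> d = ADup G a \<Longrightarrow> e = ADisc G a \<Longrightarrow>
    (mk_diagram [(d, [0], [1, 2]), (e, [2], [])] {0, 1, 2} (\<lambda>_. a),
     mk_diagram [] {0} (\<lambda>_. a),
     id, id(0 := 1)) \<in> markov_templates G"
| right_counitality: "a \<in> Letters G \<Longrightarrow> d = ADup G a \<Longrightarrow> e = ADisc G a \<Longrightarrow>
    (mk_diagram [(d, [0], [1, 2]), (e, [1], [])] {0, 1, 2} (\<lambda>_. a),
     mk_diagram [] {0} (\<lambda>_. a),
     id, id(0 := 2)) \<in> markov_templates G"
| cocommutativity: "a \<in> Letters G \<Longrightarrow> d = ADup G a \<Longrightarrow>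
    (mk_diagram [(d, [0], [1, 2])] {0, 1, 2} (\<lambda>_. a),
     mk_diagram [(d, [0], [1, 2])] {0, 1, 2} (\<lambda>_. a),
     id, id(1 := 2, 2 := 1)) \<in> markov_templates G"
| naturality: "f \<in> Arrows G \<Longrightarrow> ASrc G f = xs \<Longrightarrow> ATgt G f = ys \<Longrightarrow> k = length xs \<Longrightarrow> m = length ys \<Longrightarrow>
    (mk_diagram ((f, [0..<k], [k..<k + m]) # map (\<lambda>j. (ADisc G (ys ! j), [k + j], [])) [0..<m])
       {..<k + m} (\<lambda>e. (xs @ ys) ! e),
     mk_diagram (map (\<lambda>i. (ADisc G (xs ! i), [i], [])) [0..<k]) {..<k} (\<lambda>e. xs ! e),
     id, id) \<in> markov_templates G"
| swap: "t \<in> markov_templates G \<Longrightarrow> swap_template t \<in> markov_templates G"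

definition markov_congruence ::
  "('s, 'a, 'z) dd_graph_monoid_scheme \<Rightarrow> (('s, 'a) iso_class \<times> ('s, 'a) iso_class) set" where
  "markov_congruence G =
     {(iso_class_of \<Gamma>, iso_class_of \<Upsilon>) | \<Gamma> \<Upsilon> :: (nat, nat, 's, 'a) adiagram.
        is_adiagram G \<Gamma> \<and> is_adiagram G \<Upsilon> \<and> (surgery_step G (markov_templates G))\<^sup>*\<^sup>* \<Gamma> \<Upsilon>}"


section \<open>The quotient\<close>

definition quotient_cat :: "('o, 'm) sym_cat \<Rightarrow> ('m \<times> 'm) set \<Rightarrow> ('o, 'm set) sym_cat" where
  "quotient_cat C R =
     \<lparr> Obj = Obj C,
       Arr = Arr C // R,
       Dom = (\<lambda>A. Dom C (SOME f. f \<in> A)),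
       Cod = (\<lambda>A. Cod C (SOME f. f \<in> A)),
       Idn = (\<lambda>X. R `` {Idn C X}),
       Cmp = (\<lambda>B A. \<Union>f \<in> A. \<Union>g \<in> B. R `` {g \<cdot>\<^bsub>C\<^esub> f}),
       TObj = TObj C,
       TArr = (\<lambda>A B. \<Union>f \<in> A. \<Union>g \<in> B. R `` {f \<odot>\<^bsub>C\<^esub> g}),
       Unit = Unit C,
       Assoc = (\<lambda>X Y Z. R `` {Assoc C X Y Z}),
       LUnit = (\<lambda>X. R `` {LUnit C X}),
       RUnit = (\<lambda>X. R `` {RUnit C X}),
       Sym = (\<lambda>X Y. R `` {Sym C X Y}) \<rparr>"

text \<open>The first outputs of the duplicates form the first copy of the word in the codomain, the second
  outputs the second copy.\<close>

definition dup_diagram ::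
  "('s, 'a, 'z) dd_graph_monoid_scheme \<Rightarrow> 's list \<Rightarrow> (nat, nat, 's, 'a) adiagram" where
  "dup_diagram G w =
    (let n = length w in
     anchor (mk_diagram (map (\<lambda>i. (ADup G (w ! i), [i], [n + i, 2 * n + i])) [0..<n])
              {..<3 * n} (\<lambda>e. w ! (e mod n)))
       [0..<n] [n..<3 * n])"

definition i_m ::
  "('s, 'a, 'z) dd_graph_monoid_scheme \<Rightarrow> ('s, 'a, 's list, ('s, 'a) iso_class set) gm_hom" where
  "i_m G = \<lparr> HLetter = (\<lambda>a. [a]),
             HArrow = (\<lambda>k. markov_congruence G `` {iso_class_of (arrow_diagram G k)}) \<rparr>"

definition free_markov ::
  "('s, 'a, 'z) dd_graph_monoid_scheme \<Rightarrow> ('s list, ('s, 'a) iso_class set) markov_cat" where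
  "free_markov G =
    (let Q = quotient_cat (diagram_cat G) (markov_congruence G) in
     sym_cat.extend Q (markov_cat.fields
       (\<lambda>w. markov_congruence G `` {iso_class_of (dup_diagram G w)})
       (\<lambda>w. foldr (\<lambda>a A. HArrow (i_m G) (ADisc G a) \<odot>\<^bsub>Q\<^esub> A) w (Idn Q []))))"

end

theory Submission
 imports Defs
begin

text \<open>Name every edge of an anchored diagram by its source. Sorting the nodes topologically then writes the
 diagram as a composite of arrows of \<open>G\<close> whiskered by identities and of permutations of wires, and any two sortings
 differ by exchanges of adjacent independent nodes, so that an interpretation of the arrows of \<open>G\<close> in a strict
 symmetric monoidal category on words extends to all diagrams. A normal subgraph separates the remaining nodes
 into those before and those after it; hence surgery replaces the factor \<open>l\<close> of a composite \<open>q (l \<otimes> 1) p\<close>, and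
 \<open>S\<^sub>M\<close> is the congruence generated by the Markov axioms for the letters and arrows. A Markov category \<open>D\<close> that is not
 strict is replaced by the strict category of words and arrows between the left-bracketed products \<open>W w\<close>; the
 coherence isomorphisms \<open>W u \<otimes> W v \<rightarrow> W (u v)\<close> become the structure of \<open>F\<close>. For an arbitrary Markov functor \<open>F\<close>
 extending \<open>f\<close>, its structure gives isomorphisms \<open>W w \<rightarrow> F w\<close>, which are natural since they are so on generators;
 comparing those of \<open>F\<close> and \<open>F'\<close> gives the required isomorphism.\<close>

text \<open>A word with repeated letters does not say which wire goes where, while a wiring is a
  bijection of positions. Wires therefore carry distinct names, and two orderings of the same names
  determine an arrow \<open>perm\<close>; its functoriality takes the place of a coherence theorem
  for symmetries. Isomorphism classes consist of diagrams on natural numbers, whereas gluing and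
  surgery produce sums of node types; term graphs are compared across arbitrary node types, and
  \<open>realize\<close> brings each back to numbers. Acyclicity is handled through rank functions,
  because these can be written down explicitly for glued graphs and for surgery results, where
  cycles would have to be traced: after a surgery the new nodes are ranked between the nodes before
  and the nodes after the subgraph. In the target category naturality of discards makes the unit
  object terminal. Every equation between arrows into the unit then holds at once, in particular the
  template for discards, and so does the equality of the two unitors at the unit.\<close>

abbreviation Iff :: "bool => bool => bool" (infixr "<->" 25) where "A <-> B == A = B"
abbreviation "icls == iso_class_of"
notation Cmp (infixr "**\<index>" 65) and TArr (infixr "##\<index>" 70)

section \<open>Categories through domains and codomains\<close>

context category
begin

lemma homD [dest]: "f:Hom C X Y ==> f:Arr C & Dom C f = X & Cod C f = Y"
 by (simp add: Hom_def)

lemma homI: "f:Arr C ==> Dom C f = X ==> Cod C f = Y ==> f:Hom C X Y"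
 by (simp add: Hom_def)

lemma dom_obj' [simp]: "f:Arr C ==> Dom C f:Obj C"
 by (rule dom_obj)

lemma cod_obj' [simp]: "f:Arr C ==> Cod C f:Obj C"
 by (rule cod_obj)

lemma id_arr [simp]:
 assumes "X:Obj C"
 shows "Idn C X:Arr C" "Dom C (Idn C X) = X" "Cod C (Idn C X) = X"
 using id_hom[OF assms] by auto

lemma cmp_arr [simp]:
 assumes "f:Arr C" "g:Arr C" "Cod C f = Dom C g"
 shows "g ** f:Arr C" "Dom C (g ** f) = Dom C f" "Cod C (g ** f) = Cod C g"
 using comp_hom[of f "Dom C f" "Cod C f" g "Cod C g"] assms by (auto simp: Hom_def)

lemma cmp_id_left [simp]: "f:Arr C ==> Cod C f = Y ==> Idn C Y ** f = f"
 by (rule comp_id_left) (simp add: Hom_def)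

lemma cmp_id_right [simp]: "f:Arr C ==> Dom C f = X ==> f ** Idn C X = f"
 by (rule comp_id_right) (simp add: Hom_def)

lemma cmp_assoc [simp]:
 "f:Arr C ==> g:Arr C ==> h:Arr C ==> Cod C f = Dom C g ==> Cod C g = Dom C h ==>
  (h ** g) ** f = h ** g ** f"
 by (rule comp_assoc) (auto simp: Hom_def)

text \<open>In right-nested normal form \<open>h ** g\<close> is not a subterm of
  \<open>h ** g ** f\<close>; this turns an equation for \<open>h ** g\<close> into one that
  rewrites there.\<close>

lemma cmp_rewrite:
 assumes "h ** g = k" "f:Arr C" "g:Arr C" "h:Arr C" "Cod C f = Dom C g" "Cod C g = Dom C h"
 shows "h ** g ** f = k ** f"
 using assms by (simp flip: cmp_assoc)

end

section \<open>Strict symmetric monoidal categories of words\<close>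

text \<open>A coloured PROP: objects are words, the product of objects is concatenation, and
  strictness is stated as equations on \<open>##\<close> and \<open>Idn\<close>. The diagram
  category, its quotient and the word version of a Markov category are instances, so that everything
  proved here holds in each of them.\<close>

locale strict_smc = category C
 for C :: "('s list, 'm, 'z) sym_cat_scheme" (structure) +
 fixes S :: "'s set"
 assumes Obj_eq: "Obj C = lists S"
  and ten_arr [simp]: "f:Arr C ==> g:Arr C ==> f ## g:Arr C"
  and ten_dom [simp]: "f:Arr C ==> g:Arr C ==> Dom C (f ## g) = Dom C f @ Dom C g"
  and ten_cod [simp]: "f:Arr C ==> g:Arr C ==> Cod C (f ## g) = Cod C f @ Cod C g"
  and ten_id: "u:Obj C ==> v:Obj C ==> Idn C u ## Idn C v = Idn C (u @ v)"
  and interchange: "f:Arr C ==> g:Arr C ==> f':Arr C ==> g':Arr C ==>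
   Cod C f = Dom C g ==> Cod C f' = Dom C g' ==> (g ## g') ** (f ## f') = (g ** f) ## (g' ** f')"
  and ten_assoc [simp]: "f:Arr C ==> g:Arr C ==> h:Arr C ==> (f ## g) ## h = f ## g ## h"
  and ten_unit_left [simp]: "f:Arr C ==> Idn C [] ## f = f"
  and ten_unit_right [simp]: "f:Arr C ==> f ## Idn C [] = f"
  and sym_arr [simp]: "u:Obj C ==> v:Obj C ==> Sym C u v:Arr C"
  and sym_dom [simp]: "u:Obj C ==> v:Obj C ==> Dom C (Sym C u v) = u @ v"
  and sym_cod [simp]: "u:Obj C ==> v:Obj C ==> Cod C (Sym C u v) = v @ u"
  and sym_nat: "f:Arr C ==> g:Arr C ==>
   Sym C (Cod C f) (Cod C g) ** (f ## g) = (g ## f) ** Sym C (Dom C f) (Dom C g)"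
  and sym_sym: "u:Obj C ==> v:Obj C ==> Sym C v u ** Sym C u v = Idn C (u @ v)"
  and hex: "u:Obj C ==> v:Obj C ==> w:Obj C ==>
   Sym C u (v @ w) = (Idn C v ## Sym C u w) ** (Sym C u v ## Idn C w)"
begin

lemma Obj_Nil [simp]: "[]:Obj C"
 and Obj_Cons [simp]: "a # u:Obj C <-> a:S & u:Obj C"
 and Obj_append [simp]: "u @ v:Obj C <-> u:Obj C & v:Obj C"
 by (auto simp: Obj_eq)

lemma inter3:
 assumes "f:Arr C" "g:Arr C" "f':Arr C" "g':Arr C" "Cod C f = Dom C g" "Cod C f' = Dom C g'"
  "h:Arr C" "Cod C h = Dom C f @ Dom C f'"
 shows "(g ## g') ** (f ## f') ** h = ((g ** f) ## (g' ** f')) ** h"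
 using assms by (simp flip: interchange)

lemma whisker:
 assumes "f:Arr C" "g:Arr C" "Cod C f = Dom C g" "u:Obj C"
 shows "Idn C u ## (g ** f) = (Idn C u ## g) ** (Idn C u ## f)"
  "(g ** f) ## Idn C u = (g ## Idn C u) ** (f ## Idn C u)"
 using assms by (auto simp: interchange)

lemma ten_id3: "u:Obj C ==> v:Obj C ==> f:Arr C ==> Idn C u ## Idn C v ## f = Idn C (u @ v) ## f"
 using ten_assoc[of "Idn C u" "Idn C v" f] by (simp add: ten_id)

lemma slide:
 assumes "f:Arr C" "g:Arr C"
 shows "(f ## Idn C (Cod C g)) ** (Idn C (Dom C f) ## g) = f ## g"
  "(Idn C (Cod C f) ## g) ** (f ## Idn C (Dom C g)) = f ## g"
 using assms by (auto simp: interchange)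

lemma sym_nat1:
 assumes "f:Arr C" "v:Obj C"
 shows "Sym C (Cod C f) v ** (f ## Idn C v) = (Idn C v ## f) ** Sym C (Dom C f) v"
  "Sym C v (Cod C f) ** (Idn C v ## f) = (f ## Idn C v) ** Sym C v (Dom C f)"
 using sym_nat[of f "Idn C v"] sym_nat[of "Idn C v" f] assms by auto

text \<open>By \<open>hex\<close> with two empty words the arrow is idempotent; being invertible by
  \<open>sym_sym\<close>, it is an identity.\<close>

lemma sym_unit_right [simp]: assumes u: "u:Obj C" shows "Sym C u [] = Idn C u"
proof -
 let ?s = "Sym C u []"
 have "?s = ?s ** ?s" using hex[OF u, of "[]" "[]"] u by simp
 moreover have "Sym C [] u ** ?s = Idn C u" using sym_sym[OF u, of "[]"] by simp
 ultimately show ?thesis using u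
  cmp_assoc[of ?s ?s "Sym C [] u"] by simp
qed

lemma sym_unit_left [simp]: assumes u: "u:Obj C" shows "Sym C [] u = Idn C u"
 using sym_sym[OF u, of "[]"] u by simp

text \<open>The right-hand side is a right inverse of \<open>Sym C w (u @ v)\<close>, and so is
  \<open>Sym C (u @ v) w\<close>, which is a left inverse as well.\<close>

lemma hex': assumes [simp]: "u:Obj C" "v:Obj C" "w:Obj C"
 shows "Sym C (u @ v) w = (Sym C u w ## Idn C v) ** (Idn C u ## Sym C v w)"
proof -
 let ?i = "(Sym C u w ## Idn C v) ** (Idn C u ## Sym C v w)"
 have 1: "Sym C w (u @ v) ** ?i = Idn C (u @ v @ w)"
  by (simp add: hex inter3 interchange sym_sym ten_id)
 have "Sym C (u @ v) w = Sym C (u @ v) w ** (Sym C w (u @ v) ** ?i)"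
  unfolding 1 by simp
 also have "... = (Sym C (u @ v) w ** Sym C w (u @ v)) ** ?i"
  by (subst cmp_assoc[of ?i]) simp_all
 also have "... = ?i" by (simp add: sym_sym)
 finally show ?thesis .
qed

text \<open>Naturality of the symmetry past \<open>c\<close> at the arrow \<open>Sym C b a\<close>,
  with \<open>hex\<close> splitting the symmetries past a product.\<close>

lemma yang_baxter:
 assumes [simp]: "a:Obj C" "b:Obj C" "c:Obj C"
 shows "(Sym C b a ## Idn C c) ** (Idn C b ## Sym C c a) ** (Sym C c b ## Idn C a) =
  (Idn C a ## Sym C c b) ** (Sym C c a ## Idn C b) ** (Idn C c ## Sym C b a)"
 using sym_nat1(2)[of "Sym C b a" c] by (simp add: hex)

subsection \<open>Permutations\<close>

lemma map_lists_mem: "map lab L:Obj C ==> x:set L ==> lab x:S"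
 by (auto simp: Obj_eq in_lists_conv_set)

lemma map_lists_subset: "map lab L:Obj C ==> set L' <= set L ==> map lab L':Obj C"
 by (auto simp: Obj_eq in_lists_conv_set)

lemma map_remove1_lists [simp]: "map lab L:Obj C ==> map lab (remove1 a L):Obj C"
 by (meson map_lists_subset set_remove1_subset)

lemma map_filter_lists [simp]: "map lab L:Obj C ==> map lab (filter Q L):Obj C"
 by (meson map_lists_subset filter_is_subset)

text \<open>The wires have names of type \<open>'e\<close> and letters \<open>lab\<close>.
  \<open>fr\<close> moves the wire \<open>a\<close> to the front through adjacent transpositions;
  \<open>perm\<close> sorts \<open>L\<close> into the order of \<open>L'\<close> by repeating this
  for each wire of \<open>L'\<close>.\<close>

primrec fr :: "('e => 's) => 'e => 'e list => 'm" where
 "fr lab a [] = Idn C []"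
| "fr lab a (b # M) = (if a = b then Idn C (map lab (b # M)) else
  (Sym C [lab b] [lab a] ## Idn C (map lab (remove1 a M))) ** (Idn C [lab b] ## fr lab a M))"

primrec perm :: "('e => 's) => 'e list => 'e list => 'm" where
 "perm lab L [] = Idn C []"
| "perm lab L (a # L') = (Idn C [lab a] ## perm lab (remove1 a L) L') ** fr lab a L"

lemma fr_arr [simp]:
 assumes "map lab L:Obj C" "a:set L"
 shows "fr lab a L:Arr C" "Dom C (fr lab a L) = map lab L"
  "Cod C (fr lab a L) = lab a # map lab (remove1 a L)"
proof -
 have "fr lab a L:Arr C & Dom C (fr lab a L) = map lab L &
   Cod C (fr lab a L) = lab a # map lab (remove1 a L)"
  using assms map_lists_mem[OF assms] by (induction L) auto
 thus "fr lab a L:Arr C" "Dom C (fr lab a L) = map lab L"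
  "Cod C (fr lab a L) = lab a # map lab (remove1 a L)" by auto
qed

definition pm :: "'e list => 'e list => bool" where
 "pm L L' <-> distinct L & distinct L' & set L = set L'"

lemma pm_Cons:
 assumes "pm L (a # L')" shows "pm (remove1 a L) L'" "a:set L" "distinct L"
 using assms by (auto simp: pm_def)

lemma pm_Nil [simp]: "pm L [] <-> L = []" "pm [] L <-> L = []"
 by (auto simp: pm_def)

lemma perm_arr [simp]:
 assumes "map lab L:Obj C" "pm L L'"
 shows "perm lab L L':Arr C" "Dom C (perm lab L L') = map lab L"
  "Cod C (perm lab L L') = map lab L'"
proof -
 have "perm lab L L':Arr C & Dom C (perm lab L L') = map lab L &
   Cod C (perm lab L L') = map lab L'"
  using assms
 proof (induction L' arbitrary: L)
  case (Cons a L')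
  note pm = pm_Cons[OF Cons.prems(2)]
  with map_lists_mem[OF Cons.prems(1), of a] Cons show ?case by simp
 qed simp
 thus "perm lab L L':Arr C" "Dom C (perm lab L L') = map lab L"
  "Cod C (perm lab L L') = map lab L'" by auto
qed

text \<open>Confluence of the sorting procedure, on which functoriality of \<open>perm\<close>
  rests: choosing the two front wires in either order gives the same arrow up to their
  transposition.\<close>

lemma fr_swap:
 assumes "distinct L" "map lab L:Obj C" "a:set L" "b:set L" "a ~= b"
 shows "(Sym C [lab b] [lab a] ## Idn C (map lab (remove1 a (remove1 b L)))) **
   (Idn C [lab b] ## fr lab a (remove1 b L)) ** fr lab b L =
  (Idn C [lab a] ## fr lab b (remove1 a L)) ** fr lab a L"
 using assms
proof (induction L)
 case (Cons c M)
 have [simp]: "lab a:S" "lab b:S" "lab c:S" "map lab M:Obj C"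
  using Cons.prems map_lists_mem[OF Cons.prems(2)] by auto
 have rc: "remove1 b (remove1 a M) = remove1 a (remove1 b M)" by (rule remove1_commute)
 consider "c = a" | "c = b" | "c ~= a" "c ~= b" by blast
 thus ?case
 proof cases
  case 1
  thus ?thesis using Cons.prems
   by (simp add: inter3 interchange sym_sym ten_id)
 next
  case 2
  thus ?thesis using Cons.prems by (simp add: ten_id)
 next
  case 3
  have mem [simp]: "a:set M" "b:set M" "a:set (remove1 b M)" "b:set (remove1 a M)"
   using Cons.prems 3 by auto
  let ?r = "map lab (remove1 a (remove1 b M))"
  let ?A = "fr lab a (remove1 b M)" and ?B = "fr lab b (remove1 a M)"
  have IH: "(Sym C [lab b] [lab a] ## Idn C ?r) ** (Idn C [lab b] ## ?A) ** fr lab b M =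
   (Idn C [lab a] ## ?B) ** fr lab a M"
   using Cons 3 by simp
  \<comment> \<open>With \<open>c\<close> in front of both wires, each side is a composite of the
    whiskered factors named here, \<open>?r\<close> being the untouched wires. \<open>e1\<close> and
    \<open>e2\<close> slide independent moves past each other, \<open>e3\<close> is Yang-Baxter on
    the three leading wires, and \<open>e4\<close> is the induction hypothesis beside the wire
    \<open>c\<close>.\<close>
  define x1 where "x1 = Sym C [lab b] [lab a] ## Idn C (lab c # ?r)"
  define x2 where "x2 = Idn C [lab b] ## Sym C [lab c] [lab a] ## Idn C ?r"
  define x3 where "x3 = Idn C [lab b, lab c] ## ?A"
  define x4 where "x4 = Sym C [lab c] [lab b] ## Idn C (map lab (remove1 b M))"
  define x5 where "x5 = Idn C [lab c] ## fr lab b M"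
  define y3 where "y3 = Sym C [lab c] [lab b] ## Idn C (lab a # ?r)"
  define y4 where "y4 = Idn C [lab c, lab b] ## ?A"
  define z1 where "z1 = Idn C [lab a] ## Sym C [lab c] [lab b] ## Idn C ?r"
  define z2 where "z2 = Sym C [lab c] [lab a] ## Idn C (lab b # ?r)"
  define z3 where "z3 = Idn C [lab c] ## Sym C [lab b] [lab a] ## Idn C ?r"
  define w3 where "w3 = Idn C [lab c, lab a] ## ?B"
  define w5 where "w5 = Idn C [lab c] ## fr lab a M"
  define v2 where "v2 = Idn C [lab a, lab c] ## ?B"
  define v3 where "v3 = Sym C [lab c] [lab a] ## Idn C (map lab (remove1 a M))"
  note defs = x1_def x2_def x3_def x4_def x5_def y3_def y4_def z1_def z2_def z3_def w3_def w5_def v2_def v3_def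
  have [simp]: "x1:Arr C" "x2:Arr C" "x3:Arr C" "x4:Arr C" "x5:Arr C" "y3:Arr C" "y4:Arr C"
   "z1:Arr C" "z2:Arr C" "z3:Arr C" "w3:Arr C" "w5:Arr C" "v2:Arr C" "v3:Arr C"
   by (auto simp: defs)
  have [simp]: "Cod C x2 = Dom C x1" "Cod C x3 = Dom C x2" "Cod C x4 = Dom C x3" "Cod C x5 = Dom C x4"
   "Cod C y3 = Dom C x2" "Cod C y4 = Dom C y3" "Dom C y4 = Dom C x4" "Cod C z2 = Dom C z1" "Cod C z3 = Dom C z2"
   "Dom C z3 = Dom C y3" "Cod C w3 = Dom C z2" "Cod C w5 = Dom C w3" "Cod C v2 = Dom C z1" "Cod C v3 = Dom C v2"
   "Dom C v3 = Dom C w3"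
   by (auto simp: defs rc)
  have e1: "x3 ** x4 = y3 ** y4"
   using slide[of "Sym C [lab c] [lab b]" ?A] by (simp add: defs)
  have e2: "z2 ** w3 = v2 ** v3"
   using slide[of "Sym C [lab c] [lab a]" ?B] by (simp add: rc defs)
  have e3: "x1 ** x2 ** y3 = z1 ** z2 ** z3"
  proof -
   have "x1 = (Sym C [lab b] [lab a] ## Idn C [lab c]) ## Idn C ?r"
    "y3 = (Sym C [lab c] [lab b] ## Idn C [lab a]) ## Idn C ?r"
    "z2 = (Sym C [lab c] [lab a] ## Idn C [lab b]) ## Idn C ?r"
    "x2 = (Idn C [lab b] ## Sym C [lab c] [lab a]) ## Idn C ?r"
    "z1 = (Idn C [lab a] ## Sym C [lab c] [lab b]) ## Idn C ?r"
    "z3 = (Idn C [lab c] ## Sym C [lab b] [lab a]) ## Idn C ?r"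
    by (auto simp: defs ten_id)
   thus ?thesis
    using yang_baxter[of "[lab a]" "[lab b]" "[lab c]"] by (simp add: interchange del: ten_assoc)
  qed
  have e4: "z3 ** y4 ** x5 = w3 ** w5"
   using arg_cong[OF IH, of "%f. Idn C [lab c] ## f"]
    ten_id3[of "[lab c]" "[lab b]" ?A] ten_id3[of "[lab c]" "[lab a]" ?B] Cons.prems
   by (simp add: defs whisker)
  have "x1 ** x2 ** x3 ** x4 ** x5 = x1 ** x2 ** (x3 ** x4) ** x5" by simp
  also have "... = (x1 ** x2 ** y3) ** y4 ** x5" unfolding e1 by simp
  also have "... = z1 ** z2 ** (z3 ** y4 ** x5)" unfolding e3 by simp
  also have "... = z1 ** (z2 ** w3) ** w5" unfolding e4 by simp
  also have "... = z1 ** v2 ** v3 ** w5" unfolding e2 by simp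
  finally have "x1 ** (x2 ** x3) ** x4 ** x5 = (z1 ** v2) ** v3 ** w5" by simp
  moreover have "x2 ** x3 = Idn C [lab b] ## ((Sym C [lab c] [lab a] ## Idn C ?r) ** (Idn C [lab c] ## ?A))"
   "z1 ** v2 = Idn C [lab a] ## ((Sym C [lab c] [lab b] ## Idn C ?r) ** (Idn C [lab c] ## ?B))"
   using ten_id3[of "[lab b]" "[lab c]" ?A] ten_id3[of "[lab a]" "[lab c]" ?B]
   using Cons.prems by (simp_all add: defs whisker rc)
  ultimately show ?thesis using Cons.prems 3 by (simp add: rc x1_def x4_def x5_def v3_def w5_def)
 qed
qed simp

lemma pm_remove1: "pm L L' ==> pm (remove1 a L) (remove1 a L')"
 by (auto simp: pm_def)

lemma pm_sym: "pm L L' ==> pm L' L"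
 and pm_trans: "pm L L' ==> pm L' L'' ==> pm L L''"
 and pm_refl: "distinct L ==> pm L L"
 by (auto simp: pm_def)

lemma pm_in_set: "pm L L' ==> a:set L' ==> a:set L"
 by (auto simp: pm_def)

lemma pm_Obj: "pm L L' ==> map lab L:Obj C ==> map lab L':Obj C"
 by (erule map_lists_subset) (auto simp: pm_def)

text \<open>The step where another wire heads \<open>L'\<close> is \<open>fr_swap\<close>. The
  equation lets \<open>perm_comp\<close> peel off one wire of the final list at a time.\<close>

lemma fr_perm:
 assumes "pm L L'" "map lab L:Obj C" "a:set L'"
 shows "fr lab a L' ** perm lab L L' = (Idn C [lab a] ## perm lab (remove1 a L) (remove1 a L')) ** fr lab a L"
 using assms
proof (induction L' arbitrary: L)
 case (Cons b M)
 note pm = pm_Cons[OF Cons.prems(1)]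
 have [simp]: "map lab L:Obj C" "a:set L" "b:set L" "lab a:S" "lab b:S" "pm (remove1 b L) M"
  "distinct L" "map lab M:Obj C"
  using Cons.prems map_lists_mem[OF Cons.prems(2)] pm pm_in_set[OF Cons.prems(1)]
   pm_Obj[OF Cons.prems(1,2)] by auto
 show ?case
 proof (cases "a = b")
  case True
  thus ?thesis using Cons.prems by simp
 next
  case False
  let ?Q = "perm lab (remove1 a (remove1 b L)) (remove1 a M)"
  let ?r = "map lab (remove1 a M)" and ?s = "map lab (remove1 a (remove1 b L))"
  have [simp]: "a:set M" using False Cons.prems by simp
  have [simp]: "a:set (remove1 b L)" "b:set (remove1 a L)" using False by auto
  have [simp]: "pm (remove1 a (remove1 b L)) (remove1 a M)" "pm (remove1 b (remove1 a L)) (remove1 a M)"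
   using pm_remove1[OF pm(1)] by (auto simp: remove1_commute)
  have IH: "fr lab a M ** perm lab (remove1 b L) M = (Idn C [lab a] ## ?Q) ** fr lab a (remove1 b L)"
   by (rule Cons.IH) (use Cons.prems pm in auto)
  have "fr lab a (b # M) ** perm lab L (b # M) =
   (Sym C [lab b] [lab a] ## Idn C ?r) ** (Idn C [lab b] ## (fr lab a M ** perm lab (remove1 b L) M)) ** fr lab b L"
   using False by (simp add: inter3)
  also have "... = ((Sym C [lab b] [lab a] ## Idn C ?r) ** (Idn C [lab b, lab a] ## ?Q)) ** (Idn C [lab b] ## fr lab a (remove1 b L)) ** fr lab b L"
   unfolding IH using False ten_id3[of "[lab b]" "[lab a]" ?Q] by (simp add: whisker)
  also have "(Sym C [lab b] [lab a] ## Idn C ?r) ** (Idn C [lab b, lab a] ## ?Q)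
    = (Idn C [lab a, lab b] ## ?Q) ** (Sym C [lab b] [lab a] ## Idn C ?s)"
   using slide[of "Sym C [lab b] [lab a]" ?Q] by simp
  also have "(...) ** (Idn C [lab b] ## fr lab a (remove1 b L)) ** fr lab b L
   = (Idn C [lab a, lab b] ## ?Q) ** (Idn C [lab a] ## fr lab b (remove1 a L)) ** fr lab a L"
   using fr_swap[of L lab a b] False by (simp add: remove1_commute)
  also have "... = (Idn C [lab a] ## perm lab (remove1 a L) (b # remove1 a M)) ** fr lab a L"
   using ten_id3[of "[lab a]" "[lab b]" ?Q] False by (simp add: remove1_commute whisker)
  finally show ?thesis using False by simp
 qed
qed simp

text \<open>Coherence for symmetries in usable form: a composite of permutations of named wires
  depends only on its first and last lists.\<close>

lemma perm_comp:
 assumes "pm L L'" "pm L' L''" "map lab L:Obj C"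
 shows "perm lab L' L'' ** perm lab L L' = perm lab L L''"
 using assms
proof (induction L'' arbitrary: L L')
 case (Cons a M)
 note pm = pm_Cons[OF Cons.prems(2)]
 have [simp]: "a:set L'" "map lab L:Obj C" "map lab L':Obj C" "pm L L'" "lab a:S" "a:set L" "distinct L'"
  "pm (remove1 a L') M" "pm (remove1 a L) (remove1 a L')"
  using pm pm_Obj pm_remove1 Cons.prems map_lists_mem[of lab L] pm_in_set by metis+
 have "perm lab (remove1 a L') M ** perm lab (remove1 a L) (remove1 a L') = perm lab (remove1 a L) M"
  by (rule Cons.IH) simp_all
 with fr_perm[of L L' lab a] show ?case by (simp add: inter3)
qed simp

lemma perm_id: "distinct L ==> map lab L:Obj C ==> perm lab L L = Idn C (map lab L)"
 by (induction L) (auto simp: ten_id)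

lemma fr_append:
 assumes "a:set L" "map lab L:Obj C" "map lab R:Obj C"
 shows "fr lab a (L @ R) = fr lab a L ## Idn C (map lab R)"
 using assms
proof (induction L)
 case (Cons b M)
 thus ?case using map_lists_mem[OF Cons.prems(2,1)]
  by (auto simp: ten_id whisker remove1_append)
qed simp

lemma perm_append:
 assumes "pm L1 M1" "pm L2 M2" "set L1 Int set L2 = {}" "map lab L1:Obj C" "map lab L2:Obj C"
 shows "perm lab (L1 @ L2) (M1 @ M2) = perm lab L1 M1 ## perm lab L2 M2"
 using assms
proof (induction M1 arbitrary: L1)
 case (Cons a M)
 note pm = pm_Cons[OF Cons.prems(1)]
 have [simp]: "a:set L1" "lab a:S" "pm (remove1 a L1) M" "pm L2 M2" "map lab L1:Obj C" "map lab L2:Obj C"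
  using pm map_lists_mem[of lab L1] Cons.prems by auto
 have "perm lab (remove1 a L1 @ L2) (M @ M2) = perm lab (remove1 a L1) M ## perm lab L2 M2"
  by (rule Cons.IH) (use Cons.prems in "auto dest: set_remove1_subset[THEN subsetD]")
 thus ?case
  using interchange[of "fr lab a L1" "Idn C [lab a] ## perm lab (remove1 a L1) M" "Idn C (map lab L2)" "perm lab L2 M2"]
  by (simp add: remove1_append fr_append)
qed simp

lemma fr_end:
 assumes "b ~: set A" "map lab A:Obj C" "lab b:S"
 shows "fr lab b (A @ [b]) = Sym C (map lab A) [lab b]"
 using assms
proof (induction A)
 case (Cons a A)
 thus ?case using hex'[of "[lab a]" "map lab A" "[lab b]"] by (simp add: remove1_append)
qed simp

text \<open>The first wire of \<open>B\<close> passes all of \<open>A\<close>, which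
  \<open>fr_end\<close> identifies as a symmetry, and \<open>hex\<close> joins it with the rest.
  This leads back from permutations to the given symmetries.\<close>

lemma perm_sym:
 assumes "distinct (A @ B)" "map lab A:Obj C" "map lab B:Obj C"
 shows "perm lab (A @ B) (B @ A) = Sym C (map lab A) (map lab B)"
 using assms
proof (induction B)
 case Nil
 thus ?case by (simp add: perm_id)
next
 case (Cons b B)
 have "fr lab b ((A @ [b]) @ B) = Sym C (map lab A) [lab b] ## Idn C (map lab B)"
  using Cons.prems by (subst fr_append) (auto simp: fr_end)
 thus ?case using Cons hex[of "map lab A" "[lab b]" "map lab B"] by (simp add: remove1_append)
qed

text \<open>Names matter only up to an injection that preserves letters.\<close>

lemma perm_rename:
 assumes "inj_on q (set L)" "pm L L'" "ALL e:set L. lab' (q e) = lab e"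
 shows "perm lab' (map q L) (map q L') = perm lab L L'"
proof -
 have rem: "remove1 (q a) (map q L) = map q (remove1 a L)" if "inj_on q (set L)" "a:set L" for a L
  using that by (induction L) (auto simp: inj_on_def)
 have rl: "map (lab' \<circ> q) (remove1 a L) = map lab (remove1 a L)" if "ALL e:set L. lab' (q e) = lab e" for a L
  using that by (auto dest: set_remove1_subset[THEN subsetD])
 have fr: "fr lab' (q a) (map q L) = fr lab a L"
  if "a:set L" "inj_on q (set L)" "ALL e:set L. lab' (q e) = lab e" for a L
  using that
 proof (induction L)
  case (Cons b L)
  thus ?case
   by (auto simp: inj_on_def rem rl intro!: arg_cong[of _ _ "Idn C"])
 qed simp
 show ?thesis using assms
 proof (induction L' arbitrary: L)
  case (Cons a M)
  have "perm lab' (map q (remove1 a L)) (map q M) = perm lab (remove1 a L) M"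
   by (rule Cons.IH) (use Cons.prems pm_Cons[OF Cons.prems(2)] in
    "auto dest: set_remove1_subset[THEN subsetD] elim!: inj_on_subset")
  with Cons.prems pm_Cons[OF Cons.prems(2)] show ?case by (simp add: rem fr)
 qed simp
qed

subsection \<open>Evaluation of a list of nodes along a frontier of edges\<close>

definition rem :: "'e list => 'e list => 'e list" where
 "rem L A = filter (%e. e ~: set A) L"

lemma set_rem [simp]: "set (rem L A) = set L - set A"
 by (auto simp: rem_def)

lemma distinct_rem [simp]: "distinct L ==> distinct (rem L A)"
 by (simp add: rem_def)

lemma map_rem_Obj [simp]: "map lab L:Obj C ==> map lab (rem L A):Obj C"
 by (simp add: rem_def)

lemma rem_append: "rem (L @ L') A = rem L A @ rem L' A"
 by (simp add: rem_def)

lemma rem_disjoint: "set L Int set A = {} ==> rem L A = L"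
 by (auto simp: rem_def filter_id_conv)

lemma rem_self [simp]: "rem A A = []"
 by (simp add: rem_def)

text \<open>\<open>L\<close> lists the edges already produced and still unconsumed. Each node has
  its inputs permuted to the front, acts there, and leaves its outputs in front of the remaining
  edges; \<open>out\<close> fixes the order at the end.\<close>

primrec ev :: "('e => 's) => ('n => 'e list) => ('n => 'e list) => ('n => 'm) =>
  'e list => 'n list => 'e list => 'm" where
 "ev lab ins ots fm L [] out = perm lab L out"
| "ev lab ins ots fm L (x # xs) out =
  ev lab ins ots fm (ots x @ rem L (ins x)) xs out **
  (fm x ## Idn C (map lab (rem L (ins x)))) ** perm lab L (ins x @ rem L (ins x))"

text \<open>Only sets of edges are tracked, since the order of the frontier is absorbed by
  \<open>perm\<close>: each node must find its inputs among the live edges, and exactly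
  \<open>B\<close> must be left.\<close>

primrec go :: "('n => 'e list) => ('n => 'e list) => 'e set => 'n list => 'e set => bool" where
 "go ins ots A [] B <-> A = B"
| "go ins ots A (x # xs) B <-> set (ins x) <= A & go ins ots (set (ots x) Un (A - set (ins x))) xs B"

definition nodes_ok :: "('e => 's) => ('n => 'e list) => ('n => 'e list) => ('n => 'm) => 'n set => bool" where
 "nodes_ok lab ins ots fm N <-> (ALL x:N. distinct (ins x) & fm x:Arr C &
   Dom C (fm x) = map lab (ins x) & Cod C (fm x) = map lab (ots x))"

lemma nodes_okD:
 assumes "nodes_ok lab ins ots fm N" "x:N"
 shows "distinct (ins x)" "fm x:Arr C" "Dom C (fm x) = map lab (ins x)" "Cod C (fm x) = map lab (ots x)"
  "map lab (ins x):Obj C" "map lab (ots x):Obj C"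
 using assms dom_obj[of "fm x"] cod_obj[of "fm x"] by (auto simp: nodes_ok_def)

text \<open>Freshness of the outputs with respect to each other and to \<open>L\<close> is demanded
  for the whole run at once, so that every frontier met on the way is duplicate-free.\<close>

definition runs :: "('e => 's) => ('n => 'e list) => ('n => 'e list) => ('n => 'm) =>
  'e list => 'n list => 'e list => bool" where
 "runs lab ins ots fm L xs out <-> distinct (L @ concat (map ots xs)) & distinct out &
   map lab L:Obj C & nodes_ok lab ins ots fm (set xs) & go ins ots (set L) xs (set out)"

lemma runs_Nil [simp]: "runs lab ins ots fm L [] out <-> pm L out & map lab L:Obj C"
 by (auto simp: runs_def pm_def nodes_ok_def)

lemma runs_Cons:
 "runs lab ins ots fm L (x # xs) out <-> distinct L & map lab L:Obj C & set (ins x) <= set L &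
   distinct (ots x @ concat (map ots xs)) & set L Int set (ots x @ concat (map ots xs)) = {} &
   nodes_ok lab ins ots fm {x} & runs lab ins ots fm (ots x @ rem L (ins x)) xs out"
proof -
 have ok: "nodes_ok lab ins ots fm (set (x # xs)) <->
  nodes_ok lab ins ots fm {x} & nodes_ok lab ins ots fm (set xs)"
  by (auto simp: nodes_ok_def)
 have "nodes_ok lab ins ots fm {x} ==> map lab (ots x):Obj C"
  using nodes_okD[of lab ins ots fm "{x}" x] by simp
 thus ?thesis unfolding runs_def ok by auto
qed

context
 fixes lab :: "'e => 's" and ins ots :: "'n => 'e list" and fm :: "'n => 'm"
begin

abbreviation "Ev == ev lab ins ots fm"
abbreviation "Runs == runs lab ins ots fm"

lemma runs_step:
 assumes "Runs L (x # xs) out"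
 shows "distinct L" "map lab L:Obj C" "pm L (ins x @ rem L (ins x))" "Runs (ots x @ rem L (ins x)) xs out"
  "fm x:Arr C" "Dom C (fm x) = map lab (ins x)" "Cod C (fm x) = map lab (ots x)"
  "distinct (ots x @ rem L (ins x))" "map lab (ins x):Obj C" "map lab (ots x):Obj C"
  "map lab (rem L (ins x)):Obj C" "set (ins x) <= set L" "set (ots x) Int set L = {}" "distinct (ins x)" "distinct (ots x)"
 using assms nodes_okD[of lab ins ots fm "{x}" x] by (auto simp: runs_Cons pm_def)

lemma runs_distinct: "Runs L xs out ==> distinct L" "Runs L xs out ==> map lab L:Obj C"
 by (auto simp: runs_def)

lemma ev_arr [simp]:
 assumes "Runs L xs out"
 shows "Ev L xs out:Arr C" "Dom C (Ev L xs out) = map lab L" "Cod C (Ev L xs out) = map lab out"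
proof -
 have "Ev L xs out:Arr C & Dom C (Ev L xs out) = map lab L & Cod C (Ev L xs out) = map lab out"
  using assms
 proof (induction xs arbitrary: L)
  case (Cons x xs)
  note st = runs_step[OF Cons.prems]
  from Cons.IH[OF st(4)] st show ?case by simp
 qed simp
 thus "Ev L xs out:Arr C" "Dom C (Ev L xs out) = map lab L" "Cod C (Ev L xs out) = map lab out"
  by auto
qed

lemma runs_pm: assumes "pm L L'" "Runs L' xs out" shows "Runs L xs out"
 using assms by (auto simp: runs_def pm_def map_lists_subset)

text \<open>A reordering of the frontier matters only for the untouched edges once the inputs of the
  node are in front; it slides past the node and is passed on to the rest of the run.\<close>

lemma ev_perm:
 assumes "pm L L'" "Runs L' xs out"
 shows "Ev L' xs out ** perm lab L L' = Ev L xs out"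
 using assms
proof (induction xs arbitrary: L L')
 case Nil
 thus ?case using pm_Obj[OF pm_sym[OF Nil(1)], of lab] by (simp add: perm_comp)
next
 case (Cons x xs)
 note st' = runs_step[OF Cons.prems(2)]
 note st = runs_step[OF runs_pm[OF Cons.prems]]
 have pr: "pm (rem L (ins x)) (rem L' (ins x))"
  using Cons.prems(1) by (auto simp: pm_def)
 let ?p = "perm lab (rem L (ins x)) (rem L' (ins x))" and ?L = "map lab (rem L (ins x))"
 have "perm lab L' (ins x @ rem L' (ins x)) ** perm lab L L' = perm lab L (ins x @ rem L' (ins x))"
  by (rule perm_comp) (use st st' Cons.prems in auto)
 also have "... = perm lab (ins x @ rem L (ins x)) (ins x @ rem L' (ins x)) ** perm lab L (ins x @ rem L (ins x))"
  by (rule perm_comp[symmetric]) (use st st' Cons.prems pr in "auto simp: pm_def")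
 also have "perm lab (ins x @ rem L (ins x)) (ins x @ rem L' (ins x)) = Idn C (map lab (ins x)) ## ?p"
  using perm_append[of "ins x" "ins x" "rem L (ins x)" "rem L' (ins x)" lab] st st' pr
  by (auto simp: perm_id pm_def)
 finally have 1: "perm lab L' (ins x @ rem L' (ins x)) ** perm lab L L' = (Idn C (map lab (ins x)) ## ?p) ** perm lab L (ins x @ rem L (ins x))" .
 have p2: "pm (ots x @ rem L (ins x)) (ots x @ rem L' (ins x))"
  using st st' pr by (auto simp: pm_def)
 have 2: "Idn C (map lab (ots x)) ## ?p = perm lab (ots x @ rem L (ins x)) (ots x @ rem L' (ins x))"
  using perm_append[of "ots x" "ots x" "rem L (ins x)" "rem L' (ins x)" lab] st st' pr
  by (auto simp: perm_id pm_def)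
 have 3: "(fm x ## Idn C (map lab (rem L' (ins x)))) ** (Idn C (map lab (ins x)) ## ?p) = (Idn C (map lab (ots x)) ## ?p) ** (fm x ## Idn C ?L)"
  using slide[of "fm x" ?p] st st' pr by simp
 let ?E = "Ev (ots x @ rem L' (ins x)) xs out"
 have "Ev L' (x # xs) out ** perm lab L L' = ?E ** (fm x ## Idn C (map lab (rem L' (ins x)))) ** (perm lab L' (ins x @ rem L' (ins x)) ** perm lab L L')"
  using st st' Cons.prems(1) by simp
 also have "... = ?E ** ((fm x ## Idn C (map lab (rem L' (ins x)))) ** (Idn C (map lab (ins x)) ## ?p)) ** perm lab L (ins x @ rem L (ins x))"
  unfolding 1 using st st' pr by simp
 also have "... = (?E ** perm lab (ots x @ rem L (ins x)) (ots x @ rem L' (ins x))) ** (fm x ## Idn C ?L) ** perm lab L (ins x @ rem L (ins x))"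
  unfolding 3 unfolding 2[symmetric] using st st' pr by simp
 also have "?E ** perm lab (ots x @ rem L (ins x)) (ots x @ rem L' (ins x)) = Ev (ots x @ rem L (ins x)) xs out"
  by (rule Cons.IH[OF p2 st'(4)])
 finally show ?case by simp
qed

text \<open>Both runs being possible forces independence: neither node consumes an output of the
  other. Each run then equals one with the two nodes side by side in a single factor, and the two
  arrangements are related by naturality of the symmetry.\<close>

lemma ev_swap:
 assumes xy: "Runs L (x # y # xs) out" and yx: "Runs L (y # x # xs) out"
 shows "Ev L (x # y # xs) out = Ev L (y # x # xs) out"
proof -
 let ?R = "rem (rem L (ins x)) (ins y)"
 have R': "?R = rem (rem L (ins y)) (ins x)" by (simp add: rem_def conj_commute)
 note a = runs_step[OF xy] note a' = runs_step[OF a(4)]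
 note b = runs_step[OF yx] note b' = runs_step[OF b(4)]
 have disj: "set (ins x) Int set (ins y) = {}" "set (ots x) Int set (ots y) = {}"
  "set (ins x) Int set (ots y) = {}" "set (ins y) Int set (ots x) = {}" "set L Int set (ots x) = {}" "set L Int set (ots y) = {}"
  using a a' b b' by auto
 \<comment> \<open>Stated for arbitrary nodes, since it is applied to both orders below.\<close>
 have one: "Ev L (x # y # xs) out = Ev (ots x @ ots y @ rem (rem L (ins x)) (ins y)) xs out **
   (fm x ## fm y ## Idn C (map lab (rem (rem L (ins x)) (ins y)))) ** perm lab L (ins x @ ins y @ rem (rem L (ins x)) (ins y))"
  if xy: "Runs L (x # y # xs) out" and disj: "set (ins x) Int set (ins y) = {}" "set (ots x) Int set (ots y) = {}"
  "set (ins x) Int set (ots y) = {}" "set (ins y) Int set (ots x) = {}" "set L Int set (ots x) = {}" "set L Int set (ots y) = {}" for x y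
 proof -
  note a = runs_step[OF xy] note a' = runs_step[OF a(4)]
  let ?R = "rem (rem L (ins x)) (ins y)"
  have r: "rem (ots x @ rem L (ins x)) (ins y) = ots x @ ?R"
   using disj by (subst rem_append, subst rem_disjoint) auto
  \<comment> \<open>A frontier beginning with the inputs of \<open>x\<close> and then those of
    \<open>y\<close>: the permutation before \<open>x\<close> becomes an identity and the one before
    \<open>y\<close> a single whiskered symmetry.\<close>
  let ?M = "ins x @ ins y @ ?R"
  have pmM: "pm L ?M" using a a' disj by (auto simp: pm_def)
  have RM: "Runs ?M (x # y # xs) out" by (rule runs_pm[OF pm_sym[OF pmM] xy])
  note c = runs_step[OF RM] note c' = runs_step[OF c(4)]
  have rM: "rem ?M (ins x) = ins y @ ?R" using disj
   by (subst rem_append, subst rem_disjoint) auto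
  have rM2: "rem (ots x @ ins y @ ?R) (ins y) = ots x @ ?R" using disj
   by (simp add: rem_append rem_disjoint Int_commute)
  have [simp]: "map lab ?R:Obj C" using a by simp
  have dR: "distinct (ins y @ ots x @ ?R)" "distinct (ots y @ ots x @ ?R)"
   using a a' disj by auto
  have p1: "perm lab ?M (ins x @ ins y @ ?R) = Idn C (map lab ?M)"
   using a a' c by (intro perm_id) auto
  have "perm lab ((ots x @ ins y) @ ?R) ((ins y @ ots x) @ ?R) = perm lab (ots x @ ins y) (ins y @ ots x) ## perm lab ?R ?R"
   using dR a a' by (intro perm_append) (auto simp: pm_def)
  also have "... = Sym C (map lab (ots x)) (map lab (ins y)) ## Idn C (map lab ?R)"
   using dR a a' by (subst perm_sym) (auto simp: perm_id)
  finally have p2: "perm lab (ots x @ ins y @ ?R) (ins y @ ots x @ ?R) = ..." by simp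
  have "perm lab ((ots x @ ots y) @ ?R) ((ots y @ ots x) @ ?R) = perm lab (ots x @ ots y) (ots y @ ots x) ## perm lab ?R ?R"
   using dR a a' by (intro perm_append) (auto simp: pm_def)
  also have "... = Sym C (map lab (ots x)) (map lab (ots y)) ## Idn C (map lab ?R)"
   using dR a a' by (subst perm_sym) (auto simp: perm_id)
  finally have p3: "perm lab (ots x @ ots y @ ?R) (ots y @ ots x @ ?R) = ..." by simp
  have run2: "Runs (ots y @ ots x @ ?R) xs out" using a' by (simp add: r)
  have pm2: "pm (ots x @ ots y @ ?R) (ots y @ ots x @ ?R)" using dR by (auto simp: pm_def)
  let ?E = "Ev (ots y @ ots x @ ?R) xs out"
  have "Ev ?M (x # y # xs) out = ?E ** (fm y ## Idn C (map lab (ots x @ ?R))) **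
    (Sym C (map lab (ots x)) (map lab (ins y)) ## Idn C (map lab ?R)) ** (fm x ## Idn C (map lab (ins y @ ?R)))"
   using a a' c run2 by (simp only: ev.simps rM rM2 p1 p2) simp
  also have "... = ?E ** (((fm y ## Idn C (map lab (ots x))) ** Sym C (map lab (ots x)) (map lab (ins y)) ** (fm x ## Idn C (map lab (ins y))))
     ## Idn C (map lab ?R))"
   using a a' by (simp add: whisker flip: ten_id)
  also have "(fm y ## Idn C (map lab (ots x))) ** Sym C (map lab (ots x)) (map lab (ins y)) ** (fm x ## Idn C (map lab (ins y)))
   = Sym C (map lab (ots x)) (map lab (ots y)) ** (fm x ## fm y)"
   using a a' sym_nat1(1)[of "fm x" "map lab (ins y)"] sym_nat[of "fm x" "fm y"] slide(1)[of "fm y" "fm x"]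
   by (simp flip: cmp_assoc)
  also have "?E ** ((...) ## Idn C (map lab ?R)) = (?E ** perm lab (ots x @ ots y @ ?R) (ots y @ ots x @ ?R)) **
    (fm x ## fm y ## Idn C (map lab ?R))"
   using a a' run2 by (simp add: p3 whisker)
  also have "?E ** perm lab (ots x @ ots y @ ?R) (ots y @ ots x @ ?R) = Ev (ots x @ ots y @ ?R) xs out"
   by (rule ev_perm[OF pm2 run2])
  finally have "Ev ?M (x # y # xs) out = Ev (ots x @ ots y @ ?R) xs out ** (fm x ## fm y ## Idn C (map lab ?R))" .
  with ev_perm[OF pmM RM, symmetric] show ?thesis
   using a a' pmM runs_pm[OF pm2 run2] by (simp del: ev.simps)
 qed
 have dR: "distinct (ots x @ ots y @ ?R)" "distinct (ins x @ ins y @ ?R)"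
   using a a' disj by auto
 have [simp]: "map lab ?R:Obj C" using a by simp
 have q1: "perm lab L (ins y @ ins x @ ?R) = (Sym C (map lab (ins x)) (map lab (ins y)) ## Idn C (map lab ?R)) ** perm lab L (ins x @ ins y @ ?R)"
 proof -
  have "perm lab ((ins x @ ins y) @ ?R) ((ins y @ ins x) @ ?R) = perm lab (ins x @ ins y) (ins y @ ins x) ## perm lab ?R ?R"
   using dR a a' by (intro perm_append) (auto simp: pm_def)
  also have "... = Sym C (map lab (ins x)) (map lab (ins y)) ## Idn C (map lab ?R)"
   using dR a a' by (subst perm_sym) (auto simp: perm_id)
  moreover have "perm lab (ins x @ ins y @ ?R) (ins y @ ins x @ ?R) ** perm lab L (ins x @ ins y @ ?R) = perm lab L (ins y @ ins x @ ?R)"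
   using dR a a' b b' by (intro perm_comp) (auto simp: pm_def)
  ultimately show ?thesis by simp
 qed
 have r: "rem (ots x @ rem L (ins x)) (ins y) = ots x @ ?R"
   using disj by (subst rem_append, subst rem_disjoint) auto
 have r2: "rem (ots y @ rem L (ins y)) (ins x) = ots y @ ?R"
   using disj by (subst rem_append, subst rem_disjoint) (auto simp: R')
 have pm2: "pm (ots x @ ots y @ ?R) (ots y @ ots x @ ?R)" using dR by (auto simp: pm_def)
 have run3: "Runs (ots y @ ots x @ ?R) xs out" using a'(4) by (simp add: r)
 have run2: "Runs (ots x @ ots y @ ?R) xs out" by (rule runs_pm[OF pm2 run3])
 have p3: "perm lab (ots x @ ots y @ ?R) (ots y @ ots x @ ?R) = Sym C (map lab (ots x)) (map lab (ots y)) ## Idn C (map lab ?R)"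
 proof -
  have "perm lab ((ots x @ ots y) @ ?R) ((ots y @ ots x) @ ?R) = perm lab (ots x @ ots y) (ots y @ ots x) ## perm lab ?R ?R"
   using dR a a' by (intro perm_append) (auto simp: pm_def)
  also have "... = Sym C (map lab (ots x)) (map lab (ots y)) ## Idn C (map lab ?R)"
   using dR a a' by (subst perm_sym) (auto simp: perm_id)
  finally show ?thesis by simp
 qed
 have pmL: "pm L (ins x @ ins y @ ?R)" using a a' b dR by (auto simp: pm_def)
 have sl: "(fm y ## fm x) ** Sym C (map lab (ins x)) (map lab (ins y)) = Sym C (map lab (ots x)) (map lab (ots y)) ** (fm x ## fm y)"
  using sym_nat[of "fm x" "fm y"] a b by simp
 have "Ev L (y # x # xs) out = Ev (ots y @ ots x @ ?R) xs out **
   (fm y ## fm x ## Idn C (map lab ?R)) ** (Sym C (map lab (ins x)) (map lab (ins y)) ## Idn C (map lab ?R)) ** perm lab L (ins x @ ins y @ ?R)"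
  using one[OF yx] disj by (simp only: R'[symmetric] q1[symmetric]) (auto simp: Int_commute)
 also have "... = Ev (ots y @ ots x @ ?R) xs out **
   (((fm y ## fm x) ** Sym C (map lab (ins x)) (map lab (ins y))) ## Idn C (map lab ?R)) ** perm lab L (ins x @ ins y @ ?R)"
  using a b run3 pmL by (simp add: whisker)
 also have "... = (Ev (ots y @ ots x @ ?R) xs out ** perm lab (ots x @ ots y @ ?R) (ots y @ ots x @ ?R)) **
   (fm x ## fm y ## Idn C (map lab ?R)) ** perm lab L (ins x @ ins y @ ?R)"
  unfolding sl using a b run3 pmL by (simp add: whisker p3)
 also have "... = Ev L (x # y # xs) out"
  unfolding ev_perm[OF pm2 run3] using one[OF xy] disj by auto
 finally show ?thesis by simp
qed

lemma ev_post:
 assumes "Runs L xs out" "pm out out'"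
 shows "Runs L xs out'" "perm lab out out' ** Ev L xs out = Ev L xs out'"
proof -
 show "Runs L xs out'"
  using assms by (auto simp: runs_def pm_def)
 show "perm lab out out' ** Ev L xs out = Ev L xs out'"
  using assms
 proof (induction xs arbitrary: L)
  case Nil
  thus ?case by (simp add: perm_comp)
 next
  case (Cons x xs)
  note st = runs_step[OF Cons.prems(1)]
  have "map lab out:Obj C" using ev_arr[OF Cons.prems(1)] by (metis cod_obj)
  hence [simp]: "perm lab out out':Arr C" "Dom C (perm lab out out') = map lab out" using Cons.prems by auto
  show ?case using st cmp_rewrite[OF Cons.IH[OF st(4) Cons.prems(2)]] by simp
 qed
qed

lemma ev_append:
 assumes "Runs L xs L2" "Runs L2 ys out" "distinct (L @ concat (map ots (xs @ ys)))"
 shows "Runs L (xs @ ys) out & Ev L (xs @ ys) out = Ev L2 ys out ** Ev L xs L2"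
 using assms
proof (induction xs arbitrary: L)
 case Nil
 thus ?case by (auto simp: ev_perm intro: runs_pm)
next
 case (Cons x xs)
 note st = runs_step[OF Cons.prems(1)]
 have "Runs (ots x @ rem L (ins x)) (xs @ ys) out &
   Ev (ots x @ rem L (ins x)) (xs @ ys) out = Ev L2 ys out ** Ev (ots x @ rem L (ins x)) xs L2"
  by (rule Cons.IH) (use st Cons.prems in auto)
 thus ?case using st Cons.prems by (auto simp: runs_Cons)
qed

lemma runs_swap:
 assumes "Runs L (y # x # zs) out" "set (ins x) <= set L"
 shows "Runs L (x # y # zs) out"
proof -
 note a = runs_step[OF assms(1)] note b = runs_step[OF a(4)]
 have e: "set (ots x) Un (set (ots y) Un (set L - set (ins y)) - set (ins x)) =
   set (ots y) Un (set (ots x) Un (set L - set (ins x)) - set (ins y))"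
  using assms a b by (auto simp: runs_Cons)
 have "set (ins y) <= set (ots x) Un (set L - set (ins x))"
  using assms a b by auto
 with assms a b show ?thesis unfolding runs_def by (auto simp: e nodes_ok_def)
qed

lemma runs_avail:
 assumes "Runs L (ys @ x # zs) out"
 shows "set (ins x) <= set L Un set (concat (map ots ys))"
 using assms
proof (induction ys arbitrary: L)
 case Nil
 thus ?case by (auto simp: runs_def)
next
 case (Cons y ys)
 from Cons.IH[of "ots y @ rem L (ins y)"] runs_step(4)[of L y "ys @ x # zs" out] Cons.prems show ?case
  by auto
qed

text \<open>By repeated exchange of adjacent nodes. An input of \<open>x\<close> that is live at the
  start stays live until \<open>x\<close> runs: outputs are fresh, so a consumed edge could not come
  back.\<close>

lemma ev_front:
 assumes "Runs L (ys @ x # zs) out" "set (ins x) <= set L"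
 shows "Runs L (x # ys @ zs) out & Ev L (ys @ x # zs) out = Ev L (x # ys @ zs) out"
 using assms
proof (induction ys arbitrary: L)
 case (Cons y ys)
 let ?L = "ots y @ rem L (ins y)"
 have pr: "Runs L (y # ys @ x # zs) out" using Cons.prems by simp
 note a = runs_step[OF pr]
 have "set (ins x) <= set ?L"
  using runs_avail[OF a(4)] Cons.prems(2) pr by (auto simp: runs_Cons)
 from Cons.IH[OF a(4) this] have IH: "Runs ?L (x # ys @ zs) out" "Ev ?L (ys @ x # zs) out = Ev ?L (x # ys @ zs) out"
  by auto
 have 1: "Runs L (y # x # ys @ zs) out"
  using pr IH(1) by (subst (asm) runs_Cons, subst runs_Cons) auto
 have 2: "Runs L (x # y # ys @ zs) out" by (rule runs_swap[OF 1 Cons.prems(2)])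
 have "Ev L (y # ys @ x # zs) out = Ev L (y # x # ys @ zs) out" using IH(2) by simp
 with 2 ev_swap[OF 1 2] show ?case by (simp del: ev.simps)
qed simp

text \<open>The first node of one order has its inputs live at the start, so \<open>ev_front\<close>
  brings it to the front of the other order as well, and the induction hypothesis compares what
  follows.\<close>

theorem ev_order:
 assumes "Runs L xs out" "Runs L ys out" "distinct xs" "distinct ys" "set xs = set ys"
 shows "Ev L xs out = Ev L ys out"
 using assms
proof (induction xs arbitrary: L ys)
 case (Cons x xs)
 then obtain ys1 ys2 where ys: "ys = ys1 @ x # ys2" by (metis list.set_intros(1) split_list)
 note a = runs_step[OF Cons.prems(1)]
 have f: "Runs L (x # ys1 @ ys2) out" "Ev L ys out = Ev L (x # ys1 @ ys2) out"
  using ev_front[of L ys1 x ys2 out] Cons.prems ys a by auto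
 have "Ev (ots x @ rem L (ins x)) xs out = Ev (ots x @ rem L (ins x)) (ys1 @ ys2) out"
  by (rule Cons.IH) (use Cons.prems ys a runs_step[OF f(1)] in auto)
 thus ?case using f by simp
qed simp

lemma ev_tensor_right:
 assumes "Runs L xs out" "distinct (L @ concat (map ots xs) @ R)" "map lab R:Obj C"
 shows "Runs (L @ R) xs (out @ R) & Ev (L @ R) xs (out @ R) = Ev L xs out ## Idn C (map lab R)"
 using assms
proof (induction xs arbitrary: L)
 case Nil
 thus ?case
  using perm_append[of L out R R lab] by (auto simp: pm_def perm_id)
next
 case (Cons x xs)
 note a = runs_step[OF Cons.prems(1)]
 have r: "rem (L @ R) (ins x) = rem L (ins x) @ R"
  using a Cons.prems by (subst rem_append, subst (2) rem_disjoint) auto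
 have IH: "Runs ((ots x @ rem L (ins x)) @ R) xs (out @ R)"
  "Ev ((ots x @ rem L (ins x)) @ R) xs (out @ R) = Ev (ots x @ rem L (ins x)) xs out ## Idn C (map lab R)"
  using Cons.IH[of "ots x @ rem L (ins x)"] a Cons.prems by (simp_all add: Int_Un_distrib Int_Un_distrib2) blast+
 have p: "perm lab (L @ R) ((ins x @ rem L (ins x)) @ R) = perm lab L (ins x @ rem L (ins x)) ## Idn C (map lab R)"
  using perm_append[of L "ins x @ rem L (ins x)" R R lab] a Cons.prems pm_refl[of R]
  by (simp add: perm_id) blast
 show ?case using IH a Cons.prems p
  by (auto simp: r runs_Cons whisker ten_id)
qed

text \<open>Active edges are kept in front, so only idle wires to their right pass directly through
  the recursion; wires on the left are reached by conjugating with block symmetries.\<close>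

lemma ev_tensor_left:
 assumes "Runs L xs out" "distinct (L @ concat (map ots xs) @ R)" "map lab R:Obj C"
 shows "Runs (R @ L) xs (R @ out) & Ev (R @ L) xs (R @ out) = Idn C (map lab R) ## Ev L xs out"
proof -
 have dout: "set out <= set L Un set (concat (map ots xs))"
  using assms(1)
 proof (induction xs arbitrary: L)
  case (Cons x xs)
  from Cons.IH[OF runs_step(4)[OF Cons.prems]] show ?case by auto
 qed (auto simp: pm_def)
 have o: "distinct out" using assms(1) by (simp add: runs_def)
 have t: "Runs (L @ R) xs (out @ R)" "Ev (L @ R) xs (out @ R) = Ev L xs out ## Idn C (map lab R)"
  using ev_tensor_right[OF assms] by auto
 have p1: "pm (R @ L) (L @ R)" and p2: "pm (out @ R) (R @ out)" using assms dout o
  by (auto simp: pm_def)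
 note t' = ev_post[OF t(1) p2]
 have [simp]: "map lab out:Obj C" "map lab L:Obj C"
  using assms dout ev_arr[OF assms(1)] runs_distinct[OF assms(1)] cod_obj by metis+
 have "Ev (R @ L) xs (R @ out) = perm lab (out @ R) (R @ out) ** Ev (L @ R) xs (out @ R) ** perm lab (R @ L) (L @ R)"
  using ev_perm[OF p1 t'(1)] t'(2) t(1) p1 p2 assms by (simp flip: cmp_assoc)
 also have "... = Sym C (map lab out) (map lab R) ** (Ev L xs out ## Idn C (map lab R)) ** Sym C (map lab R) (map lab L)"
  using p1 p2 assms(3) by (simp add: t(2) perm_sym pm_def)
 also have "... = Idn C (map lab R) ## Ev L xs out"
  using sym_nat1(1)[of "Ev L xs out" "map lab R"] assms sym_sym[of "map lab R" "map lab L"]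
   cmp_assoc[of "Sym C (map lab R) (map lab L)" "Ev L xs out ## Idn C (map lab R)" "Sym C (map lab out) (map lab R)"]
  by simp
 finally show ?thesis using runs_pm[OF p1 t'(1)] by simp
qed

end

text \<open>The reason why evaluation is an invariant of the isomorphism class; it also lets the
  parts of a glued graph be evaluated in their own names.\<close>

lemma ev_rename:
 assumes "runs lab ins ots fm L xs out" "inj_on q (set L Un set (concat (map ots xs)))" "inj_on p (set xs)"
  "ALL e:set L Un set (concat (map ots xs)). lab' (q e) = lab e"
  "ALL x:set xs. ins' (p x) = map q (ins x) & ots' (p x) = map q (ots x) & fm' (p x) = fm x"
 shows "runs lab' ins' ots' fm' (map q L) (map p xs) (map q out) &
  ev lab' ins' ots' fm' (map q L) (map p xs) (map q out) = ev lab ins ots fm L xs out"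
 using assms
proof (induction xs arbitrary: L)
 case Nil
 have "pm (map q L) (map q out)" using Nil by (auto simp: pm_def distinct_map)
 moreover have "map lab' (map q L) = map lab L" using Nil by simp
 ultimately show ?case using Nil by (simp add: perm_rename del: map_map)
next
 case (Cons x xs)
 note a = runs_step[OF Cons.prems(1)]
 let ?L = "ots x @ rem L (ins x)"
 have q: "inj_on q (set L)" using Cons.prems(2) by (auto elim: inj_on_subset)
 have r: "rem (map q L) (map q (ins x)) = map q (rem L (ins x))"
  using q a(12) by (auto simp: rem_def filter_map o_def inj_on_def intro!: arg_cong[of _ _ "map q"] filter_cong)
 have l: "map lab' (map q M) = map lab M" if "set M <= set L Un set (concat (map ots (x # xs)))" for M
  using that Cons.prems(4) by auto
 have IH: "runs lab' ins' ots' fm' (map q ?L) (map p xs) (map q out) &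
  ev lab' ins' ots' fm' (map q ?L) (map p xs) (map q out) = ev lab ins ots fm ?L xs out"
  by (rule Cons.IH[OF a(4)]) (use Cons.prems in "auto elim!: inj_on_subset")
 have p: "perm lab' (map q L) (map q (ins x @ rem L (ins x))) = perm lab L (ins x @ rem L (ins x))"
  by (rule perm_rename) (use q a Cons.prems in auto)
 have cc: "concat (map ots' (map p xs)) = map q (concat (map ots xs))"
  using Cons.prems(5) by (simp add: map_concat o_def cong: map_cong)
 have d: "distinct (map q (L @ ots x @ concat (map ots xs)))"
  using Cons.prems(1,2) by (subst distinct_map) (auto simp: runs_def elim!: inj_on_subset)
 have l1: "map (lab' \<circ> q) L = map lab L" "map (lab' \<circ> q) (ots x) = map lab (ots x)" "map (lab' \<circ> q) (ins x) = map lab (ins x)"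
   "map (lab' \<circ> q) (rem L (ins x)) = map lab (rem L (ins x))"
  using l[of L] l[of "ots x"] l[of "ins x"] l[of "rem L (ins x)"] a by auto
 have "distinct (map q (ins x))" using a q by (auto simp: distinct_map elim: inj_on_subset)
 hence ok: "nodes_ok lab' ins' ots' fm' {p x}"
  using Cons.prems(5) a by (auto simp: nodes_ok_def l1)
 have e: "ins' (p x) = map q (ins x)" "ots' (p x) = map q (ots x)" "fm' (p x) = fm x"
  using Cons.prems(5) by auto
 have "runs lab' ins' ots' fm' (map q L) (p x # map p xs) (map q out)"
  using IH ok d a(2,12) by (simp add: runs_Cons e r cc l1 del: concat.simps map_map) (simp add: l1 image_mono)
 moreover have "ev lab' ins' ots' fm' (map q L) (p x # map p xs) (map q out) = ev lab ins ots fm L (x # xs) out"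
  using IH p by (simp add: e r l1)
 ultimately show ?case by simp
qed

end

section \<open>Term graphs\<close>

text \<open>An edge of an anchored diagram is determined by its source: a position in the domain or an output of a
 node. Naming edges this way turns gluing into substitution, and isomorphisms into bijections of nodes.\<close>

datatype 'n port = Inp nat | Outp 'n nat for map: mpt

text \<open>Edges have no field of their own: \<open>TI\<close> and \<open>TO\<close> say which port
  feeds each input of a node and each place of the codomain, and the number and letters of the
  output ports follow from the value of the node.\<close>

record ('n, 's, 'a) tg =
 TN :: "'n set"
 TV :: "'n => 'a"
 TD :: "'s list"
 TI :: "'n => 'n port list"
 TO :: "'n port list"

definition tgiso :: "('n1 => 'n2) => ('n1, 's, 'a) tg => ('n2, 's, 'a) tg => bool" where
 "tgiso p T T' <-> bij_betw p (TN T) (TN T') & TD T' = TD T & TO T' = map (mpt p) (TO T) &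
   (ALL x:TN T. TV T' (p x) = TV T x & TI T' (p x) = map (mpt p) (TI T x))"

definition tgeq :: "('n1, 's, 'a) tg => ('n2, 's, 'a) tg => bool" (infix "\<simeq>" 50) where
 "T \<simeq> T' <-> (EX p. tgiso p T T')"

definition idx :: "'e list => 'e => nat" where
 "idx xs e = length (takeWhile (%x. x ~= e) xs)"

lemma idx_less [simp]: "e:set xs ==> idx xs e < length xs"
 and nth_idx [simp]: "e:set xs ==> xs ! idx xs e = e"
 by (induction xs) (auto simp: idx_def)

lemma idx_nth [simp]: "distinct xs ==> i < length xs ==> idx xs (xs ! i) = i"
 by (metis idx_less nth_eq_iff_index_eq nth_idx nth_mem)

lemma idx_map: "inj_on q (set xs) ==> e:set xs ==> idx (map q xs) (q e) = idx xs e"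
proof (induction xs)
 case (Cons x xs)
 hence "inj_on q (set xs)" by (auto elim: inj_on_subset)
 with Cons show ?case by (auto simp: idx_def inj_on_def)
qed simp

lemma idx_upt [simp]: "i < n ==> idx [0..<n] i = i"
 using idx_nth[of "[0..<n]" i] by simp

text \<open>Counting the strict predecessors under the transitive closure gives a function that
  increases along \<open>r\<close>, because by acyclicity no element precedes itself.\<close>

lemma acyclic_rank:
 assumes "finite r" "acyclic r"
 shows "EX rk :: 'n => nat. ALL (x, y):r. rk x < rk y"
proof -
 define rk where "rk x = card {z. (z, x):r\<^sup>+}" for x
 have fin: "finite {z. (z, x):r\<^sup>+}" for x
  by (rule finite_subset[of _ "Domain (r\<^sup>+)"]) (use assms(1) in "auto simp: finite_Domain dest: tranclD")
 have "rk x < rk y" if "(x, y):r" for x y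
  unfolding rk_def
 proof (rule psubset_card_mono[OF fin])
  have "x ~: {z. (z, x):r\<^sup>+}" using assms(2) by (auto simp: acyclic_def)
  moreover have "x:{z. (z, y):r\<^sup>+}" using that by auto
  moreover have "{z. (z, x):r\<^sup>+} <= {z. (z, y):r\<^sup>+}" using that by auto
  ultimately show "{z. (z, x):r\<^sup>+} \<subset> {z. (z, y):r\<^sup>+}" by blast
 qed
 thus ?thesis by blast
qed

lemma rank_acyclic:
 fixes rk :: "'n => nat"
 assumes "ALL (x, y):r. rk x < rk y"
 shows "acyclic r"
proof -
 have "rk x < rk y" if "(x, y):r\<^sup>+" for x y
  using that by induction (use assms in force)+
 thus ?thesis unfolding acyclic_def by fastforce
qed

lemma acyclic_edges_iff:
 assumes "finite (Edges Ga)"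
 shows "acyclic {(x, y). EX e:Edges Ga. Src Ga e = Some x & Tgt Ga e = Some y} <->
  (EX rk :: 'n => nat. ALL e:Edges Ga. ALL x y. Src Ga e = Some x --> Tgt Ga e = Some y --> rk x < rk y)"
  (is "acyclic ?r <-> _")
proof -
 have "?r <= (%e. (the (Src Ga e), the (Tgt Ga e))) ` Edges Ga" by force
 hence "finite ?r" using assms by (meson finite_surj)
 show ?thesis
 proof
  assume "acyclic ?r"
  from acyclic_rank[OF \<open>finite ?r\<close> this] show "EX rk :: 'n => nat. ALL e:Edges Ga. ALL x y. Src Ga e = Some x --> Tgt Ga e = Some y --> rk x < rk y"
   by blast
 next
  assume "EX rk :: 'n => nat. ALL e:Edges Ga. ALL x y. Src Ga e = Some x --> Tgt Ga e = Some y --> rk x < rk y"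
  then obtain rk :: "'n => nat" where "ALL e:Edges Ga. ALL x y. Src Ga e = Some x --> Tgt Ga e = Some y --> rk x < rk y" ..
  thus "acyclic ?r" by (intro rank_acyclic[of _ rk]) auto
 qed
qed

context
 fixes G :: "('s, 'a, 'z) graph_monoid_scheme"
begin

definition plab :: "('n, 's, 'a) tg => 'n port => 's" where
 "plab T p = (case p of Inp i => TD T ! i | Outp x j => ATgt G (TV T x) ! j)"

definition outports :: "('n, 's, 'a) tg => 'n => 'n port list" where
 "outports T x = map (Outp x) [0..<length (ATgt G (TV T x))]"

definition inports :: "('n, 's, 'a) tg => 'n port list" where
 "inports T = map Inp [0..<length (TD T)]"

definition ports :: "('n, 's, 'a) tg => 'n port set" where
 "ports T = set (inports T) Un (UN x:TN T. set (outports T x))"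

lemma ports_simps [simp]: "Inp i:ports T <-> i < length (TD T)"
 "Outp x j:ports T <-> x:TN T & j < length (ATgt G (TV T x))"
 by (auto simp: ports_def inports_def outports_def image_iff)

lemma plab_simps [simp]: "plab T (Inp i) = TD T ! i" "plab T (Outp x j) = ATgt G (TV T x) ! j"
 by (auto simp: plab_def)

text \<open>Every edge has exactly one target: the lists \<open>TI\<close> and \<open>TO\<close> are
  duplicate-free, pairwise disjoint and together exhaust the ports.\<close>

definition is_tg :: "('n, 's, 'a) tg => bool" where
 "is_tg T <-> finite (TN T) & TD T:lists (Letters G) &
   (ALL x:TN T. TV T x:Arrows G & distinct (TI T x) & map (plab T) (TI T x) = ASrc G (TV T x)) &
   distinct (TO T) & (ALL x:TN T. ALL y:TN T. x ~= y --> set (TI T x) Int set (TI T y) = {}) &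
   (ALL x:TN T. set (TI T x) Int set (TO T) = {}) &
   (UN x:TN T. set (TI T x)) Un set (TO T) = ports T &
   (EX rk :: 'n => nat. ALL x:TN T. ALL y j. Outp y j:set (TI T x) --> rk y < rk x)"

definition tcod :: "('n, 's, 'a) tg => 's list" where
 "tcod T = map (plab T) (TO T)"

lemma finite_ports: "is_tg T ==> finite (ports T)"
 by (auto simp: is_tg_def ports_def)

lemma tg_ports:
 assumes "is_tg T"
 shows "x:TN T ==> set (TI T x) <= ports T" "set (TO T) <= ports T"
 using assms unfolding is_tg_def by blast+

lemma plab_iso:
 assumes "tgiso p T T'" "q:ports T"
 shows "plab T' (mpt p q) = plab T q"
 using assms by (cases q) (auto simp: tgiso_def)

lemma ports_iso:
 assumes "tgiso p T T'"
 shows "bij_betw (mpt p) (ports T) (ports T')"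
proof -
 have b: "bij_betw p (TN T) (TN T')" using assms by (simp add: tgiso_def)
 have "inj_on (mpt p) (ports T)"
 proof (rule inj_onI)
  fix u v assume "u:ports T" "v:ports T" "mpt p u = mpt p v"
  thus "u = v" using b by (cases u; cases v) (auto simp: bij_betw_def inj_on_def)
 qed
 moreover have "mpt p ` ports T = ports T'"
 proof (intro set_eqI iffI)
  fix v assume "v:ports T'"
  thus "v:mpt p ` ports T"
  proof (cases v)
   case (Inp i)
   thus ?thesis using \<open>v:ports T'\<close> assms by (auto simp: tgiso_def intro!: image_eqI[of _ _ "Inp i"])
  next
   case (Outp y j)
   then obtain x where "x:TN T" "y = p x" using \<open>v:ports T'\<close> b by (auto simp: bij_betw_def)
   thus ?thesis using Outp \<open>v:ports T'\<close> assms
    by (auto simp: tgiso_def intro!: image_eqI[of _ _ "Outp x j"])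
  qed
 next
  fix v assume "v:mpt p ` ports T"
  then obtain u where "u:ports T" "v = mpt p u" by blast
  thus "v:ports T'" using assms b by (cases u) (auto simp: tgiso_def bij_betw_def)
 qed
 ultimately show ?thesis by (simp add: bij_betw_def)
qed

lemma tcod_iso:
 assumes "tgiso p T T'" "is_tg T"
 shows "tcod T' = tcod T"
proof -
 have "TO T' = map (mpt p) (TO T)" using assms(1) by (simp add: tgiso_def)
 thus ?thesis using tg_ports(2)[OF assms(2)] by (auto simp: tcod_def plab_iso[OF assms(1)])
qed

lemma tg_iso:
 assumes i: "tgiso p T T'" and t: "is_tg T"
 shows "is_tg T'"
proof -
 have b: "bij_betw p (TN T) (TN T')" and N': "TN T' = p ` TN T" and inj: "inj_on p (TN T)"
  using i by (auto simp: tgiso_def bij_betw_def)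
 have pinj: "inj_on (mpt p) (ports T)" and pim: "mpt p ` ports T = ports T'"
  using ports_iso[OF i] by (auto simp: bij_betw_def)
 have ti: "TI T' (p x) = map (mpt p) (TI T x)" "TV T' (p x) = TV T x" if "x:TN T" for x
  using i that by (auto simp: tgiso_def)
 have tO: "TO T' = map (mpt p) (TO T)" "TD T' = TD T" using i by (auto simp: tgiso_def)
 note sub = tg_ports[OF t]
 have d: "mpt p ` A Int mpt p ` B = {}" if "A Int B = {}" "A <= ports T" "B <= ports T" for A B
  using pinj that by (metis image_empty inj_on_image_Int)
 from t obtain rk :: "_ => nat" where rk: "ALL x:TN T. ALL y j. Outp y j:set (TI T x) --> rk y < rk x"
  by (auto simp: is_tg_def)
 define rk' where "rk' y = rk (inv_into (TN T) p y)" for y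
 have "EX rk :: _ => nat. ALL x:TN T'. ALL y j. Outp y j:set (TI T' x) --> rk y < rk x"
 proof (rule exI[of _ rk'], intro ballI allI impI)
  fix x' y j assume "x':TN T'" and o: "Outp y j:set (TI T' x')"
  then obtain x where x: "x' = p x" "x:TN T" using N' by auto
  with o ti obtain u where u: "u:set (TI T x)" "Outp y j = mpt p u" by auto
  from u(2)[symmetric] obtain z where z: "u = Outp z j" "y = p z" by (cases u) auto
  with sub(1)[OF x(2)] u have "z:TN T" by auto
  thus "rk' y < rk' x'" using rk u z x inj by (auto simp: rk'_def)
 qed
 moreover have "map (plab T') (TI T' (p x)) = map (plab T) (TI T x)" if "x:TN T" for x
  using that sub(1)[OF that] by (auto simp: ti plab_iso[OF i])
 moreover have "distinct (TI T' (p x))" if "x:TN T" for x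
  using that t sub(1)[OF that] pinj by (auto simp: ti distinct_map is_tg_def elim: inj_on_subset)
 moreover have "distinct (TO T')"
  using t sub(2) pinj by (auto simp: tO distinct_map is_tg_def elim: inj_on_subset)
 moreover have "(UN x:TN T'. set (TI T' x)) Un set (TO T') = mpt p ` ((UN x:TN T. set (TI T x)) Un set (TO T))"
  by (auto simp: N' tO ti)
 moreover have "set (TI T' (p x)) Int set (TI T' (p y)) = {}" if "x:TN T" "y:TN T" "p x ~= p y" for x y
 proof -
  have "x ~= y" using that by auto
  hence "set (TI T x) Int set (TI T y) = {}" using t that by (simp add: is_tg_def)
  thus ?thesis using that sub d[of "set (TI T x)" "set (TI T y)"] by (simp add: ti)
 qed
 moreover have "set (TI T' (p x)) Int set (TO T') = {}" if "x:TN T" for x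
  using that t sub d[of "set (TI T x)" "set (TO T)"] by (auto simp: ti tO is_tg_def)
 moreover have "(UN x:TN T. set (TI T x)) Un set (TO T) = ports T" using t by (simp add: is_tg_def)
 moreover have "finite (TN T')" "TD T':lists (Letters G)" using t by (simp_all add: is_tg_def N' tO)
 moreover have "!!x. x:TN T ==> TV T' (p x):Arrows G" "!!x. x:TN T ==> map (plab T) (TI T x) = ASrc G (TV T' (p x))"
  using t by (simp_all add: is_tg_def ti)
 ultimately show ?thesis unfolding is_tg_def pim[symmetric] by (simp only:) (simp add: N' del: ex_simps all_simps)
qed

end

lemma tgiso_sym:
 assumes i: "tgiso p T T'" and "!!x. x:TN T ==> set (TI T x) <= ports G T" "set (TO T) <= ports G T"
 shows "tgiso (inv_into (TN T) p) T' T"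
proof -
 let ?p = "inv_into (TN T) p"
 have b: "bij_betw p (TN T) (TN T')" using i by (auto simp: tgiso_def)
 hence inj: "inj_on p (TN T)" by (simp add: bij_betw_def)
 have m: "mpt ?p (mpt p u) = u" if "u:ports G T" for u
  using that inj by (cases u) auto
 have M: "map (mpt ?p) (map (mpt p) us) = us" if "set us <= ports G T" for us
  using that m by (induction us) auto
 have "TV T (?p y) = TV T' y & TI T (?p y) = map (mpt ?p) (TI T' y)" if "y:TN T'" for y
 proof -
  from that b obtain x where "x:TN T" "y = p x" by (auto simp: bij_betw_def)
  thus ?thesis using i inj M assms(2)[of x] by (simp add: tgiso_def)
 qed
 thus ?thesis using i M[OF assms(3)] b by (auto simp: tgiso_def bij_betw_inv_into)
qed

lemma tgiso_trans: "tgiso p T T' ==> tgiso q T' T'' ==> tgiso (q \<circ> p) T T''"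
 by (auto simp: tgiso_def port.map_comp o_def bij_betw_apply intro: bij_betw_trans[unfolded o_def])

lemma tgeq_trans: "T \<simeq> T' ==> T' \<simeq> T'' ==> T \<simeq> T''"
 unfolding tgeq_def using tgiso_trans by blast

lemma tgeq_sym: "T \<simeq> T' ==> is_tg G T ==> T' \<simeq> T"
 unfolding tgeq_def using tgiso_sym tg_ports by metis

section \<open>Anchored diagrams as term graphs\<close>

definition pt :: "('n, 'e, 's, 'a) adiagram => 'e => 'n port" where
 "pt Ga e = (case Src Ga e of None => Inp (idx (DomL Ga) e) | Some x => Outp x (idx (Outs Ga x) e))"

definition canon :: "('n, 'e, 's, 'a) adiagram => ('n, 's, 'a) tg" where
 "canon Ga = \<lparr> TN = Nodes Ga, TV = NVal Ga, TD = dom_word Ga, TI = (%x. map (pt Ga) (Ins Ga x)),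
   TO = map (pt Ga) (CodL Ga) \<rparr>"

lemma canon_simps [simp]: "TN (canon Ga) = Nodes Ga" "TV (canon Ga) = NVal Ga" "TD (canon Ga) = dom_word Ga"
 "TI (canon Ga) x = map (pt Ga) (Ins Ga x)" "TO (canon Ga) = map (pt Ga) (CodL Ga)"
 by (simp_all add: canon_def)

text \<open>A flat list of conditions with acyclicity turned into a rank function; validity of
  constructed diagrams is proved in this form.\<close>

lemma is_adiagram_iff:
 "is_adiagram G Ga <-> finite (Nodes Ga) & finite (Edges Ga) &
   (ALL e:Edges Ga. set_option (Src Ga e) <= Nodes Ga & set_option (Tgt Ga e) <= Nodes Ga & EVal Ga e:Letters G) &
   (ALL x:Nodes Ga. distinct (Ins Ga x) & set (Ins Ga x) = {e:Edges Ga. Tgt Ga e = Some x} &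
    distinct (Outs Ga x) & set (Outs Ga x) = {e:Edges Ga. Src Ga e = Some x} &
    NVal Ga x:Arrows G & ASrc G (NVal Ga x) = map (EVal Ga) (Ins Ga x) &
    ATgt G (NVal Ga x) = map (EVal Ga) (Outs Ga x)) &
   distinct (DomL Ga) & set (DomL Ga) = {e:Edges Ga. Src Ga e = None} &
   distinct (CodL Ga) & set (CodL Ga) = {e:Edges Ga. Tgt Ga e = None} &
   (EX rk :: 'n => nat. ALL e:Edges Ga. ALL x y. Src Ga e = Some x --> Tgt Ga e = Some y --> rk x < rk y)"
 for Ga :: "('n, 'e, 's, 'a, 'y) adiagram_scheme"
 using acyclic_edges_iff[of Ga]
 unfolding is_adiagram_def is_diagram_def is_graph_def dom_edges_def cod_edges_def by blast

locale adiag =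
 fixes G :: "('s, 'a, 'z) graph_monoid_scheme" and Ga :: "('n, 'e, 's, 'a) adiagram"
 assumes ad: "is_adiagram G Ga"
begin

lemma fin [simp]: "finite (Nodes Ga)" "finite (Edges Ga)"
 using ad by (auto simp: is_adiagram_iff)

lemma edge:
 assumes "e:Edges Ga"
 shows "Src Ga e = Some x ==> x:Nodes Ga" "Tgt Ga e = Some x ==> x:Nodes Ga" "EVal Ga e:Letters G"
 using ad assms by (auto simp: is_adiagram_iff)

lemma node:
 assumes "x:Nodes Ga"
 shows "distinct (Ins Ga x)" "set (Ins Ga x) = {e:Edges Ga. Tgt Ga e = Some x}" "distinct (Outs Ga x)"
  "set (Outs Ga x) = {e:Edges Ga. Src Ga e = Some x}" "NVal Ga x:Arrows G"
  "ASrc G (NVal Ga x) = map (EVal Ga) (Ins Ga x)" "ATgt G (NVal Ga x) = map (EVal Ga) (Outs Ga x)"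
 using ad assms by (auto simp: is_adiagram_iff)

lemma anc: "distinct (DomL Ga)" "set (DomL Ga) = {e:Edges Ga. Src Ga e = None}"
 "distinct (CodL Ga)" "set (CodL Ga) = {e:Edges Ga. Tgt Ga e = None}"
 using ad by (auto simp: is_adiagram_iff)

lemma pt_ports:
 assumes "e:Edges Ga"
 shows "pt Ga e:ports G (canon Ga)" "plab G (canon Ga) (pt Ga e) = EVal Ga e"
 using assms edge[OF assms] anc node
 by (auto simp: pt_def dom_word_def split: option.split)

lemma pt_inj: "inj_on (pt Ga) (Edges Ga)"
proof (rule inj_onI)
 fix e f assume e: "e:Edges Ga" and f: "f:Edges Ga" and eq: "pt Ga e = pt Ga f"
 show "e = f"
 proof (cases "Src Ga e")
  case None
  hence "Src Ga f = None" using eq by (auto simp: pt_def split: option.splits)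
  with None eq have "idx (DomL Ga) e = idx (DomL Ga) f" by (simp add: pt_def)
  with None \<open>Src Ga f = None\<close> e f anc(2) show ?thesis by (metis (mono_tags, lifting) mem_Collect_eq nth_idx)
 next
  case (Some x)
  hence f': "Src Ga f = Some x" using eq by (auto simp: pt_def split: option.splits)
  with Some eq have "idx (Outs Ga x) e = idx (Outs Ga x) f" by (simp add: pt_def)
  moreover have "e:set (Outs Ga x)" "f:set (Outs Ga x)" using Some f' e f node(4) edge(1) by auto
  ultimately show ?thesis by (metis nth_idx)
 qed
qed

lemma pt_nth: "i < length (DomL Ga) ==> pt Ga (DomL Ga ! i) = Inp i"
 "x:Nodes Ga ==> j < length (Outs Ga x) ==> pt Ga (Outs Ga x ! j) = Outp x j"
proof -
 assume i: "i < length (DomL Ga)"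
 hence "Src Ga (DomL Ga ! i) = None" using anc(2) nth_mem by blast
 thus "pt Ga (DomL Ga ! i) = Inp i" using i anc(1) by (simp add: pt_def)
next
 assume x: "x:Nodes Ga" "j < length (Outs Ga x)"
 hence "Src Ga (Outs Ga x ! j) = Some x" using node(4)[OF x(1)] nth_mem by blast
 thus "pt Ga (Outs Ga x ! j) = Outp x j" using x node(3) by (simp add: pt_def)
qed

lemma map_pt: "map (pt Ga) (DomL Ga) = inports (canon Ga)"
 "x:Nodes Ga ==> map (pt Ga) (Outs Ga x) = outports G (canon Ga) x"
 using node(7)[of x] by (auto simp: inports_def outports_def pt_nth dom_word_def intro!: nth_equalityI)

lemma pt_image: "pt Ga ` Edges Ga = ports G (canon Ga)"
proof
 show "pt Ga ` Edges Ga <= ports G (canon Ga)" using pt_ports by auto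
 have "set (inports (canon Ga)) <= pt Ga ` Edges Ga" using anc by (auto simp flip: map_pt)
 moreover have "set (outports G (canon Ga) x) <= pt Ga ` Edges Ga" if "x:Nodes Ga" for x
  using that node by (auto simp flip: map_pt)
 ultimately show "ports G (canon Ga) <= pt Ga ` Edges Ga" by (auto simp: ports_def)
qed

lemma sub_edges: "x:Nodes Ga ==> set (Ins Ga x) <= Edges Ga" "x:Nodes Ga ==> set (Outs Ga x) <= Edges Ga"
 "set (DomL Ga) <= Edges Ga" "set (CodL Ga) <= Edges Ga"
 using node(2,4) anc(2,4) by auto

lemma map_EVal: "set es <= Edges Ga ==> map (plab G (canon Ga)) (map (pt Ga) es) = map (EVal Ga) es"
 using pt_ports(2) by auto

lemma tcod_canon: "tcod G (canon Ga) = cod_word Ga"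
 using map_EVal[OF sub_edges(4)] by (simp add: tcod_def cod_word_def)

lemma pt_Int: "set A <= Edges Ga ==> set B <= Edges Ga ==> set A Int set B = {} ==> pt Ga ` set A Int pt Ga ` set B = {}"
 using pt_inj by (metis image_empty inj_on_image_Int)

lemma canon_tg: "is_tg G (canon Ga)"
proof -
 note inj = inj_on_subset[OF pt_inj]
 obtain rk :: "'n => nat" where rk: "ALL e:Edges Ga. ALL x y. Src Ga e = Some x --> Tgt Ga e = Some y --> rk x < rk y"
  using ad by (auto simp: is_adiagram_iff)
 have "rk y < rk x" if x: "x:Nodes Ga" and "Outp y j:pt Ga ` set (Ins Ga x)" for x y j
 proof -
  from that obtain e where e: "e:set (Ins Ga x)" "pt Ga e = Outp y j" by auto
  hence "e:Edges Ga" "Tgt Ga e = Some x" "Src Ga e = Some y" using node(2)[OF x]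
   by (auto simp: pt_def split: option.splits)
  thus ?thesis using rk by blast
 qed
 moreover have "(UN x:Nodes Ga. pt Ga ` set (Ins Ga x)) Un pt Ga ` set (CodL Ga) = ports G (canon Ga)"
 proof -
  have "(UN x:Nodes Ga. set (Ins Ga x)) Un set (CodL Ga) = Edges Ga"
  proof
   show "Edges Ga <= (UN x:Nodes Ga. set (Ins Ga x)) Un set (CodL Ga)"
   proof
    fix e assume e: "e:Edges Ga"
    thus "e:(UN x:Nodes Ga. set (Ins Ga x)) Un set (CodL Ga)"
     using edge(2)[OF e] node(2) anc(4) by (cases "Tgt Ga e") auto
   qed
  qed (use sub_edges in auto)
  thus ?thesis by (metis image_UN image_Un pt_image)
 qed
 moreover have "pt Ga ` set (Ins Ga x) Int pt Ga ` set (Ins Ga y) = {}" if "x:Nodes Ga" "y:Nodes Ga" "x ~= y" for x y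
  using that node(2) by (intro pt_Int sub_edges) auto
 moreover have "pt Ga ` set (Ins Ga x) Int pt Ga ` set (CodL Ga) = {}" if "x:Nodes Ga" for x
  using that node(2) anc by (intro pt_Int sub_edges) auto
 moreover have "TD (canon Ga):lists (Letters G)"
  using edge(3) sub_edges(3) by (fastforce simp: dom_word_def)
 moreover have "distinct (map (pt Ga) (CodL Ga))" using inj[OF sub_edges(4)] anc by (simp add: distinct_map)
 moreover have "distinct (map (pt Ga) (Ins Ga x))" if "x:Nodes Ga" for x
  using inj[OF sub_edges(1)[OF that]] node[OF that] by (simp add: distinct_map)
 moreover have "EX rk :: 'n => nat. ALL x:Nodes Ga. ALL y j. Outp y j:pt Ga ` set (Ins Ga x) --> rk y < rk x"
  using calculation(1) by blast
 ultimately show ?thesis unfolding is_tg_def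
  using map_EVal[OF sub_edges(1)] node(1,5,6) by (simp del: map_map ex_simps all_simps)
qed

end

lemma adiagram_iso_valid:
 fixes Ga :: "('n, 'e, 's, 'a) adiagram" and Up :: "('n2, 'e2, 's, 'a) adiagram"
 assumes i: "diagram_iso Ga Up p q" "DomL Up = map q (DomL Ga)" "CodL Up = map q (CodL Ga)"
  and ad: "is_adiagram G Ga"
 shows "is_adiagram G Up"
proof -
 interpret adiag G Ga by unfold_locales fact
 have N: "Nodes Up = p ` Nodes Ga" and E: "Edges Up = q ` Edges Ga" and pi: "inj_on p (Nodes Ga)" and qi: "inj_on q (Edges Ga)"
  using i by (auto simp: diagram_iso_def bij_betw_def)
 have e: "Src Up (q e) = map_option p (Src Ga e)" "Tgt Up (q e) = map_option p (Tgt Ga e)" "EVal Up (q e) = EVal Ga e"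
  if "e:Edges Ga" for e
  using i that by (auto simp: diagram_iso_def)
 have n: "Ins Up (p x) = map q (Ins Ga x)" "Outs Up (p x) = map q (Outs Ga x)" "NVal Up (p x) = NVal Ga x"
  if "x:Nodes Ga" for x
  using i that by (auto simp: diagram_iso_def)
 have s: "set_option (map_option p z) = p ` set_option z" for z by (cases z) auto
 have qd: "distinct (map q es)" if "distinct es" "set es <= Edges Ga" for es
  using that inj_on_subset[OF qi] by (auto simp: distinct_map)
 have St: "Src Up (q e) = Some (p x) <-> Src Ga e = Some x" "Tgt Up (q e) = Some (p x) <-> Tgt Ga e = Some x"
  if "e:Edges Ga" "x:Nodes Ga" for e x
  using that edge(1,2)[OF that(1)] pi e by (auto simp: inj_on_eq_iff)
 obtain rk :: "'n => nat" where rk: "ALL e:Edges Ga. ALL x y. Src Ga e = Some x --> Tgt Ga e = Some y --> rk x < rk y"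
  using ad by (auto simp: is_adiagram_iff)
 show ?thesis unfolding is_adiagram_iff
 proof (intro conjI ballI)
  show "finite (Nodes Up)" "finite (Edges Up)" by (simp_all add: N E)
 next
  fix f assume "f:Edges Up"
  then obtain d where d: "d:Edges Ga" "f = q d" by (auto simp: E)
  thus "set_option (Src Up f) <= Nodes Up" "set_option (Tgt Up f) <= Nodes Up" "EVal Up f:Letters G"
   using edge[OF d(1)] by (auto simp: e N s)
 next
  fix y assume "y:Nodes Up"
  then obtain x where x: "x:Nodes Ga" "y = p x" by (auto simp: N)
  note nx = node[OF x(1)]
  show "distinct (Ins Up y)" "distinct (Outs Up y)" using x nx by (auto simp: n intro!: qd)
  show "set (Ins Up y) = {f:Edges Up. Tgt Up f = Some y}" "set (Outs Up y) = {f:Edges Up. Src Up f = Some y}"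
   using x nx St by (auto simp: n E)
  show "NVal Up y:Arrows G" using x nx by (simp add: n)
  show "ASrc G (NVal Up y) = map (EVal Up) (Ins Up y)" "ATgt G (NVal Up y) = map (EVal Up) (Outs Up y)"
   using x nx by (auto simp: n e)
 next
  show "distinct (DomL Up)" "distinct (CodL Up)" using anc i by (auto intro!: qd)
  show "set (DomL Up) = {f:Edges Up. Src Up f = None}" "set (CodL Up) = {f:Edges Up. Tgt Up f = None}"
   using anc by (auto simp: i E e)
 next
  have "rk (inv_into (Nodes Ga) p y) < rk (inv_into (Nodes Ga) p z)"
   if f: "f:Edges Up" "Src Up f = Some y" "Tgt Up f = Some z" for f y z
  proof -
   from f obtain d where d: "d:Edges Ga" "f = q d" by (auto simp: E)
   then obtain y' z' where "Src Ga d = Some y'" "Tgt Ga d = Some z'" "y = p y'" "z = p z'" using f by (auto simp: e)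
   thus ?thesis using d rk edge[OF d(1)] pi by simp
  qed
  thus "EX rk :: _ => nat. ALL e:Edges Up. ALL x y. Src Up e = Some x --> Tgt Up e = Some y --> rk x < rk y"
   by (intro exI[of _ "rk \<circ> inv_into (Nodes Ga) p"]) simp
 qed
qed

lemma adiagram_iso_canon:
 assumes i: "diagram_iso Ga Up p q" "DomL Up = map q (DomL Ga)" "CodL Up = map q (CodL Ga)"
  and ad: "is_adiagram G Ga"
 shows "tgiso p (canon Ga) (canon Up)"
proof -
 interpret adiag G Ga by unfold_locales fact
 have qi: "inj_on q (Edges Ga)" using i by (auto simp: diagram_iso_def bij_betw_def)
 have p: "pt Up (q e) = mpt p (pt Ga e)" if e: "e:Edges Ga" for e
 proof (cases "Src Ga e")
  case None
  hence "e:set (DomL Ga)" using anc e by simp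
  with None i e idx_map[OF inj_on_subset[OF qi sub_edges(3)]] show ?thesis
   by (simp add: pt_def diagram_iso_def)
 next
  case (Some x)
  hence x: "x:Nodes Ga" using edge(1) e by blast
  hence "e:set (Outs Ga x)" using node(4) e Some by auto
  with Some i e x idx_map[OF inj_on_subset[OF qi sub_edges(2)[OF x]]] show ?thesis
   by (simp add: pt_def diagram_iso_def)
 qed
 have P: "map (pt Up) (map q es) = map (mpt p) (map (pt Ga) es)" if "set es <= Edges Ga" for es
  using that p by auto
 have "map (EVal Up) (map q (DomL Ga)) = map (EVal Ga) (DomL Ga)"
  using i sub_edges(3) by (auto simp: diagram_iso_def)
 thus ?thesis
  using i P[OF sub_edges(4)] P[OF sub_edges(1)] by (simp add: tgiso_def diagram_iso_def dom_word_def del: map_map)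
qed

text \<open>The edge bijection is forced by the node bijection, because an edge is recovered from
  its port. Isomorphism of diagrams thereby becomes isomorphism of term graphs.\<close>

lemma canon_iso_adiagram:
 assumes ad: "is_adiagram G Ga" "is_adiagram G Up" and i: "tgiso p (canon Ga) (canon Up)"
 shows "EX q. diagram_iso Ga Up p q & DomL Up = map q (DomL Ga) & CodL Up = map q (CodL Ga) &
  (ALL e:Edges Ga. pt Up (q e) = mpt p (pt Ga e))"
proof -
 interpret A: adiag G Ga by unfold_locales fact
 interpret B: adiag G Up by unfold_locales fact
 define q where "q e = inv_into (Edges Up) (pt Up) (mpt p (pt Ga e))" for e
 have pb: "bij_betw (mpt p) (ports G (canon Ga)) (ports G (canon Up))" by (rule ports_iso[OF i])
 have ba: "bij_betw (pt Ga) (Edges Ga) (ports G (canon Ga))" using A.pt_inj A.pt_image by (simp add: bij_betw_def)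
 have bb: "bij_betw (pt Up) (Edges Up) (ports G (canon Up))" using B.pt_inj B.pt_image by (simp add: bij_betw_def)
 have q: "bij_betw q (Edges Ga) (Edges Up)"
  using bij_betw_trans[OF bij_betw_trans[OF ba pb] bij_betw_inv_into[OF bb]] by (simp add: q_def[abs_def] o_def)
 have pq: "pt Up (q e) = mpt p (pt Ga e)" if "e:Edges Ga" for e
  unfolding q_def by (rule bij_betw_inv_into_right[OF bb]) (meson that bij_betwE ba pb)
 have qE: "set es <= Edges Ga ==> set (map q es) <= Edges Up" for es using q by (auto simp: bij_betw_def)
 have eqI: "map q es = fs" if "set es <= Edges Ga" "set fs <= Edges Up" "map (pt Up) fs = map (mpt p) (map (pt Ga) es)" for es fs
 proof -
  have "map (pt Up) (map q es) = map (pt Up) fs" using that pq by auto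
  thus ?thesis using B.pt_inj qE[OF that(1)] that(2) by (meson inj_on_map_eq_map inj_on_subset le_sup_iff)
 qed
 have pn: "bij_betw p (Nodes Ga) (Nodes Up)" using i by (simp add: tgiso_def)
 have n: "x:Nodes Ga ==> p x:Nodes Up" for x using pn by (auto simp: bij_betw_def)
 have cod: "CodL Up = map q (CodL Ga)"
  using i by (intro eqI[symmetric] A.sub_edges B.sub_edges) (auto simp: tgiso_def)
 have ins: "Ins Up (p x) = map q (Ins Ga x)" if "x:Nodes Ga" for x
  using i that n[OF that] by (intro eqI[symmetric] A.sub_edges B.sub_edges) (auto simp: tgiso_def)
 have dw: "dom_word Up = dom_word Ga" and nv: "!!x. x:Nodes Ga ==> NVal Up (p x) = NVal Ga x" using i by (auto simp: tgiso_def)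
 have dom: "DomL Up = map q (DomL Ga)"
  using dw by (intro eqI[symmetric] A.sub_edges B.sub_edges) (auto simp: A.map_pt B.map_pt inports_def)
 have outs: "Outs Up (p x) = map q (Outs Ga x)" if "x:Nodes Ga" for x
  using nv[OF that] that n[OF that] by (intro eqI[symmetric] A.sub_edges B.sub_edges) (auto simp: A.map_pt B.map_pt outports_def)
 have ev: "EVal Up (q e) = EVal Ga e" if e: "e:Edges Ga" for e
  using A.pt_ports[OF e] B.pt_ports(2)[OF bij_betw_apply[OF q e]] pq[OF e] plab_iso[OF i A.pt_ports(1)[OF e]] by simp
 have src: "Src Up (q e) = map_option p (Src Ga e)" if e: "e:Edges Ga" for e
  using pq[OF e] by (auto simp: pt_def split: option.splits)
 have tgt: "Tgt Up (q e) = map_option p (Tgt Ga e)" if e: "e:Edges Ga" for e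
 proof (cases "Tgt Ga e")
  case None
  hence "e:set (CodL Ga)" using e A.anc by simp
  hence "q e:set (CodL Up)" by (simp add: cod)
  thus ?thesis using None B.anc by simp
 next
  case (Some x)
  hence x: "x:Nodes Ga" using A.edge(2) e by blast
  hence "e:set (Ins Ga x)" using e A.node(2) Some by simp
  hence "q e:set (Ins Up (p x))" by (simp add: ins x)
  thus ?thesis using Some B.node(2)[OF n[OF x]] by simp
 qed
 show ?thesis
  using cod ins dom outs ev src tgt q pn nv pq unfolding diagram_iso_def by blast
qed

subsection \<open>Isomorphism classes\<close>

lemma plab_Letters:
 assumes "free_graph_monoid G" "is_tg G T" "u:ports G T"
 shows "plab G T u:Letters G"
proof (cases u)
 case (Inp i)
 thus ?thesis using assms by (auto simp: is_tg_def in_lists_conv_set)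
next
 case (Outp x j)
 hence "ATgt G (TV T x):lists (Letters G)" "j < length (ATgt G (TV T x))"
  using assms by (auto simp: is_tg_def free_graph_monoid_def)
 thus ?thesis using Outp by (auto simp: in_lists_conv_set)
qed

text \<open>The ports themselves serve as edges, coded by numbers; the target of an edge is the node
  whose input list contains the port.\<close>

lemma realize:
 fixes T :: "('n, 's, 'a) tg"
 assumes fg: "free_graph_monoid G" and t: "is_tg G T"
 shows "EX Ga :: (nat, nat, 's, 'a) adiagram. is_adiagram G Ga & T \<simeq> canon Ga"
proof -
 obtain p :: "'n => nat" where p: "inj_on p (TN T)"
  using t finite_imp_inj_to_nat_seg[of "TN T"] by (auto simp: is_tg_def)
 obtain c :: "'n port => nat" where c: "inj_on c (ports G T)"
  using finite_imp_inj_to_nat_seg[OF finite_ports[OF t]] by blast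
 define ip where "ip = inv_into (TN T) p"
 define ic where "ic = inv_into (ports G T) c"
 have ip [simp]: "x:TN T ==> ip (p x) = x" for x using p by (simp add: ip_def)
 have ic [simp]: "u:ports G T ==> ic (c u) = u" for u using c by (simp add: ic_def)
 define Ga :: "(nat, nat, 's, 'a) adiagram" where "Ga = \<lparr> Nodes = p ` TN T, Edges = c ` ports G T,
  Src = (%e. case ic e of Inp _ => None | Outp x _ => Some (p x)),
  Tgt = (%e. if EX x:TN T. ic e:set (TI T x) then Some (p (SOME x. x:TN T & ic e:set (TI T x))) else None),
  Ins = (%y. map c (TI T (ip y))), Outs = (%y. map c (outports G T (ip y))),
  EVal = (%e. plab G T (ic e)), NVal = (%y. TV T (ip y)), DomL = map c (inports T), CodL = map c (TO T) \<rparr>"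
 have s [simp]: "Nodes Ga = p ` TN T" "Edges Ga = c ` ports G T"
  "Ins Ga y = map c (TI T (ip y))" "Outs Ga y = map c (outports G T (ip y))" "EVal Ga e = plab G T (ic e)"
  "NVal Ga y = TV T (ip y)" "DomL Ga = map c (inports T)" "CodL Ga = map c (TO T)"
  "Src Ga e = (case ic e of Inp _ => None | Outp x _ => Some (p x))" for y e by (simp_all add: Ga_def)
 note sub = tg_ports[OF t]
 have un: "(UN x:TN T. set (TI T x)) Un set (TO T) = ports G T" using t by (simp add: is_tg_def)
 have dj: "x:TN T ==> y:TN T ==> u:set (TI T x) ==> u:set (TI T y) ==> x = y" for x y u
  using t unfolding is_tg_def by (metis disjoint_iff)
 have djo: "x:TN T ==> u:set (TI T x) ==> u ~: set (TO T)" for x u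
  using t unfolding is_tg_def by (metis disjoint_iff)
 have tgt1: "Tgt Ga (c u) = Some (p x)" if "x:TN T" "u:set (TI T x)" for x u
 proof -
  have "u:ports G T" using sub(1) that by blast
  moreover have "(SOME y. y:TN T & u:set (TI T y)) = x" using that dj by blast
  ultimately show ?thesis using that by (auto simp: Ga_def)
 qed
 have tgt2: "Tgt Ga (c u) = None" if "u:set (TO T)" for u
  using that djo sub(2) by (auto simp: Ga_def)
 have tgt: "u:ports G T ==> Tgt Ga (c u) = Some (p x) <-> u:set (TI T x)" if "x:TN T" for u x
 proof
  assume u: "u:ports G T" "Tgt Ga (c u) = Some (p x)"
  hence "u ~: set (TO T)" using tgt2 by auto
  then obtain y where y: "y:TN T" "u:set (TI T y)" using un u(1) by blast
  with tgt1[OF y] u(2) p that show "u:set (TI T x)" by (simp add: inj_on_eq_iff)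
 qed (use tgt1 that in blast)
 have tgt0: "u:ports G T ==> Tgt Ga (c u) = None <-> u:set (TO T)" for u
 proof
  assume u: "u:ports G T" "Tgt Ga (c u) = None"
  thus "u:set (TO T)" using tgt1 un by (metis UN_E UnE option.distinct(1))
 qed (use tgt2 in blast)
 have [simp]: "distinct (inports T)" "distinct (outports G T x)" for x
  by (auto simp: inports_def outports_def distinct_map inj_on_def)
 have outs: "set (outports G T x) <= ports G T" if "x:TN T" for x using that by (auto simp: ports_def)
 have ins: "set (inports T) <= ports G T" by (auto simp: ports_def)
 have cd: "distinct (map c us)" if "distinct us" "set us <= ports G T" for us
  using that c by (auto simp: distinct_map elim: inj_on_subset)
 have pl: "map (%e. plab G T (ic e)) (map c us) = map (plab G T) us" if "set us <= ports G T" for us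
  using that by auto
 obtain rk :: "'n => nat" where rk: "ALL x:TN T. ALL y j. Outp y j:set (TI T x) --> rk y < rk x"
  using t by (auto simp: is_tg_def)
 have srcO: "u:ports G T ==> Src Ga (c u) = Some (p x) <-> u:set (outports G T x)" if "x:TN T" for u x
  using that p by (cases u) (auto simp: outports_def inj_on_eq_iff)
 have srcI: "u:ports G T ==> Src Ga (c u) = None <-> u:set (inports T)" for u
  by (cases u) (auto simp: inports_def)
 have ad: "is_adiagram G Ga"
  unfolding is_adiagram_iff
 proof (intro conjI ballI)
  show "finite (Nodes Ga)" "finite (Edges Ga)" using t finite_ports[OF t] by (auto simp: is_tg_def)
 next
  fix e assume "e:Edges Ga"
  then obtain u where u: "u:ports G T" "e = c u" by auto
  show "set_option (Src Ga e) <= Nodes Ga" using u by (cases u) auto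
  show "set_option (Tgt Ga e) <= Nodes Ga"
  proof (cases "u:set (TO T)")
   case False
   then obtain x where "x:TN T" "u:set (TI T x)" using un u by blast
   thus ?thesis using tgt1 u by simp
  qed (simp add: tgt2 u)
  show "EVal Ga e:Letters G" using u plab_Letters[OF fg t] by simp
 next
  fix y assume "y:Nodes Ga"
  then obtain x where x: "x:TN T" "y = p x" by auto
  have tx: "TV T x:Arrows G" "distinct (TI T x)" "map (plab G T) (TI T x) = ASrc G (TV T x)"
   using t x by (auto simp: is_tg_def)
  show "distinct (Ins Ga y)" "distinct (Outs Ga y)" using x(2) cd[OF tx(2) sub(1)[OF x(1)]] cd[OF _ outs[OF x(1)]] x(1) by simp_all
  show "set (Ins Ga y) = {e:Edges Ga. Tgt Ga e = Some y}" using x tgt sub(1)[OF x(1)] by auto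
  show "set (Outs Ga y) = {e:Edges Ga. Src Ga e = Some y}"
   using x srcO outs[OF x(1)] by (auto simp del: s(9))
  show "NVal Ga y:Arrows G" using tx x by simp
  show "ASrc G (NVal Ga y) = map (EVal Ga) (Ins Ga y)" using tx x pl[OF sub(1)[OF x(1)]] by (simp add: s(5)[abs_def] del: map_map)
  show "ATgt G (NVal Ga y) = map (EVal Ga) (Outs Ga y)" using x pl[OF outs[OF x(1)]]
   by (simp add: s(5)[abs_def] del: map_map) (auto simp: outports_def intro!: nth_equalityI)
 next
  show "distinct (DomL Ga)" "distinct (CodL Ga)" using ins sub t by (auto intro!: cd simp: is_tg_def)
  show "set (DomL Ga) = {e:Edges Ga. Src Ga e = None}" using srcI ins by (auto simp del: s(9))
  show "set (CodL Ga) = {e:Edges Ga. Tgt Ga e = None}" using tgt0 sub by auto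
 next
  have "rk (ip y) < rk (ip z)" if e: "e:Edges Ga" "Src Ga e = Some y" "Tgt Ga e = Some z" for e y z
  proof -
   from e obtain u where u: "u:ports G T" "e = c u" by auto
   from u e obtain x where x: "x:TN T" "u:set (TI T x)" using un tgt2 by fastforce
   from u e obtain w j where w: "u = Outp w j" "y = p w" by (cases u) auto
   show ?thesis using w u x e tgt1[OF x] rk by auto
  qed
  thus "EX rk :: nat => nat. ALL e:Edges Ga. ALL x y. Src Ga e = Some x --> Tgt Ga e = Some y --> rk x < rk y"
   by (intro exI[of _ "rk \<circ> ip"]) auto
 qed
 have pc: "pt Ga (c u) = mpt p u" if "u:ports G T" for u
 proof (cases u)
  case (Inp i)
  have "idx (map c (inports T)) (c u) = idx (inports T) u"
   using that Inp c ins by (intro idx_map) (auto simp: inports_def elim: inj_on_subset)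
  also have "... = i" using that Inp idx_map[of Inp "[0..<length (TD T)]" i] by (auto simp: inports_def inj_on_def)
  finally show ?thesis using that Inp by (simp add: pt_def)
 next
  case (Outp x j)
  hence x: "x:TN T" "j < length (ATgt G (TV T x))" using that by auto
  have "idx (map c (outports G T x)) (c u) = idx (outports G T x) u"
   using x Outp c outs[OF x(1)] by (intro idx_map) (auto simp: outports_def elim: inj_on_subset)
  also have "... = j" using x Outp idx_map[of "Outp x" "[0..<length (ATgt G (TV T x))]" j] by (auto simp: outports_def inj_on_def)
  finally show ?thesis using that Outp x by (simp add: pt_def)
 qed
 have "dom_word Ga = TD T"
  using pl[OF ins] by (auto simp: dom_word_def s(5)[abs_def] inports_def intro!: nth_equalityI)
 hence "tgiso p T (canon Ga)"
  unfolding tgiso_def using p sub pc by (auto simp: bij_betw_def)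
 with ad show ?thesis unfolding tgeq_def by blast
qed

text \<open>Attaches to a term graph over any node type an isomorphism class of diagrams on numbers,
  so that the sum types produced by gluing can be handled directly.\<close>

definition cls :: "('s, 'a, 'z) graph_monoid_scheme => ('n, 's, 'a) tg => ('s, 'a) iso_class" where
 "cls G T = {Up. is_adiagram G Up & T \<simeq> canon Up}"

lemma adiagram_isomorphic_iff:
 assumes "is_adiagram G Ga"
 shows "adiagram_isomorphic Ga Up <-> is_adiagram G Up & canon Ga \<simeq> canon Up"
proof
 assume "adiagram_isomorphic Ga Up"
 then obtain p q where "diagram_iso Ga Up p q" "DomL Up = map q (DomL Ga)" "CodL Up = map q (CodL Ga)"
  unfolding adiagram_isomorphic_def by blast
 from adiagram_iso_valid[OF this assms] adiagram_iso_canon[OF this assms]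
 show "is_adiagram G Up & canon Ga \<simeq> canon Up" unfolding tgeq_def by blast
next
 assume "is_adiagram G Up & canon Ga \<simeq> canon Up"
 thus "adiagram_isomorphic Ga Up"
  using canon_iso_adiagram[OF assms] unfolding adiagram_isomorphic_def tgeq_def by blast
qed

lemma iso_class_cls: "is_adiagram G Ga ==> icls Ga = cls G (canon Ga)"
 unfolding iso_class_of_def cls_def using adiagram_isomorphic_iff by blast

lemma cls_eqI: "T \<simeq> T' ==> is_tg G T ==> cls G T = cls G T'"
 unfolding cls_def using tgeq_trans[of T' T] tgeq_trans[of T T'] tgeq_sym[of T T' G] by auto

text \<open>Two equal classes could both be empty; \<open>realize\<close> excludes this by providing
  a common member.\<close>

lemma cls_eqD:
 assumes "cls G T = cls G T'" "free_graph_monoid G" "is_tg G T" "is_tg G T'"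
 shows "T \<simeq> T'"
proof -
 obtain Ga :: "(nat, nat, _, _) adiagram" where "is_adiagram G Ga" "T \<simeq> canon Ga" using realize assms by blast
 hence "Ga:cls G T'" using assms(1) by (auto simp: cls_def)
 hence "T' \<simeq> canon Ga" by (simp add: cls_def)
 with \<open>T \<simeq> canon Ga\<close> assms show ?thesis using tgeq_trans tgeq_sym by blast
qed

section \<open>Gluing and disjoint union of term graphs\<close>

text \<open>Gluing seen from the sources: an edge starting at place \<open>i\<close> of the second
  domain now starts where the \<open>i\<close>-th codomain edge of the first graph starts.\<close>

definition glue_port :: "'n1 port list => 'n2 port => ('n1 + 'n2) port" where
 "glue_port os u = (case u of Inp i => mpt Inl (os ! i) | Outp y j => Outp (Inr y) j)"

lemma glue_port_simps [simp]: "glue_port os (Inp i) = mpt Inl (os ! i)" "glue_port os (Outp y j) = Outp (Inr y) j"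
 by (simp_all add: glue_port_def)

definition tglue :: "('n1, 's, 'a) tg => ('n2, 's, 'a) tg => ('n1 + 'n2, 's, 'a) tg" where
 "tglue T U = \<lparr> TN = TN T <+> TN U, TV = case_sum (TV T) (TV U), TD = TD T,
   TI = case_sum (%x. map (mpt Inl) (TI T x)) (%y. map (glue_port (TO T)) (TI U y)),
   TO = map (glue_port (TO T)) (TO U) \<rparr>"

definition shift :: "nat => 'n2 port => ('n1 + 'n2) port" where
 "shift n u = (case u of Inp i => Inp (n + i) | Outp y j => Outp (Inr y) j)"

lemma shift_simps [simp]: "shift n (Inp i) = Inp (n + i)" "shift n (Outp y j) = Outp (Inr y) j"
 by (simp_all add: shift_def)

definition tdu :: "('n1, 's, 'a) tg => ('n2, 's, 'a) tg => ('n1 + 'n2, 's, 'a) tg" where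
 "tdu T U = \<lparr> TN = TN T <+> TN U, TV = case_sum (TV T) (TV U), TD = TD T @ TD U,
   TI = case_sum (%x. map (mpt Inl) (TI T x)) (%y. map (shift (length (TD T))) (TI U y)),
   TO = map (mpt Inl) (TO T) @ map (shift (length (TD T))) (TO U) \<rparr>"

definition twire :: "'s list => nat list => (nat, 's, 'a) tg" where
 "twire w cs = \<lparr> TN = {}, TV = undefined, TD = w, TI = (%_. []), TO = map Inp cs \<rparr>"

lemma tglue_simps [simp]: "TN (tglue T U) = TN T <+> TN U" "TD (tglue T U) = TD T"
 "TV (tglue T U) (Inl x) = TV T x" "TV (tglue T U) (Inr y) = TV U y"
 "TI (tglue T U) (Inl x) = map (mpt Inl) (TI T x)" "TI (tglue T U) (Inr y) = map (glue_port (TO T)) (TI U y)"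
 "TO (tglue T U) = map (glue_port (TO T)) (TO U)"
 by (simp_all add: tglue_def)

lemma tdu_simps [simp]: "TN (tdu T U) = TN T <+> TN U" "TD (tdu T U) = TD T @ TD U"
 "TV (tdu T U) (Inl x) = TV T x" "TV (tdu T U) (Inr y) = TV U y"
 "TI (tdu T U) (Inl x) = map (mpt Inl) (TI T x)" "TI (tdu T U) (Inr y) = map (shift (length (TD T))) (TI U y)"
 "TO (tdu T U) = map (mpt Inl) (TO T) @ map (shift (length (TD T))) (TO U)"
 by (simp_all add: tdu_def)

lemma twire_simps [simp]: "TN (twire w cs) = {}" "TD (twire w cs) = w" "TO (twire w cs) = map Inp cs"
 by (simp_all add: twire_def)

lemma map_of_zip_idx:
 "length xs = length ys ==> map_of (zip xs ys) e = (if e:set xs then Some (ys ! idx xs e) else None)"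
 by (induction xs ys rule: list_induct2) (auto simp: idx_def)

lemma length_tcod: "length (tcod G T) = length (TO T)"
 by (simp add: tcod_def)

lemma glue_valid:
 fixes Ga :: "('n1, 'e1, 's, 'a) adiagram" and Up :: "('n2, 'e2, 's, 'a) adiagram"
 assumes G: "is_adiagram G Ga" "is_adiagram G Up" and w: "cod_word Ga = dom_word Up"
 shows "is_adiagram G (glue Ga Up) & tgiso id (canon (glue Ga Up)) (tglue (canon Ga) (canon Up))"
proof -
 interpret A: adiag G Ga by unfold_locales fact
 interpret B: adiag G Up by unfold_locales fact
 have len: "length (CodL Ga) = length (DomL Up)" using arg_cong[OF w, of length] by (simp add: cod_word_def dom_word_def)
 \<comment> \<open>\<open>r\<close> sends an edge of \<open>Up\<close> to its copy after gluing;
   domain edges are absorbed into the matching codomain edges of \<open>Ga\<close>.\<close>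
 define r where "r e = (if e:set (DomL Up) then Inl (CodL Ga ! idx (DomL Up) e) else Inr e)" for e
 define De where "De = glue Ga Up"
 have r: "(%e. case map_of (zip (DomL Up) (CodL Ga)) e of None => Inr e | Some e' => Inl e') = r"
  by (rule ext) (simp add: map_of_zip_idx len r_def)
 have E: "Edges De = Edges Ga <+> (Edges Up - set (DomL Up))" and N: "Nodes De = Nodes Ga <+> Nodes Up"
  and src: "!!e. Src De (Inl e) = map_option Inl (Src Ga e)" "!!e. Src De (Inr e) = map_option Inr (Src Up e)"
  and tgt: "!!e. Tgt De (Inl e) = (if e:set (CodL Ga) then map_option Inr (Tgt Up (DomL Up ! idx (CodL Ga) e)) else map_option Inl (Tgt Ga e))"
   "!!e. Tgt De (Inr e) = map_option Inr (Tgt Up e)"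
  and ins: "!!x. Ins De (Inl x) = map Inl (Ins Ga x)" "!!y. Ins De (Inr y) = map r (Ins Up y)"
  and outs: "!!x. Outs De (Inl x) = map Inl (Outs Ga x)" "!!y. Outs De (Inr y) = map Inr (Outs Up y)"
  and ev: "!!e. EVal De (Inl e) = EVal Ga e" "!!e. EVal De (Inr e) = EVal Up e"
  and nv: "!!x. NVal De (Inl x) = NVal Ga x" "!!x. NVal De (Inr x) = NVal Up x"
  and dl: "DomL De = map Inl (DomL Ga)" and cl: "CodL De = map r (CodL Up)"
  unfolding De_def glue_def Let_def r by (simp_all add: map_of_zip_idx len)
 have cod: "CodL Ga ! i:Edges Ga" "EVal Ga (CodL Ga ! i) = EVal Up (DomL Up ! i)" if "i < length (CodL Ga)" for i
  using that A.sub_edges(4) arg_cong[OF w, of "%l. l ! i"] len nth_mem by (auto simp: cod_word_def dom_word_def)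
 have rE: "r e:Edges De" "Tgt De (r e) = map_option Inr (Tgt Up e)" "EVal De (r e) = EVal Up e" if "e:Edges Up" for e
 proof -
  have "CodL Ga ! idx (DomL Up) e:set (CodL Ga)" if "e:set (DomL Up)"
   using that len by simp
  thus "r e:Edges De" "Tgt De (r e) = map_option Inr (Tgt Up e)" "EVal De (r e) = EVal Up e"
   using that cod A.anc(3) len by (auto simp: r_def E tgt ev)
 qed
 have rinj: "inj_on r (Edges Up)"
 proof (rule inj_onI)
  fix e f assume "e:Edges Up" "f:Edges Up" "r e = r f"
  thus "e = f" using A.anc(3) len
   by (auto simp: r_def nth_eq_iff_index_eq split: if_splits) (metis nth_idx)
 qed
 \<comment> \<open>Classification by targets: a joined edge counts as an edge of \<open>Up\<close>,
   whose end it keeps.\<close>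
 have cases: "(EX d. e = Inl d & d:Edges Ga & d ~: set (CodL Ga)) \<or> (EX d:Edges Up. e = r d)" if "e:Edges De" for e
 proof (cases e)
  case (Inl d)
  show ?thesis
  proof (cases "d:set (CodL Ga)")
   case True
   hence "r (DomL Up ! idx (CodL Ga) d) = e" "DomL Up ! idx (CodL Ga) d:Edges Up"
    using Inl B.anc len B.sub_edges(3) by (auto simp: r_def simp flip: len)
   thus ?thesis by blast
  qed (use that Inl E in auto)
 next
  case (Inr d)
  thus ?thesis using that by (auto simp: E r_def)
 qed
 have d: "distinct (map r es)" if "distinct es" "set es <= Edges Up" for es
  using that rinj by (auto simp: distinct_map elim: inj_on_subset)
 have mr: "map (EVal De) (map r es) = map (EVal Up) es" if "set es <= Edges Up" for es
  using that rE(3) by auto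
 have ml: "map (EVal De) (map Inl es) = map (EVal Ga) es" "map (EVal De) (map Inr es') = map (EVal Up) es'" for es es'
  by (auto simp: ev)
 have so: "set_option (map_option f z) = f ` set_option z" for f :: "'x => 'y" and z by (cases z) auto
 have tl: "e:set (CodL Ga)" if "e:Edges Ga" "Tgt Ga e = None" for e using that A.anc by auto
 obtain rk1 :: "'n1 => nat" where rk1: "ALL e:Edges Ga. ALL x y. Src Ga e = Some x --> Tgt Ga e = Some y --> rk1 x < rk1 y"
  using G by (auto simp: is_adiagram_iff)
 obtain rk2 :: "'n2 => nat" where rk2: "ALL e:Edges Up. ALL x y. Src Up e = Some x --> Tgt Up e = Some y --> rk2 x < rk2 y"
  using G by (auto simp: is_adiagram_iff)
 \<comment> \<open>\<open>M\<close> lifts all ranks of \<open>Up\<close> above those of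
   \<open>Ga\<close>, since edges cross only from \<open>Ga\<close> to \<open>Up\<close>.\<close>
 obtain M where M: "ALL x:Nodes Ga. rk1 x < M"
  using finite_nat_set_iff_bounded[of "rk1 ` Nodes Ga"] A.fin by auto
 have v: "is_adiagram G De"
  unfolding is_adiagram_iff
 proof (intro conjI ballI)
  show "finite (Nodes De)" "finite (Edges De)" by (simp_all add: N E)
 next
  fix e assume e: "e:Edges De"
  show "set_option (Src De e) <= Nodes De"
   using e A.edge B.edge by (auto simp: E N src so)
  show "set_option (Tgt De e) <= Nodes De"
   using cases[OF e] A.edge B.edge by (auto simp: N rE so tgt)
  show "EVal De e:Letters G"
   using cases[OF e] A.edge B.edge by (auto simp: rE ev)
 next
  fix z assume z: "z:Nodes De"
  show "distinct (Ins De z)" "distinct (Outs De z)"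
   using z A.node B.node B.sub_edges by (auto simp: N ins outs distinct_map intro!: d inj_on_subset[OF rinj])
  show "set (Ins De z) = {e:Edges De. Tgt De e = Some z}"
  proof (intro set_eqI iffI)
   fix e assume "e:set (Ins De z)"
   thus "e:{e:Edges De. Tgt De e = Some z}"
    using z A.node B.node A.anc by (auto simp: N ins rE) (auto simp: E tgt)
  next
   fix e assume "e:{e:Edges De. Tgt De e = Some z}"
   hence e: "e:Edges De" "Tgt De e = Some z" by auto
   show "e:set (Ins De z)" using cases[OF e(1)] e(2) A.node B.node A.edge B.edge
    by (auto simp: rE tgt ins)
  qed
  show "set (Outs De z) = {e:Edges De. Src De e = Some z}"
   using z A.node B.node B.anc by (auto simp: N E src outs)
  show "NVal De z:Arrows G" using z A.node B.node by (auto simp: N nv)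
  show "ASrc G (NVal De z) = map (EVal De) (Ins De z)" "ATgt G (NVal De z) = map (EVal De) (Outs De z)"
   using z A.node B.node mr[OF B.sub_edges(1)] by (auto simp: N nv ins outs ml simp del: map_map)
 next
  show "distinct (DomL De)" "distinct (CodL De)" using A.anc B.anc B.sub_edges by (auto simp: dl cl distinct_map intro!: d inj_on_subset[OF rinj])
  show "set (DomL De) = {e:Edges De. Src De e = None}" using A.anc B.anc by (auto simp: dl E src)
  show "set (CodL De) = {e:Edges De. Tgt De e = None}"
  proof (intro set_eqI iffI)
   fix e assume "e:set (CodL De)"
   thus "e:{e:Edges De. Tgt De e = None}" using B.anc by (auto simp: cl rE)
  next
   fix e assume "e:{e:Edges De. Tgt De e = None}"
   hence e: "e:Edges De" "Tgt De e = None" by auto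
   show "e:set (CodL De)" using cases[OF e(1)] e(2) tl B.anc by (auto simp: rE tgt cl)
  qed
 next
  show "EX rk :: 'n1 + 'n2 => nat. ALL e:Edges De. ALL x y. Src De e = Some x --> Tgt De e = Some y --> rk x < rk y"
  proof (intro exI ballI allI impI)
   fix e x y assume e: "e:Edges De" "Src De e = Some x" "Tgt De e = Some y"
   from cases[OF e(1)] show "case_sum rk1 (%y. M + rk2 y) x < case_sum rk1 (%y. M + rk2 y) y"
   proof (elim disjE exE conjE bexE)
    fix d assume "e = Inl d" "d:Edges Ga" "d ~: set (CodL Ga)"
    thus ?thesis using e rk1 by (auto simp: src tgt)
   next
    fix d assume d: "e = r d" "d:Edges Up"
    show ?thesis
    proof (cases "d:set (DomL Up)")
     case True
     define c where "c = CodL Ga ! idx (DomL Up) d"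
     have c: "c:Edges Ga" "r d = Inl c" using True len cod(1) by (auto simp: c_def r_def)
     obtain x' where x': "x = Inl x'" "Src Ga c = Some x'" using e(2) d(1) c(2) by (auto simp: src)
     obtain y' where y': "y = Inr y'" using e(3) d rE(2)[OF d(2)] by auto
     have "rk1 x' < M" using M A.edge(1)[OF c(1) x'(2)] by blast
     thus ?thesis using x' y' by simp
    next
     case False
     thus ?thesis using d e rk2 by (auto simp: rE) (auto simp: r_def src)
    qed
   qed
  qed
 qed
 have ptl: "pt De (Inl e) = mpt Inl (pt Ga e)" if "e:Edges Ga" for e
 proof (cases "Src Ga e")
  case None
  hence "e:set (DomL Ga)" using that A.anc by simp
  thus ?thesis using None by (simp add: pt_def src dl idx_map)
 next
  case (Some x)
  hence "e:set (Outs Ga x)" using that A.node(4)[of x] A.edge(1)[of e x] by simp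
  thus ?thesis using Some by (simp add: pt_def src outs idx_map)
 qed
 have ptr: "pt De (r e) = glue_port (TO (canon Ga)) (pt Up e)" if e: "e:Edges Up" for e
 proof (cases "Src Up e")
  case None
  hence "e:set (DomL Up)" using e B.anc by simp
  thus ?thesis using None len cod by (simp add: r_def ptl) (simp add: pt_def)
 next
  case (Some x)
  hence "e:set (Outs Up x)" "e ~: set (DomL Up)" using e B.node(4)[of x] B.edge(1)[of e x] B.anc by auto
  thus ?thesis using Some by (simp add: r_def pt_def src outs idx_map)
 qed
 have mptl: "map (pt De) (map Inl es) = map (mpt Inl) (map (pt Ga) es)" if "set es <= Edges Ga" for es
  using that ptl by auto
 have mptr: "map (pt De) (map r es) = map (glue_port (TO (canon Ga))) (map (pt Up) es)" if "set es <= Edges Up" for es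
  using that ptr by auto
 have "tgiso id (canon De) (tglue (canon Ga) (canon Up))"
  unfolding tgiso_def
  using mptl[OF A.sub_edges(1)] mptr[OF B.sub_edges(1)] mptr[OF B.sub_edges(4)]
  by (auto simp: N nv ins cl dl dom_word_def ml port.map_id0 ev simp del: map_map)
 with v show ?thesis by (simp add: De_def)
qed

lemma du_valid:
 fixes Ga :: "('n1, 'e1, 's, 'a) adiagram" and Up :: "('n2, 'e2, 's, 'a) adiagram"
 assumes G: "is_adiagram G Ga" "is_adiagram G Up"
 shows "is_adiagram G (disjoint_union Ga Up) & tgiso id (canon (disjoint_union Ga Up)) (tdu (canon Ga) (canon Up))"
proof -
 interpret A: adiag G Ga by unfold_locales fact
 interpret B: adiag G Up by unfold_locales fact
 define De where "De = disjoint_union Ga Up"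
 have E: "Edges De = Edges Ga <+> Edges Up" and N: "Nodes De = Nodes Ga <+> Nodes Up"
  and src: "!!e. Src De (Inl e) = map_option Inl (Src Ga e)" "!!e. Src De (Inr e) = map_option Inr (Src Up e)"
  and tgt: "!!e. Tgt De (Inl e) = map_option Inl (Tgt Ga e)" "!!e. Tgt De (Inr e) = map_option Inr (Tgt Up e)"
  and ins: "!!x. Ins De (Inl x) = map Inl (Ins Ga x)" "!!y. Ins De (Inr y) = map Inr (Ins Up y)"
  and outs: "!!x. Outs De (Inl x) = map Inl (Outs Ga x)" "!!y. Outs De (Inr y) = map Inr (Outs Up y)"
  and ev: "!!e. EVal De (Inl e) = EVal Ga e" "!!e. EVal De (Inr e) = EVal Up e"
  and nv: "!!x. NVal De (Inl x) = NVal Ga x" "!!x. NVal De (Inr x) = NVal Up x"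
  and dl: "DomL De = map Inl (DomL Ga) @ map Inr (DomL Up)" and cl: "CodL De = map Inl (CodL Ga) @ map Inr (CodL Up)"
  unfolding De_def disjoint_union_def by simp_all
 have ml: "map (EVal De) (map Inl es) = map (EVal Ga) es" "map (EVal De) (map Inr es') = map (EVal Up) es'" for es es'
  by (auto simp: ev)
 have so: "set_option (map_option f z) = f ` set_option z" for f :: "'x => 'y" and z by (cases z) auto
 obtain rk1 :: "'n1 => nat" where rk1: "ALL e:Edges Ga. ALL x y. Src Ga e = Some x --> Tgt Ga e = Some y --> rk1 x < rk1 y"
  using G by (auto simp: is_adiagram_iff)
 obtain rk2 :: "'n2 => nat" where rk2: "ALL e:Edges Up. ALL x y. Src Up e = Some x --> Tgt Up e = Some y --> rk2 x < rk2 y"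
  using G by (auto simp: is_adiagram_iff)
 have v: "is_adiagram G De"
  unfolding is_adiagram_iff
 proof (intro conjI ballI)
  show "finite (Nodes De)" "finite (Edges De)" by (simp_all add: N E)
 next
  fix e assume e: "e:Edges De"
  show "set_option (Src De e) <= Nodes De" "set_option (Tgt De e) <= Nodes De" "EVal De e:Letters G"
   using e A.edge B.edge by (auto simp: E N src tgt so ev)
 next
  fix z assume z: "z:Nodes De"
  show "distinct (Ins De z)" "distinct (Outs De z)"
   using z A.node B.node by (auto simp: N ins outs distinct_map)
  show "set (Ins De z) = {e:Edges De. Tgt De e = Some z}" "set (Outs De z) = {e:Edges De. Src De e = Some z}"
   using z A.node B.node by (auto simp: N E src tgt ins outs)
  show "NVal De z:Arrows G" using z A.node B.node by (auto simp: N nv)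
  show "ASrc G (NVal De z) = map (EVal De) (Ins De z)" "ATgt G (NVal De z) = map (EVal De) (Outs De z)"
   using z A.node B.node by (auto simp: N nv ins outs ml simp del: map_map)
 next
  show "distinct (DomL De)" "distinct (CodL De)" using A.anc B.anc by (auto simp: dl cl distinct_map)
  show "set (DomL De) = {e:Edges De. Src De e = None}" "set (CodL De) = {e:Edges De. Tgt De e = None}"
   using A.anc B.anc by (auto simp: dl cl E src tgt)
 next
  show "EX rk :: 'n1 + 'n2 => nat. ALL e:Edges De. ALL x y. Src De e = Some x --> Tgt De e = Some y --> rk x < rk y"
   by (rule exI[of _ "case_sum rk1 rk2"]) (use rk1 rk2 in "auto simp: E src tgt")
 qed
 have idl: "idx (map Inl xs @ ys) (Inl e) = idx xs e" if "e:set xs" for xs :: "'x list" and ys :: "('x + 'y) list" and e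
  using that by (induction xs) (auto simp: idx_def)
 have idr: "idx (map Inl xs @ map Inr ys) (Inr e) = length xs + idx ys e" if "e:set ys"
  for xs :: "'x list" and ys :: "'y list" and e
 proof -
  have "idx (map Inl xs @ map Inr ys) (Inr e :: 'x + 'y) = length xs + idx (map Inr ys :: ('x + 'y) list) (Inr e)"
   by (induction xs) (auto simp: idx_def)
  thus ?thesis using that by (simp add: idx_map)
 qed
 have ptl: "pt De (Inl e) = mpt Inl (pt Ga e)" if "e:Edges Ga" for e
 proof (cases "Src Ga e")
  case None
  hence "e:set (DomL Ga)" using that A.anc by simp
  thus ?thesis using None by (simp add: pt_def src dl idl)
 next
  case (Some x)
  hence "e:set (Outs Ga x)" using that A.node(4)[of x] A.edge(1)[of e x] by simp
  thus ?thesis using Some by (simp add: pt_def src outs idx_map)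
 qed
 have ptr: "pt De (Inr e) = shift (length (dom_word Ga)) (pt Up e)" if e: "e:Edges Up" for e
 proof (cases "Src Up e")
  case None
  hence "e:set (DomL Up)" using e B.anc by simp
  thus ?thesis using None by (simp add: pt_def src dl idr dom_word_def)
 next
  case (Some x)
  hence "e:set (Outs Up x)" using e B.node(4)[of x] B.edge(1)[of e x] by auto
  thus ?thesis using Some by (simp add: pt_def src outs idx_map)
 qed
 have mptl: "map (pt De) (map Inl es) = map (mpt Inl) (map (pt Ga) es)" if "set es <= Edges Ga" for es
  using that ptl by auto
 have mptr: "map (pt De) (map Inr es) = map (shift (length (dom_word Ga))) (map (pt Up) es)" if "set es <= Edges Up" for es
  using that ptr by auto
 have dw: "dom_word De = dom_word Ga @ dom_word Up" by (simp add: dom_word_def dl ev)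
 have "tgiso id (canon De) (tdu (canon Ga) (canon Up))"
  unfolding tgiso_def
  using mptl[OF A.sub_edges(1)] mptl[OF A.sub_edges(4)] mptr[OF B.sub_edges(1)] mptr[OF B.sub_edges(4)]
  by (auto simp: N nv ins cl dw port.map_id0 ev simp del: map_map)
 with v show ?thesis by (simp add: De_def)
qed

section \<open>Gluing and union on isomorphism classes of term graphs\<close>

lemma tg_Inp:
 assumes "is_tg G T"
 shows "x:TN T ==> Inp i:set (TI T x) ==> i < length (TD T)" "Inp i:set (TO T) ==> i < length (TD T)"
 using tg_ports[OF assms] by fastforce+

lemma tg_Outp:
 assumes "is_tg G T"
 shows "x:TN T ==> Outp y j:set (TI T x) ==> y:TN T" "Outp y j:set (TO T) ==> y:TN T"
 using tg_ports[OF assms] by fastforce+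

lemma bij_map_sum: "bij_betw p A B ==> bij_betw q A' B' ==> bij_betw (map_sum p q) (A <+> A') (B <+> B')"
proof -
 assume b: "bij_betw p A B" "bij_betw q A' B'"
 hence "map_sum p q ` (A <+> A') = B <+> B'"
  by (auto simp: Plus_def image_Un image_image bij_betw_def)
 moreover have "inj_on (map_sum p q) (A <+> A')"
  using b by (auto simp: bij_betw_def intro!: inj_onI dest: inj_onD)
 ultimately show ?thesis by (simp add: bij_betw_def)
qed

lemma tgeqD:
 assumes "T \<simeq> T'" "is_tg G T"
 shows "TD T' = TD T" "tcod G T' = tcod G T" "length (TO T') = length (TO T)"
 using assms tcod_iso[of _ T T' G] by (auto simp: tgeq_def tgiso_def)

lemma tglue_cong:
 assumes "T \<simeq> T'" "U \<simeq> U'" "is_tg G U" "length (TO T) = length (TD U)"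
 shows "tglue T U \<simeq> tglue T' U'"
proof -
 obtain p q where i: "tgiso p T T'" "tgiso q U U'" using assms by (auto simp: tgeq_def)
 have gp: "mpt (map_sum p q) (glue_port (TO T) u) = glue_port (TO T') (mpt q u)"
  if "!!i. u = Inp i ==> i < length (TD U)" for u
  using that i assms(4) by (cases u) (auto simp: tgiso_def port.map_comp o_def)
 have m: "map (mpt (map_sum p q)) (map (glue_port (TO T)) us) = map (glue_port (TO T')) (map (mpt q) us)"
  if "!!i. Inp i:set us ==> i < length (TD U)" for us
  using that by (auto intro!: gp)
 have "tgiso (map_sum p q) (tglue T U) (tglue T' U')"
  unfolding tgiso_def
 proof (intro conjI ballI)
  fix z assume "z:TN (tglue T U)"
  thus "TV (tglue T' U') (map_sum p q z) = TV (tglue T U) z"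
   "TI (tglue T' U') (map_sum p q z) = map (mpt (map_sum p q)) (TI (tglue T U) z)"
   using i m[OF tg_Inp(1)[OF assms(3)]] by (auto simp: tgiso_def port.map_comp o_def simp del: map_map) (auto simp: port.map_comp o_def)
 qed (use i m[OF tg_Inp(2)[OF assms(3)]] in "auto simp: tgiso_def bij_map_sum simp del: map_map")
 thus ?thesis by (auto simp: tgeq_def)
qed

lemma tdu_cong:
 assumes "T \<simeq> T'" "U \<simeq> U'"
 shows "tdu T U \<simeq> tdu T' U'"
proof -
 obtain p q where i: "tgiso p T T'" "tgiso q U U'" using assms by (auto simp: tgeq_def)
 have m: "mpt (map_sum p q) (shift n u) = shift n (mpt q u)" for u n by (cases u) auto
 have "tgiso (map_sum p q) (tdu T U) (tdu T' U')"
  using i by (auto simp: tgiso_def bij_map_sum m port.map_comp o_def)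
 thus ?thesis by (auto simp: tgeq_def)
qed

text \<open>Validity is inherited from diagrams: both graphs are realised, the diagrams are glued by
  \<open>glue_valid\<close>, and the result is isomorphic to \<open>tglue T U\<close>.\<close>

lemma tg_tglue:
 assumes fg: "free_graph_monoid G" and T: "is_tg G T" and U: "is_tg G U" and w: "tcod G T = TD U"
 shows "is_tg G (tglue T U)" "cls G (tglue T U) = (UN Ga:cls G T. UN Up:cls G U. icls (glue Ga Up))"
proof -
 have len: "length (TO T) = length (TD U)" using arg_cong[OF w, of length] by (simp add: tcod_def)
 have *: "is_tg G (tglue T U) & icls (glue Ga Up) = cls G (tglue T U)"
  if "Ga:cls G T" "Up:cls G U" for Ga Up
 proof -
  have ad: "is_adiagram G Ga" "is_adiagram G Up" and e: "T \<simeq> canon Ga" "U \<simeq> canon Up" using that by (auto simp: cls_def)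
  have cw: "cod_word Ga = dom_word Up"
   using w tgeqD[OF e(1) T] tgeqD[OF e(2) U] adiag.tcod_canon[OF adiag.intro, OF ad(1)] by simp
  note g = glue_valid[OF ad cw]
  have ct: "is_tg G (canon (glue Ga Up))" using g adiag.canon_tg[OF adiag.intro] by blast
  have 1: "canon (glue Ga Up) \<simeq> tglue (canon Ga) (canon Up)" using g tgeq_def by blast
  have "length (TO (canon Ga)) = length (TD (canon Up))" using len tgeqD[OF e(1) T] tgeqD[OF e(2) U] by simp
  hence 2: "tglue (canon Ga) (canon Up) \<simeq> tglue T U"
   using tgeq_sym[OF e(1) T] tgeq_sym[OF e(2) U] adiag.canon_tg[OF adiag.intro, OF ad(2)] by (intro tglue_cong)
  have "canon (glue Ga Up) \<simeq> tglue T U" using 1 2 tgeq_trans by blast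
  thus ?thesis using ct cls_eqI[OF _ ct] g iso_class_cls[of G "glue Ga Up"] tg_iso tgeq_def by metis
 qed
 obtain Ga Up where "Ga:cls G T" "Up:cls G U" using realize[OF fg T] realize[OF fg U] by (auto simp: cls_def)
 with * show "is_tg G (tglue T U)" "cls G (tglue T U) = (UN Ga:cls G T. UN Up:cls G U. icls (glue Ga Up))"
  by blast+
qed

lemma tg_tdu:
 assumes fg: "free_graph_monoid G" and T: "is_tg G T" and U: "is_tg G U"
 shows "is_tg G (tdu T U)" "cls G (tdu T U) = (UN Ga:cls G T. UN Up:cls G U. icls (disjoint_union Ga Up))"
proof -
 have *: "is_tg G (tdu T U) & icls (disjoint_union Ga Up) = cls G (tdu T U)"
  if "Ga:cls G T" "Up:cls G U" for Ga Up
 proof -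
  have ad: "is_adiagram G Ga" "is_adiagram G Up" and e: "T \<simeq> canon Ga" "U \<simeq> canon Up" using that by (auto simp: cls_def)
  note g = du_valid[OF ad]
  have ct: "is_tg G (canon (disjoint_union Ga Up))" using g adiag.canon_tg[OF adiag.intro] by blast
  have 1: "canon (disjoint_union Ga Up) \<simeq> tdu (canon Ga) (canon Up)" using g tgeq_def by blast
  have 2: "tdu (canon Ga) (canon Up) \<simeq> tdu T U"
   using tgeq_sym[OF e(1) T] tgeq_sym[OF e(2) U] by (intro tdu_cong)
  have "canon (disjoint_union Ga Up) \<simeq> tdu T U" using 1 2 tgeq_trans by blast
  thus ?thesis using ct cls_eqI[OF _ ct] g iso_class_cls[of G "disjoint_union Ga Up"] tg_iso tgeq_def by metis
 qed
 obtain Ga Up where "Ga:cls G T" "Up:cls G U" using realize[OF fg T] realize[OF fg U] by (auto simp: cls_def)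
 with * show "is_tg G (tdu T U)" "cls G (tdu T U) = (UN Ga:cls G T. UN Up:cls G U. icls (disjoint_union Ga Up))"
  by blast+
qed

lemma tg_twire:
 assumes "w:lists (Letters G)" "distinct cs" "set cs = {..<length w}"
 shows "is_tg G (twire w cs)"
 unfolding is_tg_def using assms by (auto simp: distinct_map inj_on_def ports_def inports_def)

lemma wires_valid:
 fixes G :: "('s, 'a, 'z) graph_monoid_scheme"
 assumes "w:lists (Letters G)" "distinct cs" "set cs = {..<length w}"
 shows "is_adiagram G (wires w cs)" "icls (wires w cs) = cls G (twire w cs)"
proof -
 have s: "Nodes (wires w cs) = {}" "Edges (wires w cs) = {..<length w}" "Src (wires w cs) = (%_. None)"
  "Tgt (wires w cs) = (%_. None)" "DomL (wires w cs) = [0..<length w]" "CodL (wires w cs) = cs" "EVal (wires w cs) = (!) w"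
  by (simp_all add: wires_def anchor_def mk_diagram_def diagram.defs adiagram.defs)
 show v: "is_adiagram G (wires w cs :: (nat, nat, 's, 'a) adiagram)"
  unfolding is_adiagram_iff s using assms by (auto simp: in_lists_conv_set)
 have "pt (wires w cs :: (nat, nat, 's, 'a) adiagram) e = Inp e" if "e < length w" for e
  using that by (simp add: pt_def s)
 hence "tgiso id (canon (wires w cs :: (nat, nat, 's, 'a) adiagram)) (twire w cs)"
  using assms by (auto simp: tgiso_def s dom_word_def intro!: nth_equalityI)
 hence "canon (wires w cs :: (nat, nat, 's, 'a) adiagram) \<simeq> twire w cs" by (auto simp: tgeq_def)
 thus "icls (wires w cs) = cls G (twire w cs)"
  using iso_class_cls[OF v] cls_eqI adiag.canon_tg[OF adiag.intro, OF v] by metis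
qed

section \<open>The strict symmetric monoidal category of diagrams\<close>

lemma tgeqI:
 assumes "bij_betw p (TN T) (TN T')" "TD T' = TD T" "TO T' = map (mpt p) (TO T)"
  "!!x. x:TN T ==> TV T' (p x) = TV T x" "!!x. x:TN T ==> TI T' (p x) = map (mpt p) (TI T x)"
 shows "T \<simeq> T'"
 unfolding tgeq_def tgiso_def using assms by blast

lemma twire_eqI: "TN T = {} ==> TD T = w ==> TO T = map Inp cs ==> twire w cs \<simeq> T"
 by (rule tgeqI[of undefined]) (auto simp: bij_betw_def)

text \<open>\<open>glue_port\<close> looks positions up in a list, so equations about it hold only
  for positions in range.\<close>

definition inb :: "nat => 'n port => bool" where
 "inb n u <-> (ALL i. u = Inp i --> i < n)"

lemma inb_simps [simp]: "inb n (Inp i) <-> i < n" "inb n (Outp x j)"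
 by (auto simp: inb_def)

lemma tg_inb:
 assumes "is_tg G T"
 shows "x:TN T ==> u:set (TI T x) ==> inb (length (TD T)) u" "u:set (TO T) ==> inb (length (TD T)) u"
 using tg_Inp[OF assms] by (auto simp: inb_def)

abbreviation "tid w == twire w [0..<length w]"

definition tsym :: "'s list => 's list => (nat, 's, 'a) tg" where
 "tsym u w = twire (u @ w) ([length u..<length u + length w] @ [0..<length u])"

lemma tsym_simps [simp]: "TN (tsym u w) = {}" "TD (tsym u w) = u @ w"
 "length (TO (tsym u w)) = length u + length w"
 "i < length w ==> TO (tsym u w) ! i = Inp (length u + i)"
 "i < length u ==> TO (tsym u w) ! (length w + i) = Inp i"
 by (simp_all add: tsym_def nth_append)

definition mid :: "('a + 'b) + 'c => 'a + ('b + 'c)" where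
 "mid = case_sum (case_sum Inl (Inr \<circ> Inl)) (Inr \<circ> Inr)"

lemma mid_simps [simp]: "mid (Inl (Inl x)) = Inl x" "mid (Inl (Inr y)) = Inr (Inl y)" "mid (Inr z) = Inr (Inr z)"
 by (simp_all add: mid_def)

lemma bij_mid: "bij_betw mid ((A <+> B) <+> C) (A <+> (B <+> C))"
 by (rule bij_betw_byWitness[where f' = "case_sum (Inl \<circ> Inl) (case_sum (Inl \<circ> Inr) Inr)"]) auto

definition exch :: "('a + 'b) + ('c + 'd) => ('a + 'c) + ('b + 'd)" where
 "exch = case_sum (case_sum (Inl \<circ> Inl) (Inr \<circ> Inl)) (case_sum (Inl \<circ> Inr) (Inr \<circ> Inr))"

lemma exch_simps [simp]: "exch (Inl (Inl x)) = Inl (Inl x)" "exch (Inl (Inr y)) = Inr (Inl y)"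
  "exch (Inr (Inl z)) = Inl (Inr z)" "exch (Inr (Inr w)) = Inr (Inr w)"
 by (simp_all add: exch_def)

lemma bij_exch: "bij_betw exch ((A <+> B) <+> (C <+> D)) ((A <+> C) <+> (B <+> D))"
 by (rule bij_betw_byWitness[where f' = exch]) auto

lemma tg_twire_id: "w:lists (Letters G) ==> is_tg G (tid w)"
 by (rule tg_twire) auto

lemma tcod_tid [simp]: "tcod G (tid w) = w"
 by (simp add: tcod_def o_def map_nth)

lemma tg_tsym: "u:lists (Letters G) ==> w:lists (Letters G) ==> is_tg G (tsym u w)"
 unfolding tsym_def by (rule tg_twire) auto

lemma tcod_tsym [simp]: "tcod G (tsym u w) = w @ u"
 by (auto simp: tcod_def tsym_def nth_append intro!: nth_equalityI)

lemma tcod_nth: "i < length (TO T) ==> tcod G T ! i = plab G T (TO T ! i)"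
 by (simp add: tcod_def)

lemma tglue_id_left:
 fixes T :: "('n, 's, 'a) tg"
 assumes "is_tg G T" "w = TD T" shows "tglue (tid w) T \<simeq> T"
\<comment> \<open>The identity wiring has no nodes, so the branch \<open>undefined\<close> acts on
  nothing.\<close>
proof (rule tgeqI[of "case_sum undefined id"])
 show "bij_betw (case_sum undefined id) (TN (tglue (tid w) T)) (TN T)"
  by (rule bij_betw_byWitness[where f' = Inr]) auto
 have g: "mpt (case_sum undefined id) (glue_port (map Inp [0..<length w] :: nat port list) u) = u"
  if "inb (length (TD T)) u" for u :: "'n port"
  using that assms by (cases u) auto
 show "TO T = map (mpt (case_sum undefined id)) (TO (tglue (tid w) T))"
  using g tg_inb(2)[OF assms(1)] by (auto intro!: map_idI[symmetric])
 fix x assume x: "x:TN (tglue (tid w) T)"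
 thus "TI T (case_sum undefined id x) = map (mpt (case_sum undefined id)) (TI (tglue (tid w) T) x)"
  using g tg_inb(1)[OF assms(1)] by (auto intro!: map_idI[symmetric])
 show "TV T (case_sum undefined id x) = TV (tglue (tid w) T) x" using x by auto
qed (use assms in auto)

lemma tglue_id_right: assumes "is_tg G T" "w = tcod G T" shows "tglue T (tid w) \<simeq> T"
proof (rule tgeqI[of "case_sum id undefined"])
 show "bij_betw (case_sum id undefined) (TN (tglue T (tid w))) (TN T)"
  by (rule bij_betw_byWitness[where f' = Inl]) auto
 show "TO T = map (mpt (case_sum id undefined)) (TO (tglue T (tid w)))"
  using assms by (auto simp: tcod_def port.map_comp o_def port.map_ident intro!: nth_equalityI)
 fix x assume x: "x:TN (tglue T (tid w))"
 thus "TI T (case_sum id undefined x) = map (mpt (case_sum id undefined)) (TI (tglue T (tid w)) x)"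
  by (auto simp: port.map_comp o_def port.map_ident)
 show "TV T (case_sum id undefined x) = TV (tglue T (tid w)) x" using x by auto
qed (use assms in auto)

lemma tglue_assoc:
 fixes A :: "('x, 's, 'a) tg" and B :: "('y, 's, 'a) tg" and C :: "('n, 's, 'a) tg"
 assumes "is_tg G C" "length (TO B) = length (TD C)"
 shows "tglue (tglue A B) C \<simeq> tglue A (tglue B C)"
proof (rule tgeqI[of mid])
 show "bij_betw mid (TN (tglue (tglue A B) C)) (TN (tglue A (tglue B C)))" by (simp add: bij_mid)
 have h: "glue_port (TO A) (mpt Inl v :: ('y + 'n) port) = mpt mid (mpt Inl (glue_port (TO A) v))" for v
  by (cases v) (auto simp: port.map_comp o_def)
 have g: "mpt mid (glue_port (map (glue_port (TO A)) (TO B)) u) = glue_port (TO A) (glue_port (TO B) u)"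
  if "inb (length (TD C)) u" for u :: "'n port"
  using that assms by (cases u) (auto simp: h)
 show "TO (tglue A (tglue B C)) = map (mpt mid) (TO (tglue (tglue A B) C))"
  using g tg_inb(2)[OF assms(1)] by auto
 fix x assume x: "x:TN (tglue (tglue A B) C)"
 thus "TI (tglue A (tglue B C)) (mid x) = map (mpt mid) (TI (tglue (tglue A B) C) x)"
  using g tg_inb(1)[OF assms(1)] by (auto simp: h port.map_comp o_def)
 show "TV (tglue A (tglue B C)) (mid x) = TV (tglue (tglue A B) C) x" using x by auto
qed auto

lemma tdu_interchange:
 fixes A :: "('n1, 's, 'a) tg" and B :: "('n2, 's, 'a) tg" and C :: "('n3, 's, 'a) tg" and D :: "('n4, 's, 'a) tg"
 assumes "is_tg G C" "is_tg G D" "length (TO A) = length (TD C)" "length (TO B) = length (TD D)"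
 shows "tglue (tdu A B) (tdu C D) \<simeq> tdu (tglue A C) (tglue B D)"
proof (rule tgeqI[of exch])
 let ?T = "tglue (tdu A B) (tdu C D)" and ?U = "tdu (tglue A C) (tglue B D)"
 show "bij_betw exch (TN ?T) (TN ?U)" by (simp add: bij_exch)
 have s: "mpt exch (mpt Inl (shift n v :: ('n1 + 'n2) port) :: (_ + ('n3 + 'n4)) port) = shift n (mpt Inl v)" for v n
  by (cases v) auto
 have s': "mpt exch (mpt Inl (mpt Inl v :: ('n1 + 'n2) port) :: (_ + ('n3 + 'n4)) port) = mpt Inl (mpt Inl v)" for v
  by (cases v) auto
 have 1: "mpt exch (glue_port (TO (tdu A B)) (mpt Inl u :: ('n3 + 'n4) port)) = mpt Inl (glue_port (TO A) u)"
  if "inb (length (TD C)) u" for u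
  using that assms by (cases u) (auto simp: nth_append s')
 have 2: "mpt exch (glue_port (TO (tdu A B)) (shift (length (TD C)) u :: ('n3 + 'n4) port)) = shift (length (TD A)) (glue_port (TO B) u)"
  if "inb (length (TD D)) u" for u
  using that assms by (cases u) (auto simp: nth_append s)
 show "TO ?U = map (mpt exch) (TO ?T)"
  using 1 2 tg_inb(2)[OF assms(1)] tg_inb(2)[OF assms(2)] by (auto simp del: tdu_simps(7)) (auto simp: tdu_simps(7))
 fix x assume x: "x:TN ?T"
 thus "TI ?U (exch x) = map (mpt exch) (TI ?T x)"
  using 1 2 tg_inb(1)[OF assms(1)] tg_inb(1)[OF assms(2)] by (auto simp: s s' simp del: tdu_simps(7))
 show "TV ?U (exch x) = TV ?T x" using x by auto
qed auto

lemma tdu_assoc: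
 fixes A :: "('n1, 's, 'a) tg" and B :: "('n2, 's, 'a) tg" and C :: "('n3, 's, 'a) tg"
 shows "tdu (tdu A B) C \<simeq> tdu A (tdu B C)"
proof (rule tgeqI[of mid])
 show "bij_betw mid (TN (tdu (tdu A B) C)) (TN (tdu A (tdu B C)))" by (simp add: bij_mid)
 have 1: "mpt mid (mpt Inl (shift n v :: ('n1 + 'n2) port) :: (_ + 'n3) port) = shift n (mpt Inl v)" for v n
  by (cases v) auto
 have 2: "mpt mid (shift (n + m) v :: (('n1 + 'n2) + 'n3) port) = shift n (shift m v)" for v n m by (cases v) auto
 have 3: "mpt mid (mpt Inl (mpt Inl v :: ('n1 + 'n2) port) :: (_ + 'n3) port) = mpt Inl v" for v
  by (cases v) auto
 show "TO (tdu A (tdu B C)) = map (mpt mid) (TO (tdu (tdu A B) C))"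
  by (auto simp: 1 2 3)
 fix x assume x: "x:TN (tdu (tdu A B) C)"
 thus "TI (tdu A (tdu B C)) (mid x) = map (mpt mid) (TI (tdu (tdu A B) C) x)"
   "TV (tdu A (tdu B C)) (mid x) = TV (tdu (tdu A B) C) x" by (auto simp: 1 2 3)
qed auto

lemma tdu_unit_left: "tdu (tid []) T \<simeq> T"
proof (rule tgeqI[of "case_sum undefined id"])
 show "bij_betw (case_sum undefined id) (TN (tdu (tid []) T)) (TN T)"
  by (rule bij_betw_byWitness[where f' = Inr]) auto
 have g: "mpt (case_sum undefined id) (shift 0 u) = u" for u :: "'a port" by (cases u) auto
 show "TO T = map (mpt (case_sum undefined id)) (TO (tdu (tid []) T))" by (auto simp: g o_def)
 fix x assume x: "x:TN (tdu (tid []) T)"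
 thus "TI T (case_sum undefined id x) = map (mpt (case_sum undefined id)) (TI (tdu (tid []) T) x)"
  "TV T (case_sum undefined id x) = TV (tdu (tid []) T) x" by (auto simp: g o_def)
qed auto

lemma tdu_unit_right: "tdu T (tid []) \<simeq> T"
proof (rule tgeqI[of "case_sum id undefined"])
 show "bij_betw (case_sum id undefined) (TN (tdu T (tid []))) (TN T)"
  by (rule bij_betw_byWitness[where f' = Inl]) auto
 show "TO T = map (mpt (case_sum id undefined)) (TO (tdu T (tid [])))"
  by (auto simp: port.map_comp o_def port.map_ident)
 fix x assume x: "x:TN (tdu T (tid []))"
 thus "TI T (case_sum id undefined x) = map (mpt (case_sum id undefined)) (TI (tdu T (tid [])) x)"
  "TV T (case_sum id undefined x) = TV (tdu T (tid [])) x" by (auto simp: port.map_comp o_def port.map_ident)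
qed auto

text \<open>The node bijection exchanges the two summands and passes them across the empty node set
  of the wiring.\<close>

lemma tsym_natural:
 fixes A :: "('n1, 's, 'a) tg" and B :: "('n2, 's, 'a) tg"
 assumes "is_tg G A" "is_tg G B" "u = tcod G A" "v = tcod G B" "u' = TD A" "v' = TD B"
 shows "tglue (tdu A B) (tsym u v) \<simeq> tglue (tsym u' v') (tdu B A)"
proof -
 define p :: "('n1 + 'n2) + nat => nat + ('n2 + 'n1)" where "p = case_sum (case_sum (Inr \<circ> Inr) (Inr \<circ> Inl)) Inl"
 have [simp]: "p (Inl (Inl x)) = Inr (Inr x)" "p (Inl (Inr y)) = Inr (Inl y)" for x y by (simp_all add: p_def)
 let ?T = "tglue (tdu A B) (tsym u v)" and ?U = "tglue (tsym u' v') (tdu B A)"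
 have 1: "mpt p (mpt Inl (mpt Inl a)) = glue_port (TO (tsym u' v' :: (nat, 's, 'a) tg)) (shift (length (TD B)) a)"
  if "inb (length (TD A)) a" for a
  using that assms by (cases a) (auto simp: nth_append)
 have 2: "mpt p (mpt Inl (shift (length (TD A)) b)) = glue_port (TO (tsym u' v' :: (nat, 's, 'a) tg)) (mpt Inl b)"
  if "inb (length (TD B)) b" for b
  using that assms by (cases b) (auto simp: tsym_def nth_append)
 have l: "length (TO A) = length u" "length (TO B) = length v" using assms by (simp_all add: tcod_def)
 have TOT: "TO ?T = map (mpt Inl) (map (shift (length (TD A))) (TO B) @ map (mpt Inl) (TO A))"
  by (auto simp: tsym_def nth_append l intro!: nth_equalityI)
 show ?thesis
 proof (rule tgeqI[of p])
  show "bij_betw p (TN ?T) (TN ?U)"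
   by (rule bij_betw_byWitness[where f' = "case_sum Inr (case_sum (Inl \<circ> Inr) (Inl \<circ> Inl))"]) auto
  show "TO ?U = map (mpt p) (TO ?T)"
   unfolding TOT using 1 2 tg_inb(2)[OF assms(1)] tg_inb(2)[OF assms(2)] by auto
  fix x assume x: "x:TN ?T"
  thus "TI ?U (p x) = map (mpt p) (TI ?T x)"
   using 1 2 tg_inb(1)[OF assms(1)] tg_inb(1)[OF assms(2)] by auto
  show "TV ?U (p x) = TV ?T x" using x by auto
 qed (use assms in auto)
qed

locale fgm =
 fixes G :: "('s, 'a, 'z) graph_monoid_scheme"
 assumes fg: "free_graph_monoid G"
begin

abbreviation "DC == diagram_cat G"
abbreviation DC_cmp (infixr "**." 65) where "g **. f == g **\<^bsub>DC\<^esub> f"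
abbreviation DC_ten (infixr "##." 70) where "f ##. g == f ##\<^bsub>DC\<^esub> g"

lemma DC_simps: "Obj DC = lists (Letters G)" "TObj DC = (@)" "Unit DC = []"
 "Idn DC = (%w. icls (wires w [0..<length w]))" "Sym DC = (%u w. icls (sym_diagram u w))"
 by (simp_all add: diagram_cat_def)

lemma Arr_cls: fixes T :: "('n, 's, 'a) tg" assumes "is_tg G T" shows "cls G T:Arr DC"
proof -
 obtain Ga :: "(nat, nat, 's, 'a) adiagram" where g: "is_adiagram G Ga" "T \<simeq> canon Ga"
  using realize[OF fg assms] by blast
 hence "cls G T = icls Ga" using cls_eqI[OF g(2) assms] iso_class_cls[OF g(1)] by simp
 with g show ?thesis by (auto simp: diagram_cat_def)
qed

lemma ArrE:
 assumes "A:Arr DC"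
 obtains T :: "(nat, 's, 'a) tg" where "is_tg G T" "A = cls G T"
proof -
 from assms obtain Ga :: "(nat, nat, 's, 'a) adiagram" where g: "is_adiagram G Ga" "A = icls Ga"
  by (auto simp: diagram_cat_def)
 show thesis by (rule that[OF adiag.canon_tg[OF adiag.intro, OF g(1)]]) (simp add: g iso_class_cls[OF g(1)])
qed

lemma Dom_cls [simp]: assumes "is_tg G T" shows "Dom DC (cls G T) = TD T" "Cod DC (cls G T) = tcod G T"
proof -
 define R where "R = (SOME Ga. Ga:cls G T)"
 obtain Ga :: "(nat, nat, 's, 'a) adiagram" where "is_adiagram G Ga" "T \<simeq> canon Ga"
  using realize[OF fg assms] by blast
 hence "Ga:cls G T" by (simp add: cls_def)
 hence "R:cls G T" unfolding R_def by (rule someI)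
 hence R: "is_adiagram G R" "T \<simeq> canon R" by (simp_all add: cls_def)
 have "Dom DC (cls G T) = dom_word R" "Cod DC (cls G T) = cod_word R"
  by (simp_all add: diagram_cat_def R_def)
 thus "Dom DC (cls G T) = TD T" "Cod DC (cls G T) = tcod G T"
  using tgeqD[OF R(2) assms] adiag.tcod_canon[OF adiag.intro, OF R(1)] by simp_all
qed

lemma Idn_cls: "w:lists (Letters G) ==> Idn DC w = cls G (tid w)"
 by (simp add: DC_simps wires_valid atLeast0LessThan)

lemma Sym_cls: "u:lists (Letters G) ==> w:lists (Letters G) ==> Sym DC u w = cls G (tsym u w)"
 by (simp add: DC_simps sym_diagram_def tsym_def) (intro wires_valid, auto)

lemma Cmp_cls: "is_tg G T ==> is_tg G U ==> tcod G T = TD U ==> cls G U **. cls G T = cls G (tglue T U)"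
 by (subst tg_tglue(2)[OF fg]) (auto simp: diagram_cat_def)

lemma TArr_cls: "is_tg G T ==> is_tg G U ==> cls G T ##. cls G U = cls G (tdu T U)"
 by (subst tg_tdu(2)[OF fg]) (auto simp: diagram_cat_def)

lemma tcod_tglue:
 assumes "is_tg G T" "is_tg G U" "tcod G T = TD U"
 shows "tcod G (tglue T U) = tcod G U"
proof -
 have len: "length (TO T) = length (TD U)" using arg_cong[OF assms(3), of length] by (simp add: length_tcod)
 have i: "plab G (tglue T U) (mpt Inl u) = plab G T u" for u by (cases u) auto
 have "plab G (tglue T U) (glue_port (TO T) u) = plab G U u" if "u:set (TO U)" for u
  using tg_inb(2)[OF assms(2) that] len assms(3)[symmetric] by (cases u) (auto simp: i tcod_nth)
 thus ?thesis by (simp add: tcod_def)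
qed

lemma tcod_tdu:
 assumes "is_tg G T" "is_tg G U"
 shows "tcod G (tdu T U) = tcod G T @ tcod G U"
proof -
 have "plab G (tdu T U) (mpt Inl u) = plab G T u" if "u:set (TO T)" for u
  using tg_inb(2)[OF assms(1) that] by (cases u) (auto simp: nth_append)
 moreover have "plab G (tdu T U) (shift (length (TD T)) u) = plab G U u" if "u:set (TO U)" for u
  by (cases u) (auto simp: nth_append)
 ultimately show ?thesis by (simp add: tcod_def)
qed

lemma TD_lists: "is_tg G T ==> TD T:lists (Letters G)"
 by (simp add: is_tg_def)

lemma tcod_lists: "is_tg G T ==> tcod G T:lists (Letters G)"
 using plab_Letters[OF fg, of T] tg_ports(2)[of G T] by (auto simp: tcod_def subset_iff)

lemmas tgs = tg_tglue(1)[OF fg] tg_tdu(1)[OF fg] tg_twire_id tg_tsym TD_lists tcod_lists tcod_tglue tcod_tdu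

lemma tlen: "tcod G T = w ==> length (TO T) = length w" by (auto simp: tcod_def)

text \<open>Each equation is an isomorphism of term graphs, which \<open>cls_eqI\<close> turns into
  an equality of classes.\<close>

sublocale DC: strict_smc DC "Letters G"
proof unfold_locales
 fix f assume "f:Arr DC"
 then obtain T :: "(nat, 's, 'a) tg" where "is_tg G T" "f = cls G T" by (rule ArrE)
 thus "Dom DC f:Obj DC" "Cod DC f:Obj DC" by (simp_all add: DC_simps tgs)
next
 fix X assume "X:Obj DC"
 thus "Idn DC X:Hom DC X X" by (simp add: DC_simps(1) Idn_cls Hom_def Arr_cls tgs)
next
 fix f X Y g Z assume "f:Hom DC X Y" "g:Hom DC Y Z"
 thus "g **. f:Hom DC X Z"
  by (auto simp: Hom_def Cmp_cls Arr_cls tgs elim!: ArrE)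
next
 fix f X Y assume f: "f:Hom DC X Y"
 then obtain T :: "(nat, 's, 'a) tg" where T: "is_tg G T" "f = cls G T" by (auto simp: Hom_def elim!: ArrE)
 have "cls G (tglue (tid (TD T)) T) = cls G T"
  by (rule cls_eqI[OF tglue_id_left[where G = G]]) (simp_all add: T tgs)
 moreover have "cls G (tglue T (tid (tcod G T))) = cls G T"
  by (rule cls_eqI[OF tglue_id_right[where G = G]]) (simp_all add: T tgs)
 ultimately show "Idn DC Y **. f = f" "f **. Idn DC X = f"
  using f T by (auto simp: Hom_def Idn_cls Cmp_cls tgs)
next
 fix f W X g Y h Z assume "f:Hom DC W X" "g:Hom DC X Y" "h:Hom DC Y Z"
 then obtain A B D :: "(nat, 's, 'a) tg" where T: "is_tg G A" "is_tg G B" "is_tg G D" "f = cls G A" "g = cls G B" "h = cls G D"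
  "tcod G A = TD B" "tcod G B = TD D"
  by (auto simp: Hom_def elim!: ArrE)
 have "cls G (tglue (tglue A B) D) = cls G (tglue A (tglue B D))"
  by (rule cls_eqI[OF tglue_assoc[where G = G]]) (simp_all add: T tgs tlen)
 thus "(h **. g) **. f = h **. g **. f"
  by (simp add: T Cmp_cls tgs)
next
 show "Obj DC = lists (Letters G)" by (simp add: DC_simps)
next
 fix f g assume "f:Arr DC" "g:Arr DC"
 thus "f ##. g:Arr DC" "Dom DC (f ##. g) = Dom DC f @ Dom DC g" "Cod DC (f ##. g) = Cod DC f @ Cod DC g"
  by (auto simp: TArr_cls Arr_cls tgs elim!: ArrE)
next
 fix u v assume uv: "u:Obj DC" "v:Obj DC"
 have e: "(tid (u @ v) :: (nat, 's, 'a) tg) \<simeq> tdu (tid u) (tid v)"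
  by (rule twire_eqI) (auto simp: nth_append intro!: nth_equalityI)
 thus "Idn DC u ##. Idn DC v = Idn DC (u @ v)"
  using uv cls_eqI[OF e, of G] tg_twire_id[of "u @ v" G] by (simp add: DC_simps(1) Idn_cls TArr_cls tgs)
next
 fix f g f' g' assume "f:Arr DC" "g:Arr DC" "f':Arr DC" "g':Arr DC" "Cod DC f = Dom DC g" "Cod DC f' = Dom DC g'"
 then obtain A B A' B' :: "(nat, 's, 'a) tg" where T: "is_tg G A" "is_tg G B" "is_tg G A'" "is_tg G B'"
  "f = cls G A" "g = cls G B" "f' = cls G A'" "g' = cls G B'" "tcod G A = TD B" "tcod G A' = TD B'"
  by (auto elim!: ArrE)
 have "cls G (tglue (tdu A A') (tdu B B')) = cls G (tdu (tglue A B) (tglue A' B'))"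
  by (rule cls_eqI[OF tdu_interchange[where G = G]]) (simp_all add: T tgs tlen)
 thus "(g ##. g') **. (f ##. f') = (g **. f) ##. (g' **. f')"
  by (simp add: T Cmp_cls TArr_cls tgs)
next
 fix f g h assume "f:Arr DC" "g:Arr DC" "h:Arr DC"
 then obtain A B D :: "(nat, 's, 'a) tg" where T: "is_tg G A" "is_tg G B" "is_tg G D" "f = cls G A" "g = cls G B" "h = cls G D"
  by (auto elim!: ArrE)
 have "cls G (tdu (tdu A B) D) = cls G (tdu A (tdu B D))"
  by (rule cls_eqI[OF tdu_assoc]) (simp add: T tgs)
 thus "(f ##. g) ##. h = f ##. g ##. h"
  by (simp add: T TArr_cls tgs)
next
 fix f assume "f:Arr DC"
 then obtain T :: "(nat, 's, 'a) tg" where T: "is_tg G T" "f = cls G T" by (rule ArrE)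
 have n: "[]:lists (Letters G)" by simp
 have "cls G (tdu (tid []) T) = cls G T"
  by (rule cls_eqI[OF tdu_unit_left]) (intro tgs(2) T(1) tgs(3) n)
 moreover have "cls G (tdu T (tid [])) = cls G T"
  by (rule cls_eqI[OF tdu_unit_right]) (intro tgs(2) T(1) tgs(3) n)
 ultimately show "Idn DC [] ##. f = f" "f ##. Idn DC [] = f"
  unfolding T(2) Idn_cls[OF n] by (simp_all only: TArr_cls T tgs(3)[OF n])
next
 fix u v assume uv: "u:Obj DC" "v:Obj DC"
 thus "Sym DC u v:Arr DC" "Dom DC (Sym DC u v) = u @ v" "Cod DC (Sym DC u v) = v @ u"
  by (simp_all add: DC_simps(1) Sym_cls Arr_cls tgs)
 have e: "(tid (u @ v) :: (nat, 's, 'a) tg) \<simeq> tglue (tsym u v) (tsym v u)"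
  by (rule twire_eqI) (auto simp: tsym_def nth_append intro!: nth_equalityI)
 thus "Sym DC v u **. Sym DC u v = Idn DC (u @ v)"
  using uv cls_eqI[OF e, of G] tg_twire_id[of "u @ v" G] by (simp add: DC_simps(1) Sym_cls Idn_cls Cmp_cls tgs)
next
 fix f g assume "f:Arr DC" "g:Arr DC"
 then obtain A B :: "(nat, 's, 'a) tg" where T: "is_tg G A" "is_tg G B" "f = cls G A" "g = cls G B"
  by (auto elim!: ArrE)
 have "cls G (tglue (tdu A B) (tsym (tcod G A) (tcod G B))) = cls G (tglue (tsym (TD A) (TD B)) (tdu B A))"
  by (rule cls_eqI[OF tsym_natural[where G = G]]) (simp_all add: T tgs)
 thus "Sym DC (Cod DC f) (Cod DC g) **. (f ##. g) = (g ##. f) **. Sym DC (Dom DC f) (Dom DC g)"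
  by (simp add: T TArr_cls Sym_cls Cmp_cls tgs)
next
 fix u v w assume uvw: "u:Obj DC" "v:Obj DC" "w:Obj DC"
 have e: "(tsym u (v @ w) :: (nat, 's, 'a) tg) \<simeq> tglue (tdu (tsym u v) (tid w)) (tdu (tid v) (tsym u w))"
  unfolding tsym_def[of u "v @ w"]
  by (rule twire_eqI) (auto simp: tsym_def nth_append intro!: nth_equalityI)
 thus "Sym DC u (v @ w) = (Idn DC v ##. Sym DC u w) **. (Sym DC u v ##. Idn DC w)"
  using uvw cls_eqI[OF e, of G] tg_tsym[of u G "v @ w"] by (simp add: DC_simps(1) Sym_cls Idn_cls Cmp_cls TArr_cls tgs)
qed

end

section \<open>Cutting a term graph\<close>

context fgm
begin

abbreviation "pl == plab G"

text \<open>The vocabulary of a cut. \<open>avail\<close> collects the edges that start in the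
  domain or in \<open>A\<close>, a \<open>down\<close> set contains with a node all nodes it depends
  on, and the \<open>frontier\<close> consists of the edges that start on the side of
  \<open>A\<close> and end beyond it.\<close>

definition avail :: "('n, 's, 'a) tg => 'n set => 'n port set" where
 "avail T A = {u:ports G T. ALL x j. u = Outp x j --> x:A}"

definition used :: "('n, 's, 'a) tg => 'n set => 'n port set" where
 "used T A = (UN x:A. set (TI T x))"

definition down :: "('n, 's, 'a) tg => 'n set => bool" where
 "down T A <-> A <= TN T & used T A <= avail T A"

definition frontier :: "('n, 's, 'a) tg => 'n set => 'n port set" where
 "frontier T A = avail T A - used T A"

definition lowT :: "('n, 's, 'a) tg => 'n set => 'n port list => ('n, 's, 'a) tg" where
 "lowT T A L = \<lparr> TN = A, TV = TV T, TD = TD T, TI = TI T, TO = L \<rparr>"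

text \<open>Above the cut, an edge listed in \<open>L\<close> becomes a domain edge and is named by
  its place in \<open>L\<close>.\<close>

definition ix :: "'n port list => 'n port => 'n port" where
 "ix L u = (if u:set L then Inp (idx L u) else u)"

definition highT :: "('n, 's, 'a) tg => 'n set => 'n port list => ('n, 's, 'a) tg" where
 "highT T B L = \<lparr> TN = B, TV = TV T, TD = map (pl T) L, TI = (%x. map (ix L) (TI T x)), TO = map (ix L) (TO T) \<rparr>"

lemma lowT_simps [simp]: "TN (lowT T A L) = A" "TV (lowT T A L) = TV T" "TD (lowT T A L) = TD T"
 "TI (lowT T A L) = TI T" "TO (lowT T A L) = L"
 by (simp_all add: lowT_def)

lemma highT_simps [simp]: "TN (highT T A L) = A" "TV (highT T A L) = TV T" "TD (highT T A L) = map (pl T) L"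
 "TI (highT T A L) x = map (ix L) (TI T x)" "TO (highT T A L) = map (ix L) (TO T)"
 by (simp_all add: highT_def)

lemma pl_lowT [simp]: "pl (lowT T A L) = pl T"
 by (rule ext) (simp add: plab_def split: port.split)

lemma tg_node:
 assumes "is_tg G T" "x:TN T"
 shows "TV T x:Arrows G" "distinct (TI T x)" "map (pl T) (TI T x) = ASrc G (TV T x)" "set (TI T x) Int set (TO T) = {}"
  "y:TN T ==> x ~= y ==> set (TI T x) Int set (TI T y) = {}"
 using assms by (simp_all add: is_tg_def)

lemma tg_glob:
 assumes "is_tg G T"
 shows "finite (TN T)" "TD T:lists (Letters G)" "distinct (TO T)" "used T (TN T) Un set (TO T) = ports G T"
  "EX rk :: _ => nat. ALL x:TN T. ALL y j. Outp y j:set (TI T x) --> rk y < rk x"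
 using assms unfolding is_tg_def used_def by (simp_all only:)

lemma tg_low:
 assumes T: "is_tg G T" and A: "down T A" and L: "distinct L" "set L = frontier T A"
 shows "is_tg G (lowT T A L)" "tcod G (lowT T A L) = map (pl T) L"
proof -
 have sub: "A <= TN T" using A by (simp add: down_def)
 have ports: "ports G (lowT T A L) = avail T A"
  using sub by (auto simp: avail_def ports_def inports_def outports_def)
 obtain rk :: "_ => nat" where rk: "ALL x:TN T. ALL y j. Outp y j:set (TI T x) --> rk y < rk x"
  using tg_glob(5)[OF T] by blast
 have "EX rk :: _ => nat. ALL x:A. ALL y j. Outp y j:set (TI T x) --> rk y < rk x"
  by (rule exI[of _ rk]) (use rk sub in blast)
 moreover have "used T A Un set L = avail T A" using A L by (auto simp: down_def frontier_def)
 moreover have "used T A Int set L = {}" using L by (auto simp: frontier_def)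
 ultimately show "is_tg G (lowT T A L)" unfolding is_tg_def ports
  using sub L tg_node[OF T] tg_glob[OF T] finite_subset[OF sub]
  by (auto simp: used_def subset_iff simp del: ex_simps all_simps)
 show "tcod G (lowT T A L) = map (pl T) L" by (simp add: tcod_def)
qed

lemma ix_inj: "inj_on (ix L) (set L Un {u. ALL i. u ~= Inp i})"
 by (rule inj_onI) (auto simp: ix_def split: if_splits, metis nth_idx)

text \<open>\<open>high_rest\<close> is the key: the upper nodes and the codomain together consume
  exactly the frontier edges and the outputs of the upper nodes. On these ports \<open>ix L\<close>
  is injective and preserves letters, so each condition carries over from \<open>T\<close>.\<close>

lemma tg_high:
 fixes T :: "('n, 's, 'a) tg"
 assumes T: "is_tg G T" and A: "down T A" and L: "distinct L" "set L = frontier T A"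
 shows "is_tg G (highT T (TN T - A) L)" "tcod G (highT T (TN T - A) L) = tcod G T"
  and high_rest: "used T (TN T - A) Un set (TO T) = set L Un {u:ports G T. EX x:TN T - A. EX j. u = Outp x j}"
  and pl_high: "!!u. u:used T (TN T - A) Un set (TO T) ==> pl (highT T (TN T - A) L) (ix L u) = pl T u"
proof -
 let ?H = "highT T (TN T - A) L" and ?N = "{u:ports G T. EX x:TN T - A. EX j. u = Outp x j}"
 have sub: "A <= TN T" and usub: "used T A <= avail T A" using A by (auto simp: down_def)
 have du: "used T A Int used T (TN T - A) = {}" "used T A Int set (TO T) = {}" "used T (TN T - A) Int set (TO T) = {}"
  using tg_node(5)[OF T] tg_node(4)[OF T] sub unfolding used_def by blast+
 have "used T (TN T) = used T A Un used T (TN T - A)" using sub by (auto simp: used_def)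
 hence "used T (TN T - A) Un set (TO T) = ports G T - used T A" using tg_glob(4)[OF T] du by blast
 also have "... = set L Un ?N"
 proof -
  have "ports G T = avail T A Un ?N"
  proof (intro set_eqI iffI)
   fix u assume "u:ports G T"
   thus "u:avail T A Un ?N" by (cases u) (auto simp: avail_def)
  qed (auto simp: avail_def)
  moreover have "?N Int used T A = {}" using usub by (auto simp: avail_def)
  ultimately show ?thesis using L(2) by (auto simp: frontier_def)
 qed
 finally show rest: "used T (TN T - A) Un set (TO T) = set L Un ?N" .
 have NL: "?N Int set L = {}" using L by (auto simp: frontier_def avail_def)
 have inj: "inj_on (ix L) (set L Un ?N)"
  by (rule inj_on_subset[OF ix_inj]) auto
 have im: "ix L ` (set L Un ?N) = ports G ?H"
 proof -
  have "ix L ` ?N = ?N" using NL by (auto simp: ix_def image_iff)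
  moreover have "ix L ` set L = ({Inp i |i. i < length L} :: 'n port set)"
  proof (intro set_eqI iffI)
   fix v assume "v:({Inp i |i. i < length L} :: 'n port set)"
   then obtain i where "v = Inp i" "i < length L" by blast
   hence "v = ix L (L ! i)" "L ! i:set L" using L(1) by (auto simp: ix_def)
   thus "v:ix L ` set L" by blast
  qed (auto simp: ix_def)
  moreover have "ports G ?H = ({Inp i |i. i < length L} :: 'n port set) Un ?N"
   using sub by (auto simp: ports_def inports_def outports_def)
  ultimately show ?thesis by (simp add: image_Un)
 qed
 show plh: "pl ?H (ix L u) = pl T u" if "u:used T (TN T - A) Un set (TO T)" for u
  using that NL unfolding rest by (auto simp: ix_def)
 have d: "distinct (map (ix L) us)" if "distinct us" "set us <= set L Un ?N" for us
  using that inj_on_subset[OF inj] by (auto simp: distinct_map)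
 have dj: "ix L ` X Int ix L ` Y = {}" if "X Int Y = {}" "X <= set L Un ?N" "Y <= set L Un ?N" for X Y
  using inj_on_image_Int[OF inj that(2,3)] that(1) by simp
 have TIs: "set (TI T x) <= set L Un ?N" if "x:TN T - A" for x using that rest by (auto simp: used_def)
 have TOs: "set (TO T) <= set L Un ?N" using rest by blast
 obtain rk :: "_ => nat" where rk: "ALL x:TN T. ALL y j. Outp y j:set (TI T x) --> rk y < rk x"
  using tg_glob(5)[OF T] by blast
 show "is_tg G ?H" unfolding is_tg_def
 proof (intro conjI ballI impI)
  show "finite (TN ?H)" using tg_glob(1)[OF T] by simp
  show "TD ?H:lists (Letters G)"
  proof -
   have "set L <= ports G T" using L(2) by (auto simp: frontier_def avail_def)
   hence "set (map (pl T) L) <= Letters G" using plab_Letters[OF fg T] by auto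
   thus ?thesis by (simp add: lists_eq_set)
  qed
  show "distinct (TO ?H)" using d[OF tg_glob(3)[OF T] TOs] by simp
  show "(UN x:TN ?H. set (TI ?H x)) Un set (TO ?H) = ports G ?H"
   using arg_cong[OF rest, of "image (ix L)"] unfolding im by (simp add: used_def image_Un image_UN)
  show "EX rk :: _ => nat. ALL x:TN ?H. ALL y j. Outp y j:set (TI ?H x) --> rk y < rk x"
   by (rule exI[of _ rk]) (use rk in "auto simp: ix_def split: if_splits")
 next
  fix x assume "x:TN ?H"
  hence x: "x:TN T - A" "x:TN T" by auto
  show "TV ?H x:Arrows G" "distinct (TI ?H x)" using tg_node[OF T x(2)] d[OF _ TIs[OF x(1)]] by auto
  show "map (pl ?H) (TI ?H x) = ASrc G (TV ?H x)"
  proof -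
   have "map (pl ?H) (map (ix L) (TI T x)) = map (pl T) (TI T x)"
    using plh x(1) by (simp add: used_def) blast
   thus ?thesis using tg_node(3)[OF T x(2)] by simp
  qed
  show "set (TI ?H x) Int set (TO ?H) = {}" using dj[OF tg_node(4)[OF T x(2)] TIs[OF x(1)] TOs] by simp
  fix y assume "y:TN ?H" "x ~= y"
  thus "set (TI ?H x) Int set (TI ?H y) = {}"
   using dj[OF tg_node(5)[OF T x(2)] TIs[OF x(1)] TIs] by simp
 qed
 show "tcod G ?H = tcod G T" using plh by (simp add: tcod_def)
qed

text \<open>The shape of composite in which a surgery acts: \<open>T\<close>, then \<open>X\<close>
  beside the wires \<open>w\<close>, then \<open>U\<close>.\<close>

definition ctx :: "('n1, 's, 'a) tg => ('k, 's, 'a) tg => 's list => ('n2, 's, 'a) tg => (('n1 + ('k + nat)) + 'n2, 's, 'a) tg" where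
 "ctx T X w U = tglue (tglue T (tdu X (tid w))) U"

text \<open>Places an abstract \<open>X\<close> inside a term graph: its nodes go along
  \<open>p\<close>, its domain edges are the ports listed in \<open>I\<close>.\<close>

definition emb :: "('k => 'n) => 'n port list => 'k port => 'n port" where
 "emb p I u = (case u of Inp i => I ! i | Outp y j => Outp (p y) j)"

lemma emb_simps [simp]: "emb p I (Inp i) = I ! i" "emb p I (Outp y j) = Outp (p y) j"
 by (simp_all add: emb_def)

definition ctx_map :: "('k => 'n) => ('n + ('k + nat)) + 'n => 'n" where
 "ctx_map p = case_sum (case_sum id (case_sum p undefined)) id"

lemma ctx_map_simps [simp]: "ctx_map p (Inl (Inl x)) = x" "ctx_map p (Inl (Inr (Inl y))) = p y" "ctx_map p (Inr z) = z"
 by (simp_all add: ctx_map_def)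

text \<open>The frontier of \<open>A\<close> splits into the edges \<open>I\<close> that enter the
  copy of \<open>X\<close> and the edges \<open>W\<close> that pass beside it. Crossing the copy
  exchanges \<open>I\<close> for its outgoing edges \<open>J\<close>, so \<open>J @ W\<close> lists
  the frontier of the enlarged down set, and the three layers glue back to \<open>T\<close>.\<close>

lemma decomp:
 fixes T :: "('n, 's, 'a) tg" and X :: "('k, 's, 'a) tg"
 assumes T: "is_tg G T" and X: "is_tg G X" and A: "down T A" and AN: "down T (A Un p ` TN X)"
  and p: "inj_on p (TN X)" "A Int p ` TN X = {}"
  and L: "distinct (I @ W)" "set (I @ W) = frontier T A" and I: "map (pl T) I = TD X"
  and emb: "!!y. y:TN X ==> TI T (p y) = map (emb p I) (TI X y) & TV T (p y) = TV X y"
 defines "J == map (emb p I) (TO X)" and "B == TN T - (A Un p ` TN X)"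
 shows "tgiso (ctx_map p) (ctx (lowT T A (I @ W)) X (map (pl T) W) (highT T B (J @ W))) T"
  and "distinct (J @ W)" "set (J @ W) = frontier T (A Un p ` TN X)" "map (pl T) J = tcod G X"
proof -
 have len: "length I = length (TD X)" using arg_cong[OF I, of length] by simp
 have sub: "A Un p ` TN X <= TN T" using AN by (simp add: down_def)
 let ?e = "emb p I"
 have einj: "inj_on ?e (ports G X)"
 proof (rule inj_onI)
  fix u v assume u: "u:ports G X" and v: "v:ports G X" and e: "?e u = ?e v"
  \<comment> \<open>A port in \<open>I\<close> starts in the domain or in \<open>A\<close>, never at
    a node of the copy.\<close>
  have no: "I ! i ~= Outp (p y) j" if "i < length I" "y:TN X" for i y j
  proof
   assume "I ! i = Outp (p y) j"
   hence "Outp (p y) j:frontier T A" using L(2) that(1) nth_mem[of i I] by auto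
   thus False using p(2) that(2) by (auto simp: frontier_def avail_def)
  qed
  show "u = v" using u v e L(1) p(1) no no[symmetric] len
   by (cases u; cases v) (auto simp: nth_eq_iff_index_eq inj_on_eq_iff)
 qed
 have atgt: "ATgt G (TV T (p y)) = ATgt G (TV X y)" if "y:TN X" for y using emb that by simp
 have eim: "?e ` ports G X = set I Un {u:ports G T. EX y:TN X. EX j. u = Outp (p y) j}"
 proof (intro set_eqI iffI)
  fix v assume "v:?e ` ports G X"
  then obtain u where "u:ports G X" "v = ?e u" by blast
  thus "v:set I Un {u:ports G T. EX y:TN X. EX j. u = Outp (p y) j}"
   using sub len atgt by (cases u) auto
 next
  fix v assume "v:set I Un {u:ports G T. EX y:TN X. EX j. u = Outp (p y) j}"
  thus "v:?e ` ports G X"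
  proof
   assume "v:set I"
   then obtain i where "i < length I" "v = I ! i" by (auto simp: in_set_conv_nth)
   thus ?thesis using len by (intro image_eqI[of _ _ "Inp i"]) auto
  next
   assume "v:{u:ports G T. EX y:TN X. EX j. u = Outp (p y) j}"
   then obtain y j where "v:ports G T" "y:TN X" "v = Outp (p y) j" by auto
   thus ?thesis using atgt by (intro image_eqI[of _ _ "Outp y j"]) auto
  qed
 qed
 have xs: "!!x. x:TN X ==> set (TI X x) <= ports G X" "set (TO X) <= ports G X" using tg_ports[OF X] by auto
 have usedN: "used T (p ` TN X) = ?e ` used X (TN X)" using emb by (auto simp: used_def)
 have dJ: "distinct J" using inj_on_subset[OF einj xs(2)] tg_glob(3)[OF X] unfolding J_def by (simp add: distinct_map)
 have "used X (TN X) Int set (TO X) = {}" using tg_node(4)[OF X] by (auto simp: used_def)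
 hence toX: "set (TO X) = ports G X - used X (TN X)" using tg_glob(4)[OF X] by blast
 have uX: "used X (TN X) <= ports G X" using tg_glob(4)[OF X] by blast
 have sJ: "set J = ?e ` ports G X - used T (p ` TN X)"
  unfolding J_def usedN using inj_on_image_set_diff[OF einj _ uX, of "ports G X"] toX by simp
 have av: "avail T (A Un p ` TN X) = avail T A Un {u:ports G T. EX y:TN X. EX j. u = Outp (p y) j}"
 proof (intro set_eqI iffI)
  fix u assume "u:avail T (A Un p ` TN X)"
  thus "u:avail T A Un {u:ports G T. EX y:TN X. EX j. u = Outp (p y) j}"
   by (cases u) (auto simp: avail_def)
 qed (auto simp: avail_def)
 have us: "used T (A Un p ` TN X) = used T A Un used T (p ` TN X)" by (auto simp: used_def)
 have usI: "used T (p ` TN X) <= ?e ` ports G X" unfolding usedN by (rule image_mono) (use xs in "auto simp: used_def")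
 have dW: "set W Int ?e ` ports G X = {}"
  using L p(2) unfolding eim by (auto simp: frontier_def avail_def)
 show dJW: "distinct (J @ W)" using dJ L dW sJ by auto
 have nA: "{u:ports G T. EX y:TN X. EX j. u = Outp (p y) j} Int used T A = {}"
 proof (intro equals0I)
  fix u assume "u:{u:ports G T. EX y:TN X. EX j. u = Outp (p y) j} Int used T A"
  then obtain y j where "y:TN X" "Outp (p y) j:avail T A" using A by (auto simp: down_def)
  thus False using p(2) by (auto simp: avail_def)
 qed
 show sJW: "set (J @ W) = frontier T (A Un p ` TN X)"
 proof -
  have "frontier T (A Un p ` TN X) = (frontier T A Un {u:ports G T. EX y:TN X. EX j. u = Outp (p y) j}) - used T (p ` TN X)"
   unfolding frontier_def av us using nA by blast
  also have "... = (set W Un ?e ` ports G X) - used T (p ` TN X)"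
   unfolding eim L(2)[symmetric] by auto
  also have "... = set W Un set J" unfolding sJ using dW usI by blast
  finally show ?thesis by auto
 qed
 have ple: "pl T (?e u) = pl X u" if "u:ports G X" for u
  using that I[symmetric] atgt by (cases u) auto
 show "map (pl T) J = tcod G X" using ple xs(2) by (auto simp: J_def tcod_def)
 have rest: "used T B Un set (TO T) = set (J @ W) Un {u:ports G T. EX x:B. EX j. u = Outp x j}"
  unfolding B_def by (rule high_rest[OF T AN dJW sJW])
 define M where "M = tglue (lowT T A (I @ W)) (tdu X (tid (map (pl T) W)))"
 let ?P = "mpt (ctx_map p)"
 have P1: "?P (mpt Inl (mpt Inl u)) = u" for u by (cases u) auto
 have P2: "?P (mpt Inl (glue_port (I @ W) (mpt Inl u))) = ?e u" if "u:ports G X" for u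
  using that len by (cases u) (auto simp: P1 nth_append)
 have TOM: "map (?P \<circ> mpt Inl) (TO M) = J @ W"
 proof -
  have "map (?P \<circ> mpt Inl) (map (glue_port (I @ W)) (map (mpt Inl) (TO X))) = J"
   using P2 xs(2) by (auto simp: J_def)
  moreover have "map (?P \<circ> mpt Inl) (map (glue_port (I @ W)) (map (shift (length (TD X))) (map Inp [0..<length W]))) = W"
   by (auto simp: nth_append len P1 intro!: nth_equalityI)
  ultimately show ?thesis by (simp add: M_def del: map_map)
 qed
 \<comment> \<open>For an edge used above the cut: if it crosses the cut, its place in
   \<open>J @ W\<close> leads back to it; otherwise it starts at an upper node and keeps its
   name.\<close>
 have P3: "?P (glue_port (TO M) (ix (J @ W) u)) = u" if uB: "u:used T B Un set (TO T)" for u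
 proof (cases "u:set (J @ W)")
  case True
  have l: "length (TO M) = length (J @ W)" using arg_cong[OF TOM, of length] by simp
  hence i: "idx (J @ W) u < length (TO M)" using True by (simp only: l idx_less)
  have "?P (glue_port (TO M) (ix (J @ W) u)) = map (?P \<circ> mpt Inl) (TO M) ! idx (J @ W) u"
   using True i by (simp add: ix_def)
  also have "... = u" unfolding TOM using True by (rule nth_idx)
  finally show ?thesis .
 next
  case False
  then obtain x j where "u = Outp x j" using uB rest by blast
  thus ?thesis using False by (simp add: ix_def)
 qed
 show "tgiso (ctx_map p) (ctx (lowT T A (I @ W)) X (map (pl T) W) (highT T B (J @ W))) T"
  unfolding tgiso_def ctx_def M_def[symmetric]
 proof (intro conjI ballI)
  show "bij_betw (ctx_map p) (TN (tglue M (highT T B (J @ W)))) (TN T)"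
   by (rule bij_betw_byWitness[where f' = "%x. if x:A then Inl (Inl x) else if x:p ` TN X then Inl (Inr (Inl (inv_into (TN X) p x))) else Inr x"])
    (use p sub in "auto simp: M_def B_def inv_into_into f_inv_into_f dest: inj_onD")
  show "TD T = TD (tglue M (highT T B (J @ W)))" by (simp add: M_def)
  show "TO T = map ?P (TO (tglue M (highT T B (J @ W))))"
   using P3 by (auto intro!: map_idI[symmetric])
 next
  fix z assume "z:TN (tglue M (highT T B (J @ W)))"
  then consider x where "z = Inl (Inl x)" "x:A" | y where "z = Inl (Inr (Inl y))" "y:TN X" | x where "z = Inr x" "x:B"
   by (auto simp: M_def)
  hence "TV T (ctx_map p z) = TV (tglue M (highT T B (J @ W))) z &
   TI T (ctx_map p z) = map ?P (TI (tglue M (highT T B (J @ W))) z)"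
  proof cases
   case 1
   thus ?thesis by (simp add: M_def) (auto simp: P1 intro!: map_idI[symmetric])
  next
   case 2
   thus ?thesis using emb[OF 2(2)] P2 xs(1)[OF 2(2)] by (auto simp: M_def)
  next
   case 3
   hence "?P (glue_port (TO M) (ix (J @ W) u)) = u" if "u:set (TI T x)" for u
    using that by (intro P3) (auto simp: used_def)
   thus ?thesis using 3 by (auto intro!: map_idI[symmetric])
  qed
  thus "TV T (ctx_map p z) = TV (tglue M (highT T B (J @ W))) z"
   "TI T (ctx_map p z) = map ?P (TI (tglue M (highT T B (J @ W))) z)" by auto
 qed
qed

end

section \<open>Single arrows, wirings and topological orders as term graphs\<close>

lemma idx_append: "idx (A @ B) m = (if m:set A then idx A m else length A + idx B m)"
 by (induction A) (auto simp: idx_def)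

lemma idx_inj: "inj_on (idx L) (set L)"
 by (rule inj_onI) (metis nth_idx)

lemma idx_image: "distinct L ==> idx L ` set L = {..<length L}"
proof (intro set_eqI iffI)
 fix i assume "distinct L" "i:{..<length L}"
 thus "i:idx L ` set L" by (intro image_eqI[of _ _ "L ! i"]) auto
qed auto

lemma map_idx_self: "distinct L ==> map (idx L) L = [0..<length L]"
 by (rule nth_equalityI) auto

definition tarrow :: "('s, 'a, 'z) graph_monoid_scheme => 'a => (nat, 's, 'a) tg" where
 "tarrow G k = \<lparr> TN = {0}, TV = (%_. k), TD = ASrc G k, TI = (%_. map Inp [0..<length (ASrc G k)]),
  TO = map (Outp 0) [0..<length (ATgt G k)] \<rparr>"

lemma tarrow_simps [simp]: "TN (tarrow G k) = {0}" "TV (tarrow G k) x = k" "TD (tarrow G k) = ASrc G k"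
 "TI (tarrow G k) x = map Inp [0..<length (ASrc G k)]" "TO (tarrow G k) = map (Outp 0) [0..<length (ATgt G k)]"
 by (simp_all add: tarrow_def)

context fgm
begin

lemma tg_tarrow: "k:Arrows G ==> is_tg G (tarrow G k)" "tcod G (tarrow G k) = ATgt G k"
proof -
 assume k: "k:Arrows G"
 have "map (%i. ASrc G k ! i) [0..<length (ASrc G k)] = ASrc G k" by (rule map_nth)
 thus "is_tg G (tarrow G k)"
  using k fg unfolding is_tg_def
  by (auto simp: distinct_map inj_on_def ports_def inports_def outports_def free_graph_monoid_def o_def)
next
 show "tcod G (tarrow G k) = ATgt G k" by (simp add: tcod_def o_def map_nth)
qed

lemma arrow_diagram_cls:
 assumes k: "k:Arrows G"
 shows "is_adiagram G (arrow_diagram G k)" "icls (arrow_diagram G k) = cls G (tarrow G k)"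
proof -
 let ?n = "length (ASrc G k)" and ?m = "length (ATgt G k)"
 let ?D = "arrow_diagram G k :: (nat, nat, 's, 'a) adiagram"
 have s: "Nodes ?D = {0}" "Edges ?D = {..<?n + ?m}" "Src ?D = (%e. if e:{?n..<?n + ?m} then Some 0 else None)"
  "Tgt ?D = (%e. if e < ?n then Some 0 else None)" "Ins ?D 0 = [0..<?n]" "Outs ?D 0 = [?n..<?n + ?m]"
  "EVal ?D = (!) (ASrc G k @ ATgt G k)" "NVal ?D 0 = k" "DomL ?D = [0..<?n]" "CodL ?D = [?n..<?n + ?m]"
  by (auto simp: arrow_diagram_def anchor_def mk_diagram_def diagram.defs adiagram.defs Let_def)
 have l: "ASrc G k:lists (Letters G)" "ATgt G k:lists (Letters G)" using fg k by (auto simp: free_graph_monoid_def)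
 show v: "is_adiagram G ?D"
  unfolding is_adiagram_iff s
  using k l by (auto simp: s nth_append in_lists_conv_set intro!: nth_equalityI exI[of _ id])
 have p: "pt ?D e = (if e < ?n then Inp e else Outp 0 (e - ?n))" if "e < ?n + ?m" for e
 proof -
  have "idx [?n..<?n + ?m] e = e - ?n" if "\<not> e < ?n"
   using idx_nth[of "[?n..<?n + ?m]" "e - ?n"] that \<open>e < ?n + ?m\<close> by simp
  thus ?thesis using that by (auto simp: pt_def s)
 qed
 have "tgiso id (canon ?D) (tarrow G k)"
  using p by (auto simp: tgiso_def s dom_word_def nth_append intro!: nth_equalityI)
 hence "canon ?D \<simeq> tarrow G k" by (auto simp: tgeq_def)
 thus "icls ?D = cls G (tarrow G k)"
  using iso_class_cls[OF v] cls_eqI adiag.canon_tg[OF adiag.intro, OF v] by metis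
qed

lemma twire_idx:
 assumes "DC.pm L L'" "map lb L:Obj DC"
 shows "is_tg G (twire (map lb L) (map (idx L) L'))" "tcod G (twire (map lb L) (map (idx L) L')) = map lb L'"
proof -
 have pm: "distinct L" "distinct L'" "set L' = set L" using assms by (auto simp: DC.pm_def)
 show "is_tg G (twire (map lb L) (map (idx L) L'))"
  using pm assms(2) idx_inj[of L] idx_image[of L] by (intro tg_twire) (auto simp: DC_simps distinct_map)
 show "tcod G (twire (map lb L) (map (idx L) L')) = map lb L'"
  using pm by (auto simp: tcod_def)
qed

text \<open>With \<open>L\<close> split at \<open>a\<close>, the move to the front is the symmetry
  of the part before \<open>a\<close> with \<open>a\<close>, whiskered by the part after it; its
  wiring can be computed explicitly.\<close>

lemma fr_cls:
 assumes L: "distinct L" "a:set L" "map lb L:Obj DC"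
 shows "DC.fr lb a L = cls G (twire (map lb L) (map (idx L) (a # remove1 a L)))"
proof -
 obtain A B where s: "L = A @ a # B" "a ~: set A" using L(2) split_list_first by metis
 have o: "map lb A:lists (Letters G)" "map lb B:lists (Letters G)" "[lb a]:lists (Letters G)"
  using L(3) unfolding s DC_simps by simp_all
 have o': "map lb A:Obj DC" "map lb B:Obj DC" "lb a:Letters G" using o by (simp_all add: DC_simps)
 have "DC.fr lb a ((A @ [a]) @ B) = DC.fr lb a (A @ [a]) ##. Idn DC (map lb B)"
  by (rule DC.fr_append) (use o' in auto)
 also have "... = Sym DC (map lb A) [lb a] ##. Idn DC (map lb B)"
  using s(2) o' by (simp add: DC.fr_end)
 also have "... = cls G (tdu (tsym (map lb A) [lb a]) (tid (map lb B)))"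
  by (simp only: Sym_cls[OF o(1,3)] Idn_cls[OF o(2)] TArr_cls[OF tgs(4)[OF o(1,3)] tgs(3)[OF o(2)]])
 also have "... = cls G (twire (map lb L) (map (idx L) (a # remove1 a L)))"
 proof (rule cls_eqI[symmetric])
  have pm: "DC.pm L (a # remove1 a L)" using L by (auto simp: DC.pm_def)
  show "is_tg G (twire (map lb L) (map (idx L) (a # remove1 a L)))" by (rule twire_idx(1)[OF pm L(3)])
  have d: "distinct A" "distinct B" "set A Int set B = {}" "a ~: set B" using L(1) s by auto
  have "map (idx L) A = [0..<length A]" "map (idx L) B = map (%i. Suc (length A) + i) [0..<length B]"
   using d map_idx_self[of A] map_idx_self[of B] s unfolding s(1)
   by (auto simp: idx_append intro!: nth_equalityI) (auto simp: idx_def idx_nth[unfolded idx_def])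
  moreover have "remove1 a L = A @ B" using s by (simp add: remove1_append)
  moreover have "idx (a # B) a = 0" by (simp add: idx_def)
  hence "idx L a = length A" using s by (simp add: idx_append)
  ultimately have "map (idx L) (a # remove1 a L) = length A # [0..<length A] @ map (%i. Suc (length A) + i) [0..<length B]"
   by simp
  thus "twire (map lb L) (map (idx L) (a # remove1 a L)) \<simeq> tdu (tsym (map lb A) [lb a]) (tid (map lb B))"
   by (intro twire_eqI) (auto simp: tsym_def s(1))
 qed
 finally show ?thesis using s(1) by simp
qed

text \<open>Identifies the abstract permutations with diagrams without nodes, which are thereby
  generated by symmetries.\<close>

lemma perm_cls:
 assumes "DC.pm L L'" "map lb L:Obj DC"
 shows "DC.perm lb L L' = cls G (twire (map lb L) (map (idx L) L'))"
 using assms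
proof (induction L' arbitrary: L)
 case Nil
 thus ?case by (simp add: Idn_cls)
next
 case (Cons a M)
 note pm = DC.pm_Cons[OF Cons.prems(1)]
 have la: "lb a:Letters G" using DC.map_lists_mem[OF Cons.prems(2) pm(2)] .
 let ?R = "remove1 a L"
 have R: "map lb ?R:Obj DC" using Cons.prems(2) by simp
 have IH: "DC.perm lb ?R M = cls G (twire (map lb ?R) (map (idx ?R) M))"
  by (rule Cons.IH[OF pm(1) R])
 have pm2: "DC.pm L (a # ?R)" using pm by (auto simp: DC.pm_def)
 let ?T = "twire (map lb L) (map (idx L) (a # ?R))"
 let ?U = "tdu (tid [lb a]) (twire (map lb ?R) (map (idx ?R) M))"
 note t1 = twire_idx[OF pm2 Cons.prems(2)] note t2 = twire_idx[OF pm(1) R]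
 have la': "[lb a]:lists (Letters G)" using la by simp
 have tU: "is_tg G ?U" by (rule tgs(2)[OF tgs(3)[OF la'] t2(1)])
 have "DC.perm lb L (a # M) = cls G ?U **. cls G ?T"
  using IH fr_cls[OF pm(3,2) Cons.prems(2)] TArr_cls[OF tgs(3)[OF la'] t2(1)] Idn_cls[OF la'] by simp
 also have "... = cls G (tglue ?T ?U)" by (rule Cmp_cls[OF t1(1) tU]) (use t1(2) in simp)
 also have "... = cls G (twire (map lb L) (map (idx L) (a # M)))"
 proof (rule cls_eqI[symmetric])
  show "is_tg G (twire (map lb L) (map (idx L) (a # M)))" by (rule twire_idx(1)[OF Cons.prems])
  have "m:set ?R" if "m:set M" for m using that pm(1) by (auto simp: DC.pm_def simp del: set_remove1_eq)
  thus "twire (map lb L) (map (idx L) (a # M)) \<simeq> tglue ?T ?U"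
   by (intro twire_eqI) auto
 qed
 finally show ?case .
qed

definition topo :: "('n, 's, 'a) tg => 'n list => bool" where
 "topo T xs <-> distinct xs & set xs = TN T &
   (ALL ys x zs. xs = ys @ x # zs --> (ALL y j. Outp y j:set (TI T x) --> y:set ys))"

text \<open>Sorting by a rank function works although ranks may repeat, because dependencies raise
  the rank strictly.\<close>

lemma topo_ex:
 assumes T: "is_tg G T"
 shows "EX xs. topo T xs"
proof -
 obtain rk :: "_ => nat" where rk: "ALL x:TN T. ALL y j. Outp y j:set (TI T x) --> rk y < rk x"
  using tg_glob(5)[OF T] by blast
 obtain l where l: "set l = TN T" "distinct l" using finite_distinct_list[OF tg_glob(1)[OF T]] by blast
 define xs where "xs = sort_key rk l"
 have "y:set ys" if "xs = ys @ x # zs" "Outp y j:set (TI T x)" for ys x zs y j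
 proof -
  have sx: "set xs = TN T" using l by (simp add: xs_def)
  hence x: "x:TN T" unfolding that(1) by auto
  have y: "y:TN T" "rk y < rk x" using tg_Outp(1)[OF T x that(2)] rk x that(2) by blast+
  have "sorted (map rk xs)" by (simp add: xs_def)
  hence "ALL z:set zs. rk x <= rk z" using that(1) by (simp add: sorted_append)
  moreover have "y:set (ys @ x # zs)" using y sx unfolding that(1) by simp
  ultimately show ?thesis using y(2) by auto
 qed
 moreover have "distinct xs" "set xs = TN T" using l by (simp_all add: xs_def)
 ultimately have "topo T xs" unfolding topo_def by blast
 thus ?thesis ..
qed

text \<open>After a prefix \<open>ys\<close> of the order the live edges form the frontier of
  \<open>set ys\<close>; running the next node removes its inputs and adds its outputs.\<close>

lemma topo_go:
 assumes T: "is_tg G T" and "topo T xs"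
 shows "DC.go (TI T) (outports G T) (set (inports T)) xs (set (TO T))"
proof -
 have d: "distinct xs" and s: "set xs = TN T"
  and dep: "!!ys x zs y j. xs = ys @ x # zs ==> Outp y j:set (TI T x) ==> y:set ys"
  using assms(2) unfolding topo_def by blast+
 have nd: "used T (TN T) Int set (TO T) = {}" using tg_node(4)[OF T] by (auto simp: used_def)
 have "DC.go (TI T) (outports G T) (frontier T (set ys)) zs (set (TO T))"
  if "xs = ys @ zs" "used T (set ys) <= avail T (set ys)" for ys zs
  using that
 proof (induction zs arbitrary: ys)
  case Nil
  hence "set ys = TN T" using s by simp
  moreover have "avail T (TN T) = ports G T" by (auto simp: avail_def)
  ultimately have "frontier T (set ys) = ports G T - used T (TN T)" by (simp add: frontier_def)
  also have "... = set (TO T)" using tg_glob(4)[OF T] nd by blast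
  finally show ?case by simp
 next
  case (Cons x zs)
  have x: "x:TN T" "x ~: set ys" and ys: "set ys <= TN T" using Cons.prems(1) s d by auto
  have 1: "set (TI T x) <= avail T (set ys)"
   using dep[OF Cons.prems(1)] tg_ports(1)[OF T x(1)] by (auto simp: avail_def)
  have 2: "set (TI T x) Int used T (set ys) = {}"
   unfolding used_def using tg_node(5)[OF T x(1)] ys x(2) by blast
  have 3: "avail T (set (ys @ [x])) = avail T (set ys) Un set (outports G T x)"
  proof (intro set_eqI iffI)
   fix u assume "u:avail T (set (ys @ [x]))"
   thus "u:avail T (set ys) Un set (outports G T x)"
    by (cases u) (auto simp: avail_def outports_def)
  qed (use x in "auto simp: avail_def outports_def")
  have 4: "set (outports G T x) Int avail T (set ys) = {}" using x(2) by (auto simp: avail_def outports_def)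
  have 5: "used T (set (ys @ [x])) = used T (set ys) Un set (TI T x)" by (auto simp: used_def)
  have "DC.go (TI T) (outports G T) (frontier T (set (ys @ [x]))) zs (set (TO T))"
   by (rule Cons.IH) (use Cons.prems 1 3 5 in auto)
  moreover have "frontier T (set (ys @ [x])) = set (outports G T x) Un (frontier T (set ys) - set (TI T x))"
   unfolding frontier_def 3 5 using 1 2 4 Cons.prems(2) by blast
  ultimately show ?case using 1 2 by (auto simp: frontier_def)
 qed
 from this[of "[]" xs] have "DC.go (TI T) (outports G T) (frontier T {}) xs (set (TO T))" by (simp add: used_def)
 moreover have "frontier T {} = set (inports T)"
  by (auto simp: frontier_def avail_def used_def inports_def ports_def outports_def)
 ultimately show ?thesis by simp
qed

end

section \<open>Interpretation of diagrams\<close>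

lemma (in strict_smc) perm_induct:
 assumes id: "!!u. u:Obj C ==> Q (Idn C u)" and sym: "!!u v. u:Obj C ==> v:Obj C ==> Q (Sym C u v)"
  and cmp: "!!g h. g:Arr C ==> h:Arr C ==> Cod C g = Dom C h ==> Q g ==> Q h ==> Q (h ** g)"
  and ten: "!!g h. g:Arr C ==> h:Arr C ==> Q g ==> Q h ==> Q (g ## h)"
  and L: "pm L L'" "map lb L:Obj C"
 shows "Q (perm lb L L')"
proof -
 have fr: "Q (fr lb a L)" if "a:set L" "map lb L:Obj C" for a L
  using that
 proof (induction L)
  case (Cons b L)
  thus ?case using map_lists_mem[OF Cons.prems(2,1)] by (auto intro!: cmp ten id sym)
 qed simp
 show ?thesis using L
 proof (induction L' arbitrary: L)
  case Nil
  thus ?case by (simp add: id)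
 next
  case (Cons a M)
  note pm = pm_Cons[OF Cons.prems(1)]
  show ?case using pm Cons map_lists_mem[OF Cons.prems(2) pm(2)] fr by (auto intro!: cmp ten id)
 qed
qed

text \<open>An evaluation is built from identities, symmetries and node values by composition and
  products. Applied to the diagram category this becomes induction over generators.\<close>

lemma (in strict_smc) ev_induct:
 assumes id: "!!u. u:Obj C ==> Q (Idn C u)" and sym: "!!u v. u:Obj C ==> v:Obj C ==> Q (Sym C u v)"
  and cmp: "!!g h. g:Arr C ==> h:Arr C ==> Cod C g = Dom C h ==> Q g ==> Q h ==> Q (h ** g)"
  and ten: "!!g h. g:Arr C ==> h:Arr C ==> Q g ==> Q h ==> Q (g ## h)"
  and fm: "!!x. x:set xs ==> Q (fm x)" and r: "runs lb ins ots fm L xs out"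
 shows "Q (ev lb ins ots fm L xs out)"
 using fm r
proof (induction xs arbitrary: L)
 case Nil
 thus ?case using perm_induct[of Q L out lb] assms(1-4) by simp
next
 case (Cons x xs)
 note st = runs_step[OF Cons.prems(2)]
 have "Q (perm lb L (ins x @ rem L (ins x)))" using st by (intro perm_induct[of Q] id sym cmp ten) auto
 moreover have "Q (ev lb ins ots fm (ots x @ rem L (ins x)) xs out)" using Cons st by simp
 moreover have "Q (fm x)" using Cons.prems by simp
 ultimately show ?case using st by (auto intro!: cmp ten id)
qed

locale interp = fgm G + M: strict_smc M "Letters G"
 for G :: "('s, 'a, 'z) graph_monoid_scheme" and M :: "('s list, 'm, 'y) sym_cat_scheme" (structure) +
 fixes f :: "'a => 'm"
 assumes f_arr: "k:Arrows G ==> f k:Arr M" "k:Arrows G ==> Dom M (f k) = ASrc G k"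
  "k:Arrows G ==> Cod M (f k) = ATgt G k"
begin

abbreviation "evL T == M.ev (pl T) (TI T) (outports G T) (%x. f (TV T x))"
abbreviation "runsL T == M.runs (pl T) (TI T) (outports G T) (%x. f (TV T x))"
abbreviation "evT T xs == evL T (inports T) xs (TO T)"
abbreviation "runsT T xs == runsL T (inports T) xs (TO T)"

lemma MObj: "Obj M = lists (Letters G)"
 by (rule M.Obj_eq)

lemma map_pl_inports: "map (pl T) (inports T) = TD T"
 by (simp add: inports_def o_def map_nth)

lemma map_pl_outports: "map (pl T) (outports G T x) = ATgt G (TV T x)"
 by (simp add: outports_def o_def map_nth)

lemma distinct_ports: "distinct xs ==> distinct (inports T @ concat (map (outports G T) xs))"
proof -
 assume "distinct xs"
 hence "distinct (concat (map (outports G T) xs))"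
  by (induction xs) (auto simp: outports_def distinct_map inj_on_def)
 thus ?thesis by (auto simp: inports_def outports_def distinct_map inj_on_def)
qed

lemma set_ports: "set xs <= TN T ==> set (inports T) Un set (concat (map (outports G T) xs)) <= ports G T"
 by (auto simp: ports_def)

lemma nodes_okT: "is_tg G T ==> N <= TN T ==> M.nodes_ok (pl T) (TI T) (outports G T) (%x. f (TV T x)) N"
 unfolding M.nodes_ok_def using tg_node(1-3)[of T] f_arr by (auto simp: map_pl_outports)

lemma runs_topo:
 assumes "is_tg G T" "topo T xs"
 shows "runsT T xs"
 unfolding M.runs_def using distinct_ports[of xs T] topo_go[OF assms] nodes_okT[OF assms(1), of "set xs"] assms
  tg_glob(3)[OF assms(1)] TD_lists[OF assms(1)]
 by (simp add: topo_def map_pl_inports MObj)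

text \<open>The choices of a representative and of a topological order are immaterial by
  \<open>phi_eq\<close>.\<close>

definition phi :: "('s, 'a) iso_class => 'm" where
 "phi A = (let T = (SOME T :: (nat, 's, 'a) tg. is_tg G T & cls G T = A) in evT T (SOME xs. topo T xs))"

text \<open>An isomorphism to the chosen representative renames ports and nodes, which
  \<open>ev_rename\<close> permits, and \<open>ev_order\<close> compares the transported order with
  the chosen one. Hence \<open>phi\<close> may be computed from any representative and any order
  that runs.\<close>

lemma phi_eq:
 fixes T :: "('n, 's, 'a) tg"
 assumes T: "is_tg G T" and xs: "runsT T xs" "distinct xs" "set xs = TN T"
 shows "phi (cls G T) = evT T xs"
proof -
 define T0 where "T0 = (SOME T' :: (nat, 's, 'a) tg. is_tg G T' & cls G T' = cls G T)"
 obtain T' :: "(nat, 's, 'a) tg" where "is_tg G T'" "cls G T' = cls G T" using ArrE[OF Arr_cls[OF T]] by metis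
 hence T0: "is_tg G T0 & cls G T0 = cls G T" unfolding T0_def by (metis (mono_tags, lifting) someI)
 define xs0 where "xs0 = (SOME xs. topo T0 xs)"
 have xs0: "topo T0 xs0" unfolding xs0_def using topo_ex T0 by (metis someI)
 obtain p where i: "tgiso p T T0" using cls_eqD[of G T T0] T T0 fg by (auto simp: tgeq_def)
 have b: "bij_betw p (TN T) (TN T0)" using i by (simp add: tgiso_def)
 let ?q = "mpt p"
 have inp: "map ?q (inports T) = inports T0" using i by (simp add: tgiso_def inports_def)
 have outp: "map ?q (outports G T x) = outports G T0 (p x)" if "x:TN T" for x using i that by (simp add: tgiso_def outports_def)
 have to: "map ?q (TO T) = TO T0" using i by (simp add: tgiso_def)
 have sp: "set (inports T) Un set (concat (map (outports G T) xs)) <= ports G T" by (rule set_ports) (simp add: xs)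
 have "runsL T0 (map ?q (inports T)) (map p xs) (map ?q (TO T)) &
  evL T0 (map ?q (inports T)) (map p xs) (map ?q (TO T)) = evT T xs"
 proof (rule M.ev_rename[OF xs(1)])
  show "inj_on ?q (set (inports T) Un set (concat (map (outports G T) xs)))"
   using ports_iso[OF i, of G] by (intro inj_on_subset[OF _ sp]) (simp add: bij_betw_def)
  show "inj_on p (set xs)" using b xs(3) by (simp add: bij_betw_def)
  show "ALL e:set (inports T) Un set (concat (map (outports G T) xs)). pl T0 (?q e) = pl T e"
   using sp plab_iso[OF i, of _ G] by blast
  show "ALL x:set xs. TI T0 (p x) = map ?q (TI T x) & outports G T0 (p x) = map ?q (outports G T x) & f (TV T0 (p x)) = f (TV T x)"
   using xs(3) i outp by (simp add: tgiso_def)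
 qed
 hence r: "runsT T0 (map p xs)" "evT T0 (map p xs) = evT T xs" by (simp_all add: inp to)
 have "evT T0 xs0 = evT T0 (map p xs)"
  by (rule M.ev_order[OF runs_topo[OF conjunct1[OF T0] xs0] r(1)])
   (use xs0 b xs in "auto simp: topo_def distinct_map bij_betw_def")
 thus ?thesis using r(2) by (simp add: phi_def Let_def T0_def[symmetric] xs0_def[symmetric])
qed

lemma phi_topo: "is_tg G T ==> topo T xs ==> phi (cls G T) = evT T xs"
 by (rule phi_eq) (auto simp: runs_topo topo_def)

lemma phi_arr [simp]:
 assumes "A:Arr DC"
 shows "phi A:Arr M" "Dom M (phi A) = Dom DC A" "Cod M (phi A) = Cod DC A"
proof -
 obtain T :: "(nat, 's, 'a) tg" where T: "is_tg G T" "A = cls G T" using assms by (rule ArrE)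
 obtain xs where xs: "topo T xs" using topo_ex[OF T(1)] by blast
 note r = runs_topo[OF T(1) xs]
 show "phi A:Arr M" "Dom M (phi A) = Dom DC A" "Cod M (phi A) = Cod DC A"
  using M.ev_arr[OF r] phi_topo[OF T(1) xs] T by (simp_all add: map_pl_inports tcod_def)
qed

lemma topo_of:
 assumes "is_tg G T" obtains xs where "runsT T xs" "distinct xs" "set xs = TN T" "phi (cls G T) = evT T xs"
proof -
 obtain xs where xs: "topo T xs" using topo_ex[OF assms] by blast
 show thesis by (rule that[OF runs_topo[OF assms xs] _ _ phi_topo[OF assms xs]]) (use xs in "simp_all add: topo_def")
qed

lemma phi_cmp:
 assumes "A:Arr DC" "B:Arr DC" "Cod DC A = Dom DC B"
 shows "phi (B **. A) = phi B ** phi A"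
proof -
 obtain T :: "(nat, 's, 'a) tg" where T: "is_tg G T" "A = cls G T" using assms(1) by (rule ArrE)
 obtain U :: "(nat, 's, 'a) tg" where U: "is_tg G U" "B = cls G U" using assms(2) by (rule ArrE)
 have w: "tcod G T = TD U" using assms(3) T U by simp
 have len: "length (TO T) = length (TD U)" using arg_cong[OF w, of length] by (simp add: length_tcod)
 let ?V = "tglue T U"
 have V: "is_tg G ?V" by (rule tgs(1)[OF T(1) U(1) w])
 obtain xs where xs: "runsT T xs" "distinct xs" "set xs = TN T" "phi A = evT T xs" using topo_of[OF T(1)] T(2) by metis
 obtain ys where ys: "runsT U ys" "distinct ys" "set ys = TN U" "phi B = evT U ys" using topo_of[OF U(1)] U(2) by metis
 have spT: "set (inports T) Un set (concat (map (outports G T) xs)) <= ports G T" by (rule set_ports) (simp add: xs)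
 have spU: "set (inports U) Un set (concat (map (outports G U) ys)) <= ports G U" by (rule set_ports) (simp add: ys)
 let ?l = "mpt Inl :: nat port => (nat + nat) port" and ?g = "glue_port (TO T) :: nat port => (nat + nat) port"
 have inT: "map ?l (inports T) = inports ?V" by (simp add: inports_def)
 have pll: "pl ?V (?l u) = pl T u" for u by (cases u) auto
 have r1: "runsL ?V (map ?l (inports T)) (map Inl xs) (map ?l (TO T)) &
  evL ?V (map ?l (inports T)) (map Inl xs) (map ?l (TO T)) = evT T xs"
 proof (rule M.ev_rename[OF xs(1)])
  show "inj_on ?l (set (inports T) Un set (concat (map (outports G T) xs)))"
   by (rule inj_on_subset[OF port.inj_map]) auto
 qed (auto simp: pll outports_def)
 \<comment> \<open>After gluing, the frontier left by \<open>T\<close> is the one at which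
   \<open>U\<close> starts, so \<open>ev_append\<close> can join the two runs.\<close>
 have inU: "map ?g (inports U) = map ?l (TO T)"
  by (auto simp: inports_def len intro!: nth_equalityI)
 have ginj: "inj_on ?g (ports G U)"
 proof (rule inj_onI)
  fix u v assume uv: "u:ports G U" "v:ports G U" "?g u = ?g v"
  have inj: "?l a = ?l b <-> a = b" for a b :: "nat port" using port.inj_map[of Inl] by (auto simp: inj_def)
  have no: "?l a ~= Outp (Inr y) j" for a :: "nat port" and y :: nat and j by (cases a) auto
  show "u = v" using uv len tg_glob(3)[OF T(1)] no no[symmetric]
   by (cases u; cases v) (auto simp: inj nth_eq_iff_index_eq)
 qed
 have plg: "pl ?V (?g u) = pl U u" if "u:ports G U" for u
 proof (cases u)
  case (Inp i)
  hence "i < length (TO T)" using that len by simp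
  thus ?thesis using Inp tcod_nth[of i T G] w by (simp add: pll)
 qed simp
 have r2: "runsL ?V (map ?g (inports U)) (map Inr ys) (map ?g (TO U)) &
  evL ?V (map ?g (inports U)) (map Inr ys) (map ?g (TO U)) = evT U ys"
 proof (rule M.ev_rename[OF ys(1)])
  show "inj_on ?g (set (inports U) Un set (concat (map (outports G U) ys)))"
   using ginj spU by (rule inj_on_subset)
  show "ALL e:set (inports U) Un set (concat (map (outports G U) ys)). pl ?V (?g e) = pl U e"
   using spU plg by blast
 qed (auto simp: outports_def)
 have d: "distinct (map Inl xs @ map Inr ys)" using xs ys by (auto simp: distinct_map)
 have R: "runsL ?V (map ?l (inports T)) (map Inl xs @ map Inr ys) (map ?g (TO U)) &
   evL ?V (map ?l (inports T)) (map Inl xs @ map Inr ys) (map ?g (TO U)) = evT U ys ** evT T xs"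
  using M.ev_append[OF conjunct1[OF r1], of "map Inr ys" "map ?g (TO U)"] r1 r2 distinct_ports[OF d, of ?V]
  unfolding inU inT by simp
 have "phi (cls G ?V) = evT ?V (map Inl xs @ map Inr ys)"
  by (rule phi_eq[OF V]) (use R d xs ys in "auto simp: inT")
 thus ?thesis using R xs(4) ys(4) T U Cmp_cls[OF T(1) U(1) w] by (simp add: inT)
qed

text \<open>All nodes of \<open>T\<close> run before those of \<open>U\<close>, with the wires of
  the other graph idle; interchange combines the two whiskered runs.\<close>

lemma phi_ten:
 assumes "A:Arr DC" "B:Arr DC"
 shows "phi (A ##. B) = phi A ## phi B"
proof -
 obtain T :: "(nat, 's, 'a) tg" where T: "is_tg G T" "A = cls G T" using assms(1) by (rule ArrE)
 obtain U :: "(nat, 's, 'a) tg" where U: "is_tg G U" "B = cls G U" using assms(2) by (rule ArrE)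
 let ?V = "tdu T U"
 have V: "is_tg G ?V" by (rule tgs(2)[OF T(1) U(1)])
 obtain xs where xs: "runsT T xs" "distinct xs" "set xs = TN T" "phi A = evT T xs" using topo_of[OF T(1)] T(2) by metis
 obtain ys where ys: "runsT U ys" "distinct ys" "set ys = TN U" "phi B = evT U ys" using topo_of[OF U(1)] U(2) by metis
 have spT: "set (inports T) Un set (concat (map (outports G T) xs)) <= ports G T" by (rule set_ports) (simp add: xs)
 let ?l = "mpt Inl :: nat port => (nat + nat) port" and ?s = "shift (length (TD T)) :: nat port => (nat + nat) port"
 let ?L1 = "map ?l (inports T)" and ?L2 = "map ?s (inports U)" and ?O1 = "map ?l (TO T)" and ?O2 = "map ?s (TO U)"
 have inV: "inports ?V = ?L1 @ ?L2"
  by (auto simp: inports_def intro!: nth_equalityI simp: nth_append)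
 have pll: "pl ?V (?l u) = pl T u" if "u:ports G T" for u using that by (cases u) (auto simp: nth_append)
 have pls: "pl ?V (?s u) = pl U u" for u by (cases u) (auto simp: nth_append)
 have r1: "runsL ?V ?L1 (map Inl xs) ?O1 & evL ?V ?L1 (map Inl xs) ?O1 = evT T xs"
 proof (rule M.ev_rename[OF xs(1)])
  show "inj_on ?l (set (inports T) Un set (concat (map (outports G T) xs)))"
   by (rule inj_on_subset[OF port.inj_map]) auto
  show "ALL e:set (inports T) Un set (concat (map (outports G T) xs)). pl ?V (?l e) = pl T e"
   using spT pll by blast
 qed (auto simp: outports_def)
 have sinj: "inj ?s"
 proof (rule injI)
  fix u v :: "nat port" assume "?s u = (?s v :: (nat + nat) port)"
  thus "u = v" by (cases u; cases v) auto
 qed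
 have r2: "runsL ?V ?L2 (map Inr ys) ?O2 & evL ?V ?L2 (map Inr ys) ?O2 = evT U ys"
  by (rule M.ev_rename[OF ys(1)]) (auto simp: pls outports_def intro: inj_on_subset[OF sinj])
 have d: "distinct (map Inl xs @ map Inr ys)" using xs ys by (auto simp: distinct_map)
 note D = distinct_ports[OF d, of ?V, unfolded inV]
 have o1: "set ?O1 <= set ?L1 Un set (concat (map (outports G ?V) (map Inl xs)))"
 proof -
  have "set (TO T) <= ports G T" by (rule tg_ports(2)[OF T(1)])
  moreover have "?l ` ports G T <= set ?L1 Un set (concat (map (outports G ?V) (map Inl xs)))"
   using xs(3) by (auto simp: ports_def outports_def)
  ultimately show ?thesis by auto
 qed
 have mO: "map (pl ?V) ?L2:Obj M" "map (pl ?V) ?O1:Obj M"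
  using M.runs_distinct(2)[OF conjunct1[OF r2]] M.ev_arr(3)[OF conjunct1[OF r1]] M.ev_arr(1)[OF conjunct1[OF r1]] M.cod_obj
  by metis+
 have a: "runsL ?V (?L1 @ ?L2) (map Inl xs) (?O1 @ ?L2) & evL ?V (?L1 @ ?L2) (map Inl xs) (?O1 @ ?L2) = evT T xs ## Idn M (map (pl ?V) ?L2)"
 proof -
  have "distinct (?L1 @ concat (map (outports G ?V) (map Inl xs)) @ ?L2)"
   using D unfolding map_append concat_append distinct_append set_append by blast
  from M.ev_tensor_right[OF conjunct1[OF r1] this mO(1)] show ?thesis using r1 by simp
 qed
 have dO1: "distinct ?O1" using r1 by (simp add: M.runs_def)
 have b: "runsL ?V (?O1 @ ?L2) (map Inr ys) (?O1 @ ?O2) & evL ?V (?O1 @ ?L2) (map Inr ys) (?O1 @ ?O2) = Idn M (map (pl ?V) ?O1) ## evT U ys"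
 proof -
  have "distinct (?L2 @ concat (map (outports G ?V) (map Inr ys)) @ ?O1)"
   using D dO1 o1 unfolding map_append concat_append distinct_append set_append by blast
  from M.ev_tensor_left[OF conjunct1[OF r2] this mO(2)] show ?thesis using r2 by simp
 qed
 have R: "runsL ?V (inports ?V) (map Inl xs @ map Inr ys) (?O1 @ ?O2) &
   evL ?V (inports ?V) (map Inl xs @ map Inr ys) (?O1 @ ?O2) =
   (Idn M (map (pl ?V) ?O1) ## evT U ys) ** (evT T xs ## Idn M (map (pl ?V) ?L2))"
  using M.ev_append[OF conjunct1[OF a] conjunct1[OF b]] a b D by (simp add: inV)
 have "phi (cls G ?V) = evT ?V (map Inl xs @ map Inr ys)"
  by (rule phi_eq[OF V]) (use R d xs ys in auto)
 also have "... = phi A ## phi B"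
 proof -
  have "phi A:Arr M" "phi B:Arr M" using assms by simp_all
  moreover have "Cod M (evT T xs) = map (pl ?V) ?O1" "Dom M (evT U ys) = map (pl ?V) ?L2"
   using M.ev_arr[OF conjunct1[OF r1]] M.ev_arr[OF conjunct1[OF r2]] r1 r2 by metis+
  ultimately show ?thesis using R M.slide(2)[of "phi A" "phi B"] xs(4) ys(4) by simp
 qed
 finally show ?thesis using T U TArr_cls[OF T(1) U(1)] by simp
qed

lemma phi_sym:
 assumes "u:Obj DC" "v:Obj DC"
 shows "phi (Sym DC u v) = Sym M u v"
proof -
 have uv: "u:lists (Letters G)" "v:lists (Letters G)" using assms by (simp_all add: DC_simps)
 let ?T = "tsym u v :: (nat, 's, 'a) tg"
 let ?A = "map Inp [0..<length u] :: nat port list" and ?B = "map Inp [length u..<length u + length v] :: nat port list"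
 have i: "inports ?T = ?A @ ?B" "TO ?T = ?B @ ?A"
  using upt_add_eq_append[of 0 "length u" "length v"] by (simp_all add: inports_def tsym_def)
 have l: "map (pl ?T) ?A = u" "map (pl ?T) ?B = v" by (auto intro!: nth_equalityI simp: nth_append)
 have d: "distinct (?A @ ?B)" by (auto simp: distinct_map inj_on_def)
 have ob: "u:Obj M" "v:Obj M" using uv by (simp_all add: MObj)
 have r: "runsT ?T []" using d ob by (auto simp: i l M.pm_def simp del: map_map)
 have "phi (cls G ?T) = evT ?T []" by (rule phi_eq[OF tgs(4)[OF uv] r]) auto
 also have "... = M.perm (pl ?T) (?A @ ?B) (?B @ ?A)" by (simp add: i)
 also have "... = Sym M u v" using M.perm_sym[OF d, of "pl ?T"] ob by (simp add: l del: map_map)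
 finally show ?thesis using uv by (simp add: Sym_cls)
qed

text \<open>The identity is read as a symmetry with the empty word.\<close>

lemma phi_idn: assumes "u:Obj DC" shows "phi (Idn DC u) = Idn M u"
proof -
 have "u:Obj M" using assms by (simp add: MObj DC_simps(1))
 thus ?thesis using phi_sym[OF assms, of "[]"] DC.sym_unit_right[OF assms] M.sym_unit_right[of u] by simp
qed

lemma phi_arrow:
 assumes k: "k:Arrows G"
 shows "phi (cls G (tarrow G k)) = f k"
proof -
 let ?T = "tarrow G k"
 have T: "is_tg G ?T" by (rule tg_tarrow(1)[OF k])
 have tp: "topo ?T [0]" by (auto simp: topo_def Cons_eq_append_conv)
 have i: "TI ?T 0 = inports ?T" "outports G ?T 0 = TO ?T" by (auto simp: inports_def outports_def)
 note r = runs_topo[OF T tp]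
 note st = M.runs_step[OF r]
 have io: "inports ?T @ M.rem (inports ?T) (inports ?T) = inports ?T" by simp
 have d: "distinct (TO ?T)" using tg_glob(3)[OF T] .
 have o: "map (pl ?T) (TO ?T):Obj M" "map (pl ?T) (inports ?T):Obj M" using st by (simp_all only: i)
 have "evT ?T [0] = Idn M (ATgt G k) ** (f k ## Idn M []) ** Idn M (ASrc G k)"
  using st d o tg_tarrow(2)[of k] map_pl_inports[of ?T] unfolding M.ev.simps i
  by (simp add: M.perm_id tcod_def del: tarrow_simps(4,5) map_map)
 also have "... = f k" using f_arr[OF k] by simp
 finally show ?thesis using phi_topo[OF T tp] by simp
qed

end

section \<open>Generation by the arrows of the graph monoid\<close>

context fgm
begin

abbreviation "gen k == cls G (tarrow G k)"

lemma gen_arr: "k:Arrows G ==> gen k:Arr DC" "k:Arrows G ==> Dom DC (gen k) = ASrc G k"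
 "k:Arrows G ==> Cod DC (gen k) = ATgt G k"
 using tg_tarrow Arr_cls by auto

lemma wire_cls:
 assumes T: "is_tg G T" and N: "TN T = {}"
 shows "cls G T = DC.perm (pl T) (inports T) (TO T)" "DC.pm (inports T) (TO T)" "map (pl T) (inports T) = TD T"
proof -
 have sp: "set (inports T) = set (TO T)" using tg_glob(4)[OF T] N by (simp add: used_def ports_def)
 show pm: "DC.pm (inports T) (TO T)"
  using sp tg_glob(3)[OF T] by (auto simp: DC.pm_def inports_def distinct_map inj_on_def)
 show l: "map (pl T) (inports T) = TD T" by (simp add: inports_def o_def map_nth)
 have ob: "map (pl T) (inports T):Obj DC" using TD_lists[OF T] by (simp add: l DC_simps(1))
 have "idx (inports T) (Inp i) = i" if "i < length (TD T)" for i
  using idx_map[of Inp "[0..<length (TD T)]" i] that by (auto simp: inports_def inj_on_def)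
 hence "TO T = map Inp (map (idx (inports T)) (TO T))"
  by (auto simp: sp[symmetric] inports_def intro!: map_idI[symmetric])
 hence "twire (TD T) (map (idx (inports T)) (TO T)) \<simeq> T" by (intro twire_eqI N refl)
 hence "cls G (twire (TD T) (map (idx (inports T)) (TO T))) = cls G T"
  using twire_idx(1)[OF pm ob] by (intro cls_eqI) (simp_all only: l)
 thus "cls G T = DC.perm (pl T) (inports T) (TO T)" using perm_cls[OF pm ob] by (simp only: l)
qed

lemma frontier_empty: "frontier T {} = set (inports T)"
 by (auto simp: frontier_def avail_def used_def inports_def ports_def outports_def)

lemma ctx_cls:
 fixes T :: "('n1, 's, 'a) tg" and X :: "('n2, 's, 'a) tg" and U :: "('n3, 's, 'a) tg"
 assumes "is_tg G T" "is_tg G X" "is_tg G U" "w:lists (Letters G)" "tcod G T = TD X @ w" "tcod G X @ w = TD U"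
 shows "is_tg G (ctx T X w U)" "cls G (ctx T X w U) = cls G U **. (cls G X ##. Idn DC w) **. cls G T"
proof -
 note tw = tgs(3)[OF assms(4)]
 note m = tgs(2)[OF assms(2) tw]
 have c: "tcod G (tdu X (tid w)) = TD U" using tcod_tdu[OF assms(2) tw] assms(6) by simp
 have t: "is_tg G (tglue T (tdu X (tid w)))" "tcod G (tglue T (tdu X (tid w))) = TD U"
  using tgs(1)[OF assms(1) m] tcod_tglue[OF assms(1) m] assms(5) c by simp_all
 show "is_tg G (ctx T X w U)" unfolding ctx_def by (rule tgs(1)[OF t(1) assms(3) t(2)])
 have "cls G (ctx T X w U) = cls G U **. cls G (tglue T (tdu X (tid w)))"
  unfolding ctx_def by (rule Cmp_cls[OF t(1) assms(3) t(2), symmetric])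
 also have "cls G (tglue T (tdu X (tid w))) = (cls G X ##. Idn DC w) **. cls G T"
  using Cmp_cls[OF assms(1) m] assms(5) TArr_cls[OF assms(2) tw] Idn_cls[OF assms(4)] by simp
 finally show "cls G (ctx T X w U) = cls G U **. (cls G X ##. Idn DC w) **. cls G T" .
qed

lemma self_interp: "interp G DC gen"
 by unfold_locales (simp_all add: gen_arr)

text \<open>Interpreting diagrams in their own category gives each diagram back, which is generation
  by the arrows of \<open>G\<close>. The first node of the order is split off by
  \<open>decomp\<close> with no nodes below it; the graph above is evaluated by the induction
  hypothesis, with ports renamed by \<open>ix\<close>.\<close>

lemma self_ev:
 fixes T :: "('n, 's, 'a) tg"
 assumes "is_tg G T" "DC.runs (pl T) (TI T) (outports G T) (%x. gen (TV T x)) (inports T) xs (TO T)"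
  "distinct xs" "set xs = TN T"
 shows "cls G T = DC.ev (pl T) (TI T) (outports G T) (%x. gen (TV T x)) (inports T) xs (TO T)"
 using assms
proof (induction xs arbitrary: T)
 case Nil
 thus ?case using wire_cls(1)[of T] by simp
next
 case (Cons x xs)
 note T = Cons.prems(1)
 note st = DC.runs_step[OF Cons.prems(2)]
 let ?k = "TV T x" let ?X = "tarrow G ?k"
 have x: "x:TN T" using Cons.prems(4) by auto
 have k: "?k:Arrows G" by (rule tg_node(1)[OF T x])
 note X = tg_tarrow(1)[OF k]
 let ?p = "%_::nat. x"
 define W where "W = DC.rem (inports T) (TI T x)"
 define L2 where "L2 = outports G T x @ W"
 have d0: "down T {}" by (simp add: down_def used_def)
 have dx: "down T ({} Un ?p ` TN ?X)"
  using st(12) x by (auto simp: down_def used_def avail_def inports_def)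
 have fr: "set (TI T x @ W) = frontier T {}" using st(12) by (auto simp: W_def frontier_empty)
 have dL: "distinct (TI T x @ W)" using st(3) by (simp add: DC.pm_def W_def)
 have I: "map (pl T) (TI T x) = TD ?X" using tg_node(3)[OF T x] by simp
 have len: "length (TI T x) = length (ASrc G ?k)" using arg_cong[OF I, of length] by simp
 have e: "TI T (?p y) = map (emb ?p (TI T x)) (TI ?X y) & TV T (?p y) = TV ?X y" if "y:TN ?X" for y
  using len by (auto intro!: nth_equalityI)
 have p: "inj_on ?p (TN ?X)" "{} Int ?p ` TN ?X = {}" by auto
 have J: "map (emb ?p (TI T x)) (TO ?X) = outports G T x" by (simp add: outports_def)
 have AB: "{} Un ?p ` TN ?X = {x}" by simp
 note dc = decomp[OF T X d0 dx p dL fr I e, unfolded J AB]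
 let ?lo = "lowT T {} (TI T x @ W)" let ?hi = "highT T (TN T - {x}) L2"
 have lo: "is_tg G ?lo" "tcod G ?lo = map (pl T) (TI T x @ W)" by (rule tg_low[OF T d0 dL fr])+
 have dL2: "distinct L2" and fL2: "set L2 = frontier T {x}" using dc(2,3) by (simp_all add: L2_def)
 have hi: "is_tg G ?hi" "tcod G ?hi = tcod G T"
  by (rule tg_high[OF T dx[unfolded AB] dL2 fL2])+
 have w: "map (pl T) W:lists (Letters G)" using st(11) by (simp add: W_def DC_simps(1))
 have c1: "tcod G ?lo = TD ?X @ map (pl T) W" using lo(2) I by simp
 have c2: "tcod G ?X @ map (pl T) W = TD ?hi" using dc(4) by (simp add: L2_def)
 note cx = ctx_cls[OF lo(1) X hi(1) w c1 c2]
 have "ctx ?lo ?X (map (pl T) W) ?hi \<simeq> T" using dc(1) unfolding L2_def tgeq_def by blast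
 hence "cls G T = cls G (ctx ?lo ?X (map (pl T) W) ?hi)" by (rule cls_eqI[OF _ cx(1), symmetric])
 also have "... = cls G ?hi **. (gen ?k ##. Idn DC (map (pl T) W)) **. cls G ?lo" by (rule cx(2))
 also have "cls G ?lo = DC.perm (pl T) (inports T) (TI T x @ W)"
  using wire_cls(1)[OF lo(1)] by (simp add: inports_def)
 also have "cls G ?hi = DC.ev (pl T) (TI T) (outports G T) (%x. gen (TV T x)) L2 xs (TO T)"
 proof -
  let ?q = "ix L2"
  have xs: "set xs = TN T - {x}" "distinct xs" using Cons.prems(3,4) by auto
  have no: "Outp y j ~: set L2" if "y:set xs" for y j
   using that xs by (auto simp: L2_def W_def outports_def inports_def)
  have os: "map ?q (outports G T y) = outports G T y" if "y:set xs" for y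
   using no[OF that] by (auto simp: outports_def ix_def)
  have inp: "map ?q L2 = inports ?hi" using map_idx_self[OF dL2] dL2
   by (auto simp: inports_def ix_def intro!: nth_equalityI)
  have plh: "pl ?hi (?q u) = pl T u" if "u:set L2 Un set (concat (map (outports G T) xs))" for u
   using that no by (auto simp: ix_def outports_def)
  have "DC.runs (pl ?hi) (TI ?hi) (outports G ?hi) (%x. gen (TV ?hi x)) (map ?q L2) (map id xs) (map ?q (TO T)) &
   DC.ev (pl ?hi) (TI ?hi) (outports G ?hi) (%x. gen (TV ?hi x)) (map ?q L2) (map id xs) (map ?q (TO T)) =
   DC.ev (pl T) (TI T) (outports G T) (%x. gen (TV T x)) L2 xs (TO T)"
  proof (rule DC.ev_rename)
   show "DC.runs (pl T) (TI T) (outports G T) (%x. gen (TV T x)) L2 xs (TO T)" using st(4) by (simp add: L2_def W_def)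
   show "inj_on ?q (set L2 Un set (concat (map (outports G T) xs)))"
    by (rule inj_on_subset[OF ix_inj]) (auto simp: outports_def)
   show "ALL e:set L2 Un set (concat (map (outports G T) xs)). pl ?hi (?q e) = pl T e" using plh by blast
   show "ALL y:set xs. TI ?hi (id y) = map ?q (TI T y) & outports G ?hi (id y) = map ?q (outports G T y) &
     gen (TV ?hi (id y)) = gen (TV T y)"
    using os by (simp add: outports_def)
  qed simp
  hence r: "DC.runs (pl ?hi) (TI ?hi) (outports G ?hi) (%x. gen (TV ?hi x)) (inports ?hi) xs (TO ?hi)"
   and ee: "DC.ev (pl ?hi) (TI ?hi) (outports G ?hi) (%x. gen (TV ?hi x)) (inports ?hi) xs (TO ?hi) =
    DC.ev (pl T) (TI T) (outports G T) (%x. gen (TV T x)) L2 xs (TO T)"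
   by (simp_all add: inp)
  have "cls G ?hi = DC.ev (pl ?hi) (TI ?hi) (outports G ?hi) (%x. gen (TV ?hi x)) (inports ?hi) xs (TO ?hi)"
   by (rule Cons.IH[OF hi(1) r xs(2)]) (simp add: xs(1))
  thus ?thesis unfolding ee .
 qed
 finally show ?case by (simp add: L2_def W_def)
qed

theorem gen_induct:
 assumes "A:Arr DC" and id: "!!u. u:Obj DC ==> Q (Idn DC u)"
  and sym: "!!u v. u:Obj DC ==> v:Obj DC ==> Q (Sym DC u v)"
  and cmp: "!!g h. g:Arr DC ==> h:Arr DC ==> Cod DC g = Dom DC h ==> Q g ==> Q h ==> Q (h **. g)"
  and ten: "!!g h. g:Arr DC ==> h:Arr DC ==> Q g ==> Q h ==> Q (g ##. h)"
  and gen: "!!k. k:Arrows G ==> Q (gen k)"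
 shows "Q A"
proof -
 interpret self: interp G DC gen by (rule self_interp)
 obtain T :: "(nat, 's, 'a) tg" where T: "is_tg G T" "A = cls G T" using assms(1) by (rule ArrE)
 obtain xs where xs: "self.runsT T xs" "distinct xs" "set xs = TN T" using self.topo_of[OF T(1)] by metis
 have "Q (self.evT T xs)"
  by (rule DC.ev_induct[OF id sym cmp ten _ xs(1)]) (use gen tg_node(1)[OF T(1)] xs(3) in auto)
 thus ?thesis using self_ev[OF T(1) xs] T(2) by simp
qed

text \<open>Evaluation along the edges of the diagram itself instead of ports; the templates and the
  duplicate diagrams are computed this way.\<close>

lemma adiagram_ev:
 fixes Ga :: "('n, 'e, 's, 'a) adiagram"
 assumes ad: "is_adiagram G Ga" and xs: "distinct xs" "set xs = Nodes Ga"
  and go: "DC.go (Ins Ga) (Outs Ga) (set (DomL Ga)) xs (set (CodL Ga))"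
 shows "icls Ga = DC.ev (EVal Ga) (Ins Ga) (Outs Ga) (%x. gen (NVal Ga x)) (DomL Ga) xs (CodL Ga)"
proof -
 interpret adiag G Ga by unfold_locales fact
 have d: "distinct (DomL Ga @ concat (map (Outs Ga) xs))"
 proof -
  have "distinct (concat (map (Outs Ga) ys))" if "distinct ys" "set ys <= Nodes Ga" for ys
   using that by (induction ys) (use node in auto)
  thus ?thesis using xs anc node by auto
 qed
 have r: "DC.runs (EVal Ga) (Ins Ga) (Outs Ga) (%x. gen (NVal Ga x)) (DomL Ga) xs (CodL Ga)"
  unfolding DC.runs_def DC.nodes_ok_def
  using d anc go node gen_arr xs edge(3) by (auto simp: DC_simps(1))
 let ?q = "pt Ga" let ?T = "canon Ga"
 have sub: "set (DomL Ga) Un set (concat (map (Outs Ga) xs)) <= Edges Ga"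
  using sub_edges xs by auto
 have "DC.runs (pl ?T) (TI ?T) (outports G ?T) (%x. gen (TV ?T x)) (map ?q (DomL Ga)) (map id xs) (map ?q (CodL Ga)) &
  DC.ev (pl ?T) (TI ?T) (outports G ?T) (%x. gen (TV ?T x)) (map ?q (DomL Ga)) (map id xs) (map ?q (CodL Ga)) =
  DC.ev (EVal Ga) (Ins Ga) (Outs Ga) (%x. gen (NVal Ga x)) (DomL Ga) xs (CodL Ga)"
 proof (rule DC.ev_rename[OF r])
  show "inj_on ?q (set (DomL Ga) Un set (concat (map (Outs Ga) xs)))" using pt_inj sub by (rule inj_on_subset)
  show "ALL e:set (DomL Ga) Un set (concat (map (Outs Ga) xs)). pl ?T (?q e) = EVal Ga e" using sub pt_ports(2) by blast
 qed (use xs map_pt(2) in auto)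
 with self_ev[OF canon_tg, of xs] xs show ?thesis by (simp add: map_pt(1) iso_class_cls[OF ad])
qed

end

section \<open>Surgery\<close>

text \<open>A normal subgraph cuts the remaining nodes into those before and those after it; \<open>c\<close> is \<open>0\<close> before,
 \<open>1\<close> inside and \<open>2\<close> after the subgraph.\<close>

definition strat :: "('n, 'e, 's, 'a, 'z) diagram_scheme => 'n set => 'e set => ('n => nat) => bool" where
 "strat Ga N E c <-> N <= Nodes Ga & E <= Edges Ga & (ALL x:Nodes Ga. c x <= 2 & (c x = 1 <-> x:N)) &
   (ALL e:Edges Ga. ALL x y. Src Ga e = Some x --> Tgt Ga e = Some y --> c x <= c y) &
   (ALL e:E. (ALL x. Src Ga e = Some x --> c x <= 1) & (ALL y. Tgt Ga e = Some y --> 1 <= c y)) &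
   (ALL e:Edges Ga. ALL x:N. Src Ga e = Some x \<or> Tgt Ga e = Some x --> e:E)"

lemma directed_path_Cons:
 "directed_path Ga (e # p) <-> e:Edges Ga & (p = [] \<or> directed_path Ga p & (EX y. Tgt Ga e = Some y & Src Ga (hd p) = Some y))"
 by (cases p; cases "Tgt Ga e") (auto simp: directed_path_def)

lemma path_mono:
 fixes c :: "'n => nat" and Ga :: "('n, 'e, 'z) graph_scheme"
 assumes m: "ALL e:Edges Ga. ALL x y. Src Ga e = Some x --> Tgt Ga e = Some y --> c x <= c y"
  and "directed_path Ga p" "Src Ga (hd p) = Some x" "f:set p"
 shows "EX z. Src Ga f = Some z & c x <= c z"
 using assms(2-)
proof (induction p arbitrary: x)
 case (Cons e p)
 show ?case
 proof (cases "f = e")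
  case False
  with Cons.prems obtain y where y: "directed_path Ga p" "Tgt Ga e = Some y" "Src Ga (hd p) = Some y" "f:set p" "e:Edges Ga"
   by (auto simp: directed_path_Cons)
  hence "c x <= c y" using m Cons.prems by auto
  with Cons.IH[OF y(1,3,4)] show ?thesis by auto
 qed (use Cons in auto)
qed simp

lemma path_after:
 fixes c :: "'n => nat" and Ga :: "('n, 'e, 'z) graph_scheme"
 assumes m: "ALL e:Edges Ga. ALL x y. Src Ga e = Some x --> Tgt Ga e = Some y --> c x <= c y"
  and "directed_path Ga (e # p)" "f:set p"
 shows "EX x z. Tgt Ga e = Some x & Src Ga f = Some z & c x <= c z"
proof -
 obtain x where x: "Tgt Ga e = Some x" "directed_path Ga p" "Src Ga (hd p) = Some x"
  using assms(2,3) by (auto simp: directed_path_Cons)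
 with path_mono[OF m x(2,3) assms(3)] show ?thesis by auto
qed

lemma path_suffix: "directed_path Ga (a @ b) ==> b ~= [] ==> directed_path Ga b"
 by (induction a) (auto simp: directed_path_Cons)

text \<open>Strata never decrease along a path, so a path between nodes of stratum \<open>1\<close>
  stays there. A loose edge starts at stratum \<open>0\<close> or outside and ends at stratum
  \<open>2\<close> or outside; an edge of \<open>E\<close> cannot end at \<open>0\<close> or start
  at \<open>2\<close>, so none comes before or after it on a path.\<close>

lemma strat_normal:
 assumes s: "strat Ga N E c" and ad: "is_adiagram G Ga"
 shows "normal_subgraph Ga N E"
proof -
 have sub: "N <= Nodes Ga" "E <= Edges Ga" and c1: "!!x. x:Nodes Ga ==> c x <= 2 & (c x = 1 <-> x:N)"
  and m: "ALL e:Edges Ga. ALL x y. Src Ga e = Some x --> Tgt Ga e = Some y --> c x <= c y"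
  and cE: "!!e x. e:E ==> Src Ga e = Some x ==> c x <= 1" "!!e y. e:E ==> Tgt Ga e = Some y ==> 1 <= c y"
  and at: "!!e x. e:Edges Ga ==> x:N ==> Src Ga e = Some x \<or> Tgt Ga e = Some x ==> e:E"
  using s unfolding strat_def by blast+
 have nd: "!!e x. e:Edges Ga ==> Src Ga e = Some x \<or> Tgt Ga e = Some x ==> x:Nodes Ga"
  using ad by (auto simp: is_adiagram_iff)
 have loose: "(ALL x. Src Ga e = Some x --> c x = 0) & (ALL x. Tgt Ga e = Some x --> c x = 2)" if "loose (subdiagram Ga N E) e" for e
 proof -
  have e: "e:E" "!!x. Src Ga e = Some x \<or> Tgt Ga e = Some x ==> x ~: N"
   using that by (auto simp: loose_def subdiagram_def split: if_splits option.splits)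
  have "c x = 0" if "Src Ga e = Some x" for x
   using cE(1)[OF e(1) that] c1[of x] nd[of e x] e sub(2) that by force
  moreover have "c x = 2" if "Tgt Ga e = Some x" for x
   using cE(2)[OF e(1) that] c1[of x] nd[of e x] e sub(2) that by force
  ultimately show ?thesis by blast
 qed
 show ?thesis unfolding normal_subgraph_def
 proof (intro conjI sub notI ballI impI allI)
  assume "EX p e e'. directed_path Ga p & e:set p Int E & e':set p Int E & e ~= e' & loose (subdiagram Ga N E) e"
  then obtain p e e' where p: "directed_path Ga p" "e:set p" "e:E" "e':set p" "e':E" "e ~= e'" "loose (subdiagram Ga N E) e"
   by auto
  obtain a b where ab: "p = a @ e # b" using p(2) by (auto simp: in_set_conv_decomp)
  show False
  proof (cases "e':set b")
   case True
   from path_after[OF m path_suffix[OF p(1)[unfolded ab]] True] obtain x z where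
    "Tgt Ga e = Some x" "Src Ga e' = Some z" "c x <= c z" by auto
   thus False using loose[OF p(7)] cE(1)[OF p(5)] by fastforce
  next
   case False
   hence "e':set a" using p(4,6) ab by auto
   then obtain a1 a2 where "a = a1 @ e' # a2" by (auto simp: in_set_conv_decomp)
   hence "directed_path Ga (a1 @ (e' # a2 @ e # b))" using p(1) ab by simp
   from path_after[OF m path_suffix[OF this], of e] obtain x z where
    "Tgt Ga e' = Some x" "Src Ga e = Some z" "c x <= c z" by auto
   thus False using loose[OF p(7)] cE(2)[OF p(5)] by fastforce
  qed
 next
  fix e assume "e:Edges Ga" "set_option (Src Ga e) Int N ~= {} \<or> set_option (Tgt Ga e) Int N ~= {}"
  thus "e:E" using at by (cases "Src Ga e"; cases "Tgt Ga e") auto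
 next
  fix p x y assume "directed_path Ga p & Src Ga (hd p) = Some x & x:N & Tgt Ga (last p) = Some y & y:N"
  hence p: "directed_path Ga p" "Src Ga (hd p) = Some x" "x:N" "Tgt Ga (last p) = Some y" "y:N" by auto
  have in_p: "e:Edges Ga" if "e:set p" for e using p(1) that by (auto simp: directed_path_def)
  have cx: "c x = 1" "c y = 1" using c1 p sub by auto
  have key: "EX z w. Src Ga e = Some z & Tgt Ga e = Some w & z:N & w:N" if e: "e:set p" for e
  proof -
   obtain z where z: "Src Ga e = Some z" "c x <= c z" using path_mono[OF m p(1,2) e] by auto
   obtain w where w: "Tgt Ga e = Some w" "c w <= c y"
   proof (cases "e = last p")
    case False
    obtain a b where ab: "p = a @ e # b" using e by (auto simp: in_set_conv_decomp)
    hence b: "b ~= []" using False by auto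
    hence lb: "last p:set b" using ab by simp
    from path_after[OF m path_suffix[OF p(1)[unfolded ab]] lb] obtain w v where
     w: "Tgt Ga e = Some w" "Src Ga (last p) = Some v" "c w <= c v" by auto
    moreover have "c v <= c y" using m in_p[of "last p"] w(2) p(1,4) by (auto simp: directed_path_def)
    ultimately show thesis using that by auto
   qed (use p that in auto)
   have "c z <= c w" using m in_p[OF e] z w by auto
   hence "c z = 1" "c w = 1" using z w cx by auto
   thus ?thesis using z(1) w(1) c1 nd in_p[OF e] by metis
  qed
  show "set p <= E" using key at in_p by blast
  fix e assume "e:set p"
  thus "set_option (Tgt Ga e) <= N" using key by fastforce
 qed
qed

text \<open>Stratum \<open>0\<close> consists of the nodes outside \<open>N\<close> from which some
  path ends with an edge of \<open>E\<close>. The conditions \<open>i\<close>, \<open>ii\<close> and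
  \<open>iii\<close> of normality are what prevents an edge from \<open>N\<close> or an edge of
  \<open>E\<close> from leading back into it.\<close>

lemma normal_strat:
 fixes Ga :: "('n, 'e, 's, 'a) adiagram"
 assumes n: "normal_subgraph Ga N E" and ad: "is_adiagram G Ga"
 shows "EX c. strat Ga N E c"
proof -
 note n' = n[unfolded normal_subgraph_def]
 have sub: "N <= Nodes Ga" "E <= Edges Ga" using n' by simp_all
 have i: False if "directed_path Ga p" "e:set p" "e:E" "e':set p" "e':E" "e ~= e'" "loose (subdiagram Ga N E) e" for p e e'
  using n'[THEN conjunct2, THEN conjunct2, THEN conjunct1] that by blast
 have ii: "e:E" if "e:Edges Ga" "x:N" "Src Ga e = Some x \<or> Tgt Ga e = Some x" for e x
  using n'[THEN conjunct2, THEN conjunct2, THEN conjunct2, THEN conjunct1] that by auto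
 have iii: "set_option (Tgt Ga e) <= N" if "directed_path Ga p" "Src Ga (hd p) = Some x" "x:N" "Tgt Ga (last p) = Some y" "y:N"
  "e:set p" for p x y e
  using n'[THEN conjunct2, THEN conjunct2, THEN conjunct2, THEN conjunct2] that by blast
 have nd: "!!e x. e:Edges Ga ==> Src Ga e = Some x \<or> Tgt Ga e = Some x ==> x:Nodes Ga"
  using ad by (auto simp: is_adiagram_iff)
 obtain rk :: "'n => nat" where rk: "ALL e:Edges Ga. ALL x y. Src Ga e = Some x --> Tgt Ga e = Some y --> rk x < rk y"
  using ad by (auto simp: is_adiagram_iff)
 hence rkm: "ALL e:Edges Ga. ALL x y. Src Ga e = Some x --> Tgt Ga e = Some y --> rk x <= rk y"
  by (meson less_imp_le)
 define B where "B = {x. x ~: N & (EX p. directed_path Ga p & Src Ga (hd p) = Some x & last p:E)}"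
 have lo: "loose (subdiagram Ga N E) e" if "e:E" "!!x. Src Ga e = Some x ==> x ~: N" "!!x. Tgt Ga e = Some x ==> x ~: N" for e
  using that by (auto simp: loose_def subdiagram_def split: option.split)
 have pre: "x:B" if a: "e:Edges Ga" "Src Ga e = Some x" "Tgt Ga e = Some y" "y:B" "x ~: N" for e x y
 proof -
  obtain p where "directed_path Ga p" "Src Ga (hd p) = Some y" "last p:E" using a(4) by (auto simp: B_def)
  hence "directed_path Ga (e # p) & Src Ga (hd (e # p)) = Some x & last (e # p):E"
   using a by (cases p) (auto simp: directed_path_Cons directed_path_def[of _ "[]"])
  thus ?thesis using a(5) by (auto simp: B_def)
 qed
 have one: "x:B" if "e:E" "Src Ga e = Some x" "x ~: N" for e x
 proof -
  have "directed_path Ga [e]" using that sub by (auto simp: directed_path_Cons)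
  moreover have "Src Ga (hd [e]) = Some x" "last [e]:E" using that by auto
  ultimately show ?thesis using that(3) unfolding B_def by blast
 qed
 \<comment> \<open>The edge \<open>e\<close> prolongs the path that ends with \<open>?l\<close>. If
   \<open>?l\<close> touches \<open>N\<close>, the path returns to \<open>N\<close> and
   \<open>iii\<close> puts \<open>y\<close> into \<open>N\<close>; otherwise \<open>?l\<close> is
   loose and shares a path with \<open>e\<close>, which lies in \<open>E\<close> by
   \<open>ii\<close>, against \<open>i\<close>.\<close>
 have NB: False if e: "e:Edges Ga" "Src Ga e = Some x" "Tgt Ga e = Some y" "y:B" "x:N" for e x y
 proof -
  obtain p where p: "directed_path Ga p" "Src Ga (hd p) = Some y" "last p:E" "y ~: N" using e(4) by (auto simp: B_def)
  have pn: "p ~= []" using p(1) by (simp add: directed_path_def)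
  have ep: "directed_path Ga (e # p)" using p e by (auto simp: directed_path_Cons)
  let ?l = "last p"
  show False
  proof (cases "EX z:N. Tgt Ga ?l = Some z")
   case True
   thus False using iii[OF ep, of x _ e] e p(4) pn by auto
  next
   case notT: False
   show False
   proof (cases "EX z:N. Src Ga ?l = Some z")
    case True
    then obtain z where z: "z:N" "Src Ga ?l = Some z" by blast
    show False
    proof (cases "butlast p = []")
     case True
     hence "hd p = ?l" using pn by (cases p) auto
     thus False using p z by simp
    next
     case False
     have eq: "e # p = (e # butlast p) @ [?l]" using pn by simp
     have "directed_path Ga (e # butlast p) & Tgt Ga (last (e # butlast p)) = Src Ga ?l"
      using ep False unfolding eq directed_path_def successively_append_iff by auto
     thus False using iii[of "e # butlast p" x z e] e z p(4) by auto
    qed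
   next
    case False
    have "loose (subdiagram Ga N E) ?l" by (rule lo) (use p(3) False notT in auto)
    moreover have "e:E" using ii e by blast
    moreover have "?l ~= e" using False e by auto
    moreover have "?l:set (e # p)" using pn by simp
    ultimately show False using i[OF ep, of ?l e] p(3) by simp
   qed
  qed
 qed
 have EB: False if e: "e:E" "Tgt Ga e = Some y" "y:B" for e y
 proof (cases "EX x:N. Src Ga e = Some x")
  case True
  thus False using NB sub e by blast
 next
  case False
  obtain p where p: "directed_path Ga p" "Src Ga (hd p) = Some y" "last p:E" "y ~: N" using e(3) by (auto simp: B_def)
  have pn: "p ~= []" using p(1) by (simp add: directed_path_def)
  have ep: "directed_path Ga (e # p)" using p e sub by (auto simp: directed_path_Cons)
  have l: "loose (subdiagram Ga N E) e" by (rule lo) (use e p False in auto)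
  \<comment> \<open>By acyclicity in the form of \<open>rk\<close>: otherwise a path would lead from
    the target of \<open>e\<close> back to its source.\<close>
  have "last p ~= e"
  proof
   assume "last p = e"
   then obtain z where "Src Ga e = Some z" "rk y <= rk z" using path_mono[OF rkm p(1,2), of "last p"] pn by auto
   moreover have "rk z < rk y" using rk e sub calculation by blast
   ultimately show False by simp
  qed
  thus False using i[OF ep, of e "last p"] l e p(3) pn by auto
 qed
 define c where "c x = (if x:N then 1 else if x:B then 0 else (2::nat))" for x
 have "strat Ga N E c" unfolding strat_def
 proof (intro conjI ballI allI impI sub)
  fix e x y assume e: "e:Edges Ga" "Src Ga e = Some x" "Tgt Ga e = Some y"
  have "y:B ==> x:B & x ~: N" using pre[OF e] NB[OF e] by blast
  moreover have "y:N ==> x:N \<or> x:B" using one ii e by blast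
  ultimately show "c x <= c y" by (auto simp: c_def)
 next
  fix e x assume "e:E" "Src Ga e = Some x"
  thus "c x <= 1" using one by (auto simp: c_def)
 next
  fix e y assume "e:E" "Tgt Ga e = Some y"
  thus "1 <= c y" using EB by (auto simp: c_def)
 qed (auto simp: c_def ii)
 thus "EX c. strat Ga N E c" by (intro exI[of "strat Ga N E" c])
qed

section \<open>The result of a surgery as an anchored diagram\<close>

lemma dom_edges_iff: "e:dom_edges Ga <-> e:Edges Ga & Src Ga e = None"
 and cod_edges_iff: "e:cod_edges Ga <-> e:Edges Ga & Tgt Ga e = None"
 by (simp_all add: dom_edges_def cod_edges_def)

lemma anchor_simps [simp]:
 "Nodes (anchor Om ds cs) = Nodes Om" "Edges (anchor Om ds cs) = Edges Om" "Src (anchor Om ds cs) = Src Om" "Tgt (anchor Om ds cs) = Tgt Om"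
 "Ins (anchor Om ds cs) = Ins Om" "Outs (anchor Om ds cs) = Outs Om" "EVal (anchor Om ds cs) = EVal Om" "NVal (anchor Om ds cs) = NVal Om"
 "DomL (anchor Om ds cs) = ds" "CodL (anchor Om ds cs) = cs"
 by (simp_all add: anchor_def diagram.extend_def adiagram.fields_def)

lemma anchor_adiagram:
 "is_adiagram G (anchor Om ds cs) <-> is_diagram G Om & distinct ds & set ds = dom_edges Om & distinct cs & set cs = cod_edges Om"
 unfolding is_adiagram_def is_diagram_def is_graph_def dom_edges_def cod_edges_def by simp

locale surgery = fgm G + adiag G Ga
 for G :: "('s, 'a, 'z) graph_monoid_scheme" and Ga :: "('n, 'e, 's, 'a) adiagram" +
 fixes N :: "'n set" and E :: "'e set" and c :: "'n => nat"
  and Om :: "('k, 'f, 's, 'a) diagram" and La :: "('k2, 'f2, 's, 'a) diagram" and al be :: "'f2 => 'f"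
  and p :: "'k => 'n" and q :: "'f => 'e"
 assumes st: "strat Ga N E c" and iso: "diagram_iso Om (subdiagram Ga N E) p q"
  and Om: "is_diagram G Om" and La: "is_diagram G La"
  and al: "bij_betw al (dom_edges La) (dom_edges Om)" "!!e. e:dom_edges La ==> EVal Om (al e) = EVal La e"
  and be: "bij_betw be (cod_edges La) (cod_edges Om)" "!!e. e:cod_edges La ==> EVal Om (be e) = EVal La e"
begin

lemma c1: "N <= Nodes Ga" "E <= Edges Ga" "x:Nodes Ga ==> c x <= 2" "x:Nodes Ga ==> c x = 1 <-> x:N"
 "e:Edges Ga ==> Src Ga e = Some x ==> Tgt Ga e = Some y ==> c x <= c y"
 "e:E ==> Src Ga e = Some x ==> c x <= 1" "e:E ==> Tgt Ga e = Some y ==> 1 <= c y"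
 "e:Edges Ga ==> x:N ==> Src Ga e = Some x ==> e:E" "e:Edges Ga ==> x:N ==> Tgt Ga e = Some x ==> e:E"
 using st unfolding strat_def by blast+

lemma NE: "N = p ` Nodes Om" "inj_on p (Nodes Om)" "E = q ` Edges Om" "inj_on q (Edges Om)"
 using iso by (auto simp: diagram_iso_def subdiagram_def bij_betw_def)

lemma qE: "f:Edges Om ==> q f:E" "f:Edges Om ==> q f:Edges Ga" "y:Nodes Om ==> p y:N" "y:Nodes Om ==> p y:Nodes Ga"
 using NE c1 by auto

lemma node_iso:
 assumes "y:Nodes Om"
 shows "Ins Ga (p y) = map q (Ins Om y)" "Outs Ga (p y) = map q (Outs Om y)" "NVal Ga (p y) = NVal Om y"
proof -
 have "filter (%e. e:E) (Ins Ga (p y)) = Ins Ga (p y)" "filter (%e. e:E) (Outs Ga (p y)) = Outs Ga (p y)"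
  using node(2,4)[OF qE(4)[OF assms]] c1(8,9) qE(3)[OF assms] by (auto intro!: filter_True)
 thus "Ins Ga (p y) = map q (Ins Om y)" "Outs Ga (p y) = map q (Outs Om y)" "NVal Ga (p y) = NVal Om y"
  using iso assms by (auto simp: diagram_iso_def subdiagram_def)
qed

lemma edge_iso:
 assumes "f:Edges Om"
 shows "EVal Ga (q f) = EVal Om f"
  "Src Om f = Some y ==> Src Ga (q f) = Some (p y)" "Tgt Om f = Some y ==> Tgt Ga (q f) = Some (p y)"
  "Src Om f = None ==> Src Ga (q f) = Some x ==> x ~: N & x:Nodes Ga & c x = 0"
  "Tgt Om f = None ==> Tgt Ga (q f) = Some x ==> x ~: N & x:Nodes Ga & c x = 2"
proof -
 have i: "Src (subdiagram Ga N E) (q f) = map_option p (Src Om f)" "Tgt (subdiagram Ga N E) (q f) = map_option p (Tgt Om f)"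
  "EVal Ga (q f) = EVal Om f"
  using iso assms by (auto simp: diagram_iso_def subdiagram_def)
 show "EVal Ga (q f) = EVal Om f" by (rule i)
 show "Src Om f = Some y ==> Src Ga (q f) = Some (p y)" "Tgt Om f = Some y ==> Tgt Ga (q f) = Some (p y)"
  using i by (auto simp: subdiagram_def split: option.splits if_splits)
 have x: "x:Nodes Ga" if "Src Ga (q f) = Some x \<or> Tgt Ga (q f) = Some x" for x using edge[OF qE(2)[OF assms]] that by blast
 show "x ~: N & x:Nodes Ga & c x = 0" if a: "Src Om f = None" "Src Ga (q f) = Some x" for x
 proof -
  have "x ~: N" using i a by (auto simp: subdiagram_def split: option.splits if_splits)
  thus ?thesis using c1(4)[OF x] c1(6)[OF qE(1)[OF assms] a(2)] x a by force
 qed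
 show "x ~: N & x:Nodes Ga & c x = 2" if a: "Tgt Om f = None" "Tgt Ga (q f) = Some x" for x
 proof -
  have "x ~: N" using i a by (auto simp: subdiagram_def split: option.splits if_splits)
  thus ?thesis using c1(4)[OF x] c1(3)[OF x] c1(7)[OF qE(1)[OF assms] a(2)] x a by force
 qed
qed

lemma edge_N:
 assumes "f:Edges Om"
 shows "(EX x:N. Src Ga (q f) = Some x) <-> Src Om f ~= None" "(EX x:N. Tgt Ga (q f) = Some x) <-> Tgt Om f ~= None"
proof -
 have y: "y:Nodes Om" if "Src Om f = Some y \<or> Tgt Om f = Some y" for y
  using Om assms that unfolding is_diagram_def is_graph_def by force
 show "(EX x:N. Src Ga (q f) = Some x) <-> Src Om f ~= None"
  using edge_iso(2,4)[OF assms] y qE(3) by (cases "Src Om f") auto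
 show "(EX x:N. Tgt Ga (q f) = Some x) <-> Tgt Om f ~= None"
  using edge_iso(3,5)[OF assms] y qE(3) by (cases "Tgt Om f") auto
qed

text \<open>The renamings of \<open>surgery_result\<close> for source and for target positions. They
  may differ on a loose edge of the subgraph, which has one copy on each side.\<close>

definition rs where "rs e = (if e:E then Inr (inv_into (dom_edges La) (%d. q (al d)) e) else Inl e)"
definition rt where "rt e = (if e:E then Inr (inv_into (cod_edges La) (%d. q (be d)) e) else Inl e)"

definition SR where "SR = surgery_result Ga N E q La al be"

lemma SR_simps [simp]: "Nodes SR = (Nodes Ga - N) <+> Nodes La" "Edges SR = (Edges Ga - E) <+> Edges La"
 "Src SR (Inl e) = map_option Inl (Src Ga e)" "Tgt SR (Inl e) = map_option Inl (Tgt Ga e)"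
 "Src SR (Inr g) = (case Src La g of Some x => Some (Inr x) | None => map_option Inl (Src Ga (q (al g))))"
 "Tgt SR (Inr g) = (case Tgt La g of Some x => Some (Inr x) | None => map_option Inl (Tgt Ga (q (be g))))"
 "Ins SR (Inl x) = map rt (Ins Ga x)" "Ins SR (Inr y) = map Inr (Ins La y)"
 "Outs SR (Inl x) = map rs (Outs Ga x)" "Outs SR (Inr y) = map Inr (Outs La y)"
 "EVal SR (Inl e) = EVal Ga e" "EVal SR (Inr g) = EVal La g" "NVal SR (Inl x) = NVal Ga x" "NVal SR (Inr y) = NVal La y"
 "DomL SR = map rs (DomL Ga)" "CodL SR = map rt (CodL Ga)"
 by (simp_all add: SR_def surgery_result_def Let_def rs_def[abs_def] rt_def[abs_def])

text \<open>Edges that do not start, respectively do not end, in \<open>N\<close>. Intersected with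
  \<open>E\<close> they give the domain and the codomain of the subgraph, and on them
  \<open>rs\<close> and \<open>rt\<close> are injective.\<close>

definition "srcE = {e:Edges Ga. ALL x:N. Src Ga e ~= Some x}"
definition "tgtE = {e:Edges Ga. ALL x:N. Tgt Ga e ~= Some x}"

lemma dom_bij: "bij_betw (%d. q (al d)) (dom_edges La) (srcE Int E)"
proof -
 have "bij_betw q (dom_edges Om) (q ` dom_edges Om)" using NE(4) by (auto simp: bij_betw_def dom_edges_def elim: inj_on_subset)
 moreover have "q f:srcE <-> Src Om f = None" if "f:Edges Om" for f
  using edge_N(1)[OF that] qE(2)[OF that] unfolding srcE_def by blast
 hence "q ` dom_edges Om = srcE Int E" unfolding NE(3) dom_edges_def by blast
 ultimately show ?thesis using bij_betw_trans[OF al(1), of q] by (simp add: o_def)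
qed

lemma cod_bij: "bij_betw (%d. q (be d)) (cod_edges La) (tgtE Int E)"
proof -
 have "bij_betw q (cod_edges Om) (q ` cod_edges Om)" using NE(4) by (auto simp: bij_betw_def cod_edges_def elim: inj_on_subset)
 moreover have "q f:tgtE <-> Tgt Om f = None" if "f:Edges Om" for f
  using edge_N(2)[OF that] qE(2)[OF that] unfolding tgtE_def by blast
 hence "q ` cod_edges Om = tgtE Int E" unfolding NE(3) cod_edges_def by blast
 ultimately show ?thesis using bij_betw_trans[OF be(1), of q] by (simp add: o_def)
qed

lemma rs_eq: "d:dom_edges La ==> rs (q (al d)) = Inr d" "e ~: E ==> rs e = Inl e"
proof -
 assume d: "d:dom_edges La"
 hence "q (al d):E" using bij_betwE[OF dom_bij] by blast
 thus "rs (q (al d)) = Inr d" using bij_betw_inv_into_left[OF dom_bij d] by (simp add: rs_def)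
qed (simp add: rs_def)

lemma rt_eq: "d:cod_edges La ==> rt (q (be d)) = Inr d" "e ~: E ==> rt e = Inl e"
proof -
 assume d: "d:cod_edges La"
 hence "q (be d):E" using bij_betwE[OF cod_bij] by blast
 thus "rt (q (be d)) = Inr d" using bij_betw_inv_into_left[OF cod_bij d] by (simp add: rt_def)
qed (simp add: rt_def)

lemma srcE_cases:
 assumes "e:srcE"
 obtains d where "d:dom_edges La" "e = q (al d)" "rs e = Inr d" | "e:Edges Ga" "e ~: E" "rs e = Inl e"
proof (cases "e:E")
 case True
 hence "e:(%d. q (al d)) ` dom_edges La" using assms bij_betw_imp_surj_on[OF dom_bij] by blast
 then obtain d where "d:dom_edges La" "e = q (al d)" by blast
 thus thesis using that(1) rs_eq by blast
qed (use assms that(2) rs_eq in "auto simp: srcE_def")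

lemma tgtE_cases:
 assumes "e:tgtE"
 obtains d where "d:cod_edges La" "e = q (be d)" "rt e = Inr d" | "e:Edges Ga" "e ~: E" "rt e = Inl e"
proof (cases "e:E")
 case True
 hence "e:(%d. q (be d)) ` cod_edges La" using assms bij_betw_imp_surj_on[OF cod_bij] by blast
 then obtain d where "d:cod_edges La" "e = q (be d)" by blast
 thus thesis using that(1) rt_eq by blast
qed (use assms that(2) rt_eq in "auto simp: tgtE_def")

lemma alE: "d:dom_edges La ==> al d:Edges Om" "d:dom_edges La ==> d:Edges La" "d:dom_edges La ==> Src Om (al d) = None"
 "d:dom_edges La ==> Src La d = None"
 using bij_betwE[OF al(1)] by (auto simp: dom_edges_iff)
lemma beE: "d:cod_edges La ==> be d:Edges Om" "d:cod_edges La ==> d:Edges La" "d:cod_edges La ==> Tgt Om (be d) = None"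
 "d:cod_edges La ==> Tgt La d = None"
 using bij_betwE[OF be(1)] by (auto simp: cod_edges_iff)

lemma rs_props:
 assumes "e:srcE"
 shows "rs e:Edges SR" "Src SR (rs e) = map_option Inl (Src Ga e)" "EVal SR (rs e) = EVal Ga e"
proof -
 have "rs e:Edges SR & Src SR (rs e) = map_option Inl (Src Ga e) & EVal SR (rs e) = EVal Ga e"
 proof (rule srcE_cases[OF assms])
  fix d assume d: "d:dom_edges La" "e = q (al d)" "rs e = Inr d"
  note a = alE[OF d(1)]
  show ?thesis unfolding d(3) using a al(2)[OF d(1)] edge_iso(1)[OF a(1)] by (simp add: d(2) InrI)
 qed (simp add: InlI)
 thus "rs e:Edges SR" "Src SR (rs e) = map_option Inl (Src Ga e)" "EVal SR (rs e) = EVal Ga e" by blast+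
qed

lemma rt_props:
 assumes "e:tgtE"
 shows "rt e:Edges SR" "Tgt SR (rt e) = map_option Inl (Tgt Ga e)" "EVal SR (rt e) = EVal Ga e"
proof -
 have "rt e:Edges SR & Tgt SR (rt e) = map_option Inl (Tgt Ga e) & EVal SR (rt e) = EVal Ga e"
 proof (rule tgtE_cases[OF assms])
  fix d assume d: "d:cod_edges La" "e = q (be d)" "rt e = Inr d"
  note a = beE[OF d(1)]
  show ?thesis unfolding d(3) using a be(2)[OF d(1)] edge_iso(1)[OF a(1)] by (simp add: d(2) InrI)
 qed (simp add: InlI)
 thus "rt e:Edges SR" "Tgt SR (rt e) = map_option Inl (Tgt Ga e)" "EVal SR (rt e) = EVal Ga e" by blast+
qed

lemma rs_inj: "inj_on rs srcE"
proof (rule inj_onI)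
 fix e f assume "e:srcE" "f:srcE" "rs e = rs f"
 thus "e = f" by (elim srcE_cases) auto
qed

lemma rt_inj: "inj_on rt tgtE"
proof (rule inj_onI)
 fix e f assume "e:tgtE" "f:tgtE" "rt e = rt f"
 thus "e = f" by (elim tgtE_cases) auto
qed

lemma notE: "e:Edges Ga ==> e ~: E ==> e:srcE" "e:Edges Ga ==> e ~: E ==> e:tgtE"
 using c1(8,9) unfolding srcE_def tgtE_def by blast+

text \<open>Edges of the result are classified by their sources here and by their targets in
  \<open>SR_tgt\<close>, because an edge may have a new node at one end and an old one at the
  other.\<close>

lemma SR_src:
 assumes "g:Edges SR"
 obtains e where "e:srcE" "g = rs e" | g' x where "g = Inr g'" "g':Edges La" "Src La g' = Some x" "Src SR g = Some (Inr x)"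
proof (cases g)
 case (Inl e)
 thus thesis using assms rs_eq(2)[of e] notE(1)[of e] that(1)[of e] by auto
next
 case (Inr g')
 show thesis
 proof (cases "Src La g'")
  case None
  hence "g':dom_edges La" using Inr assms by (auto simp: dom_edges_iff)
  thus thesis using rs_eq(1)[of g'] Inr bij_betwE[OF dom_bij] that(1)[of "q (al g')"] by auto
 qed (use that(2) Inr assms in auto)
qed

lemma SR_tgt:
 assumes "g:Edges SR"
 obtains e where "e:tgtE" "g = rt e" | g' x where "g = Inr g'" "g':Edges La" "Tgt La g' = Some x" "Tgt SR g = Some (Inr x)"
proof (cases g)
 case (Inl e)
 thus thesis using assms rt_eq(2)[of e] notE(2)[of e] that(1)[of e] by auto
next
 case (Inr g')
 show thesis
 proof (cases "Tgt La g'")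
  case None
  hence "g':cod_edges La" using Inr assms by (auto simp: cod_edges_iff)
  thus thesis using rt_eq(1)[of g'] Inr bij_betwE[OF cod_bij] that(1)[of "q (be g')"] by auto
 qed (use that(2) Inr assms in auto)
qed

lemma Outs_srcE: "x:Nodes Ga ==> x ~: N ==> set (Outs Ga x) <= srcE" "set (DomL Ga) <= srcE"
 "x:Nodes Ga ==> x ~: N ==> set (Ins Ga x) <= tgtE" "set (CodL Ga) <= tgtE"
 using node anc by (auto simp: srcE_def tgtE_def)

lemma La_node:
 assumes "y:Nodes La"
 shows "distinct (Ins La y)" "set (Ins La y) = {e:Edges La. Tgt La e = Some y}" "distinct (Outs La y)"
  "set (Outs La y) = {e:Edges La. Src La e = Some y}" "NVal La y:Arrows G"
  "ASrc G (NVal La y) = map (EVal La) (Ins La y)" "ATgt G (NVal La y) = map (EVal La) (Outs La y)"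
 using La assms by (auto simp: is_diagram_def is_graph_def)

lemma La_edge:
 assumes "e:Edges La"
 shows "Src La e = Some x ==> x:Nodes La" "Tgt La e = Some x ==> x:Nodes La" "EVal La e:Letters G"
 using La assms unfolding is_diagram_def is_graph_def by force+

text \<open>Kept nodes are ordered first by stratum and then by their old rank, and the new nodes
  occupy the vacated block of stratum \<open>1\<close>. An edge of \<open>La\<close> attached to
  kept nodes can only start in stratum \<open>0\<close> and end in stratum \<open>2\<close>, so no
  cycle arises.\<close>

lemma rank_SR: "EX rk :: 'n + 'k2 => nat. ALL e:Edges SR. ALL x y. Src SR e = Some x --> Tgt SR e = Some y --> rk x < rk y"
proof -
 obtain rk :: "'n => nat" where rk: "!!e x y. e:Edges Ga ==> Src Ga e = Some x ==> Tgt Ga e = Some y ==> rk x < rk y"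
  using ad unfolding is_adiagram_iff by blast
 obtain rl :: "'k2 => nat" where rl: "!!e x y. e:Edges La ==> Src La e = Some x ==> Tgt La e = Some y ==> rl x < rl y"
  using La acyclic_edges_iff[of La] unfolding is_diagram_def is_graph_def by blast
 have fl: "finite (Nodes La)" using La by (simp add: is_diagram_def is_graph_def)
 \<comment> \<open>A strict bound for all ranks makes \<open>c x * M + rk x\<close> compare
   lexicographically; \<open>insert 0\<close> covers the case without nodes.\<close>
 define M where "M = Suc (Max (insert 0 (rk ` Nodes Ga Un rl ` Nodes La)))"
 have M: "x:Nodes Ga ==> rk x < M" "y:Nodes La ==> rl y < M" for x y
  unfolding M_def using fl by (auto intro!: le_imp_less_Suc Max_ge)
 define R where "R = case_sum (%x. c x * M + rk x) (%y. M + rl y)"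
 have m: "c x * M + rk x < c y * M + rk y" if "rk x < rk y" "c x <= c y" for x y
  using mult_le_mono1[OF that(2), of M] that(1) by linarith
 have "R x < R y" if e: "e:Edges SR" "Src SR e = Some x" "Tgt SR e = Some y" for e x y
 proof (cases e)
  case (Inl e')
  then obtain x' y' where "x = Inl x'" "y = Inl y'" "Src Ga e' = Some x'" "Tgt Ga e' = Some y'" "e':Edges Ga" using e by auto
  thus ?thesis using rk c1(5) by (auto simp: R_def intro!: m)
 next
  case (Inr g)
  hence g: "g:Edges La" using e by auto
  have x: "(EX x'. x = Inr x' & x':Nodes La & Src La g = Some x') \<or> (EX x'. x = Inl x' & x':Nodes Ga & c x' = 0)"
  proof (cases "Src La g")
   case None
   hence d: "g:dom_edges La" using g by (simp add: dom_edges_iff)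
   show ?thesis using None Inr e(2) edge_iso(4)[OF alE(1)[OF d] alE(3)[OF d]] by auto
  qed (use Inr e g La_edge(1) in auto)
  have y: "(EX y'. y = Inr y' & y':Nodes La & Tgt La g = Some y') \<or> (EX y'. y = Inl y' & y':Nodes Ga & c y' = 2)"
  proof (cases "Tgt La g")
   case None
   hence d: "g:cod_edges La" using g by (simp add: cod_edges_iff)
   show ?thesis using None Inr e(3) edge_iso(5)[OF beE(1)[OF d] beE(3)[OF d]] by auto
  qed (use Inr e g La_edge(2) in auto)
  show ?thesis using x y rl[OF g] by (auto simp: R_def dest: M)
 qed
 thus ?thesis by blast
qed

theorem SR_valid: "is_adiagram G SR"
 unfolding is_adiagram_iff
proof (intro conjI ballI rank_SR)
 show "finite (Nodes SR)" "finite (Edges SR)" using La by (simp_all add: is_diagram_def is_graph_def)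
 have S: "Src SR g = Some (Inr x) ==> x:Nodes La" "Src SR g = Some (Inl x') ==> x':Nodes Ga - N" if g: "g:Edges SR" for g x x'
  using g by (cases rule: SR_src; use rs_props(2) La_edge(1) edge(1) in "force simp: srcE_def simp del: SR_simps")+
 have T: "Tgt SR g = Some (Inr x) ==> x:Nodes La" "Tgt SR g = Some (Inl x') ==> x':Nodes Ga - N" if g: "g:Edges SR" for g x x'
  using g by (cases rule: SR_tgt; use rt_props(2) La_edge(2) edge(2) in "force simp: tgtE_def simp del: SR_simps")+
 {
  fix g assume g: "g:Edges SR"
  show "set_option (Src SR g) <= Nodes SR"
  proof
   fix z assume "z:set_option (Src SR g)"
   thus "z:Nodes SR" using S[OF g] by (cases z rule: sum.exhaust) auto
  qed
  show "set_option (Tgt SR g) <= Nodes SR"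
  proof
   fix z assume "z:set_option (Tgt SR g)"
   thus "z:Nodes SR" using T[OF g] by (cases z rule: sum.exhaust) auto
  qed
  show "EVal SR g:Letters G" using g edge(3) La_edge(3) by auto
 }
 have d: "distinct (map rs es)" if "distinct es" "set es <= srcE" for es
  using that inj_on_subset[OF rs_inj] by (auto simp: distinct_map)
 have d': "distinct (map rt es)" if "distinct es" "set es <= tgtE" for es
  using that inj_on_subset[OF rt_inj] by (auto simp: distinct_map)
 have sv: "map (EVal SR) (map rs es) = map (EVal Ga) es" if "set es <= srcE" for es using rs_props(3) that by auto
 have tv: "map (EVal SR) (map rt es) = map (EVal Ga) es" if "set es <= tgtE" for es using rt_props(3) that by auto
 \<comment> \<open>\<open>z = None\<close> yields the domain, \<open>z = Some x\<close> the outputs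
   of a kept node.\<close>
 have ss: "rs ` {e:Edges Ga. Src Ga e = z} = {g:Edges SR. Src SR g = map_option Inl z}" if z: "!!x. z = Some x ==> x ~: N" for z
 proof (intro set_eqI iffI)
  fix g assume "g:rs ` {e:Edges Ga. Src Ga e = z}"
  then obtain e where "e:srcE" "Src Ga e = z" "g = rs e" using z by (auto simp: srcE_def)
  thus "g:{g:Edges SR. Src SR g = map_option Inl z}" using rs_props by simp
 next
  fix g assume g: "g:{g:Edges SR. Src SR g = map_option Inl z}"
  hence "g:Edges SR" by blast
  thus "g:rs ` {e:Edges Ga. Src Ga e = z}"
  proof (cases rule: SR_src)
   case (1 e)
   hence "map_option Inl (Src Ga e) = (map_option Inl z :: ('n + 'k2) option)" using g rs_props(2) by auto
   hence "Src Ga e = z" by (cases z) auto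
   thus ?thesis using 1 by (auto simp: srcE_def)
  qed (use g in "cases z; auto")
 qed
 have tt: "rt ` {e:Edges Ga. Tgt Ga e = z} = {g:Edges SR. Tgt SR g = map_option Inl z}" if z: "!!x. z = Some x ==> x ~: N" for z
 proof (intro set_eqI iffI)
  fix g assume "g:rt ` {e:Edges Ga. Tgt Ga e = z}"
  then obtain e where "e:tgtE" "Tgt Ga e = z" "g = rt e" using z by (auto simp: tgtE_def)
  thus "g:{g:Edges SR. Tgt SR g = map_option Inl z}" using rt_props by simp
 next
  fix g assume g: "g:{g:Edges SR. Tgt SR g = map_option Inl z}"
  hence "g:Edges SR" by blast
  thus "g:rt ` {e:Edges Ga. Tgt Ga e = z}"
  proof (cases rule: SR_tgt)
   case (1 e)
   hence "map_option Inl (Tgt Ga e) = (map_option Inl z :: ('n + 'k2) option)" using g rt_props(2) by auto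
   hence "Tgt Ga e = z" by (cases z) auto
   thus ?thesis using 1 by (auto simp: tgtE_def)
  qed (use g in "cases z; auto")
 qed
 have sl: "{g:Edges SR. Src SR g = Some (Inr y)} = Inr ` {g:Edges La. Src La g = Some y}"
  "{g:Edges SR. Tgt SR g = Some (Inr y)} = Inr ` {g:Edges La. Tgt La g = Some y}" for y
  by (auto split: option.splits)
 show "distinct (DomL SR)" "distinct (CodL SR)" using d d' anc Outs_srcE by simp_all
 show "set (DomL SR) = {e:Edges SR. Src SR e = None}" using ss[of None] anc by simp
 show "set (CodL SR) = {e:Edges SR. Tgt SR e = None}" using tt[of None] anc by simp
 fix z assume z: "z:Nodes SR"
 then consider x where "z = Inl x" "x:Nodes Ga" "x ~: N" | y where "z = Inr y" "y:Nodes La" by auto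
 hence "distinct (Ins SR z) & distinct (Outs SR z) & set (Ins SR z) = {e:Edges SR. Tgt SR e = Some z} &
  set (Outs SR z) = {e:Edges SR. Src SR e = Some z} & NVal SR z:Arrows G & ASrc G (NVal SR z) = map (EVal SR) (Ins SR z) &
  ATgt G (NVal SR z) = map (EVal SR) (Outs SR z)"
 proof cases
  case 1
  note n = node[OF 1(2)] and o = Outs_srcE(1,3)[OF 1(2,3)]
  show ?thesis using d'[OF n(1) o(2)] d[OF n(3) o(1)] ss[of "Some x"] tt[of "Some x"] sv[OF o(1)] tv[OF o(2)] n 1 by (simp del: map_map)
 next
  case 2
  note n = La_node[OF 2(2)]
  have "set (Ins SR z) = {e:Edges SR. Tgt SR e = Some z}" "set (Outs SR z) = {e:Edges SR. Src SR e = Some z}"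
   unfolding 2(1) sl using n by auto
  thus ?thesis using n 2(1) by (simp add: distinct_map o_def)
 qed
 thus "distinct (Ins SR z)" "distinct (Outs SR z)" "set (Ins SR z) = {e:Edges SR. Tgt SR e = Some z}"
  "set (Outs SR z) = {e:Edges SR. Src SR e = Some z}" "NVal SR z:Arrows G" "ASrc G (NVal SR z) = map (EVal SR) (Ins SR z)"
  "ATgt G (NVal SR z) = map (EVal SR) (Outs SR z)" by blast+
qed

end

section \<open>Ports of a composite with a replaceable middle factor\<close>

definition midp :: "'n1 port list => 'k port => (('n1 + ('k + nat)) + 'n2) port" where
 "midp os v = mpt Inl (glue_port os (mpt Inl v))"

definition lowp :: "'n1 port => (('n1 + ('k + nat)) + 'n2) port" where
 "lowp u = mpt Inl (mpt Inl u)"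

text \<open>The port of an edge that enters the top part: it starts at a top node, or comes out of
  the middle factor through one of the outputs \<open>ks\<close>, or is one of the wires beside it,
  which occupy the places of \<open>os\<close> from \<open>n\<close> on.\<close>

definition fillp :: "'n1 port list => nat => 'k port list => 'n2 port => (('n1 + ('k + nat)) + 'n2) port" where
 "fillp os n ks u = (case u of Outp z j => Outp (Inr z) j
  | Inp i => if i < length ks then midp os (ks ! i) else lowp (os ! (n + (i - length ks))))"

lemma midp_simps [simp]: "midp os (Inp i) = lowp (os ! i)" "midp os (Outp y j) = Outp (Inl (Inr (Inl y))) j"
 by (simp_all add: midp_def lowp_def)

lemma lowp_simps [simp]: "lowp (Inp i) = Inp i" "lowp (Outp y j) = Outp (Inl (Inl y)) j"
 by (simp_all add: lowp_def)

lemma lowp_eq [simp]: "lowp u = Inp i <-> u = Inp i" "lowp u = Outp z j <-> (EX x. u = Outp x j & z = Inl (Inl x))"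
 "lowp u = lowp v <-> u = v"
proof -
 show "lowp u = Inp i <-> u = Inp i" "lowp u = Outp z j <-> (EX x. u = Outp x j & z = Inl (Inl x))" by (cases u; auto)+
 show "lowp u = lowp v <-> u = v" by (cases u; cases v) auto
qed

lemma fillp_simps [simp]: "fillp os n ks (Outp z j) = Outp (Inr z) j"
 "fillp os n ks (Inp i) = (if i < length ks then midp os (ks ! i) else lowp (os ! (n + (i - length ks))))"
 by (simp_all add: fillp_def)

lemma midp_inj:
 assumes "midp os u = (midp os v :: (('n1 + ('k + nat)) + 'n2) port)" "distinct os"
  "!!i. u = Inp i ==> i < length os" "!!i. v = Inp i ==> i < length os"
 shows "u = v"
 using assms by (cases u; cases v) (auto simp: nth_eq_iff_index_eq eq_commute[of "Outp _ _" "lowp _"])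

context fgm
begin

lemma ctx_simps:
 fixes T1 :: "('n1, 's, 'a) tg" and X :: "('k, 's, 'a) tg" and T2 :: "('n2, 's, 'a) tg"
 shows "TN (ctx T1 X w T2) = (TN T1 <+> (TN X <+> {})) <+> TN T2" "TD (ctx T1 X w T2) = TD T1"
  "TV (ctx T1 X w T2) (Inl (Inl x)) = TV T1 x" "TV (ctx T1 X w T2) (Inl (Inr (Inl y))) = TV X y" "TV (ctx T1 X w T2) (Inr z) = TV T2 z"
  "TI (ctx T1 X w T2) (Inl (Inl x)) = map lowp (TI T1 x)" "TI (ctx T1 X w T2) (Inl (Inr (Inl y))) = map (midp (TO T1)) (TI X y)"
 by (simp_all add: ctx_def lowp_def[abs_def] midp_def[abs_def] o_def)

lemma ctx_out:
 fixes T1 :: "('n1, 's, 'a) tg" and X :: "('k, 's, 'a) tg" and T2 :: "('n2, 's, 'a) tg"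
 assumes l: "length (TO T1) = length (TD X) + length w" and T2: "is_tg G T2" "length (TD T2) = length (TO X) + length w"
 shows "TO (ctx T1 X w T2) = map (fillp (TO T1) (length (TD X)) (TO X)) (TO T2)"
  "z:TN T2 ==> TI (ctx T1 X w T2) (Inr z) = map (fillp (TO T1) (length (TD X)) (TO X)) (TI T2 z)"
proof -
 let ?M = "tglue T1 (tdu X (tid w))"
 have eq: "glue_port (TO ?M) u = fillp (TO T1) (length (TD X)) (TO X) u" if "!!i. u = Inp i ==> i < length (TD T2)" for u :: "'n2 port"
  using that assms by (cases u) (auto simp: nth_append midp_def lowp_def)
 have "TO (ctx T1 X w T2) = map (glue_port (TO ?M)) (TO T2)" unfolding ctx_def by (rule tglue_simps(7))
 thus "TO (ctx T1 X w T2) = map (fillp (TO T1) (length (TD X)) (TO X)) (TO T2)"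
  using tg_Inp(2)[OF T2(1)] by (auto intro!: eq simp del: tglue_simps)
 assume z: "z:TN T2"
 have "TI (ctx T1 X w T2) (Inr z) = map (glue_port (TO ?M)) (TI T2 z)" unfolding ctx_def by (rule tglue_simps(6))
 thus "TI (ctx T1 X w T2) (Inr z) = map (fillp (TO T1) (length (TD X)) (TO X)) (TI T2 z)"
  using tg_Inp(1)[OF T2(1) z] by (auto intro!: eq simp del: tglue_simps)
qed

end

lemma map_transfer:
 assumes "map f xs = map g ys" "!!x y. x:set xs ==> y:set ys ==> f x = g y ==> f' x = g' y"
 shows "map f' xs = map g' ys"
 using assms by (auto simp: list_eq_iff_nth_eq)

text \<open>A surgery whose cut is known: \<open>P\<close> identifies the diagram with the composite
  of \<open>T1\<close>, the subgraph beside \<open>w\<close>, and \<open>T2\<close>. Such a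
  \<open>P\<close> arises both from a given surgery and from a given factorisation, so the effect of
  the replacement is analysed once for both directions.\<close>

locale replacement = surgery G Ga N E c Om La al be p q
 for G :: "('s, 'a, 'z) graph_monoid_scheme" and Ga :: "('n, 'e, 's, 'a) adiagram"
  and N :: "'n set" and E :: "'e set" and c :: "'n => nat"
  and Om :: "('k, 'f, 's, 'a) diagram" and La :: "('k2, 'f2, 's, 'a) diagram" and al be :: "'f2 => 'f"
  and p :: "'k => 'n" and q :: "'f => 'e" +
 fixes T1 :: "('n1, 's, 'a) tg" and T2 :: "('n2, 's, 'a) tg" and w :: "'s list" and ds cs :: "'f list" and ds' cs' :: "'f2 list"
  and P :: "('n1 + ('k + nat)) + 'n2 => 'n"
 assumes T1: "is_tg G T1" and T2: "is_tg G T2"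
  and ds: "distinct ds" "set ds = dom_edges Om" and cs: "distinct cs" "set cs = cod_edges Om"
  and ds': "map al ds' = ds" "distinct ds'" "set ds' = dom_edges La" and cs': "map be cs' = cs" "distinct cs'" "set cs' = cod_edges La"
  and len: "length (TO T1) = length ds + length w" "length (TD T2) = length cs + length w"
  and P: "tgiso P (ctx T1 (canon (anchor Om ds cs)) w T2) (canon Ga)"
  and Pp: "!!y. y:Nodes Om ==> P (Inl (Inr (Inl y))) = p y"
  and Pc: "!!x. x:TN T1 ==> c (P (Inl (Inl x))) = 0" "!!z. z:TN T2 ==> c (P (Inr z)) = 2"
  and Pd: "!!i. i < length ds ==> mpt P (lowp (TO T1 ! i)) = pt Ga (q (ds ! i))"
begin

abbreviation "XO == anchor Om ds cs"
abbreviation "XL == anchor La ds' cs'"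

lemma XO: "adiag G XO" by unfold_locales (simp add: anchor_adiagram Om ds cs)
lemma len': "length ds' = length ds" "length cs' = length cs" using ds'(1) cs'(1) by auto

lemma lens: "length (TO T1) = length (TD (canon XO)) + length w" "length (TD T2) = length (TO (canon XO)) + length w"
 "length (TO T1) = length (TD (canon XL)) + length w" "length (TD T2) = length (TO (canon XL)) + length w"
 using len len' by (simp_all add: dom_word_def)

lemmas outO = ctx_out[OF lens(1) T2 lens(2), simplified] and outL = ctx_out[OF lens(3) T2 lens(4), simplified]

lemma nP: "y:Nodes Om ==> Src Om f = Some y ==> f:Edges Om ==> pt Ga (q f) = Outp (p y) (idx (Outs Om y) f)"
 using edge_iso(2)[of f y] node_iso(2)[of y] idx_map[OF inj_on_subset[OF NE(4)], of "Outs Om y" f] adiag.node(4)[OF XO, of y]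
 by (auto simp: pt_def)

lemma ptq:
 assumes f: "f:Edges Om"
 shows "pt Ga (q f) = mpt P (midp (TO T1) (pt XO f))"
proof (cases "Src Om f")
 case None
 hence d: "f:set ds" using f ds by (simp add: dom_edges_iff)
 hence "pt XO f = Inp (idx ds f)" using None by (simp add: pt_def)
 thus ?thesis using Pd[of "idx ds f"] d by simp
next
 case (Some y)
 hence y: "y:Nodes Om" using adiag.edge(1)[OF XO, of f] f by simp
 thus ?thesis using nP[OF y Some f] Pp[OF y] Some by (simp add: pt_def)
qed

lemma pts:
 assumes e: "e:srcE"
 shows "pt SR (rs e) = mpt Inl (pt Ga e)"
proof (cases "Src Ga e")
 case None
 hence "e:set (DomL Ga)" using e anc by (simp add: srcE_def)
 hence "idx (map rs (DomL Ga)) (rs e) = idx (DomL Ga) e" by (intro idx_map inj_on_subset[OF rs_inj] Outs_srcE)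
 thus ?thesis using None rs_props(2)[OF e] by (simp add: pt_def)
next
 case (Some x)
 have x: "x:Nodes Ga" "x ~: N" using e Some edge(1) by (auto simp: srcE_def)
 hence "e:set (Outs Ga x)" using e Some node(4)[of x] by (simp add: srcE_def)
 hence "idx (map rs (Outs Ga x)) (rs e) = idx (Outs Ga x) e" by (intro idx_map inj_on_subset[OF rs_inj] Outs_srcE x)
 thus ?thesis using Some rs_props(2)[OF e] by (simp add: pt_def)
qed

text \<open>The node bijection after the surgery: kept nodes follow \<open>P\<close>, new nodes are
  themselves.\<close>

definition R :: "('n1 + ('k2 + nat)) + 'n2 => 'n + 'k2" where
 "R = case_sum (case_sum (%x. Inl (P (Inl (Inl x)))) (case_sum Inr undefined)) (%z. Inl (P (Inr z)))"

lemma R_simps [simp]: "R (Inl (Inl x)) = Inl (P (Inl (Inl x)))" "R (Inl (Inr (Inl y))) = Inr y" "R (Inr z) = Inl (P (Inr z))"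
 by (simp_all add: R_def)

lemma R_low: "mpt R (lowp u) = mpt Inl (mpt P (lowp u))"
 by (cases u) simp_all

lemma ptL:
 assumes g: "g:Edges La"
 shows "pt SR (Inr g) = mpt R (midp (TO T1) (pt XL g))"
proof (cases "Src La g")
 case None
 hence d: "g:dom_edges La" using g by (simp add: dom_edges_iff)
 hence g': "g:set ds'" using ds' by simp
 hence i: "idx ds' g < length ds" using idx_less[OF g'] len'(1) by simp
 have a: "al g = ds ! idx ds' g" using nth_map[of "idx ds' g" ds' al] nth_idx[OF g'] idx_less[OF g'] unfolding ds'(1) by simp
 have s: "q (al g):srcE" using bij_betwE[OF dom_bij] d by blast
 have "pt SR (Inr g) = mpt Inl (pt Ga (q (al g)))" using pts[OF s] rs_eq(1)[OF d] by simp
 also have "... = mpt R (lowp (TO T1 ! idx ds' g))" unfolding R_low Pd[OF i] a ..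
 finally show ?thesis using None by (simp add: pt_def)
next
 case (Some y)
 hence "g:set (Outs La y)" using La_node(4) La_edge(1) g by simp
 thus ?thesis using Some by (simp add: pt_def idx_map)
qed

lemma bP: "bij_betw P (TN (ctx T1 (canon XO) w T2)) (Nodes Ga)"
 using P by (simp add: tgiso_def)

lemma Pn: "x:TN T1 ==> P (Inl (Inl x)):Nodes Ga - N" "z:TN T2 ==> P (Inr z):Nodes Ga - N"
proof -
 assume x: "x:TN T1"
 hence "P (Inl (Inl x)):Nodes Ga" by (intro bij_betw_apply[OF bP]) (simp add: ctx_simps InlI InrI)
 thus "P (Inl (Inl x)):Nodes Ga - N" using Pc(1)[OF x] c1(4) by force
next
 assume z: "z:TN T2"
 hence "P (Inr z):Nodes Ga" by (intro bij_betw_apply[OF bP]) (simp add: ctx_simps InlI InrI)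
 thus "P (Inr z):Nodes Ga - N" using Pc(2)[OF z] c1(4) by force
qed

lemma low_port_inj:
 assumes "mpt P (lowp u) = mpt P (lowp v)" "!!x j. u = Outp x j ==> x:TN T1" "!!x j. v = Outp x j ==> x:TN T1"
 shows "u = v"
 using assms bP by (cases u; cases v) (auto simp: bij_betw_def ctx_simps dest!: inj_onD)

text \<open>The edge starts at a node of \<open>T2\<close>, comes out of the replaced part, or
  passes beside it. In the second case it becomes the edge of \<open>La\<close> that
  \<open>be\<close> assigns to it; in the others it lies outside \<open>E\<close> and is
  unchanged.\<close>

lemma out_eq:
 assumes e: "e:tgtE" and u: "pt Ga e = mpt P (fillp (TO T1) (length ds) (map (pt XO) cs) u)"
  and uz: "!!z j. u = Outp z j ==> z:TN T2" and ui: "!!i. u = Inp i ==> i < length cs + length w"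
 shows "pt SR (rt e) = mpt R (fillp (TO T1) (length ds') (map (pt XL) cs') u)"
proof -
 have eE: "e:Edges Ga" using e by (simp add: tgtE_def)
 have out: "pt SR (rt e) = mpt Inl (pt Ga e)" if "e ~: E"
  using pts[OF notE(1)[OF eE that]] rs_eq(2)[OF that] rt_eq(2)[OF that] by simp
 show ?thesis
 proof (cases u)
  case (Outp z j)
  hence "Src Ga e = Some (P (Inr z))" using u by (auto simp: pt_def split: option.splits)
  hence "e ~: E" using c1(6) Pc(2)[OF uz[OF Outp]] by force
  thus ?thesis using out u Outp by simp
 next
  case (Inp i)
  show ?thesis
  proof (cases "i < length cs")
   case True
   hence ci: "cs ! i:Edges Om" "cs ! i = be (cs' ! i)" "cs' ! i:cod_edges La"
    using True cs(2) cs'(1,3) len'(2) nth_mem[of i cs] nth_mem[of i cs'] nth_map[of i cs' be] by (simp_all add: cod_edges_iff)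
   have "pt Ga e = pt Ga (q (cs ! i))" using u Inp True ptq[OF ci(1)] by simp
   hence "e = q (be (cs' ! i))" using inj_onD[OF pt_inj] eE qE(2)[OF ci(1)] ci(2) by simp
   hence "rt e = Inr (cs' ! i)" using rt_eq(1)[OF ci(3)] by simp
   moreover have "cs' ! i:Edges La" using ci(3) by (simp add: cod_edges_iff)
   ultimately show ?thesis using ptL[of "cs' ! i"] Inp True len' by simp
  next
   case False
   define k where "k = length ds + (i - length cs)"
   have k: "length ds <= k" "k < length (TO T1)" using False ui[OF Inp] len by (auto simp: k_def)
   have uk: "pt Ga e = mpt P (lowp (TO T1 ! k))" using u Inp False by (simp add: k_def)
   have T1o: "TO T1 ! l = Outp x j ==> x:TN T1" if "l < length (TO T1)" for l x j
    using tg_Outp(2)[OF T1] nth_mem[OF that] by metis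
   \<comment> \<open>A wire beside the subgraph that lay in \<open>E\<close> would be one of its
     domain edges; these occupy the first \<open>length ds\<close> places of \<open>TO T1\<close>, a
     list without repetitions, while \<open>k\<close> is beyond them.\<close>
   have "e ~: E"
   proof
    assume "e:E"
    moreover have "e:srcE"
    proof (cases "TO T1 ! k")
     case (Inp i)
     hence "Src Ga e = None" using uk by (auto simp: pt_def split: option.splits)
     thus ?thesis using eE by (simp add: srcE_def)
    next
     case (Outp x j)
     hence "Src Ga e = Some (P (Inl (Inl x)))" using uk by (auto simp: pt_def split: option.splits)
     thus ?thesis using eE Pn(1)[OF T1o[OF k(2) Outp]] by (auto simp: srcE_def)
    qed
    ultimately have "e:(%d. q (al d)) ` dom_edges La" using bij_betw_imp_surj_on[OF dom_bij] by blast
    then obtain d where d: "d:dom_edges La" "e = q (al d)" by blast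
    hence "al d:set ds" using ds' by auto
    then obtain i' where i': "i' < length ds" "al d = ds ! i'" by (metis in_set_conv_nth)
    have i'': "i' < length (TO T1)" using i' len by simp
    have "mpt P (lowp (TO T1 ! k)) = mpt P (lowp (TO T1 ! i'))" using uk Pd[OF i'(1)] d(2) i'(2) by simp
    hence "TO T1 ! k = TO T1 ! i'" by (rule low_port_inj) (use T1o[OF k(2)] T1o[OF i''] in blast)+
    thus False using tg_glob(3)[OF T1] k i'(1) i'' by (simp add: nth_eq_iff_index_eq)
   qed
   thus ?thesis using out uk Inp False len' R_low by (simp add: k_def)
  qed
 qed
qed

lemma low_eq:
 assumes x: "x:TN T1" and e: "e:set (Ins Ga (P (Inl (Inl x))))" and u: "pt Ga e = mpt P (lowp u)"
 shows "pt SR (rt e) = mpt R (lowp u)"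
proof -
 have "e:Edges Ga" "Tgt Ga e = Some (P (Inl (Inl x)))" using node(2) Pn(1)[OF x] e by auto
 hence eE: "e:Edges Ga" "e ~: E" using c1(7) Pc(1)[OF x] by force+
 thus ?thesis using pts[OF notE(1)[OF eE]] rs_eq(2)[OF eE(2)] rt_eq(2)[OF eE(2)] u R_low by simp
qed

text \<open>The lower part, the upper part and the wires beside stay, so only the way they are
  connected has to be compared. \<open>map_transfer\<close> carries the known equations for ports
  over entry by entry, by \<open>low_eq\<close> below the cut and \<open>out_eq\<close> above
  it.\<close>

theorem replaced: "tgiso R (ctx T1 (canon XL) w T2) (canon SR)"
 unfolding tgiso_def
proof (intro conjI ballI)
 note tg = P[unfolded tgiso_def]
 have inj: "inj_on P (TN (ctx T1 (canon XO) w T2))" and im: "P ` TN (ctx T1 (canon XO) w T2) = Nodes Ga" using bP by (auto simp: bij_betw_def)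
 show "bij_betw R (TN (ctx T1 (canon XL) w T2)) (TN (canon SR))" unfolding bij_betw_def
 proof
  show "inj_on R (TN (ctx T1 (canon XL) w T2))"
   by (rule inj_onI) (auto simp: ctx_simps dest!: inj_onD[OF inj])
  have "Inl x:R ` TN (ctx T1 (canon XL) w T2)" if x: "x:Nodes Ga" "x ~: N" for x
  proof -
   obtain z where z: "x = P z" "z:TN (ctx T1 (canon XO) w T2)" using x im by blast
   have "\<not> (EX y. y:Nodes Om & z = Inl (Inr (Inl y)))" using z(1) x Pp qE(3) by auto
   with z(2) consider t where "z = Inl (Inl t)" "t:TN T1" | t where "z = Inr t" "t:TN T2" by (auto simp: ctx_simps)
   thus ?thesis
   proof cases
    case 1
    thus ?thesis using z(1) by (intro image_eqI[of _ _ "Inl (Inl t)"]) (simp_all add: ctx_simps InlI)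
   next
    case 2
    thus ?thesis using z(1) by (intro image_eqI[of _ _ "Inr t"]) (simp_all add: ctx_simps InrI)
   qed
  qed
  moreover have "Inr y:R ` TN (ctx T1 (canon XL) w T2)" if "y:Nodes La" for y
   by (rule image_eqI[of _ _ "Inl (Inr (Inl y))"]) (use that in "simp_all add: ctx_simps InlI InrI")
  ultimately show "R ` TN (ctx T1 (canon XL) w T2) = TN (canon SR)"
   using Pn by (auto simp: ctx_simps)
 qed
 have ev: "map (EVal SR) (map rs (DomL Ga)) = map (EVal Ga) (DomL Ga)" using rs_props(3) Outs_srcE(2) by auto
 have "TD (canon Ga) = TD T1" using tg by (simp only: ctx_simps)
 thus "TD (canon SR) = TD (ctx T1 (canon XL) w T2)"
  unfolding canon_simps dom_word_def SR_simps ev by (simp only: ctx_simps)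
 have "map (pt Ga) (CodL Ga) = map (%u. mpt P (fillp (TO T1) (length ds) (map (pt XO) cs) u)) (TO T2)"
  using tg outO(1) by (simp add: dom_word_def o_def)
 hence "map (pt SR \<circ> rt) (CodL Ga) = map (%u. mpt R (fillp (TO T1) (length ds') (map (pt XL) cs') u)) (TO T2)"
 proof (rule map_transfer)
  fix e u assume a: "e:set (CodL Ga)" "u:set (TO T2)" "pt Ga e = mpt P (fillp (TO T1) (length ds) (map (pt XO) cs) u)"
  show "(pt SR \<circ> rt) e = mpt R (fillp (TO T1) (length ds') (map (pt XL) cs') u)"
   unfolding o_def by (rule out_eq) (use a Outs_srcE(4) tg_Outp(2)[OF T2] tg_Inp(2)[OF T2] len(2) in auto)
 qed
 thus "TO (canon SR) = map (mpt R) (TO (ctx T1 (canon XL) w T2))"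
  using outL(1) by (simp add: dom_word_def o_def)
 fix z' assume "z':TN (ctx T1 (canon XL) w T2)"
 then consider x where "z' = Inl (Inl x)" "x:TN T1" | y where "z' = Inl (Inr (Inl y))" "y:Nodes La" | z where "z' = Inr z" "z:TN T2"
  by (auto simp: ctx_simps)
 hence "TV (canon SR) (R z') = TV (ctx T1 (canon XL) w T2) z' & TI (canon SR) (R z') = map (mpt R) (TI (ctx T1 (canon XL) w T2) z')"
 proof cases
  case 1
  have m: "Inl (Inl x):TN (ctx T1 (canon XO) w T2)" using 1(2) by (simp add: ctx_simps InlI)
  have "map (pt Ga) (Ins Ga (P (Inl (Inl x)))) = map (%u. mpt P (lowp u)) (TI T1 x)"
   using tg m by (simp add: ctx_simps o_def)
  hence "map (pt SR \<circ> rt) (Ins Ga (P (Inl (Inl x)))) = map (%u. mpt R (lowp u)) (TI T1 x)"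
   by (rule map_transfer) (use low_eq[OF 1(2)] in auto)
  thus ?thesis using tg m 1 by (simp add: ctx_simps o_def)
 next
  case 2
  have "map (pt SR \<circ> Inr) (Ins La y) = map (%g. mpt R (midp (TO T1) (pt XL g))) (Ins La y)"
   using ptL La_node(2)[OF 2(2)] by auto
  thus ?thesis using 2 by (simp add: ctx_simps o_def)
 next
  case 3
  have m: "Inr z:TN (ctx T1 (canon XO) w T2)" using 3(2) by (simp add: ctx_simps InrI)
  have "map (pt Ga) (Ins Ga (P (Inr z))) = map (%u. mpt P (fillp (TO T1) (length ds) (map (pt XO) cs) u)) (TI T2 z)"
   using tg m outO(2)[OF 3(2)] by (simp add: dom_word_def o_def)
  hence "map (pt SR \<circ> rt) (Ins Ga (P (Inr z))) = map (%u. mpt R (fillp (TO T1) (length ds') (map (pt XL) cs') u)) (TI T2 z)"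
  proof (rule map_transfer)
   fix e u assume a: "e:set (Ins Ga (P (Inr z)))" "u:set (TI T2 z)" "pt Ga e = mpt P (fillp (TO T1) (length ds) (map (pt XO) cs) u)"
   show "(pt SR \<circ> rt) e = mpt R (fillp (TO T1) (length ds') (map (pt XL) cs') u)"
    unfolding o_def by (rule out_eq) (use a Outs_srcE(3)[of "P (Inr z)"] Pn(2)[OF 3(2)] tg_Outp(1)[OF T2 3(2)] tg_Inp(1)[OF T2 3(2)] len(2) in auto)
  qed
  thus ?thesis using tg m 3 outL(2)[OF 3(2)] by (simp add: dom_word_def o_def ctx_simps)
 qed
 thus "TV (canon SR) (R z') = TV (ctx T1 (canon XL) w T2) z'" "TI (canon SR) (R z') = map (mpt R) (TI (ctx T1 (canon XL) w T2) z')"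
  by blast+
qed

end

section \<open>Surgery as replacement of a factor\<close>

context surgery
begin

text \<open>The nodes of stratum \<open>0\<close>, and those of stratum at most \<open>1\<close>,
  form down sets. The domain edges of the subgraph start in the first of them or in the domain and
  are consumed beyond it, so \<open>decomp\<close> applies with the subgraph as middle
  factor.\<close>

lemma cut:
 assumes ds: "distinct ds" "set ds = dom_edges Om" and cs: "distinct cs" "set cs = cod_edges Om"
 defines "X == canon (anchor Om ds cs)"
 obtains T1 T2 :: "('n, 's, 'a) tg" and w where "is_tg G T1" "is_tg G T2" "w:lists (Letters G)"
  "tcod G T1 = TD X @ w" "tcod G X @ w = TD T2" "tgiso (ctx_map p) (ctx T1 X w T2) (canon Ga)"
  "!!x. x:TN T1 ==> c x = 0" "!!x. x:TN T2 ==> c x = 2"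
  "!!i. i < length ds ==> TO T1 ! i = pt Ga (q (ds ! i))"
proof -
 let ?T = "canon Ga" let ?X = "anchor Om ds cs"
 interpret X: adiag G ?X by unfold_locales (simp add: anchor_adiagram Om ds cs)
 note T = canon_tg
 define A where "A = {x:Nodes Ga. c x = 0}"
 have ptA: "pt Ga e:avail ?T B <-> (ALL x. Src Ga e = Some x --> x:B)" if "e:Edges Ga" for e B
  using pt_ports(1)[OF that] by (auto simp: avail_def pt_def split: option.splits)
 have Us: "used ?T B = pt Ga ` {e:Edges Ga. EX x:B. Tgt Ga e = Some x}" if "B <= Nodes Ga" for B
  using that node(2) by (force simp: used_def)
 have dn: "down ?T B" if B: "B <= Nodes Ga" "!!e x y. e:Edges Ga ==> Src Ga e = Some x ==> Tgt Ga e = Some y ==> y:B ==> x:B" for B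
  unfolding down_def using B ptA by (auto simp: Us[OF B(1)])
 have A: "down ?T A" by (rule dn) (use c1(5) edge in "force simp: A_def")+
 have AN: "A Un p ` TN X = {x:Nodes Ga. c x <= 1}" using c1(1,4) by (auto simp: A_def X_def NE(1)[symmetric] le_Suc_eq)
 have AN': "down ?T (A Un p ` TN X)" unfolding AN by (rule dn) (use c1(5) edge in "force")+
 define I where "I = map (%d. pt Ga (q d)) ds"
 have dsE: "set ds <= Edges Om" using ds by (auto simp: dom_edges_def)
 have dI: "distinct I" unfolding I_def distinct_map
  using ds(1) dsE qE(2) NE(4) pt_inj by (auto simp: inj_on_def subset_iff)
 have frI: "set I <= frontier ?T A"
 proof
  fix u assume "u:set I"
  then obtain d where d: "d:dom_edges Om" "u = pt Ga (q d)" using ds by (auto simp: I_def)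
  hence dE: "d:Edges Om" "Src Om d = None" by (auto simp: dom_edges_def)
  have "u:avail ?T A" unfolding d(2) ptA[OF qE(2)[OF dE(1)]] using edge_iso(4)[OF dE(1,2)] by (auto simp: A_def)
  moreover have "u ~: used ?T A"
  proof
   assume "u:used ?T A"
   then obtain e x where "e:Edges Ga" "x:A" "Tgt Ga e = Some x" "pt Ga (q d) = pt Ga e" using Us[of A] d by (auto simp: A_def)
   hence "x:A" "Tgt Ga (q d) = Some x" using inj_onD[OF pt_inj, of "q d" e] qE(2)[OF dE(1)] by auto
   thus False using c1(7)[OF qE(1)[OF dE(1)], of x] by (simp add: A_def)
  qed
  ultimately show "u:frontier ?T A" by (simp add: frontier_def)
 qed
 have "finite (frontier ?T A)" unfolding frontier_def avail_def using finite_ports[OF T] by simp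
 then obtain W where W: "set W = frontier ?T A - set I" "distinct W" using finite_distinct_list[of "frontier ?T A - set I"] by auto
 have IW: "distinct (I @ W)" "set (I @ W) = frontier ?T A" using dI W frI by auto
 have Il: "map (pl ?T) I = TD X"
  using dsE pt_ports(2)[OF qE(2)] edge_iso(1) by (auto simp: I_def X_def dom_word_def)
 have emb: "pt Ga (q f) = emb p I (pt ?X f)" if f: "f:Edges Om" for f
 proof (cases "Src Om f")
  case None
  hence d: "f:set ds" using f ds by (simp add: dom_edges_iff)
  have "pt ?X f = Inp (idx ds f)" using None by (simp add: pt_def)
  thus ?thesis using d by (simp add: I_def)
 next
  case (Some y)
  hence y: "y:Nodes Om" using X.edge(1)[of f] f by simp
  moreover have "f:set (Outs Om y)" using X.node(4)[of y] y f Some by simp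
  moreover have "set (Outs Om y) <= Edges Om" using X.node(4)[of y] y by auto
  ultimately show ?thesis using Some edge_iso(2)[OF f Some] node_iso(2)[OF y] idx_map[OF inj_on_subset[OF NE(4)]]
   by (simp add: pt_def)
 qed
 have X: "is_tg G X" unfolding X_def by (rule X.canon_tg)
 have e: "TI ?T (p y) = map (emb p I) (TI X y) & TV ?T (p y) = TV X y" if "y:TN X" for y
 proof -
  have y: "y:Nodes Om" using that by (simp add: X_def)
  hence "set (Ins Om y) <= Edges Om" using X.node(2)[of y] by auto
  thus ?thesis using node_iso(1,3)[OF y] emb by (auto simp: X_def)
 qed
 have pX: "inj_on p (TN X)" "A Int p ` TN X = {}" using NE(2) c1(4)[OF qE(4)] qE(3) by (fastforce simp: X_def A_def)+
 note D = decomp[OF T X A AN' pX IW Il e]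
 let ?J = "map (emb p I) (TO X)"
 show thesis
 proof (rule that)
  note lo = tg_low[OF T A IW] and hi = tg_high[OF T AN' D(2,3)]
  show "is_tg G (lowT ?T A (I @ W))" by (rule lo)
  show "is_tg G (highT ?T (TN ?T - (A Un p ` TN X)) (?J @ W))" by (rule hi)
  have "set W <= ports G ?T" using W by (auto simp: frontier_def avail_def)
  thus "map (pl ?T) W:lists (Letters G)" using plab_Letters[OF fg T] by (auto simp: lists_eq_set subset_iff)
  show "tcod G (lowT ?T A (I @ W)) = TD X @ map (pl ?T) W" using lo(2) Il by simp
  show "tcod G X @ map (pl ?T) W = TD (highT ?T (TN ?T - (A Un p ` TN X)) (?J @ W))" using D(4) by simp
  show "tgiso (ctx_map p) (ctx (lowT ?T A (I @ W)) X (map (pl ?T) W) (highT ?T (TN ?T - (A Un p ` TN X)) (?J @ W))) ?T" by (rule D(1))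
  show "x:TN (lowT ?T A (I @ W)) ==> c x = 0" for x by (simp add: A_def)
  show "x:TN (highT ?T (TN ?T - (A Un p ` TN X)) (?J @ W)) ==> c x = 2" for x
   unfolding AN using c1(3)[of x] by auto
  show "i < length ds ==> TO (lowT ?T A (I @ W)) ! i = pt Ga (q (ds ! i))" for i
   by (simp add: I_def nth_append)
 qed
qed

lemma surgery_ctx:
 assumes ds: "distinct ds" "set ds = dom_edges Om" and cs: "distinct cs" "set cs = cod_edges Om"
  and ds': "map al ds' = ds" "distinct ds'" "set ds' = dom_edges La" and cs': "map be cs' = cs" "distinct cs'" "set cs' = cod_edges La"
 shows "EX A B w. A:Arr DC & B:Arr DC & w:Obj DC & Cod DC A = dom_word (anchor Om ds cs) @ w & Dom DC B = cod_word (anchor Om ds cs) @ w &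
  icls Ga = B **. (cls G (canon (anchor Om ds cs)) ##. Idn DC w) **. A &
  icls SR = B **. (cls G (canon (anchor La ds' cs')) ##. Idn DC w) **. A"
proof -
 let ?XO = "anchor Om ds cs" and ?XL = "anchor La ds' cs'"
 interpret XO: adiag G ?XO by unfold_locales (simp add: anchor_adiagram Om ds cs)
 interpret XL: adiag G ?XL by unfold_locales (simp add: anchor_adiagram La ds' cs')
 interpret SR: adiag G SR by unfold_locales (rule SR_valid)
 obtain T1 T2 :: "('n, 's, 'a) tg" and w where T: "is_tg G T1" "is_tg G T2" "w:lists (Letters G)"
  "tcod G T1 = TD (canon ?XO) @ w" "tcod G (canon ?XO) @ w = TD T2" "tgiso (ctx_map p) (ctx T1 (canon ?XO) w T2) (canon Ga)"
  and c: "!!x. x:TN T1 ==> c x = 0" "!!x. x:TN T2 ==> c x = 2"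
  and TO: "!!i. i < length ds ==> TO T1 ! i = pt Ga (q (ds ! i))" using cut[OF ds cs] by metis
 have l: "length (TO T1) = length ds + length w" "length (TD T2) = length cs + length w"
  using arg_cong[OF T(4), of length] arg_cong[OF T(5), of length] length_tcod[of G T1] length_tcod[of G "canon ?XO"]
  by (simp_all add: dom_word_def)
 interpret replacement G Ga N E c Om La al be p q T1 T2 w ds cs ds' cs' "ctx_map p"
  by unfold_locales (use T l c TO ds cs ds' cs' in "simp_all add: lowp_def port.map_comp o_def port.map_ident")
 have TD: "TD (canon ?XL) = TD (canon ?XO)" using ds'(3) al(2) by (auto simp: dom_word_def simp flip: ds'(1))
 have tc: "tcod G (canon ?XL) = tcod G (canon ?XO)"
  unfolding XO.tcod_canon XL.tcod_canon cod_word_def using cs'(3) be(2) by (auto simp flip: cs'(1))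
 note cO = ctx_cls[OF T(1) XO.canon_tg T(2,3,4,5)]
 note cL = ctx_cls[OF T(1) XL.canon_tg T(2,3), unfolded TD tc, OF T(4,5)]
 have "icls Ga = cls G (ctx T1 (canon ?XO) w T2)"
  using cls_eqI[OF _ cO(1)] T(6) iso_class_cls[OF ad] by (metis tgeq_def)
 moreover have "icls SR = cls G (ctx T1 (canon ?XL) w T2)"
  using cls_eqI[OF _ cL(1)] replaced iso_class_cls[OF SR_valid] by (metis tgeq_def)
 ultimately show ?thesis using cO(2) cL(2) T Arr_cls[OF T(1)] Arr_cls[OF T(2)] XO.tcod_canon
  by (rule_tac exI[of _ "cls G T1"], rule_tac exI[of _ "cls G T2"], rule_tac exI[of _ w]) (simp add: Dom_cls DC_simps(1))
qed

end

section \<open>From a factor of a composite to a normal subgraph\<close>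

locale embedded = fgm G + adiag G Ga
 for G :: "('s, 'a, 'z) graph_monoid_scheme" and Ga :: "('n, 'e, 's, 'a) adiagram" +
 fixes Om :: "('k, 'f, 's, 'a) diagram" and ds cs :: "'f list" and w :: "'s list"
  and T1 :: "('n1, 's, 'a) tg" and T2 :: "('n2, 's, 'a) tg" and P :: "('n1 + ('k + nat)) + 'n2 => 'n"
 assumes XO: "is_adiagram G (anchor Om ds cs)" and T1: "is_tg G T1" and T2: "is_tg G T2"
  and T1_cod: "tcod G T1 = dom_word (anchor Om ds cs) @ w"
  and len: "length (TO T1) = length ds + length w" "length (TD T2) = length cs + length w"
  and P: "tgiso P (ctx T1 (canon (anchor Om ds cs)) w T2) (canon Ga)"
begin

abbreviation "XO == anchor Om ds cs"
abbreviation "K == ctx T1 (canon XO) w T2"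

sublocale XO: adiag G XO by unfold_locales (rule XO)

lemma bP: "bij_betw P (TN K) (Nodes Ga)" "inj_on P (TN K)" "P ` TN K = Nodes Ga"
 using P by (auto simp: tgiso_def bij_betw_def)

lemma K_node: "x:TN T1 ==> Inl (Inl x):TN K" "y:Nodes Om ==> Inl (Inr (Inl y)):TN K" "z:TN T2 ==> Inr z:TN K"
 by (simp_all add: ctx_simps InlI InrI)

lemma node_cases:
 assumes "x:Nodes Ga"
 obtains t where "x = P (Inl (Inl t))" "t:TN T1" | y where "x = P (Inl (Inr (Inl y)))" "y:Nodes Om" | t where "x = P (Inr t)" "t:TN T2"
proof -
 obtain z where z: "x = P z" "z:TN K" using assms bP(3) by blast
 from z(2) show thesis unfolding ctx_simps by (elim PlusE) (use that z(1) in auto)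
qed

definition "pe y = P (Inl (Inr (Inl y)))"
definition "Ne = pe ` Nodes Om"
text \<open>A term graph does not name its edges, so the copy of \<open>f\<close> in
  \<open>Ga\<close> is found through its port.\<close>

definition "qe f = inv_into (Edges Ga) (pt Ga) (mpt P (midp (TO T1) (pt XO f)))"
definition "Ee = qe ` Edges Om"
definition "ce x = (if EX t:TN T1. x = P (Inl (Inl t)) then 0 else if x:Ne then 1 else (2::nat))"

lemma ce: "t:TN T1 ==> ce (P (Inl (Inl t))) = 0" "y:Nodes Om ==> ce (pe y) = 1" "z:TN T2 ==> ce (P (Inr z)) = 2"
proof -
 show "t:TN T1 ==> ce (P (Inl (Inl t))) = 0" by (auto simp: ce_def)
 assume y: "y:Nodes Om"
 hence "\<not> (EX t:TN T1. pe y = P (Inl (Inl t)))" unfolding pe_def using inj_onD[OF bP(2)] K_node by blast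
 thus "ce (pe y) = 1" using y by (auto simp: ce_def Ne_def)
next
 assume z: "z:TN T2"
 hence "\<not> (EX t:TN T1. P (Inr z) = P (Inl (Inl t)))" "P (Inr z) ~: Ne"
  unfolding Ne_def pe_def using inj_onD[OF bP(2)] K_node by blast+
 thus "ce (P (Inr z)) = 2" by (auto simp: ce_def)
qed

lemma T1_out: "l < length (TO T1) ==> TO T1 ! l:ports G T1"
 using tg_glob(4)[OF T1] nth_mem[of l "TO T1"] by blast

lemma lowp_ports: "u:ports G T1 ==> lowp u:ports G K"
 by (cases u) (auto simp: ctx_simps)

lemma midp_ports: "v:ports G (canon XO) ==> midp (TO T1) v:ports G K"
 using lowp_ports[OF T1_out] len by (cases v) (auto simp: ctx_simps dom_word_def)

lemma ports_bij: "bij_betw (mpt P) (ports G K) (ports G (canon Ga))"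
 by (rule ports_iso[OF P])

lemma qe:
 assumes f: "f:Edges Om"
 shows "qe f:Edges Ga" "pt Ga (qe f) = mpt P (midp (TO T1) (pt XO f))"
proof -
 have "midp (TO T1) (pt XO f):ports G K" by (rule midp_ports) (use XO.pt_ports(1)[of f] f in simp)
 hence "mpt P (midp (TO T1) (pt XO f)):pt Ga ` Edges Ga" unfolding pt_image by (rule bij_betw_apply[OF ports_bij])
 thus "qe f:Edges Ga" "pt Ga (qe f) = mpt P (midp (TO T1) (pt XO f))"
  unfolding qe_def by (auto intro: inv_into_into f_inv_into_f)
qed

lemma P_inj: "u:ports G K ==> v:ports G K ==> mpt P u = mpt P v ==> u = v"
 using ports_bij by (auto simp: bij_betw_def dest: inj_onD)

lemma qe_inj: "inj_on qe (Edges Om)"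
proof (rule inj_onI)
 fix f g assume f: "f:Edges Om" and g: "g:Edges Om" and "qe f = qe g"
 hence "mpt P (midp (TO T1) (pt XO f)) = mpt P (midp (TO T1) (pt XO g))" using qe(2) by metis
 hence "midp (TO T1) (pt XO f) = (midp (TO T1) (pt XO g) :: (('n1 + ('k + nat)) + 'n2) port)"
  by (intro P_inj midp_ports) (use f g XO.pt_ports(1) in simp_all)
 hence "pt XO f = pt XO g"
 proof (rule midp_inj[OF _ tg_glob(3)[OF T1]])
  have "Inp i:ports G (canon XO) ==> i < length (TO T1)" for i using len by (simp add: dom_word_def)
  thus "pt XO f = Inp i ==> i < length (TO T1)" "pt XO g = Inp i ==> i < length (TO T1)" for i
   using XO.pt_ports(1)[of f] XO.pt_ports(1)[of g] f g by simp_all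
 qed
 thus "f = g" using XO.pt_inj f g by (auto dest: inj_onD)
qed

lemma eqI: "set es <= Edges Ga ==> set fs <= Edges Ga ==> map (pt Ga) es = map (pt Ga) fs ==> es = fs"
 using pt_inj by (meson inj_on_map_eq_map inj_on_subset le_sup_iff)

lemma node_emb:
 assumes y: "y:Nodes Om"
 shows "pe y:Nodes Ga" "Ins Ga (pe y) = map qe (Ins Om y)" "Outs Ga (pe y) = map qe (Outs Om y)" "NVal Ga (pe y) = NVal Om y"
proof -
 show n: "pe y:Nodes Ga" unfolding pe_def by (rule bij_betw_apply[OF bP(1) K_node(2)[OF y]])
 have i: "NVal Ga (pe y) = NVal Om y & map (pt Ga) (Ins Ga (pe y)) = map (mpt P) (map (midp (TO T1)) (map (pt XO) (Ins Om y)))"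
  using P K_node(2)[OF y] unfolding tgiso_def pe_def by (simp add: ctx_simps)
 thus nv: "NVal Ga (pe y) = NVal Om y" by blast
 have sub: "set (Ins Om y) <= Edges Om" "set (Outs Om y) <= Edges Om" using XO.sub_edges y by simp_all
 show "Ins Ga (pe y) = map qe (Ins Om y)"
  by (rule eqI) (use sub_edges(1)[OF n] sub qe i in auto)
 show "Outs Ga (pe y) = map qe (Outs Om y)"
 proof (rule eqI)
  have "map (pt Ga) (map qe (Outs Om y)) = map (%f. mpt P (midp (TO T1) (pt XO f))) (Outs Om y)"
   using sub qe by auto
  also have "... = map (mpt P) (map (midp (TO T1)) (map (pt XO) (Outs XO y)))" by simp
  also have "... = outports G (canon Ga) (pe y)" using XO.map_pt(2)[of y] y nv by (simp add: outports_def pe_def)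
  finally show "map (pt Ga) (Outs Ga (pe y)) = map (pt Ga) (map qe (Outs Om y))" using map_pt(2)[OF n] by simp
 qed (use sub_edges(2)[OF n] sub qe in auto)
qed

lemma pt_Src: "pt Ga e = Inp i ==> Src Ga e = None" "pt Ga e = Outp x j ==> Src Ga e = Some x"
 by (auto simp: pt_def split: option.splits)

lemma src_emb:
 assumes f: "f:Edges Om"
 shows "Src Om f = Some y ==> Src Ga (qe f) = Some (pe y)"
  "Src Om f = None ==> Src Ga (qe f) = Some x ==> ce x = 0"
proof -
 assume "Src Om f = Some y"
 hence "pt Ga (qe f) = Outp (pe y) (idx (Outs Om y) f)" using qe(2)[OF f] by (simp add: pt_def[of XO] pe_def)
 thus "Src Ga (qe f) = Some (pe y)" by (rule pt_Src)
next
 assume n: "Src Om f = None" and s: "Src Ga (qe f) = Some x"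
 hence d: "idx ds f < length (TO T1)" using XO.anc(2) f len idx_less[of f ds] by (simp add: trans_less_add1)
 have p: "pt Ga (qe f) = mpt P (lowp (TO T1 ! idx ds f))" using qe(2)[OF f] n by (simp add: pt_def[of XO])
 show "ce x = 0"
 proof (cases "TO T1 ! idx ds f")
  case (Inp i)
  thus ?thesis using p s pt_Src(1) by simp
 next
  case (Outp t j)
  hence "t:TN T1" using T1_out[OF d] by simp
  moreover have "x = P (Inl (Inl t))" using p s Outp pt_Src(2) by simp
  ultimately show ?thesis using ce(1) by simp
 qed
qed

lemma tgt_low:
 assumes "t:TN T1" "Tgt Ga e = Some (P (Inl (Inl t)))" "e:Edges Ga"
 obtains u where "u:set (TI T1 t)" "u:ports G T1" "pt Ga e = mpt P (lowp u)"
proof -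
 have "e:set (Ins Ga (P (Inl (Inl t))))" using node(2)[OF bij_betw_apply[OF bP(1) K_node(1)[OF assms(1)]]] assms by simp
 moreover have "map (pt Ga) (Ins Ga (P (Inl (Inl t)))) = map (mpt P) (map lowp (TI T1 t))"
  using P K_node(1)[OF assms(1)] unfolding tgiso_def by (simp add: ctx_simps)
 ultimately have "pt Ga e:set (map (mpt P) (map lowp (TI T1 t)))" by (metis image_eqI list.set_map)
 then obtain u where "u:set (TI T1 t)" "pt Ga e = mpt P (lowp u)" by auto
 moreover from this have "u:ports G T1" using tg_ports(1)[OF T1 assms(1)] by blast
 ultimately show thesis using that by blast
qed

lemma tgt_mid:
 assumes "y:Nodes Om" "Tgt Ga e = Some (pe y)" "e:Edges Ga"
 obtains f where "f:Edges Om" "Tgt Om f = Some y" "e = qe f"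
 using node(2)[OF node_emb(1)[OF assms(1)]] node_emb(2)[OF assms(1)] XO.node(2)[of y] assms that by auto

text \<open>Were an outgoing edge of \<open>Om\<close> to end at a node of \<open>T1\<close>, its
  port would lie in \<open>T1\<close> and be both an input of that node and a member of
  \<open>TO T1\<close>, but every edge is consumed only once.\<close>

lemma tgt_emb:
 assumes f: "f:Edges Om"
 shows "Tgt Om f = Some y ==> Tgt Ga (qe f) = Some (pe y)"
  "Tgt Om f = None ==> Tgt Ga (qe f) = Some x ==> ce x = 2"
proof -
 assume t: "Tgt Om f = Some y"
 hence y: "y:Nodes Om" using XO.edge(2)[of f] f by simp
 hence "f:set (Ins Om y)" using XO.node(2)[of y] t f by simp
 hence "qe f:set (Ins Ga (pe y))" using node_emb(2)[OF y] by simp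
 thus "Tgt Ga (qe f) = Some (pe y)" using node(2)[OF node_emb(1)[OF y]] by simp
next
 assume n: "Tgt Om f = None" and s: "Tgt Ga (qe f) = Some x"
 have x: "x:Nodes Ga" using edge(2)[OF qe(1)[OF f]] s by simp
 thus "ce x = 2"
 proof (cases rule: node_cases)
  case (1 t)
  obtain u where u: "u:set (TI T1 t)" "u:ports G T1" "pt Ga (qe f) = mpt P (lowp u)"
   by (rule tgt_low[OF 1(2) s[unfolded 1(1)] qe(1)[OF f]])
  have eq: "midp (TO T1) (pt XO f) = (lowp u :: (('n1 + ('k + nat)) + 'n2) port)"
  proof (rule P_inj)
   show "midp (TO T1) (pt XO f):ports G K" by (rule midp_ports) (use XO.pt_ports(1)[of f] f in simp)
   show "lowp u:ports G K" by (rule lowp_ports[OF u(2)])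
   show "mpt P (midp (TO T1) (pt XO f)) = mpt P (lowp u)" using u(3) qe(2)[OF f] by metis
  qed
  have False
  proof (cases "pt XO f")
   case (Inp i)
   hence "i < length (TO T1)" using XO.pt_ports(1)[of f] f len by (simp add: dom_word_def)
   hence "u:set (TO T1)" using eq Inp by auto
   thus False using tg_node(4)[OF T1 1(2)] u(1) by blast
  next
   case (Outp z j)
   thus False using eq by (cases u) auto
  qed
  thus ?thesis ..
 next
  case (2 y)
  obtain g where g: "g:Edges Om" "Tgt Om g = Some y" "qe f = qe g"
   by (rule tgt_mid[OF 2(2) s[unfolded 2(1), folded pe_def] qe(1)[OF f]])
  have "f = g" by (rule inj_onD[OF qe_inj g(3) f g(1)])
  thus ?thesis using g(2) n by simp
 next
  case 3
  thus ?thesis using ce(3) by simp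
 qed
qed

lemma Ne_iff: "x:Nodes Ga ==> ce x <= 2 & (ce x = 1 <-> x:Ne)"
proof -
 assume "x:Nodes Ga"
 thus ?thesis
 proof (cases rule: node_cases)
  case (1 t)
  have "x ~: Ne" using ce(1)[OF 1(2)] ce(2) 1(1) by (auto simp: Ne_def)
  thus ?thesis using ce(1)[OF 1(2)] 1(1) by simp
 next
  case (2 y)
  thus ?thesis using ce(2)[OF 2(2)] by (auto simp: Ne_def pe_def)
 next
  case (3 z)
  have "x ~: Ne" using ce(3)[OF 3(2)] ce(2) 3(1) by (auto simp: Ne_def)
  thus ?thesis using ce(3)[OF 3(2)] 3(1) by simp
 qed
qed

lemma src_le: "f:Edges Om ==> Src Ga (qe f) = Some x ==> ce x <= 1"
proof (cases "Src Om f")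
 case (Some y)
 moreover assume "f:Edges Om" "Src Ga (qe f) = Some x"
 ultimately show ?thesis using src_emb(1)[of f y] ce(2)[of y] XO.edge(1)[of f y] by simp
qed (use src_emb(2) in fastforce)

lemma tgt_ge: "f:Edges Om ==> Tgt Ga (qe f) = Some x ==> 1 <= ce x"
proof (cases "Tgt Om f")
 case (Some y)
 moreover assume "f:Edges Om" "Tgt Ga (qe f) = Some x"
 ultimately show ?thesis using tgt_emb(1)[of f y] ce(2)[of y] XO.edge(2)[of f y] by simp
qed (use tgt_emb(2) in fastforce)

text \<open>The layers of the composite are the strata; normality of the copy then comes from
  \<open>strat_normal\<close>.\<close>

lemma strat_emb: "strat Ga Ne Ee ce"
 unfolding strat_def
proof (intro conjI ballI allI impI)
 show "Ne <= Nodes Ga" "Ee <= Edges Ga" using node_emb(1) qe(1) by (auto simp: Ne_def Ee_def)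
 show "x:Nodes Ga ==> ce x <= 2" "x:Nodes Ga ==> (ce x = 1) = (x:Ne)" for x using Ne_iff by auto
 show "e:Ee ==> Src Ga e = Some x ==> ce x <= 1" "e:Ee ==> Tgt Ga e = Some x ==> 1 <= ce x" for e x
  using src_le tgt_ge by (auto simp: Ee_def)
 show "e:Ee" if e: "e:Edges Ga" "x:Ne" "Src Ga e = Some x \<or> Tgt Ga e = Some x" for e x
 proof -
  obtain y where y: "y:Nodes Om" "x = pe y" using e(2) by (auto simp: Ne_def)
  have "e:set (Outs Ga x) Un set (Ins Ga x)" using e y node_emb(1)[OF y(1)] node(2,4) by auto
  thus ?thesis using node_emb(2,3)[OF y(1)] y XO.sub_edges(1,2)[of y] by (auto simp: Ee_def)
 qed
 fix e x y assume e: "e:Edges Ga" and x: "Src Ga e = Some x" and y: "Tgt Ga e = Some y"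
 have yN: "y:Nodes Ga" and xN: "x:Nodes Ga" using edge(1,2)[OF e] x y by blast+
 from yN show "ce x <= ce y"
 proof (cases rule: node_cases)
  case (1 t)
  obtain u where u: "u:ports G T1" "pt Ga e = mpt P (lowp u)" using tgt_low[OF 1(2) y[unfolded 1(1)] e] by metis
  thus ?thesis using x pt_Src ce(1) by (cases u) fastforce+
 next
  case (2 z)
  obtain f where "f:Edges Om" "e = qe f" using tgt_mid[OF 2(2) y[unfolded 2(1), folded pe_def] e] by metis
  thus ?thesis using src_le[of f x] x ce(2)[OF 2(2)] 2(1) by (simp add: pe_def)
 next
  case (3 z)
  thus ?thesis using ce(3)[OF 3(2)] Ne_iff[OF xN] by simp
 qed
qed

lemma iso_emb: "diagram_iso Om (subdiagram Ga Ne Ee) pe qe"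
 unfolding diagram_iso_def
proof (intro conjI ballI)
 have "inj_on pe (Nodes Om)" by (rule inj_onI) (use K_node(2) inj_onD[OF bP(2)] in "force simp: pe_def")
 thus "bij_betw pe (Nodes Om) (Nodes (subdiagram Ga Ne Ee))" by (simp add: bij_betw_def Ne_def subdiagram_def)
 show "bij_betw qe (Edges Om) (Edges (subdiagram Ga Ne Ee))" using qe_inj by (simp add: bij_betw_def Ee_def subdiagram_def)
 fix f assume f: "f:Edges Om"
 have c: "x:Ne ==> ce x = 1" for x using ce(2) by (auto simp: Ne_def)
 show "Src (subdiagram Ga Ne Ee) (qe f) = map_option pe (Src Om f)"
 proof (cases "Src Om f")
  case None
  thus ?thesis using src_emb(2)[OF f] c by (force simp: subdiagram_def split: option.split)
 next
  case (Some y)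
  thus ?thesis using src_emb(1)[OF f Some] XO.edge(1)[of f y] f by (simp add: subdiagram_def Ne_def)
 qed
 show "Tgt (subdiagram Ga Ne Ee) (qe f) = map_option pe (Tgt Om f)"
 proof (cases "Tgt Om f")
  case None
  thus ?thesis using tgt_emb(2)[OF f] c by (force simp: subdiagram_def split: option.split)
 next
  case (Some y)
  thus ?thesis using tgt_emb(1)[OF f Some] XO.edge(2)[of f y] f by (simp add: subdiagram_def Ne_def)
 qed
 show "EVal (subdiagram Ga Ne Ee) (qe f) = EVal Om f"
 proof (cases "pt XO f")
  case (Outp y j)
  have y: "Outp y j:ports G (canon XO)" "pl (canon XO) (Outp y j) = EVal Om f" using XO.pt_ports[of f] f Outp by simp_all
  thus ?thesis using pt_ports(2)[OF qe(1)[OF f]] qe(2)[OF f] Outp node_emb(4)[of y] by (simp add: subdiagram_def pe_def)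
 next
  case (Inp i)
  have i: "i < length ds" using XO.pt_ports(1)[of f] f Inp by (simp add: dom_word_def)
  \<comment> \<open>For an edge without a source node in \<open>Om\<close> the letter is visible
    only at the codomain of \<open>T1\<close>, which \<open>T1_cod\<close> compares with the domain
    word of the factor.\<close>
  have "plab G (canon Ga) (pt Ga (qe f)) = plab G K (midp (TO T1) (pt XO f))"
   unfolding qe(2)[OF f] by (rule plab_iso[OF P]) (use XO.pt_ports(1)[of f] f midp_ports in simp)
  also have "... = plab G K (lowp (TO T1 ! i))" by (simp add: Inp)
  also have "... = plab G T1 (TO T1 ! i)"
   using T1_out[of i] i len by (cases "TO T1 ! i") (auto simp: ctx_simps)
  also have "... = tcod G T1 ! i" using i len by (simp add: tcod_def)
  also have "... = plab G (canon XO) (pt XO f)" using i by (simp add: Inp T1_cod nth_append dom_word_def)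
  also have "... = EVal Om f" using XO.pt_ports(2)[of f] f by simp
  finally show ?thesis using pt_ports(2)[OF qe(1)[OF f]] by (simp add: subdiagram_def)
 qed
next
 fix y assume y: "y:Nodes Om"
 have "filter (%e. e:Ee) (map qe es) = map qe es" if "set es <= Edges Om" for es
  by (rule filter_True) (use that in "auto simp: Ee_def")
 thus "Ins (subdiagram Ga Ne Ee) (pe y) = map qe (Ins Om y)" "Outs (subdiagram Ga Ne Ee) (pe y) = map qe (Outs Om y)"
  "NVal (subdiagram Ga Ne Ee) (pe y) = NVal Om y"
  using XO.sub_edges(1,2)[of y] node_emb[OF y] y by (simp_all add: subdiagram_def)
qed

end

text \<open>A template is not anchored; ordering its ends compatibly with \<open>al\<close> and
  \<open>be\<close> makes its two sides parallel arrows of the diagram category.\<close>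

definition tpl_lists :: "('s, 'a, 'z) graph_monoid_scheme => ('s, 'a) template => nat list => nat list => nat list => nat list => bool" where
 "tpl_lists G = (%(Om, La, al, be) ds cs ds' cs'. is_template G (Om, La, al, be) &
   distinct ds & set ds = dom_edges Om & distinct cs & set cs = cod_edges Om &
   distinct ds' & set ds' = dom_edges La & distinct cs' & set cs' = cod_edges La & map al ds' = ds & map be cs' = cs)"

lemma tpl_lists_swap:
 assumes "tpl_lists G t ds cs ds' cs'"
 shows "tpl_lists G (swap_template t) ds' cs' ds cs"
proof -
 obtain Om La al be where t: "t = (Om, La, al, be)" by (cases t) auto
 note a = assms[unfolded t tpl_lists_def is_template_def, simplified]
 have ba: "bij_betw al (dom_edges La) (dom_edges Om)" and bb: "bij_betw be (cod_edges La) (cod_edges Om)" using a by auto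
 have da: "map (inv_into (dom_edges La) al) (map al ds') = ds'"
  using a bij_betw_inv_into_left[OF ba] by (auto intro!: map_idI)
 have db: "map (inv_into (cod_edges La) be) (map be cs') = cs'"
  using a bij_betw_inv_into_left[OF bb] by (auto intro!: map_idI)
 have va: "EVal La (inv_into (dom_edges La) al e) = EVal Om e" if e: "e:dom_edges Om" for e
  using a bij_betw_apply[OF bij_betw_inv_into[OF ba] e] bij_betw_inv_into_right[OF ba e] by metis
 have vb: "EVal La (inv_into (cod_edges La) be e) = EVal Om e" if e: "e:cod_edges Om" for e
  using a bij_betw_apply[OF bij_betw_inv_into[OF bb] e] bij_betw_inv_into_right[OF bb e] by metis
 show ?thesis unfolding t swap_template_def tpl_lists_def is_template_def prod.case
  using a da db va vb bij_betw_inv_into[OF ba] bij_betw_inv_into[OF bb] by auto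
qed

section \<open>Surgery steps as rewriting of arrows\<close>

context fgm
begin

text \<open>The idle wires \<open>w\<close> stand on the right only; a factor elsewhere is brought
  to the left by symmetries that belong to \<open>f\<close> and \<open>g\<close>.\<close>

definition rewriting :: "('s, 'a) iso_class => ('s, 'a) iso_class => ('s, 'a) iso_class => ('s, 'a) iso_class => bool" where
 "rewriting l r A B <-> (EX f g w. f:Arr DC & g:Arr DC & w:Obj DC & Cod DC f = Dom DC l @ w & Dom DC g = Cod DC l @ w &
   A = g **. (l ##. Idn DC w) **. f & B = g **. (r ##. Idn DC w) **. f)"

lemma tpl_adiagram:
 assumes "tpl_lists G (Om, La, al, be) ds cs ds' cs'"
 shows "is_adiagram G (anchor Om ds cs)" "is_adiagram G (anchor La ds' cs')"
  "dom_word (anchor La ds' cs') = dom_word (anchor Om ds cs)" "cod_word (anchor La ds' cs') = cod_word (anchor Om ds cs)"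
 using assms by (auto simp: tpl_lists_def is_template_def anchor_adiagram dom_word_def cod_word_def)

lemma tpl_cls:
 assumes "tpl_lists G (Om, La, al, be) ds cs ds' cs'"
 shows "icls (anchor Om ds cs):Arr DC" "icls (anchor La ds' cs'):Arr DC"
  "Dom DC (icls (anchor Om ds cs)) = dom_word (anchor Om ds cs)" "Cod DC (icls (anchor Om ds cs)) = cod_word (anchor Om ds cs)"
  "Dom DC (icls (anchor La ds' cs')) = dom_word (anchor Om ds cs)" "Cod DC (icls (anchor La ds' cs')) = cod_word (anchor Om ds cs)"
proof -
 note v = tpl_adiagram[OF assms]
 interpret XO: adiag G "anchor Om ds cs" by unfold_locales (rule v)
 interpret XL: adiag G "anchor La ds' cs'" by unfold_locales (rule v)
 note c = iso_class_cls[OF v(1)] iso_class_cls[OF v(2)]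
 show "icls (anchor Om ds cs):Arr DC" "icls (anchor La ds' cs'):Arr DC"
  "Dom DC (icls (anchor Om ds cs)) = dom_word (anchor Om ds cs)" "Cod DC (icls (anchor Om ds cs)) = cod_word (anchor Om ds cs)"
  "Dom DC (icls (anchor La ds' cs')) = dom_word (anchor Om ds cs)" "Cod DC (icls (anchor La ds' cs')) = cod_word (anchor Om ds cs)"
  unfolding c using XO.canon_tg XL.canon_tg XO.tcod_canon XL.tcod_canon v(3,4) Arr_cls[OF XO.canon_tg] Arr_cls[OF XL.canon_tg]
  by simp_all
qed

text \<open>A surgery fixes no order on the ends of its template, so the statement covers all
  compatible orders at once. The composite comes from cutting along the strata that
  \<open>normal_strat\<close> provides.\<close>

theorem surgery_step_rewriting:
 assumes "surgery_step G T Ga Up"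
 shows "EX Om La al be. (Om, La, al, be):T & is_template G (Om, La, al, be) & (ALL ds cs ds' cs'. tpl_lists G (Om, La, al, be) ds cs ds' cs' -->
  rewriting (icls (anchor Om ds cs)) (icls (anchor La ds' cs')) (icls Ga) (icls Up))"
proof -
 obtain Om La al be N E p q where av: "is_adiagram G Ga" "is_adiagram G Up" and t: "(Om, La, al, be):T" "is_template G (Om, La, al, be)"
  and n: "normal_subgraph Ga N E" and i: "diagram_iso Om (subdiagram Ga N E) p q"
  and sr: "adiagram_isomorphic (surgery_result Ga N E q La al be) Up"
  using assms unfolding surgery_step_def by auto
 obtain c where st: "strat Ga N E c" using normal_strat[OF n av(1)] by blast
 interpret surgery G Ga N E c Om La al be p q
  by unfold_locales (use av st i t in "simp_all add: is_template_def")
 have SRU: "icls SR = icls Up"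
 proof -
  obtain p' q' where j: "diagram_iso SR Up p' q'" "DomL Up = map q' (DomL SR)" "CodL Up = map q' (CodL SR)"
   using sr by (auto simp: adiagram_isomorphic_def SR_def)
  have "canon SR \<simeq> canon Up" using adiagram_iso_canon[OF j SR_valid] by (auto simp: tgeq_def)
  thus ?thesis using iso_class_cls[OF SR_valid] iso_class_cls[OF av(2)] cls_eqI adiag.canon_tg[of G SR] SR_valid
   by (simp add: adiag_def)
 qed
 have "rewriting (icls (anchor Om ds cs)) (icls (anchor La ds' cs')) (icls Ga) (icls Up)"
  if l: "tpl_lists G (Om, La, al, be) ds cs ds' cs'" for ds cs ds' cs'
 proof -
  note ll = l[unfolded tpl_lists_def prod.case]
  obtain A B w where "A:Arr DC" "B:Arr DC" "w:Obj DC" "Cod DC A = dom_word (anchor Om ds cs) @ w" "Dom DC B = cod_word (anchor Om ds cs) @ w"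
   "icls Ga = B **. (cls G (canon (anchor Om ds cs)) ##. Idn DC w) **. A"
   "icls SR = B **. (cls G (canon (anchor La ds' cs')) ##. Idn DC w) **. A"
   using surgery_ctx[of ds cs ds' cs'] ll by blast
  thus ?thesis unfolding rewriting_def tpl_cls[OF l] iso_class_cls[OF tpl_adiagram(1)[OF l], symmetric]
    iso_class_cls[OF tpl_adiagram(2)[OF l], symmetric] SRU[symmetric] by blast
 qed
 thus ?thesis using t by blast
qed

text \<open>The factor marks a subgraph of \<open>Ga\<close>, normal by \<open>strat_emb\<close>.
  Surgery there produces the composite with the other side of the template, hence a diagram
  isomorphic to \<open>Up\<close>.\<close>

theorem rewriting_surgery_step:
 fixes Ga Up :: "(nat, nat, 's, 'a) adiagram"
 assumes av: "is_adiagram G Ga" "is_adiagram G Up" and t: "(Om, La, al, be):T" and l: "tpl_lists G (Om, La, al, be) ds cs ds' cs'"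
  and rw: "rewriting (icls (anchor Om ds cs)) (icls (anchor La ds' cs')) (icls Ga) (icls Up)"
 shows "surgery_step G T Ga Up"
proof -
 let ?XO = "anchor Om ds cs" and ?XL = "anchor La ds' cs'"
 note ll = l[unfolded tpl_lists_def prod.case] and v = tpl_adiagram[OF l]
 interpret XO: adiag G ?XO by unfold_locales (rule v)
 interpret XL: adiag G ?XL by unfold_locales (rule v)
 obtain f g w where A: "f:Arr DC" "g:Arr DC" "w:Obj DC" "Cod DC f = dom_word ?XO @ w" "Dom DC g = cod_word ?XO @ w"
  and e: "icls Ga = g **. (icls ?XO ##. Idn DC w) **. f"
   "icls Up = g **. (icls ?XL ##. Idn DC w) **. f"
  using rw unfolding rewriting_def tpl_cls[OF l] by blast
 obtain T1 :: "(nat, 's, 'a) tg" where U1: "is_tg G T1" "f = cls G T1" using A(1) by (rule ArrE)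
 obtain T2 :: "(nat, 's, 'a) tg" where U2: "is_tg G T2" "g = cls G T2" using A(2) by (rule ArrE)
 have w: "w:lists (Letters G)" using A(3) by (simp add: DC_simps(1))
 have c1: "tcod G T1 = dom_word ?XO @ w" and c2: "TD T2 = cod_word ?XO @ w" using A(4,5) U1 U2 by simp_all
 have tO: "tcod G T1 = TD (canon ?XO) @ w" "tcod G (canon ?XO) @ w = TD T2" using c1 c2 by (simp_all add: XO.tcod_canon)
 have tL: "tcod G T1 = TD (canon ?XL) @ w" "tcod G (canon ?XL) @ w = TD T2" using c1 c2 v(3,4) by (simp_all add: XL.tcod_canon)
 note cO = ctx_cls[OF U1(1) XO.canon_tg U2(1) w tO] and cL = ctx_cls[OF U1(1) XL.canon_tg U2(1) w tL]
 have "cls G (ctx T1 (canon ?XO) w T2) = cls G (canon Ga)"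
  using e(1) cO(2) U1(2) U2(2) iso_class_cls[OF v(1)] iso_class_cls[OF av(1)] by simp
 hence "ctx T1 (canon ?XO) w T2 \<simeq> canon Ga" using cls_eqD[OF _ fg cO(1)] adiag.canon_tg[of G Ga] av(1) unfolding adiag_def by blast
 then obtain P where PP: "tgiso P (ctx T1 (canon ?XO) w T2) (canon Ga)" by (auto simp: tgeq_def)
 have le: "length (TO T1) = length ds + length w" "length (TD T2) = length cs + length w"
  using arg_cong[OF c1, of length] arg_cong[OF c2, of length] length_tcod[of G T1] by (simp_all add: dom_word_def cod_word_def)
 interpret e: embedded G Ga Om ds cs w T1 T2 P
  by unfold_locales (rule av v U1 U2 c1 le PP)+
 interpret s: surgery G Ga e.Ne e.Ee e.ce Om La al be e.pe e.qe
  by unfold_locales (use e.strat_emb e.iso_emb ll in "simp_all add: is_template_def")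
 interpret replacement G Ga e.Ne e.Ee e.ce Om La al be e.pe e.qe T1 T2 w ds cs ds' cs' P
 proof unfold_locales
  fix i assume i: "i < length ds"
  hence d: "ds ! i:Edges Om" "pt ?XO (ds ! i) = Inp i" using XO.anc(2) nth_mem[of i ds] XO.pt_nth(1)[of i] by auto
  show "mpt P (lowp (TO T1 ! i)) = pt Ga (e.qe (ds ! i))" using e.qe(2)[OF d(1)] d(2) by simp
 qed (use U1 U2 ll le PP e.ce in "simp_all add: e.pe_def")
 have valid: "is_adiagram G s.SR" by (rule s.SR_valid)
 have "cls G (ctx T1 (canon ?XL) w T2) = cls G (canon s.SR)"
  by (rule cls_eqI[OF _ cL(1)]) (use replaced in "auto simp: tgeq_def")
 moreover have "cls G (ctx T1 (canon ?XL) w T2) = cls G (canon Up)"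
  using e(2) cL(2) U1(2) U2(2) iso_class_cls[OF v(2)] iso_class_cls[OF av(2)] by simp
 ultimately have "canon s.SR \<simeq> canon Up"
  using cls_eqD[of G "canon s.SR" "canon Up"] fg valid av(2) adiag.canon_tg unfolding adiag_def by metis
 hence "adiagram_isomorphic s.SR Up" using adiagram_isomorphic_iff[OF valid] av(2) by blast
 hence fin: "adiagram_isomorphic (surgery_result Ga e.Ne e.Ee e.qe La al be) Up" by (simp only: s.SR_def)
 show ?thesis unfolding surgery_step_def
  using av t ll strat_normal[OF e.strat_emb av(1)] e.iso_emb fin by blast
qed

end

section \<open>Evaluation of diagrams given by a list of nodes\<close>

context fgm
begin

context
 fixes ns :: "('a \<times> nat list \<times> nat list) list" and es :: "nat set" and v :: "nat => 's"
 assumes fin_es: "finite es" and v_es: "!!e. e:es ==> v e:Letters G"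
  and ns_node: "!!i. i < length ns ==> fst (ns ! i):Arrows G & distinct (fst (snd (ns ! i))) & distinct (snd (snd (ns ! i))) &
   set (fst (snd (ns ! i))) <= es & set (snd (snd (ns ! i))) <= es &
   ASrc G (fst (ns ! i)) = map v (fst (snd (ns ! i))) & ATgt G (fst (ns ! i)) = map v (snd (snd (ns ! i)))"
  and ns_disj: "!!i j. i < length ns ==> j < length ns ==> i ~= j ==>
   set (fst (snd (ns ! i))) Int set (fst (snd (ns ! j))) = {} & set (snd (snd (ns ! i))) Int set (snd (snd (ns ! j))) = {}"
  and ns_topo: "!!i j. i < length ns ==> j <= i ==> set (snd (snd (ns ! i))) Int set (fst (snd (ns ! j))) = {}"
begin

abbreviation "D0 == mk_diagram ns es v"

lemma find_upt:
 assumes "!!i j. i < n ==> j < n ==> Q i ==> Q j ==> i = j"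
 shows "find Q [0..<n] = Some i <-> i < n & Q i" "find Q [0..<n] = None <-> (ALL i<n. \<not> Q i)"
proof -
 show n: "find Q [0..<n] = None <-> (ALL i<n. \<not> Q i)" by (auto simp: find_None_iff)
 show "find Q [0..<n] = Some i <-> i < n & Q i"
 proof
  assume "find Q [0..<n] = Some i"
  thus "i < n & Q i" by (auto simp: find_Some_iff)
 next
  assume i: "i < n & Q i"
  then obtain j where j: "find Q [0..<n] = Some j" using n by (cases "find Q [0..<n]") auto
  hence "j < n" "Q j" by (auto simp: find_Some_iff)
  with assms i have "i = j" by blast
  with j show "find Q [0..<n] = Some i" by simp
 qed
qed

lemma mk_simps [simp]: "Nodes D0 = {..<length ns}" "Edges D0 = es" "Ins D0 i = fst (snd (ns ! i))" "Outs D0 i = snd (snd (ns ! i))"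
 "EVal D0 = v" "NVal D0 i = fst (ns ! i)"
 by (simp_all add: mk_diagram_def)

lemma mk_Src: "Src D0 e = Some i <-> i < length ns & e:set (snd (snd (ns ! i)))"
 "Src D0 e = None <-> (ALL i<length ns. e ~: set (snd (snd (ns ! i))))"
 unfolding mk_diagram_def graph.simps diagram.simps by (rule find_upt, use ns_disj in blast)+

lemma mk_Tgt: "Tgt D0 e = Some i <-> i < length ns & e:set (fst (snd (ns ! i)))"
 "Tgt D0 e = None <-> (ALL i<length ns. e ~: set (fst (snd (ns ! i))))"
 unfolding mk_diagram_def graph.simps diagram.simps by (rule find_upt, use ns_disj in blast)+

lemma mk_dom: "dom_edges D0 = {e:es. ALL i<length ns. e ~: set (snd (snd (ns ! i)))}"
 "cod_edges D0 = {e:es. ALL i<length ns. e ~: set (fst (snd (ns ! i)))}"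
 by (auto simp: dom_edges_def cod_edges_def mk_Src mk_Tgt)

lemma mk_valid: "is_diagram G D0"
proof -
 have so: "set_option z <= A <-> (ALL i. z = Some i --> i:A)" for z and A :: "nat set" by (cases z) auto
 have "acyclic {(x, y). EX e:Edges D0. Src D0 e = Some x & Tgt D0 e = Some y}"
 proof (subst acyclic_edges_iff)
  show "finite (Edges D0)" using fin_es by simp
  have "i < j" if "i < length ns" "e:set (snd (snd (ns ! i)))" "e:set (fst (snd (ns ! j)))" for e i j
   using ns_topo[OF that(1), of j] that(2,3) by (meson disjoint_iff linorder_not_less)
  thus "EX rk :: nat => nat. ALL e:Edges D0. ALL x y. Src D0 e = Some x --> Tgt D0 e = Some y --> rk x < rk y"
   by (intro exI[of _ id]) (auto simp: mk_Src mk_Tgt)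
 qed
 thus ?thesis
  unfolding is_diagram_def is_graph_def using fin_es v_es ns_node by (auto simp: mk_Src mk_Tgt so)
qed

text \<open>The displayed set consists of the edges live before node \<open>k\<close>: not produced
  at \<open>k\<close> or later, and not consumed earlier. By \<open>ns_topo\<close> no node feeds
  itself or an earlier one, so the list order runs.\<close>

lemma mk_go:
 assumes "k <= length ns"
 shows "DC.go (Ins D0) (Outs D0) {e:es. (ALL i. k <= i --> i < length ns --> e ~: set (Outs D0 i)) & (ALL i<k. e ~: set (Ins D0 i))}
  [k..<length ns] {e:es. ALL i<length ns. e ~: set (Ins D0 i)}"
 using assms
proof (induction k rule: inc_induct)
 case base
 thus ?case by simp
next
 case (step k)
 let ?A = "%k. {e:es. (ALL i. k <= i --> i < length ns --> e ~: set (Outs D0 i)) & (ALL i<k. e ~: set (Ins D0 i))}"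
 have Ik: "e:es & (ALL i. k <= i --> i < length ns --> e ~: set (Outs D0 i)) & (ALL i<k. e ~: set (Ins D0 i))"
  if e: "e:set (Ins D0 k)" for e
 proof (intro conjI allI impI)
  show "e:es" using ns_node[OF step(2)] e by auto
  show "e ~: set (Outs D0 i)" if "k <= i" "i < length ns" for i using ns_topo[OF that(2,1)] e by auto
  show "e ~: set (Ins D0 i)" if "i < k" for i using ns_disj[of i k] that e step(2) by auto
 qed
 have Ok: "e:es & (ALL i. Suc k <= i --> i < length ns --> e ~: set (Outs D0 i)) & (ALL i<Suc k. e ~: set (Ins D0 i))"
  if e: "e:set (Outs D0 k)" for e
 proof (intro conjI allI impI)
  show "e:es" using ns_node[OF step(2)] e by auto
  show "e ~: set (Outs D0 i)" if "Suc k <= i" "i < length ns" for i using ns_disj[of i k] that e step(2) by auto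
  show "e ~: set (Ins D0 i)" if "i < Suc k" for i using ns_topo[OF step(2), of i] that e by auto
 qed
 have sub: "set (Ins D0 k) <= ?A k" using Ik by blast
 have le: "k <= i <-> i = k \<or> Suc k <= i" "i < Suc k <-> i = k \<or> i < k" for i by auto
 have "e:set (Outs D0 k) Un (?A k - set (Ins D0 k)) <-> e:?A (Suc k)" for e
 proof (cases "e:set (Outs D0 k)")
  case True
  thus ?thesis using Ok by blast
 next
  case False
  thus ?thesis unfolding le by (auto simp del: mk_simps)
 qed
 hence "set (Outs D0 k) Un (?A k - set (Ins D0 k)) = ?A (Suc k)" by blast
 thus ?case using step sub by (simp add: upt_conv_Cons del: mk_simps)
qed

lemma mk_ev:
 assumes ds: "distinct ds" "set ds = dom_edges D0" and cs: "distinct cs" "set cs = cod_edges D0"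
 shows "is_adiagram G (anchor D0 ds cs)" "icls (anchor D0 ds cs) = DC.ev v (Ins D0) (Outs D0) (%i. gen (fst (ns ! i))) ds [0..<length ns] cs"
proof -
 show ad: "is_adiagram G (anchor D0 ds cs)" by (simp add: anchor_adiagram mk_valid ds cs)
 have "DC.go (Ins D0) (Outs D0) (set ds) [0..<length ns] (set cs)"
  using mk_go[of 0] by (simp add: ds cs mk_dom)
 hence "icls (anchor D0 ds cs) = DC.ev (EVal D0) (Ins D0) (Outs D0) (%i. gen (NVal D0 i)) ds [0..<length ns] cs"
  using adiagram_ev[OF ad, of "[0..<length ns]"] by (simp add: atLeast0LessThan del: mk_simps(3-))
 thus "icls (anchor D0 ds cs) = DC.ev v (Ins D0) (Outs D0) (%i. gen (fst (ns ! i))) ds [0..<length ns] cs" by simp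
qed

end

end

section \<open>The Markov templates as pairs of arrows\<close>

context strict_smc
begin

lemma rem_hd: "x ~: set M ==> rem (x # M) [x] = M"
 by (induction M) (auto simp: rem_def)

text \<open>With the inputs listed in node order every permutation on the way is an identity, and
  interchange combines the whiskered discards into a product.\<close>

lemma ev_discards:
 assumes x: "!!x. x:set xs ==> ins x = [c x] & ots x = [] & fm x = dsc (lab (c x))"
  and d: "distinct (map c xs)" and ob: "map lab (map c xs):Obj C"
  and dsc: "!!a. a:S ==> dsc a:Arr C & Dom C (dsc a) = [a] & Cod C (dsc a) = []"
 shows "ev lab ins ots fm (map c xs) xs [] = foldr (%a A. dsc a ## A) (map lab (map c xs)) (Idn C []) &
  ev lab ins ots fm (map c xs) xs []:Arr C & Dom C (ev lab ins ots fm (map c xs) xs []) = map lab (map c xs) &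
  Cod C (ev lab ins ots fm (map c xs) xs []) = []"
 using x d ob
proof (induction xs)
 case (Cons x xs)
 have ob': "map lab (map c xs):Obj C" "lab (c x):S" using Cons.prems(3) by (auto simp: Obj_eq)
 have d': "distinct (map c xs)" using Cons.prems(2) by simp
 note IH = Cons.IH[OF Cons.prems(1) d' ob'(1), simplified]
 have e: "rem (map c (x # xs)) [c x] = map c xs" using rem_hd[of "c x" "map c xs"] Cons.prems(2) by simp
 let ?E = "ev lab ins ots fm (map c xs) xs []" and ?m = "map lab (map c xs)"
 have p: "perm lab (map c (x # xs)) ([c x] @ map c xs) = Idn C (map lab (map c (x # xs)))"
  using perm_id[of "map c (x # xs)" lab] Cons.prems(2,3) by simp
 note dx = dsc[OF ob'(2)]
 have "ev lab ins ots fm (map c (x # xs)) (x # xs) [] = ?E ** (dsc (lab (c x)) ## Idn C ?m) ** Idn C (map lab (map c (x # xs)))"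
  using Cons.prems(1)[of x] e p by (simp del: perm.simps)
 also have "... = (Idn C [] ## ?E) ** (dsc (lab (c x)) ## Idn C ?m)" using dx IH[THEN conjunct2] ob' by simp
 also have "... = dsc (lab (c x)) ## ?E" using dx IH[THEN conjunct2] ob' by (subst interchange) simp_all
 finally have E: "ev lab ins ots fm (map c (x # xs)) (x # xs) [] = dsc (lab (c x)) ## ?E" .
 have F: "foldr (%a A. dsc a ## A) (map lab (map c (x # xs))) (Idn C []) = dsc (lab (c x)) ## ?E"
  using IH[THEN conjunct1] by simp
 show ?case unfolding E F using IH[THEN conjunct2] dx by (simp only: ten_arr ten_dom ten_cod) simp
qed simp

end

locale ddg = fgm G for G :: "('s, 'a, 'z) dd_graph_monoid_scheme" +
 assumes dd: "free_dd_graph_monoid G"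
begin

lemma dd_arrow:
 assumes "a:Letters G"
 shows "ADup G a:Arrows G" "ASrc G (ADup G a) = [a]" "ATgt G (ADup G a) = [a, a]"
  "ADisc G a:Arrows G" "ASrc G (ADisc G a) = [a]" "ATgt G (ADisc G a) = []"
 using dd assms by (auto simp: free_dd_graph_monoid_def)

abbreviation "dp a == gen (ADup G a)"
abbreviation "dc a == gen (ADisc G a)"
definition "eps w = foldr (%a A. dc a ##. A) w (Idn DC [])"

lemma dd_gen [simp]:
 assumes "a:Letters G"
 shows "dp a:Arr DC" "Dom DC (dp a) = [a]" "Cod DC (dp a) = [a, a]" "dc a:Arr DC" "Dom DC (dc a) = [a]" "Cod DC (dc a) = []"
 using gen_arr dd_arrow[OF assms] by simp_all

lemma eps [simp]: "w:Obj DC ==> eps w:Arr DC" "w:Obj DC ==> Dom DC (eps w) = w" "w:Obj DC ==> Cod DC (eps w) = []"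
 by (induction w) (auto simp: eps_def DC_simps(1))

text \<open>Each pair is the replaced side followed by the replacing side of a generating template;
  exchanged templates enter through the disjunction in \<open>mstep\<close>.\<close>

inductive markov_pair :: "('s, 'a) iso_class => ('s, 'a) iso_class => bool" where
 mp_empty: "markov_pair (Idn DC []) (Idn DC [])"
| mp_coassoc: "a:Letters G ==> markov_pair ((Idn DC [a] ##. dp a) **. dp a) ((dp a ##. Idn DC [a]) **. dp a)"
| mp_counit_left: "a:Letters G ==> markov_pair ((Idn DC [a] ##. dc a) **. dp a) (Idn DC [a])"
| mp_counit_right: "a:Letters G ==> markov_pair ((dc a ##. Idn DC [a]) **. dp a) (Idn DC [a])"
| mp_cocomm: "a:Letters G ==> markov_pair (dp a) (Sym DC [a] [a] **. dp a)"
| mp_natural: "k:Arrows G ==> markov_pair (eps (ATgt G k) **. gen k) (eps (ASrc G k))"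

definition template_for :: "('s, 'a) template => ('s, 'a) iso_class => ('s, 'a) iso_class => bool" where
 "template_for t l r <-> (EX ds cs ds' cs'. tpl_lists G t ds cs ds' cs' &
   l = icls (anchor (fst t) ds cs) & r = icls (anchor (fst (snd t)) ds' cs'))"

lemma template_forI:
 assumes "is_adiagram G (anchor Om ds cs)" "is_adiagram G (anchor La ds' cs')"
  "map al ds' = ds" "map (EVal Om) ds = map (EVal La) ds'" "map be cs' = cs" "map (EVal Om) cs = map (EVal La) cs'"
  "l = icls (anchor Om ds cs)" "r = icls (anchor La ds' cs')"
 shows "template_for (Om, La, al, be) l r"
proof -
 have *: "bij_betw f (set ys) (set (map f ys)) & (ALL e:set ys. EVal Om (f e) = EVal La e)"
  if "distinct (map f ys)" "map (EVal Om) (map f ys) = map (EVal La) ys" for f ys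
  using that by (auto simp: bij_betw_def distinct_map)
 have "tpl_lists G (Om, La, al, be) ds cs ds' cs'"
  using assms(1,2) *[of al ds'] *[of be cs'] assms(4,6) unfolding anchor_adiagram tpl_lists_def is_template_def
  by (auto simp: assms(3,5) simp del: list.set_map set_map)
 thus ?thesis unfolding template_for_def using assms by auto
qed

lemma template_for_swap: "template_for t l r ==> template_for (swap_template t) r l"
proof -
 assume "template_for t l r"
 then obtain ds cs ds' cs' where t: "tpl_lists G t ds cs ds' cs'" "l = icls (anchor (fst t) ds cs)" "r = icls (anchor (fst (snd t)) ds' cs')"
  unfolding template_for_def by blast
 have "fst (swap_template t) = fst (snd t)" "fst (snd (swap_template t)) = fst t" by (simp_all add: swap_template_def split: prod.split)
 thus "template_for (swap_template t) r l" unfolding template_for_def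
  using tpl_lists_swap[OF t(1)] t(2,3) by (intro exI[of _ ds'] exI[of _ cs'] exI[of _ ds] exI[of _ cs]) simp
qed

text \<open>The standing assumptions on diagrams from node lists as a single predicate, which can be
  checked by simplification for concrete templates.\<close>

definition "mk_ok ns es v <-> finite es & (ALL e:es. v e:Letters G) &
 (ALL i<length ns. fst (ns ! i):Arrows G & distinct (fst (snd (ns ! i))) & distinct (snd (snd (ns ! i))) &
   set (fst (snd (ns ! i))) <= es & set (snd (snd (ns ! i))) <= es &
   ASrc G (fst (ns ! i)) = map v (fst (snd (ns ! i))) & ATgt G (fst (ns ! i)) = map v (snd (snd (ns ! i)))) &
 (ALL i<length ns. ALL j<length ns. i ~= j -->
   set (fst (snd (ns ! i))) Int set (fst (snd (ns ! j))) = {} & set (snd (snd (ns ! i))) Int set (snd (snd (ns ! j))) = {}) &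
 (ALL i<length ns. ALL j<=i. set (snd (snd (ns ! i))) Int set (fst (snd (ns ! j))) = {})"

lemma mk_ok_ev:
 fixes ns :: "('a \<times> nat list \<times> nat list) list"
 assumes "mk_ok ns es v" "distinct ds" "set ds = {e:es. ALL i<length ns. e ~: set (snd (snd (ns ! i)))}"
  "distinct cs" "set cs = {e:es. ALL i<length ns. e ~: set (fst (snd (ns ! i)))}"
 shows "is_adiagram G (anchor (mk_diagram ns es v) ds cs)"
  "icls (anchor (mk_diagram ns es v) ds cs) =
   DC.ev v (%i. fst (snd (ns ! i))) (%i. snd (snd (ns ! i))) (%i. gen (fst (ns ! i))) ds [0..<length ns] cs"
proof -
 note a = assms(1)[unfolded mk_ok_def]
 have s: "Ins (mk_diagram ns es v) = (%i. fst (snd (ns ! i)))" "Outs (mk_diagram ns es v) = (%i. snd (snd (ns ! i)))"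
  by (simp_all add: mk_diagram_def)
 note f = a[THEN conjunct1] and v = a[THEN conjunct2, THEN conjunct1, rule_format]
  and n = a[THEN conjunct2, THEN conjunct2, THEN conjunct1, rule_format]
  and dj = a[THEN conjunct2, THEN conjunct2, THEN conjunct2, THEN conjunct1, rule_format]
  and tp = a[THEN conjunct2, THEN conjunct2, THEN conjunct2, THEN conjunct2, rule_format]
 have d: "set ds = dom_edges (mk_diagram ns es v)" "set cs = cod_edges (mk_diagram ns es v)"
  unfolding assms(3,5)
  by (rule mk_dom(1)[symmetric], rule f, erule v, erule n, erule (2) dj, erule (1) tp)
   (rule mk_dom(2)[symmetric], rule f, erule v, erule n, erule (2) dj, erule (1) tp)
 have "is_adiagram G (anchor (mk_diagram ns es v) ds cs) & icls (anchor (mk_diagram ns es v) ds cs) =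
   DC.ev v (Ins (mk_diagram ns es v)) (Outs (mk_diagram ns es v)) (%i. gen (fst (ns ! i))) ds [0..<length ns] cs"
  by (rule conjI, rule mk_ev(1), rule f, erule v, erule n, erule (2) dj, erule (1) tp, rule assms(2), rule d, rule assms(4), rule d)
   (rule mk_ev(2), rule f, erule v, erule n, erule (2) dj, erule (1) tp, rule assms(2), rule d, rule assms(4), rule d)
 thus "is_adiagram G (anchor (mk_diagram ns es v) ds cs)"
  "icls (anchor (mk_diagram ns es v) ds cs) =
   DC.ev v (%i. fst (snd (ns ! i))) (%i. snd (snd (ns ! i))) (%i. gen (fst (ns ! i))) ds [0..<length ns] cs"
  unfolding s by blast+
qed

lemma mk_EVal: "EVal (mk_diagram ns es v) = v"
 by (simp add: mk_diagram_def)

lemma all_lt2: "(ALL i<Suc (Suc 0). Q i) <-> Q 0 & Q (Suc 0)" "(ALL i<Suc 0. Q i) <-> Q 0" "(ALL i<=Suc 0. Q i) <-> Q 0 & Q (Suc 0)"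
 "(ALL i<=0. Q i) <-> Q (0::nat)"
 by (auto simp: less_Suc_eq le_Suc_eq)

lemma tpl_empty: "template_for (mk_diagram [] {} v, mk_diagram [] {} v, id, id) (Idn DC []) (Idn DC [])"
 by (rule template_forI[of _ "[]" "[]" _ "[]" "[]"]) (simp_all add: mk_ok_ev mk_ok_def)

lemma tpl_coassoc:
 assumes a: "a:Letters G"
 shows "template_for (mk_diagram [(ADup G a, [0], [1, 2]), (ADup G a, [2], [3, 4])] {0, 1, 2, 3, 4} (%_. a),
   mk_diagram [(ADup G a, [0], [1, 2]), (ADup G a, [1], [3, 4])] {0, 1, 2, 3, 4} (%_. a), id, id(3 := 1, 4 := 3, 2 := 4))
  ((Idn DC [a] ##. dp a) **. dp a) ((dp a ##. Idn DC [a]) **. dp a)"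
  (is "template_for (mk_diagram ?n1 ?es ?v, mk_diagram ?n2 ?es ?v, _) _ _")
proof -
 have ok: "mk_ok ?n1 ?es ?v" "mk_ok ?n2 ?es ?v" using dd_arrow[OF a] a by (simp_all add: mk_ok_def all_lt2)
 have ds: "set [0] = {e:?es. ALL i<length ?n1. e ~: set (snd (snd (?n1 ! i)))}" "set [0] = {e:?es. ALL i<length ?n2. e ~: set (snd (snd (?n2 ! i)))}"
  by (auto simp: all_lt2)
 have cs: "set [1, 3, 4] = {e:?es. ALL i<length ?n1. e ~: set (fst (snd (?n1 ! i)))}" "set [3, 4, 2] = {e:?es. ALL i<length ?n2. e ~: set (fst (snd (?n2 ! i)))}"
  by (auto simp: all_lt2)
 note e1 = mk_ok_ev[OF ok(1) _ ds(1) _ cs(1)] and e2 = mk_ok_ev[OF ok(2) _ ds(2) _ cs(2)]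
 let ?d = "dp a" and ?I = "Idn DC [a]"
 \<comment> \<open>The second duplicate takes edge \<open>2\<close>, which has to pass edge
   \<open>1\<close> first, and the final order \<open>1, 3, 4\<close> moves its outputs back. These
   two symmetries cancel by naturality.\<close>
 have p1: "DC.perm (%_. a) [1, 2] [2, 1 :: nat] = Sym DC [a] [a]" "DC.perm (%_. a) [3, 4, 1] [1, 3, 4 :: nat] = Sym DC [a, a] [a]"
  using DC.perm_sym[of "[1]" "[2 :: nat]" "%_. a"] DC.perm_sym[of "[3, 4]" "[1 :: nat]" "%_. a"] a by simp_all
 have p0: "DC.perm (%_. a) [0] [0 :: nat] = ?I" "DC.perm (%_. a) [1, 2] [1, 2 :: nat] = Idn DC [a, a]"
  "DC.perm (%_. a) [3, 4, 2] [3, 4, 2 :: nat] = Idn DC [a, a, a]"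
  using DC.perm_id[of "[0 :: nat]" "%_. a"] DC.perm_id[of "[1, 2 :: nat]" "%_. a"] DC.perm_id[of "[3, 4, 2 :: nat]" "%_. a"] a by simp_all
 have "icls (anchor (mk_diagram ?n1 ?es ?v) [0] [1, 3, 4]) =
   Sym DC [a, a] [a] **. (?d ##. ?I) **. Sym DC [a] [a] **. ?d"
  using a by (subst e1) (simp_all add: DC.rem_def p0[unfolded One_nat_def] p1[unfolded One_nat_def] del: DC.perm.simps)
 also have "... = (?I ##. ?d) **. Sym DC [a] [a] **. Sym DC [a] [a] **. ?d"
  using a DC.cmp_rewrite[OF DC.sym_nat[of ?d ?I], of "Sym DC [a] [a] **. ?d"] by simp
 also have "... = (?I ##. ?d) **. ?d"
  using a DC.cmp_rewrite[OF DC.sym_sym[of "[a]" "[a]"], of ?d] by simp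
 finally have c1: "(?I ##. ?d) **. ?d = icls (anchor (mk_diagram ?n1 ?es ?v) [0] [1, 3, 4])" ..
 have c2: "(?d ##. ?I) **. ?d = icls (anchor (mk_diagram ?n2 ?es ?v) [0] [3, 4, 2])"
  using a by (subst e2) (simp_all add: DC.rem_def p0[unfolded One_nat_def] del: DC.perm.simps)
 show ?thesis by (rule template_forI[OF e1(1) e2(1) _ _ _ _ c1 c2]) (simp_all add: mk_EVal)
qed

lemma tpl_counit:
 assumes a: "a:Letters G"
 shows "template_for (mk_diagram [(ADup G a, [0], [1, 2]), (ADisc G a, [2], [])] {0, 1, 2} (%_. a), mk_diagram [] {0} (%_. a), id, id(0 := 1))
   ((Idn DC [a] ##. dc a) **. dp a) (Idn DC [a])" (is "template_for (mk_diagram ?n1 ?es ?v, mk_diagram [] ?eo _, _, ?b1) ?l1 _")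
  and "template_for (mk_diagram [(ADup G a, [0], [1, 2]), (ADisc G a, [1], [])] {0, 1, 2} (%_. a), mk_diagram [] {0} (%_. a), id, id(0 := 2))
   ((dc a ##. Idn DC [a]) **. dp a) (Idn DC [a])" (is "template_for (mk_diagram ?n2 _ _, _, _, ?b2) ?l2 _")
proof -
 let ?d = "dp a" and ?I = "Idn DC [a]" and ?e = "dc a"
 have ok: "mk_ok ?n1 ?es ?v" "mk_ok ?n2 ?es ?v" "mk_ok [] ?eo ?v" using dd_arrow[OF a] a by (simp_all add: mk_ok_def all_lt2)
 have ds: "set [0] = {e:?es. ALL i<length ?n1. e ~: set (snd (snd (?n1 ! i)))}" "set [0] = {e:?es. ALL i<length ?n2. e ~: set (snd (snd (?n2 ! i)))}"
  by (auto simp: all_lt2)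
 have cs: "set [1] = {e:?es. ALL i<length ?n1. e ~: set (fst (snd (?n1 ! i)))}" "set [2] = {e:?es. ALL i<length ?n2. e ~: set (fst (snd (?n2 ! i)))}"
  by (auto simp: all_lt2)
 note e1 = mk_ok_ev[OF ok(1) _ ds(1) _ cs(1)] and e2 = mk_ok_ev[OF ok(2) _ ds(2) _ cs(2)] and e0 = mk_ok_ev[OF ok(3), of "[0]" "[0]", simplified]
 have p1: "DC.perm (%_. a) [1, 2] [2, 1 :: nat] = Sym DC [a] [a]" using DC.perm_sym[of "[1]" "[2 :: nat]" "%_. a"] a by simp
 have p0: "DC.perm (%_. a) [n] [n :: nat] = ?I" "DC.perm (%_. a) [1, 2] [1, 2 :: nat] = Idn DC [a, a]" for n
  using DC.perm_id[of "[n :: nat]" "%_. a"] DC.perm_id[of "[1, 2 :: nat]" "%_. a"] a by simp_all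
 have c0: "?I = icls (anchor (mk_diagram [] ?eo ?v) [0] [0])" using a by (simp add: e0)
 have "icls (anchor (mk_diagram ?n1 ?es ?v) [0] [1]) = (?e ##. ?I) **. Sym DC [a] [a] **. ?d"
  using a by (subst e1) (simp_all add: DC.rem_def p0[unfolded One_nat_def] p1[unfolded One_nat_def] del: DC.perm.simps)
 also have "... = (?I ##. ?e) **. ?d"
 proof -
  have "(?I ##. ?e) = (?e ##. ?I) **. Sym DC [a] [a]" using DC.sym_nat[of ?I ?e] a by simp
  thus ?thesis using a by simp
 qed
 finally have c1: "?l1 = icls (anchor (mk_diagram ?n1 ?es ?v) [0] [1])" ..
 have c2: "?l2 = icls (anchor (mk_diagram ?n2 ?es ?v) [0] [2])"
  using a by (subst e2) (simp_all add: DC.rem_def p0[unfolded One_nat_def] del: DC.perm.simps)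
 show "template_for (mk_diagram ?n1 ?es ?v, mk_diagram [] ?eo ?v, id, ?b1) ?l1 ?I"
  by (rule template_forI[OF e1(1) e0(1) _ _ _ _ c1 c0]) (simp_all add: mk_EVal)
 show "template_for (mk_diagram ?n2 ?es ?v, mk_diagram [] ?eo ?v, id, ?b2) ?l2 ?I"
  by (rule template_forI[OF e2(1) e0(1) _ _ _ _ c2 c0]) (simp_all add: mk_EVal)
qed

text \<open>Both sides are the same diagram with its codomain read in two orders; the second order
  contributes the symmetry.\<close>

lemma tpl_cocomm:
 assumes a: "a:Letters G"
 shows "template_for (mk_diagram [(ADup G a, [0], [1, 2])] {0, 1, 2} (%_. a), mk_diagram [(ADup G a, [0], [1, 2])] {0, 1, 2} (%_. a), id, id(1 := 2, 2 := 1))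
  (dp a) (Sym DC [a] [a] **. dp a)" (is "template_for (mk_diagram ?n ?es ?v, _) ?l ?r")
proof -
 have ok: "mk_ok ?n ?es ?v" using dd_arrow[OF a] a by (simp add: mk_ok_def all_lt2)
 have ds: "set [0] = {e:?es. ALL i<length ?n. e ~: set (snd (snd (?n ! i)))}" by (auto simp: all_lt2)
 have cs: "set [1, 2] = {e:?es. ALL i<length ?n. e ~: set (fst (snd (?n ! i)))}" "set [2, 1] = {e:?es. ALL i<length ?n. e ~: set (fst (snd (?n ! i)))}"
  by (auto simp: all_lt2)
 note e1 = mk_ok_ev[OF ok _ ds _ cs(1)] and e2 = mk_ok_ev[OF ok _ ds _ cs(2)]
 have p: "DC.perm (%_. a) [1, 2] [2, 1 :: nat] = Sym DC [a] [a]" "DC.perm (%_. a) [0] [0 :: nat] = Idn DC [a]"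
   "DC.perm (%_. a) [1, 2] [1, 2 :: nat] = Idn DC [a, a]"
  using DC.perm_sym[of "[1]" "[2 :: nat]" "%_. a"] DC.perm_id[of "[0 :: nat]" "%_. a"] DC.perm_id[of "[1, 2 :: nat]" "%_. a"] a by simp_all
 have c1: "?l = icls (anchor (mk_diagram ?n ?es ?v) [0] [1, 2])"
  using a by (subst e1) (simp_all add: DC.rem_def p[unfolded One_nat_def] del: DC.perm.simps)
 have c2: "?r = icls (anchor (mk_diagram ?n ?es ?v) [0] [2, 1])"
  using a by (subst e2) (simp_all add: DC.rem_def p[unfolded One_nat_def] del: DC.perm.simps)
 show ?thesis by (rule template_forI[OF e1(1) e2(1) _ _ _ _ c1 c2]) (simp_all add: mk_EVal)
qed

lemma tpl_natural:
 assumes f: "f:Arrows G" and xs: "ASrc G f = xs" and ys: "ATgt G f = ys" and k: "k = length xs" and m: "m = length ys"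
 shows "template_for (mk_diagram ((f, [0..<k], [k..<k + m]) # map (%j. (ADisc G (ys ! j), [k + j], [])) [0..<m]) {..<k + m} (%e. (xs @ ys) ! e),
   mk_diagram (map (%i. (ADisc G (xs ! i), [i], [])) [0..<k]) {..<k} (%e. xs ! e), id, id) (eps ys **. gen f) (eps xs)"
  (is "template_for (mk_diagram ?n ?es ?v, mk_diagram ?nl ?el ?vl, _) _ _")
proof -
 have L: "xs:lists (Letters G)" "ys:lists (Letters G)" using fg f xs ys by (auto simp: free_graph_monoid_def)
 have Lx: "i < k ==> xs ! i:Letters G" and Ly: "j < m ==> ys ! j:Letters G" for i j using L k m by (auto simp: in_lists_conv_set)
 have xsO: "xs:Obj DC" and ysO: "ys:Obj DC" using L by (simp_all add: DC_simps(1))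
 note dx = dd_arrow[OF Lx] and dy = dd_arrow[OF Ly]
 have vx: "map ?v [0..<k] = xs" and vy: "map ?v [k..<k + m] = ys" and vlx: "map ?vl [0..<k] = xs"
  using k m by (auto intro!: nth_equalityI simp: nth_append)
 have n0: "?n ! 0 = (f, [0..<k], [k..<k + m])" and nS: "!!j. j < m ==> ?n ! Suc j = (ADisc G (ys ! j), [k + j], [])"
  and ln: "length ?n = Suc m" by simp_all
 have sp: "(ALL i<Suc m. Q i) <-> Q 0 & (ALL j<m. Q (Suc j))" for Q by (auto simp: less_Suc_eq_0_disj)
 have sple: "(ALL i<=Suc n. Q i) <-> Q 0 & (ALL j<=n. Q (Suc j))" for Q n using sp by (metis Suc_le_mono le_0_eq not0_implies_Suc zero_le)
 have sp0: "(ALL i<=0. Q i) <-> Q 0" for Q :: "nat => bool" by simp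
 have vyj: "j < m ==> ?v (k + j) = ys ! j" for j using k by simp
 have vin: "?v e:Letters G" if "e < k + m" for e
 proof (cases "e < k")
  case False
  thus ?thesis using Ly[of "e - k"] that k by (simp add: nth_append)
 qed (use Lx k in "simp add: nth_append")
 have ok1: "mk_ok ?n ?es ?v" unfolding mk_ok_def ln
 proof (intro conjI)
  show "finite ?es" "ALL e:?es. ?v e:Letters G" using vin by auto
  show "ALL i<Suc m. fst (?n ! i):Arrows G & distinct (fst (snd (?n ! i))) & distinct (snd (snd (?n ! i))) &
   set (fst (snd (?n ! i))) <= ?es & set (snd (snd (?n ! i))) <= ?es &
   ASrc G (fst (?n ! i)) = map ?v (fst (snd (?n ! i))) & ATgt G (fst (?n ! i)) = map ?v (snd (snd (?n ! i)))"
   unfolding sp n0 using f xs ys vx vy dy vyj nS by auto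
  show "ALL i<Suc m. ALL j<Suc m. i ~= j --> set (fst (snd (?n ! i))) Int set (fst (snd (?n ! j))) = {} & set (snd (snd (?n ! i))) Int set (snd (snd (?n ! j))) = {}"
   unfolding sp n0 using nS by auto
  show "ALL i<Suc m. ALL j<=i. set (snd (snd (?n ! i))) Int set (fst (snd (?n ! j))) = {}"
   unfolding sp sp0 n0 using nS by auto
 qed
 have ok2: "mk_ok ?nl ?el ?vl" unfolding mk_ok_def using dx Lx by auto
 have ds: "set [0..<k] = {e:?es. ALL i<length ?n. e ~: set (snd (snd (?n ! i)))}" "set [] = {e:?es. ALL i<length ?n. e ~: set (fst (snd (?n ! i)))}"
 proof -
  show "set [0..<k] = {e:?es. ALL i<length ?n. e ~: set (snd (snd (?n ! i)))}" unfolding ln sp n0 using nS by auto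
  have "e:set [0..<k] \<or> (EX j<m. e = k + j)" if "e < k + m" for e using that by (auto intro: exI[of _ "e - k"])
  thus "set [] = {e:?es. ALL i<length ?n. e ~: set (fst (snd (?n ! i)))}" unfolding ln sp n0 using nS by fastforce
 qed
 have dsl: "set [0..<k] = {e:?el. ALL i<length ?nl. e ~: set (snd (snd (?nl ! i)))}" "set [] = {e:?el. ALL i<length ?nl. e ~: set (fst (snd (?nl ! i)))}"
  by auto
 note e1 = mk_ok_ev[OF ok1 _ ds(1) _ ds(2)] and e2 = mk_ok_ev[OF ok2 _ dsl(1) _ dsl(2)]
 have dsc: "a:Letters G ==> dc a:Arr DC & Dom DC (dc a) = [a] & Cod DC (dc a) = []" for a by simp
 have c2: "eps xs = icls (anchor (mk_diagram ?nl ?el ?vl) [0..<k] [])"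
 proof -
  have "DC.ev ?vl (%i. fst (snd (?nl ! i))) (%i. snd (snd (?nl ! i))) (%i. gen (fst (?nl ! i))) (map id [0..<k]) [0..<k] [] =
   foldr (%a A. dc a ##. A) (map ?vl (map id [0..<k])) (Idn DC [])"
   by (rule DC.ev_discards[THEN conjunct1]) (use vlx xsO dsc in auto)
  thus ?thesis using e2(2) vlx by (simp add: eps_def)
 qed
 have c1: "eps ys **. gen f = icls (anchor (mk_diagram ?n ?es ?v) [0..<k] [])"
 proof -
  \<comment> \<open>Node \<open>0\<close> carries \<open>f\<close>, so the node
    \<open>i >= 1\<close> discards the output edge \<open>k + (i - 1)\<close>.\<close>
  let ?c = "%i. k + (i - Suc 0)"
  have mc: "map ?c (map Suc [0..<m]) = [k..<k + m]" by (auto intro!: nth_equalityI)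
  have "DC.ev ?v (%i. fst (snd (?n ! i))) (%i. snd (snd (?n ! i))) (%i. gen (fst (?n ! i))) (map ?c (map Suc [0..<m])) (map Suc [0..<m]) [] =
   foldr (%a A. dc a ##. A) (map ?v (map ?c (map Suc [0..<m]))) (Idn DC [])"
  proof (rule DC.ev_discards[THEN conjunct1])
   show "distinct (map ?c (map Suc [0..<m]))" unfolding mc by simp
   show "map ?v (map ?c (map Suc [0..<m])):Obj DC" unfolding mc vy by (rule ysO)
   show "x:set (map Suc [0..<m]) ==> fst (snd (?n ! x)) = [?c x] & snd (snd (?n ! x)) = [] & gen (fst (?n ! x)) = dc (?v (?c x))" for x
   proof -
    assume "x:set (map Suc [0..<m])"
    then obtain j where "x = Suc j" "j < m" unfolding set_map set_upt by (elim imageE) simp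
    thus "fst (snd (?n ! x)) = [?c x] & snd (snd (?n ! x)) = [] & gen (fst (?n ! x)) = dc (?v (?c x))"
     using nS[of j] vyj[of j] by simp
   qed
  qed (use dsc in auto)
  hence E: "DC.ev ?v (%i. fst (snd (?n ! i))) (%i. snd (snd (?n ! i))) (%i. gen (fst (?n ! i))) [k..<k + m] (map Suc [0..<m]) [] = eps ys"
   unfolding mc vy by (simp add: eps_def)
  have up: "[0..<Suc m] = 0 # map Suc [0..<m]" by (simp add: map_Suc_upt upt_conv_Cons del: upt_Suc)
  have r: "DC.rem [0..<k] [0..<k] = []" by (simp add: DC.rem_def)
  have p: "DC.perm ?v [0..<k] [0..<k] = Idn DC xs" using DC.perm_id[of "[0..<k]" ?v] vx xsO by simp
  have "icls (anchor (mk_diagram ?n ?es ?v) [0..<k] []) = eps ys **. (gen f ##. Idn DC []) **. Idn DC xs"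
   using e1(2) unfolding ln up DC.ev.simps n0 fst_conv snd_conv r append_Nil2 list.map(1) E p by simp
  thus ?thesis using gen_arr[OF f] xs ys by simp
 qed
 show ?thesis by (rule template_forI[OF e1(1) e2(1) _ _ _ _ c1 c2]) (use vx vlx in "simp_all add: mk_EVal")
qed

theorem template_for_pair: "markov_pair l r ==> EX t:markov_templates G. template_for t l r"
proof (induction rule: markov_pair.induct)
 case mp_empty
 show ?case by (rule bexI[where x = "(mk_diagram [] {} undefined, mk_diagram [] {} undefined, id, id)"]) (rule tpl_empty markov_templates.empty)+
next
 case (mp_coassoc a)
 show ?case by (rule bexI[rotated], rule markov_templates.coassociativity[OF mp_coassoc refl], rule tpl_coassoc[OF mp_coassoc])
next
 case (mp_counit_left a)
 show ?case by (rule bexI[rotated], rule markov_templates.left_counitality[OF mp_counit_left refl refl], rule tpl_counit(1)[OF mp_counit_left])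
next
 case (mp_counit_right a)
 show ?case by (rule bexI[rotated], rule markov_templates.right_counitality[OF mp_counit_right refl refl], rule tpl_counit(2)[OF mp_counit_right])
next
 case (mp_cocomm a)
 show ?case by (rule bexI[rotated], rule markov_templates.cocommutativity[OF mp_cocomm refl], rule tpl_cocomm[OF mp_cocomm])
next
 case (mp_natural k)
 show ?case by (rule bexI[rotated], rule markov_templates.naturality[OF mp_natural refl refl refl refl], rule tpl_natural[OF mp_natural refl refl refl refl])
qed

theorem template_pair: "t:markov_templates G ==> EX l r. template_for t l r & (markov_pair l r \<or> markov_pair r l)"
proof (induction rule: markov_templates.induct)
 case (empty v)
 show ?case by (intro exI conjI disjI1) (rule tpl_empty mp_empty)+
next
 case (coassociativity a d)
 show ?case unfolding coassociativity(2)
  by (intro exI conjI disjI1) (rule tpl_coassoc mp_coassoc coassociativity(1))+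
next
 case (left_counitality a d e)
 show ?case unfolding left_counitality(2,3)
  by (intro exI conjI disjI1) (rule tpl_counit(1) mp_counit_left left_counitality(1))+
next
 case (right_counitality a d e)
 show ?case unfolding right_counitality(2,3)
  by (intro exI conjI disjI1) (rule tpl_counit(2) mp_counit_right right_counitality(1))+
next
 case (cocommutativity a d)
 show ?case unfolding cocommutativity(2)
  by (intro exI conjI disjI1) (rule tpl_cocomm mp_cocomm cocommutativity(1))+
next
 case (naturality f xs ys k m)
 have "markov_pair (eps ys **. gen f) (eps xs)" using mp_natural[OF naturality(1)] naturality(2,3) by simp
 thus ?case using tpl_natural[OF naturality] by (intro exI conjI disjI1)
next
 case (swap t)
 thus ?case using template_for_swap by blast
qed

end

section \<open>Quotients\<close>

text \<open>Agreement with the quotient is required field by field, because the free Markov category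
  extends the quotient record by duplicates and discards.\<close>

locale quot = C: strict_smc C S
 for C :: "('s list, 'm) sym_cat" and S :: "'s set" +
 fixes R :: "('m \<times> 'm) set" and Q :: "('s list, 'm set, 'z) sym_cat_scheme"
 assumes R: "equiv (Arr C) R"
  and R_dom: "(f, g):R ==> Dom C f = Dom C g & Cod C f = Cod C g"
  and R_cmp: "(f, f'):R ==> (g, g'):R ==> Cod C f = Dom C g ==> (g **\<^bsub>C\<^esub> f, g' **\<^bsub>C\<^esub> f'):R"
  and R_ten: "(f, f'):R ==> (g, g'):R ==> (f ##\<^bsub>C\<^esub> g, f' ##\<^bsub>C\<^esub> g'):R"
  and Q: "Obj Q = Obj (quotient_cat C R)" "Arr Q = Arr (quotient_cat C R)" "Dom Q = Dom (quotient_cat C R)"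
   "Cod Q = Cod (quotient_cat C R)" "Idn Q = Idn (quotient_cat C R)" "Cmp Q = Cmp (quotient_cat C R)" "TArr Q = TArr (quotient_cat C R)"
   "Sym Q = Sym (quotient_cat C R)"
begin

definition "cl f = R `` {f}"

lemma cl_eq: "f:Arr C ==> cl f = cl g <-> (f, g):R"
 unfolding cl_def using R by (metis Image_singleton_iff equiv_class_eq_iff equiv_class_self)

lemma in_cl: "g:cl f <-> (f, g):R"
 by (simp add: cl_def)

lemma self_cl: "f:Arr C ==> f:cl f"
 using R by (simp add: in_cl equiv_def refl_on_def)

lemma Q_Obj [simp]: "Obj Q = Obj C"
 by (simp add: Q quotient_cat_def)

lemma cl_arr [simp]: "f:Arr C ==> cl f:Arr Q"
 by (auto simp: Q quotient_cat_def cl_def quotientI)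

lemma Q_arrE: assumes "A:Arr Q" obtains f where "f:Arr C" "A = cl f"
 using assms by (auto simp: Q quotient_cat_def cl_def elim: quotientE)

lemma cl_dom [simp]: "f:Arr C ==> Dom Q (cl f) = Dom C f" "f:Arr C ==> Cod Q (cl f) = Cod C f"
proof -
 assume "f:Arr C"
 hence "(SOME g. g:cl f):cl f" by (rule someI[where P = "%g. g:cl f", OF self_cl])
 thus "Dom Q (cl f) = Dom C f" "Cod Q (cl f) = Cod C f" using R_dom by (auto simp: Q quotient_cat_def in_cl)
qed

lemma cl_id [simp]: "Idn Q u = cl (Idn C u)" and cl_sym [simp]: "Sym Q u w = cl (Sym C u w)"
 by (simp_all add: Q quotient_cat_def cl_def)

lemma cl_cmp [simp]:
 assumes "f:Arr C" "g:Arr C" "Cod C f = Dom C g"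
 shows "cl g **\<^bsub>Q\<^esub> cl f = cl (g **\<^bsub>C\<^esub> f)"
proof -
 have "cl (g' **\<^bsub>C\<^esub> f') = cl (g **\<^bsub>C\<^esub> f)" if "f':cl f" "g':cl g" for f' g'
  using R_cmp[OF that[unfolded in_cl] assms(3)] assms by (simp add: cl_eq[symmetric])
 hence "(UN f':cl f. UN g':cl g. cl (g' **\<^bsub>C\<^esub> f')) = (UN f':cl f. UN g':cl g. cl (g **\<^bsub>C\<^esub> f))" by simp
 also have "... = cl (g **\<^bsub>C\<^esub> f)" using self_cl assms by auto
 finally show ?thesis by (simp add: Q quotient_cat_def cl_def)
qed

lemma cl_ten [simp]:
 assumes "f:Arr C" "g:Arr C"
 shows "cl f ##\<^bsub>Q\<^esub> cl g = cl (f ##\<^bsub>C\<^esub> g)"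
proof -
 have "cl (f' ##\<^bsub>C\<^esub> g') = cl (f ##\<^bsub>C\<^esub> g)" if "f':cl f" "g':cl g" for f' g'
  using R_ten[OF that[unfolded in_cl]] assms by (simp add: cl_eq[symmetric])
 hence "(UN f':cl f. UN g':cl g. cl (f' ##\<^bsub>C\<^esub> g')) = (UN f':cl f. UN g':cl g. cl (f ##\<^bsub>C\<^esub> g))" by simp
 also have "... = cl (f ##\<^bsub>C\<^esub> g)" using self_cl assms by auto
 finally show ?thesis by (simp add: Q quotient_cat_def cl_def)
qed

lemma quot_hom: "A:Hom Q u v <-> (EX f. f:Hom C u v & A = cl f)"
 by (auto simp: Hom_def elim!: Q_arrE)

sublocale Q: strict_smc Q S
proof
 show "A:Arr Q ==> Dom Q A:Obj Q" "A:Arr Q ==> Cod Q A:Obj Q" for A by (auto elim!: Q_arrE)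
 show "u:Obj Q ==> Idn Q u:Hom Q u u" for u by (auto simp: Hom_def)
 show "A:Hom Q u v ==> B:Hom Q v w ==> B **\<^bsub>Q\<^esub> A:Hom Q u w" for A B u v w
  by (auto simp: Hom_def elim!: Q_arrE)
 show "A:Hom Q u v ==> Idn Q v **\<^bsub>Q\<^esub> A = A" "A:Hom Q u v ==> A **\<^bsub>Q\<^esub> Idn Q u = A" for A u v
  by (auto simp: Hom_def elim!: Q_arrE)
 show "A:Hom Q u v ==> B:Hom Q v w ==> D:Hom Q w x ==> (D **\<^bsub>Q\<^esub> B) **\<^bsub>Q\<^esub> A = D **\<^bsub>Q\<^esub> B **\<^bsub>Q\<^esub> A" for A B D u v w x
  by (auto simp: Hom_def elim!: Q_arrE)
 show "Obj Q = lists S" by (simp add: C.Obj_eq)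
 show "A:Arr Q ==> B:Arr Q ==> A ##\<^bsub>Q\<^esub> B:Arr Q" "A:Arr Q ==> B:Arr Q ==> Dom Q (A ##\<^bsub>Q\<^esub> B) = Dom Q A @ Dom Q B"
  "A:Arr Q ==> B:Arr Q ==> Cod Q (A ##\<^bsub>Q\<^esub> B) = Cod Q A @ Cod Q B" for A B
  by (auto elim!: Q_arrE)
 show "u:Obj Q ==> v:Obj Q ==> Idn Q u ##\<^bsub>Q\<^esub> Idn Q v = Idn Q (u @ v)" for u v by (simp add: C.ten_id)
 show "f:Arr Q ==> g:Arr Q ==> f':Arr Q ==> g':Arr Q ==> Cod Q f = Dom Q g ==> Cod Q f' = Dom Q g' ==>
   (g ##\<^bsub>Q\<^esub> g') **\<^bsub>Q\<^esub> (f ##\<^bsub>Q\<^esub> f') = (g **\<^bsub>Q\<^esub> f) ##\<^bsub>Q\<^esub> (g' **\<^bsub>Q\<^esub> f')" for f g f' g'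
  by (elim Q_arrE) (simp add: C.interchange)
 show "f:Arr Q ==> g:Arr Q ==> h:Arr Q ==> (f ##\<^bsub>Q\<^esub> g) ##\<^bsub>Q\<^esub> h = f ##\<^bsub>Q\<^esub> g ##\<^bsub>Q\<^esub> h" for f g h by (elim Q_arrE) simp
 show "f:Arr Q ==> Idn Q [] ##\<^bsub>Q\<^esub> f = f" "f:Arr Q ==> f ##\<^bsub>Q\<^esub> Idn Q [] = f" for f by (elim Q_arrE; simp)+
 show "u:Obj Q ==> v:Obj Q ==> Sym Q u v:Arr Q" "u:Obj Q ==> v:Obj Q ==> Dom Q (Sym Q u v) = u @ v"
  "u:Obj Q ==> v:Obj Q ==> Cod Q (Sym Q u v) = v @ u" for u v by simp_all
 show "f:Arr Q ==> g:Arr Q ==> Sym Q (Cod Q f) (Cod Q g) **\<^bsub>Q\<^esub> (f ##\<^bsub>Q\<^esub> g) = (g ##\<^bsub>Q\<^esub> f) **\<^bsub>Q\<^esub> Sym Q (Dom Q f) (Dom Q g)" for f g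
  by (elim Q_arrE) (simp add: C.sym_nat)
 show "u:Obj Q ==> v:Obj Q ==> Sym Q v u **\<^bsub>Q\<^esub> Sym Q u v = Idn Q (u @ v)" for u v by (simp add: C.sym_sym)
 show "u:Obj Q ==> v:Obj Q ==> w:Obj Q ==>
   Sym Q u (v @ w) = (Idn Q v ##\<^bsub>Q\<^esub> Sym Q u w) **\<^bsub>Q\<^esub> (Sym Q u v ##\<^bsub>Q\<^esub> Idn Q w)" for u v w by (simp add: C.hex)
qed

end

section \<open>The Markov congruence on arrows\<close>

context ddg
begin

definition "mstep A B <-> (EX l r. (markov_pair l r \<or> markov_pair r l) & rewriting l r A B)"

text \<open>In particular a surgery step depends only on the isomorphism classes of the two
  diagrams, so chains of diagrams and chains of arrows correspond.\<close>

lemma step_iff: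
 assumes "is_adiagram G Ga" "is_adiagram G Up"
 shows "surgery_step G (markov_templates G) Ga Up <-> mstep (icls Ga) (icls Up)"
proof
 assume "surgery_step G (markov_templates G) Ga Up"
 from surgery_step_rewriting[OF this] obtain Om La al be where t: "(Om, La, al, be):markov_templates G"
  and rw: "!!ds cs ds' cs'. tpl_lists G (Om, La, al, be) ds cs ds' cs' ==>
   rewriting (icls (anchor Om ds cs)) (icls (anchor La ds' cs')) (icls Ga) (icls Up)" by blast
 obtain l r where lr: "template_for (Om, La, al, be) l r" "markov_pair l r \<or> markov_pair r l" using template_pair[OF t] by blast
 hence "rewriting l r (icls Ga) (icls Up)" using rw by (auto simp: template_for_def)
 thus "mstep (icls Ga) (icls Up)" using lr(2) by (auto simp: mstep_def)
next
 assume "mstep (icls Ga) (icls Up)"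
 then obtain l r where lr: "markov_pair l r \<or> markov_pair r l" "rewriting l r (icls Ga) (icls Up)" by (auto simp: mstep_def)
 from lr(1) obtain t where t: "t:markov_templates G" "template_for t l r"
  using template_for_pair template_for_swap markov_templates.swap by blast
 obtain Om La al be where tt: "t = (Om, La, al, be)" by (cases t) auto
 with t(2) obtain ds cs ds' cs' where "tpl_lists G (Om, La, al, be) ds cs ds' cs'" "l = icls (anchor Om ds cs)" "r = icls (anchor La ds' cs')"
  by (auto simp: template_for_def)
 thus "surgery_step G (markov_templates G) Ga Up" using rewriting_surgery_step[OF assms t(1)[unfolded tt]] lr(2) by blast
qed

lemma rep: "A:Arr DC ==> EX Ga :: (nat, nat, 's, 'a) adiagram. is_adiagram G Ga & A = icls Ga"
 by (auto simp: diagram_cat_def)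

lemma iso_class_arr: "is_adiagram G Ga ==> icls (Ga :: (nat, nat, 's, 'a) adiagram):Arr DC"
 by (auto simp: diagram_cat_def)

lemma pair_arr:
 assumes "markov_pair l r"
 shows "l:Arr DC" "r:Arr DC" "Dom DC l = Dom DC r" "Cod DC l = Cod DC r"
proof -
 have L: "k:Arrows G ==> ATgt G k:Obj DC" "k:Arrows G ==> ASrc G k:Obj DC" for k
  using fg by (simp_all add: free_graph_monoid_def DC_simps(1))
 show "l:Arr DC" "r:Arr DC" "Dom DC l = Dom DC r" "Cod DC l = Cod DC r"
  using assms by (induction rule: markov_pair.induct; simp add: L gen_arr)+
qed

lemma mstep_arr:
 assumes "mstep A B"
 shows "A:Arr DC" "B:Arr DC" "Dom DC A = Dom DC B" "Cod DC A = Cod DC B" "mstep B A"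
proof -
 obtain l r where p: "markov_pair l r \<or> markov_pair r l" and rw: "rewriting l r A B" using assms by (auto simp: mstep_def)
 have lr: "l:Arr DC" "r:Arr DC" "Dom DC l = Dom DC r" "Cod DC l = Cod DC r" using p pair_arr by metis+
 have "A:Arr DC & B:Arr DC & Dom DC A = Dom DC B & Cod DC A = Cod DC B"
  using rw lr by (auto simp: rewriting_def)
 thus "A:Arr DC" "B:Arr DC" "Dom DC A = Dom DC B" "Cod DC A = Cod DC B" by blast+
 have "rewriting r l B A" using rw lr unfolding rewriting_def by auto
 thus "mstep B A" using p by (auto simp: mstep_def)
qed

lemma mstep_ctx:
 assumes "mstep A B" "x:Arr DC"
 shows "Cod DC A = Dom DC x ==> mstep (x **. A) (x **. B)" "Cod DC x = Dom DC A ==> mstep (A **. x) (B **. x)"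
  "mstep (A ##. x) (B ##. x)"
proof -
 obtain l r where p: "markov_pair l r \<or> markov_pair r l" and rw: "rewriting l r A B" using assms by (auto simp: mstep_def)
 have lr: "l:Arr DC" "r:Arr DC" "Dom DC l = Dom DC r" "Cod DC l = Cod DC r" using p pair_arr by metis+
 obtain f g w where f: "f:Arr DC" "g:Arr DC" "w:Obj DC" "Cod DC f = Dom DC l @ w" "Dom DC g = Cod DC l @ w"
  and A: "A = g **. (l ##. Idn DC w) **. f" and B: "B = g **. (r ##. Idn DC w) **. f"
  using rw unfolding rewriting_def by blast
 note s = f lr assms(2)
 show "mstep (x **. A) (x **. B)" if "Cod DC A = Dom DC x"
 proof -
  have "rewriting l r (x **. A) (x **. B)" unfolding rewriting_def
   by (rule exI[of _ f], rule exI[of _ "x **. g"], rule exI[of _ w]) (use s that in "simp add: A B")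
  thus ?thesis using p by (auto simp: mstep_def)
 qed
 show "mstep (A **. x) (B **. x)" if "Cod DC x = Dom DC A"
 proof -
  have "rewriting l r (A **. x) (B **. x)" unfolding rewriting_def
   by (rule exI[of _ "f **. x"], rule exI[of _ g], rule exI[of _ w]) (use s that in "simp add: A B")
  thus ?thesis using p by (auto simp: mstep_def)
 qed
 let ?w = "w @ Dom DC x"
 have wO: "?w:Obj DC" using s by simp
 \<comment> \<open>A product with \<open>x\<close> on the right only lengthens the row of idle
   wires; \<open>x\<close> itself is absorbed into the last factor.\<close>
 have e: "(g **. (h ##. Idn DC w) **. f) ##. x = (g ##. x) **. (h ##. Idn DC ?w) **. (f ##. Idn DC (Dom DC x))"
  if "h:Arr DC" "Dom DC h = Dom DC l" "Cod DC h = Cod DC l" for h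
  using that s by (simp add: DC.interchange DC.ten_id[symmetric] del: DC.ten_assoc flip: DC.ten_assoc)
 have "rewriting l r (A ##. x) (B ##. x)" unfolding rewriting_def
  by (rule exI[of _ "f ##. Idn DC (Dom DC x)"], rule exI[of _ "g ##. x"], rule exI[of _ ?w]) (use s wO e[of l] e[of r] in "simp add: A B")
 thus "mstep (A ##. x) (B ##. x)" using p by (auto simp: mstep_def)
qed

abbreviation "R == markov_congruence G"

lemma R_iff: "(A, B):R <-> A:Arr DC & mstep\<^sup>*\<^sup>* A B"
proof
 assume "(A, B):R"
 then obtain Ga Up :: "(nat, nat, 's, 'a) adiagram" where g: "A = icls Ga" "B = icls Up" "is_adiagram G Ga" "is_adiagram G Up"
  and s: "(surgery_step G (markov_templates G))\<^sup>*\<^sup>* Ga Up" by (auto simp: markov_congruence_def)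
 from s have "mstep\<^sup>*\<^sup>* (icls Ga) (icls Up)"
 proof (induction rule: rtranclp_induct)
  case (step Up Ph)
  have "is_adiagram G Up" "is_adiagram G Ph" using step(2) by (auto simp: surgery_step_def)
  hence "mstep (icls Up) (icls Ph)" using step_iff step(2) by blast
  thus ?case using step(3) by (rule rtranclp.rtrancl_into_rtrancl[rotated])
 qed simp
 thus "A:Arr DC & mstep\<^sup>*\<^sup>* A B" using g iso_class_arr by simp
next
 assume a: "A:Arr DC & mstep\<^sup>*\<^sup>* A B"
 then obtain Ga :: "(nat, nat, 's, 'a) adiagram" where g: "is_adiagram G Ga" "A = icls Ga" using rep by blast
 from a have "mstep\<^sup>*\<^sup>* A B" by blast
 hence "EX Up :: (nat, nat, 's, 'a) adiagram. is_adiagram G Up & B = icls Up & (surgery_step G (markov_templates G))\<^sup>*\<^sup>* Ga Up"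
 proof (induction rule: rtranclp_induct)
  case base
  thus ?case using g by blast
 next
  case (step B C)
  then obtain Up :: "(nat, nat, 's, 'a) adiagram" where u: "is_adiagram G Up" "B = icls Up" "(surgery_step G (markov_templates G))\<^sup>*\<^sup>* Ga Up" by blast
  obtain Ph :: "(nat, nat, 's, 'a) adiagram" where f: "is_adiagram G Ph" "C = icls Ph" using rep mstep_arr(2)[OF step(2)] by blast
  have "surgery_step G (markov_templates G) Up Ph" using step_iff[OF u(1) f(1)] step(2) u(2) f(2) by simp
  with u(3) have "(surgery_step G (markov_templates G))\<^sup>*\<^sup>* Ga Ph" by (rule rtranclp.rtrancl_into_rtrancl)
  thus ?case using f by blast
 qed
 thus "(A, B):R" using g by (auto simp: markov_congruence_def)
qed

lemma msteps_arr:
 assumes "mstep\<^sup>*\<^sup>* A B" "A:Arr DC"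
 shows "B:Arr DC & Dom DC A = Dom DC B & Cod DC A = Cod DC B & mstep\<^sup>*\<^sup>* B A"
 using assms
proof (induction rule: rtranclp_induct)
 case (step B C)
 thus ?case using mstep_arr[OF step(2)] by (auto intro: converse_rtranclp_into_rtranclp)
qed simp

text \<open>The conditions on domain and codomain admit operations such as composition with a fixed
  arrow, which make sense only for arrows parallel to \<open>A\<close>.\<close>

lemma R_map:
 assumes "(A, B):R" "!!X Y. mstep X Y ==> Dom DC X = Dom DC A ==> Cod DC X = Cod DC A ==> mstep (h X) (h Y)" "h A:Arr DC"
 shows "(h A, h B):R"
proof -
 have A: "A:Arr DC" and s: "mstep\<^sup>*\<^sup>* A B" using assms(1) R_iff by auto
 from s have "mstep\<^sup>*\<^sup>* (h A) (h B)"
 proof (induction rule: rtranclp_induct)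
  case (step B C)
  have "mstep (h B) (h C)" using assms(2)[OF step(2)] msteps_arr[OF step(1) A] by simp
  thus ?case using step(3) by (rule rtranclp.rtrancl_into_rtrancl[rotated])
 qed simp
 thus ?thesis using R_iff assms(3) by blast
qed

lemma R_sym: "(A, B):R ==> (B, A):R"
 using R_iff msteps_arr by blast

lemma R_trans: "(A, B):R ==> (B, C):R ==> (A, C):R"
 unfolding R_iff by (meson rtranclp_trans)

lemma FM_simps: "Obj (free_markov G) = Obj DC" "Arr (free_markov G) = Arr (quotient_cat DC R)" "Dom (free_markov G) = Dom (quotient_cat DC R)"
   "Cod (free_markov G) = Cod (quotient_cat DC R)" "Idn (free_markov G) = Idn (quotient_cat DC R)" "Cmp (free_markov G) = Cmp (quotient_cat DC R)"
   "TArr (free_markov G) = TArr (quotient_cat DC R)" "Sym (free_markov G) = Sym (quotient_cat DC R)"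
   "TObj (free_markov G) = (@)" "Unit (free_markov G) = []"
   "Assoc (free_markov G) u v w = R `` {Idn DC (u @ v @ w)}" "LUnit (free_markov G) u = R `` {Idn DC u}" "RUnit (free_markov G) u = R `` {Idn DC u}"
   "Dup (free_markov G) u = R `` {icls (dup_diagram G u)}"
   "Disc (free_markov G) u = foldr (%a A. HArrow (i_m G) (ADisc G a) ##\<^bsub>quotient_cat DC R\<^esub> A) u (Idn (quotient_cat DC R) [])"
 by (simp_all add: free_markov_def Let_def sym_cat.extend_def markov_cat.fields_def quotient_cat_def diagram_cat_def)

sublocale FM: quot DC "Letters G" R "free_markov G"
proof
 have ar: "f:Arr DC & g:Arr DC & Dom DC f = Dom DC g & Cod DC f = Cod DC g" if "(f, g):R" for f g
  using that[unfolded R_iff] msteps_arr[of f g] by blast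
 show "equiv (Arr DC) R"
 proof (rule equivI)
  show "R <= Arr DC \<times> Arr DC" by (rule subrelI) (use ar in blast)
  show "refl_on (Arr DC) R" by (rule refl_onI) (simp add: R_iff)
  show "sym R" by (rule symI) (rule R_sym)
  show "trans R" by (rule transI) (rule R_trans)
 qed
 show "(f, g):R ==> Dom DC f = Dom DC g & Cod DC f = Cod DC g" for f g using ar by blast
 show "(g **. f, g' **. f'):R" if a: "(f, f'):R" "(g, g'):R" "Cod DC f = Dom DC g" for f f' g g'
 proof -
  have "(g **. f, g **. f'):R"
   by (rule R_map[OF a(1), where h = "%f. g **. f"]) (use ar[OF a(1)] ar[OF a(2)] a(3) in "simp_all add: mstep_ctx")
  moreover have "(g **. f', g' **. f'):R"
   by (rule R_map[OF a(2), where h = "%g. g **. f'"]) (use ar[OF a(1)] ar[OF a(2)] a(3) in "simp_all add: mstep_ctx")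
  ultimately show ?thesis by (rule R_trans)
 qed
 have tl: "(f ##. g, f' ##. g):R" if a: "(f, f'):R" "g:Arr DC" for f f' g
  by (rule R_map[OF a(1), where h = "%f. f ##. g"]) (use ar[OF a(1)] a(2) in "simp_all add: mstep_ctx")
 show "(f ##. g, f' ##. g'):R" if a: "(f, f'):R" "(g, g'):R" for f f' g g'
 proof -
  \<comment> \<open>A factor on the left is moved to the right by conjugating with symmetries, since
    \<open>mstep_ctx\<close> covers products on the right only.\<close>
  have sw: "f' ##. h = Sym DC (Cod DC h) (Cod DC f') **. (h ##. f') **. Sym DC (Dom DC f') (Dom DC h)" if "h:Arr DC" for h
  proof -
   have f': "f':Arr DC" using ar[OF a(1)] by simp
   have "Sym DC (Cod DC h) (Cod DC f') **. (h ##. f') **. Sym DC (Dom DC f') (Dom DC h) =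
     (f' ##. h) **. Sym DC (Dom DC h) (Dom DC f') **. Sym DC (Dom DC f') (Dom DC h)"
    using that f' DC.cmp_rewrite[OF DC.sym_nat[OF that f'], of "Sym DC (Dom DC f') (Dom DC h)"] by simp
   also have "... = f' ##. h" using that f' by (simp add: DC.sym_sym)
   finally show ?thesis ..
  qed
  note f = ar[OF a(1)] and g = ar[OF a(2)]
  have "(Sym DC (Cod DC g) (Cod DC f') **. (g ##. f') **. Sym DC (Dom DC f') (Dom DC g),
    Sym DC (Cod DC g) (Cod DC f') **. (g' ##. f') **. Sym DC (Dom DC f') (Dom DC g)):R"
   by (rule R_map[OF tl[OF a(2)], where h = "%X. Sym DC (Cod DC g) (Cod DC f') **. X **. Sym DC (Dom DC f') (Dom DC g)"])
    (use f g in "simp_all add: mstep_ctx mstep_arr(1,2)")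
  hence "(f' ##. g, f' ##. g'):R" using sw[of g] sw[of g'] f g by simp
  thus ?thesis by (rule R_trans[rotated]) (rule tl[OF a(1)], use g in blast)
 qed
qed (simp_all add: FM_simps quotient_cat_def)

end

section \<open>Comonoids on words\<close>

context strict_smc
begin

definition "msw u v = Idn C u ## Sym C u v ## Idn C v"

lemma msw_arr [simp]: "u:Obj C ==> v:Obj C ==> msw u v:Arr C" "u:Obj C ==> v:Obj C ==> Dom C (msw u v) = u @ u @ v @ v"
 "u:Obj C ==> v:Obj C ==> Cod C (msw u v) = u @ v @ u @ v"
 by (simp_all add: msw_def)

lemma perm_swap:
 assumes "distinct (P @ A @ B @ Q)" "map lab (P @ A @ B @ Q):Obj C"
 shows "perm lab (P @ A @ B @ Q) (P @ B @ A @ Q) = Idn C (map lab P) ## Sym C (map lab A) (map lab B) ## Idn C (map lab Q)"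
proof -
 have o: "map lab P:Obj C" "map lab A:Obj C" "map lab B:Obj C" "map lab Q:Obj C" "map lab (A @ B):Obj C" using assms(2) by simp_all
 have "perm lab (A @ B) (B @ A) = Sym C (map lab A) (map lab B)" by (rule perm_sym) (use assms o in auto)
 hence "perm lab ((A @ B) @ Q) ((B @ A) @ Q) = Sym C (map lab A) (map lab B) ## Idn C (map lab Q)"
  using assms o by (subst perm_append) (auto simp: pm_def perm_id)
 moreover have "perm lab (P @ (A @ B) @ Q) (P @ (B @ A) @ Q) = Idn C (map lab P) ## perm lab ((A @ B) @ Q) ((B @ A) @ Q)"
  using assms o by (subst perm_append) (auto simp: pm_def perm_id)
 ultimately show ?thesis by simp
qed

text \<open>Every occurrence of a letter in the given words gets its own name, the pair of word
  index and position. Equations between rearrangements of whole words then follow from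
  \<open>perm_comp\<close>.\<close>

lemma blocks:
 obtains lab :: "nat \<times> nat => 's" and b where "!!k. k < length ws ==> map lab (b k) = ws ! k" "!!k. distinct (b k)"
  "!!k l. k ~= l ==> set (b k) Int set (b l) = {}"
proof (rule that[of "%(k, i). ws ! k ! i" "%k. map (Pair k) [0..<length (ws ! k)]"])
 show "map (%(k, i). ws ! k ! i) (map (Pair k) [0..<length (ws ! k)]) = ws ! k" for k by (simp add: map_nth o_def)
qed (auto simp: distinct_map inj_on_def)

text \<open>Both sides carry the named blocks \<open>A, A', B, B'\<close> to
  \<open>A', B', A, B\<close>.\<close>

lemma msw_sym:
 assumes [simp]: "X:Obj C" "Y:Obj C"
 shows "Sym C (X @ Y) (X @ Y) ** msw X Y = msw X Y ** (Sym C X X ## Sym C Y Y)"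
proof -
 obtain lab :: "nat \<times> nat => 's" and b where b: "!!k. k < length [X, X, Y, Y] ==> map lab (b k) = [X, X, Y, Y] ! k" "!!k. distinct (b k)"
  "!!k l. k ~= l ==> set (b k) Int set (b l) = {}" by (rule blocks[of "[X, X, Y, Y]"]) blast
 define A A' B B' where l: "A = b 0" "A' = b 1" "B = b 2" "B' = b 3"
 have m [simp]: "map lab A = X" "map lab A' = X" "map lab B = Y" "map lab B' = Y" using b(1)[of 0] b(1)[of 1] b(1)[of 2] b(1)[of 3] by (simp_all add: l)
 have d: "distinct (A @ A' @ B @ B')" using b(2) b(3) by (simp add: l Int_Un_distrib)
 have pm: "pm L M" if "set L = set M" "distinct L" "distinct M" for L M :: "(nat \<times> nat) list" using that by (simp add: pm_def)
 have e1: "perm lab (A @ A' @ B @ B') (A @ B @ A' @ B') = msw X Y" using perm_swap[of A A' B B' lab] d by (simp add: msw_def)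
 have d2: "distinct (A' @ A @ B' @ B)" using d by auto
 have e2: "perm lab (A' @ A @ B' @ B) (A' @ B' @ A @ B) = msw X Y" using perm_swap[of A' A B' B lab] d2 by (simp add: msw_def)
 have e3: "perm lab (A @ B @ A' @ B') (A' @ B' @ A @ B) = Sym C (X @ Y) (X @ Y)" using perm_sym[of "A @ B" "A' @ B'" lab] d by auto
 have e4: "perm lab (A @ A' @ B @ B') (A' @ A @ B' @ B) = Sym C X X ## Sym C Y Y"
  using perm_append[of "A @ A'" "A' @ A" "B @ B'" "B' @ B" lab] perm_sym[of A A' lab] perm_sym[of B B' lab] d by (auto simp: pm_def)
 have "perm lab (A @ B @ A' @ B') (A' @ B' @ A @ B) ** perm lab (A @ A' @ B @ B') (A @ B @ A' @ B') =
  perm lab (A' @ A @ B' @ B) (A' @ B' @ A @ B) ** perm lab (A @ A' @ B @ B') (A' @ A @ B' @ B)"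
  using d by (subst (1 2) perm_comp) (auto intro!: pm)
 thus ?thesis unfolding e1 e2 e3 e4 .
qed

text \<open>Both sides carry the named blocks \<open>A, A', B, B', D, D'\<close> to
  \<open>A, B, D, A', B', D'\<close>.\<close>

lemma msw_msw:
 assumes [simp]: "X:Obj C" "Y:Obj C" "Z:Obj C"
 shows "msw X (Y @ Z) ** (Idn C (X @ X) ## msw Y Z) = msw (X @ Y) Z ** (msw X Y ## Idn C (Z @ Z))"
proof -
 let ?w = "[X, X, Y, Y, Z, Z]"
 obtain lab :: "nat \<times> nat => 's" and b where b: "!!k. k < length ?w ==> map lab (b k) = ?w ! k" "!!k. distinct (b k)"
  "!!k l. k ~= l ==> set (b k) Int set (b l) = {}" by (rule blocks[of ?w]) blast
 define A A' B B' D D' where l: "A = b 0" "A' = b 1" "B = b 2" "B' = b 3" "D = b 4" "D' = b 5"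
 have m [simp]: "map lab A = X" "map lab A' = X" "map lab B = Y" "map lab B' = Y" "map lab D = Z" "map lab D' = Z"
  using b(1)[of 0] b(1)[of 1] b(1)[of 2] b(1)[of 3] b(1)[of 4] b(1)[of 5] by (simp_all add: l)
 have d: "distinct (A @ A' @ B @ B' @ D @ D')" using b(2) b(3) by (simp add: l Int_Un_distrib)
 have pm: "pm L M" if "set L = set M" "distinct L" "distinct M" for L M :: "(nat \<times> nat) list" using that by (simp add: pm_def)
 have e1: "perm lab (A @ A' @ B @ B' @ D @ D') (A @ A' @ B @ D @ B' @ D') = Idn C (X @ X) ## msw Y Z"
  using perm_swap[of "A @ A' @ B" B' D D' lab] d by (simp add: msw_def flip: ten_id)
 have d2: "distinct (A @ A' @ B @ D @ B' @ D')" using d by auto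
 have e2: "perm lab (A @ A' @ B @ D @ B' @ D') (A @ B @ D @ A' @ B' @ D') = msw X (Y @ Z)"
  using perm_swap[of A A' "B @ D" "B' @ D'" lab] d2 by (simp add: msw_def)
 have e3: "perm lab (A @ A' @ B @ B' @ D @ D') (A @ B @ A' @ B' @ D @ D') = msw X Y ## Idn C (Z @ Z)"
  using perm_swap[of A A' B "B' @ D @ D'" lab] d by (simp add: msw_def flip: ten_id)
 have e4: "perm lab (A @ B @ A' @ B' @ D @ D') (A @ B @ D @ A' @ B' @ D') = msw (X @ Y) Z"
 proof -
  have "distinct (A @ B @ A' @ B' @ D @ D')" using d by auto
  thus ?thesis using perm_swap[of "A @ B" "A' @ B'" D D' lab] by (simp add: msw_def)
 qed
 have "perm lab (A @ A' @ B @ D @ B' @ D') (A @ B @ D @ A' @ B' @ D') ** perm lab (A @ A' @ B @ B' @ D @ D') (A @ A' @ B @ D @ B' @ D') =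
  perm lab (A @ B @ A' @ B' @ D @ D') (A @ B @ D @ A' @ B' @ D') ** perm lab (A @ A' @ B @ B' @ D @ D') (A @ B @ A' @ B' @ D @ D')"
  using d by (subst (1 2) perm_comp) (auto intro!: pm)
 thus ?thesis unfolding e1 e2 e3 e4 .
qed

definition comonoid :: "'s list => 'm => 'm => bool" where
 "comonoid X d e <-> X:Obj C & d:Arr C & Dom C d = X & Cod C d = X @ X & e:Arr C & Dom C e = X & Cod C e = [] &
   (Idn C X ## d) ** d = (d ## Idn C X) ** d & (Idn C X ## e) ** d = Idn C X & (e ## Idn C X) ** d = Idn C X & Sym C X X ** d = d"

text \<open>For coassociativity, \<open>K1\<close> and \<open>K2\<close> push the outer
  comultiplications through the interchange. What remains is coassociativity in each factor and the
  equation \<open>K3\<close> between symmetries. The counit and cocommutativity laws reduce to the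
  factors in the same way.\<close>

lemma comonoid_ten:
 assumes "comonoid X d e" "comonoid Y d' e'"
 shows "comonoid (X @ Y) (msw X Y ** (d ## d')) (e ## e')"
proof -
 have [simp]: "X:Obj C" "Y:Obj C" "d:Arr C" "Dom C d = X" "Cod C d = X @ X" "e:Arr C" "Dom C e = X" "Cod C e = []"
  "d':Arr C" "Dom C d' = Y" "Cod C d' = Y @ Y" "e':Arr C" "Dom C e' = Y" "Cod C e' = []"
  and lX: "(Idn C X ## d) ** d = (d ## Idn C X) ** d" "(Idn C X ## e) ** d = Idn C X" "(e ## Idn C X) ** d = Idn C X" "Sym C X X ** d = d"
  and lY: "(Idn C Y ## d') ** d' = (d' ## Idn C Y) ** d'" "(Idn C Y ## e') ** d' = Idn C Y" "(e' ## Idn C Y) ** d' = Idn C Y" "Sym C Y Y ** d' = d'"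
  using assms by (simp_all add: comonoid_def)
 let ?D = "msw X Y ** (d ## d')" and ?X = "Idn C X" and ?Y = "Idn C Y" and ?sg = "Sym C X Y"
 have I: "Idn C (X @ Y) = ?X ## ?Y" by (simp add: ten_id)
 have K1: "(d ## d' ## ?X ## ?Y) ** msw X Y = (Idn C (X @ X) ## Sym C X (Y @ Y) ## ?Y) ** ((d ## ?X) ## (d' ## ?Y))"
 proof -
  have "(d ## d' ## ?X ## ?Y) ** msw X Y = (d ## (d' ## ?X) ## ?Y) ** (?X ## ?sg ## ?Y)" by (simp add: msw_def)
  also have "... = d ## ((d' ## ?X) ** ?sg) ## ?Y" by (simp add: interchange del: ten_assoc)
  also have "(d' ## ?X) ** ?sg = Sym C X (Y @ Y) ** (?X ## d')" using sym_nat1(2)[of d' X] by simp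
  also have "d ## (Sym C X (Y @ Y) ** (?X ## d')) ## ?Y = (Idn C (X @ X) ## Sym C X (Y @ Y) ## ?Y) ** (d ## (?X ## d') ## ?Y)"
   by (simp add: interchange del: ten_assoc)
  finally show ?thesis by simp
 qed
 have K2: "(?X ## ?Y ## d ## d') ** msw X Y = (?X ## Sym C (X @ X) Y ## Idn C (Y @ Y)) ** ((?X ## d) ## (?Y ## d'))"
 proof -
  have "(?X ## ?Y ## d ## d') ** msw X Y = (?X ## (?Y ## d) ## d') ** (?X ## ?sg ## ?Y)" by (simp add: msw_def)
  also have "... = ?X ## ((?Y ## d) ** ?sg) ## d'" by (simp add: interchange del: ten_assoc)
  also have "(?Y ## d) ** ?sg = Sym C (X @ X) Y ** (d ## ?Y)" using sym_nat1(1)[of d Y] by simp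
  also have "?X ## (Sym C (X @ X) Y ** (d ## ?Y)) ## d' = (?X ## Sym C (X @ X) Y ## Idn C (Y @ Y)) ** (?X ## (d ## ?Y) ## d')"
   by (simp add: interchange del: ten_assoc)
  finally show ?thesis by simp
 qed
 \<comment> \<open>Both sides carry three copies of \<open>X\<close> followed by three of
   \<open>Y\<close> to the alternating order, preserving the order of the copies.\<close>
 have K3: "(msw X Y ## ?X ## ?Y) ** (Idn C (X @ X) ## Sym C X (Y @ Y) ## ?Y) = (?X ## ?Y ## msw X Y) ** (?X ## Sym C (X @ X) Y ## Idn C (Y @ Y))"
 proof -
  have s: "(?sg ## ?Y ## ?X) ** (?X ## ?Y ## ?sg) = (?Y ## ?X ## ?sg) ** (?sg ## ?X ## ?Y)"
   using slide[of ?sg ?sg] by (simp flip: ten_id)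
  have "(?sg ## ?Y ## ?X) ** (?X ## Sym C X (Y @ Y)) = (?sg ## ?Y ## ?X) ** (?X ## ?Y ## ?sg) ** (?X ## ?sg ## ?Y)"
   by (simp add: hex whisker)
  also have "... = (?Y ## ?X ## ?sg) ** (?sg ## ?X ## ?Y) ** (?X ## ?sg ## ?Y)" using cmp_rewrite[OF s, of "?X ## ?sg ## ?Y"] by simp
  also have "... = (?Y ## ?X ## ?sg) ** (Sym C (X @ X) Y ## ?Y)" by (simp add: hex' whisker)
  finally have e: "(?sg ## ?Y ## ?X) ** (?X ## Sym C X (Y @ Y)) = (?Y ## ?X ## ?sg) ** (Sym C (X @ X) Y ## ?Y)" .
  have "(msw X Y ## ?X ## ?Y) ** (Idn C (X @ X) ## Sym C X (Y @ Y) ## ?Y) =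
   (?X ## (?sg ## ?Y ## ?X) ## ?Y) ** (?X ## (?X ## Sym C X (Y @ Y)) ## ?Y)" by (simp add: msw_def flip: ten_id)
  also have "... = ?X ## ((?Y ## ?X ## ?sg) ** (Sym C (X @ X) Y ## ?Y)) ## ?Y"
   unfolding e[symmetric] by (simp add: interchange del: ten_assoc)
  also have "... = (?X ## (?Y ## ?X ## ?sg) ## ?Y) ** (?X ## (Sym C (X @ X) Y ## ?Y) ## ?Y)" by (simp add: interchange del: ten_assoc)
  finally show ?thesis by (simp add: msw_def flip: ten_id)
 qed
 have co: "(Idn C (X @ Y) ## ?D) ** ?D = (?D ## Idn C (X @ Y)) ** ?D"
 proof -
  have "(?D ## Idn C (X @ Y)) ** ?D = (msw X Y ## ?X ## ?Y) ** (d ## d' ## ?X ## ?Y) ** msw X Y ** (d ## d')"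
   by (simp add: whisker(2)) (simp add: I)
  also have "... = (msw X Y ## ?X ## ?Y) ** (Idn C (X @ X) ## Sym C X (Y @ Y) ## ?Y) ** ((d ## ?X) ## (d' ## ?Y)) ** (d ## d')"
   using cmp_rewrite[OF K1, of "d ## d'"] by simp
  also have "((d ## ?X) ## (d' ## ?Y)) ** (d ## d') = ((d ## ?X) ** d) ## ((d' ## ?Y) ** d')" by (rule interchange) simp_all
  also have "... = ((?X ## d) ** d) ## ((?Y ## d') ** d')" by (simp only: lX lY)
  also have "(msw X Y ## ?X ## ?Y) ** (Idn C (X @ X) ## Sym C X (Y @ Y) ## ?Y) ** ... =
   (?X ## ?Y ## msw X Y) ** (?X ## Sym C (X @ X) Y ## Idn C (Y @ Y)) ** (((?X ## d) ** d) ## ((?Y ## d') ** d'))"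
   using cmp_rewrite[OF K3, of "((?X ## d) ** d) ## ((?Y ## d') ** d')"] by simp
  also have "((?X ## d) ** d) ## ((?Y ## d') ** d') = ((?X ## d) ## (?Y ## d')) ** (d ## d')" by (rule interchange[symmetric]) simp_all
  also have "(?X ## ?Y ## msw X Y) ** (?X ## Sym C (X @ X) Y ## Idn C (Y @ Y)) ** ... = (?X ## ?Y ## msw X Y) ** (?X ## ?Y ## d ## d') ** msw X Y ** (d ## d')"
   using cmp_rewrite[OF K2[symmetric], of "d ## d'"] by simp
  also have "... = (Idn C (X @ Y) ## ?D) ** ?D" by (simp add: whisker(1)) (simp add: I)
  finally show ?thesis ..
 qed
 have a1: "(?Y ## e) ** ?sg = e ## ?Y" "(e' ## ?X) ** ?sg = ?X ## e'" using sym_nat1(1)[of e Y] sym_nat1(2)[of e' X] by simp_all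
 have "(?X ## (?Y ## e) ## e') ** (?X ## ?sg ## ?Y) = ?X ## ((?Y ## e) ** ?sg) ## e'"
  by (simp add: interchange del: ten_assoc)
 hence e1: "(?X ## ?Y ## e ## e') ** msw X Y = (?X ## e) ## (?Y ## e')" by (simp add: a1 msw_def)
 have "(e ## (e' ## ?X) ## ?Y) ** (?X ## ?sg ## ?Y) = e ## ((e' ## ?X) ** ?sg) ## ?Y"
  by (simp add: interchange del: ten_assoc)
 hence e2: "(e ## e' ## ?X ## ?Y) ** msw X Y = (e ## ?X) ## (e' ## ?Y)" by (simp add: a1 msw_def)
 have cl: "(Idn C (X @ Y) ## e ## e') ** ?D = Idn C (X @ Y)" "((e ## e') ## Idn C (X @ Y)) ** ?D = Idn C (X @ Y)"
  using cmp_rewrite[OF e1, of "d ## d'"] cmp_rewrite[OF e2, of "d ## d'"] interchange[of d "?X ## e" d' "?Y ## e'"] interchange[of d "e ## ?X" d' "e' ## ?Y"]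
  by (simp_all add: I lX lY)
 have "Sym C (X @ Y) (X @ Y) ** ?D = msw X Y ** (Sym C X X ## Sym C Y Y) ** (d ## d')"
  using cmp_rewrite[OF msw_sym[of X Y], of "d ## d'"] by simp
 also have "... = ?D" using interchange[of d "Sym C X X" d' "Sym C Y Y"] by (simp add: lX lY)
 finally show ?thesis using co cl by (simp add: comonoid_def)
qed

end

text \<open>Only the types of the duplicates are fixed here, because this is applied in the diagram
  category itself, before the comonoid laws are imposed by the quotient.\<close>

locale dups = strict_smc C S for C :: "('s list, 'm, 'z) sym_cat_scheme" (structure) and S :: "'s set" +
 fixes d :: "'s => 'm"
 assumes d_arr: "a:S ==> d a:Arr C & Dom C (d a) = [a] & Cod C (d a) = [a, a]"
begin

primrec dw where
 "dw [] = Idn C []"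
| "dw (a # w) = msw [a] w ** (d a ## dw w)"

lemma d_arr' [simp]: "a:S ==> d a:Arr C" "a:S ==> Dom C (d a) = [a]" "a:S ==> Cod C (d a) = [a, a]"
 using d_arr by simp_all

lemma dw_arr [simp]: "w:Obj C ==> dw w:Arr C" "w:Obj C ==> Dom C (dw w) = w" "w:Obj C ==> Cod C (dw w) = w @ w"
 by (induction w) (auto simp: Obj_eq)

text \<open>\<open>dw\<close> is built letter by letter; \<open>msw_msw\<close>, the associativity
  of the interchange, allows splitting at an arbitrary place of the word.\<close>

lemma dw_append: "u:Obj C ==> v:Obj C ==> dw (u @ v) = msw u v ** (dw u ## dw v)"
proof (induction u)
 case Nil
 thus ?case by (simp add: msw_def ten_id)
next
 case (Cons a u)
 hence [simp]: "u:Obj C" "a:S" "v:Obj C" "[a]:Obj C" by (auto simp: Obj_eq)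
 have "dw ((a # u) @ v) = msw [a] (u @ v) ** (d a ## (msw u v ** (dw u ## dw v)))" using Cons.IH by simp
 also have "d a ## (msw u v ** (dw u ## dw v)) = (Idn C [a, a] ## msw u v) ** (d a ## dw u ## dw v)" by (subst interchange) simp_all
 also have "msw [a] (u @ v) ** ... = msw (a # u) v ** (msw [a] u ## Idn C (v @ v)) ** (d a ## dw u ## dw v)"
  using cmp_rewrite[OF msw_msw[of "[a]" u v], of "d a ## dw u ## dw v"] by simp
 also have "(msw [a] u ## Idn C (v @ v)) ** (d a ## dw u ## dw v) = dw (a # u) ## dw v"
  using interchange[of "d a ## dw u" "msw [a] u" "dw v" "Idn C (v @ v)"] by simp
 finally show ?case .
qed

text \<open>The outputs of the first duplicate wait in front while the others run; the final list
  separates them, and the permutation doing this is \<open>msw [a] w\<close>.\<close>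

lemma ev_dups:
 assumes "!!x. x:set xs ==> ins x = [c x] & ots x = [o1 x, o2 x] & fm x = d (lab (c x)) & lab (o1 x) = lab (c x) & lab (o2 x) = lab (c x)"
  and "distinct (map c xs @ map o1 xs @ map o2 xs)" and "map lab (map c xs):Obj C"
 shows "runs lab ins ots fm (map c xs) xs (map o1 xs @ map o2 xs) & ev lab ins ots fm (map c xs) xs (map o1 xs @ map o2 xs) = dw (map lab (map c xs))"
 using assms
proof (induction xs)
 case Nil
 thus ?case by simp
next
 case (Cons x xs)
 let ?L = "map c xs" and ?M1 = "map o1 xs" and ?M2 = "map o2 xs" and ?a = "lab (c x)" and ?w = "map lab (map c xs)"
 note x = Cons.prems(1)[of x, simplified]
 have o: "?w:Obj C" "?a:S" "[?a]:Obj C" using Cons.prems(3) by (auto simp: Obj_eq)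
 have da: "d ?a:Arr C" "Dom C (d ?a) = [?a]" "Cod C (d ?a) = [?a, ?a]" using o(2) by simp_all
 have IH: "runs lab ins ots fm ?L xs (?M1 @ ?M2)" "ev lab ins ots fm ?L xs (?M1 @ ?M2) = dw ?w"
  using Cons.IH[OF Cons.prems(1)] Cons.prems(2) o(1) by auto
 have oc: "set (concat (map ots xs)) = set ?M1 Un set ?M2" "distinct (concat (map ots xs))"
 proof -
  have *: "set (concat (map ots ys)) = o1 ` set ys Un o2 ` set ys & distinct (concat (map ots ys))" if "set ys <= set xs" "distinct (map o1 ys @ map o2 ys)" for ys
   using that Cons.prems(1) by (induction ys) auto
  from *[of xs] Cons.prems(2) show "set (concat (map ots xs)) = set ?M1 Un set ?M2" "distinct (concat (map ots xs))" by auto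
 qed
 have r: "rem (c x # ?L) [c x] = ?L" by (rule rem_hd) (use Cons.prems(2) in auto)
 have lo: "map lab [o1 x, o2 x] = [?a, ?a]" using x by simp
 have dd: "distinct (?L @ concat (map ots xs) @ [o1 x, o2 x])" using Cons.prems(2) oc by auto
 note T = ev_tensor_left[OF IH(1) dd]
 have T: "runs lab ins ots fm ([o1 x, o2 x] @ ?L) xs ([o1 x, o2 x] @ ?M1 @ ?M2)"
  "ev lab ins ots fm ([o1 x, o2 x] @ ?L) xs ([o1 x, o2 x] @ ?M1 @ ?M2) = Idn C [?a, ?a] ## dw ?w"
  using ev_tensor_left[OF IH(1) dd] o x IH(2) by (auto simp: Obj_eq)
 let ?out = "[o1 x] @ ?M1 @ [o2 x] @ ?M2"
 have pm: "pm ([o1 x, o2 x] @ ?M1 @ ?M2) ?out" using Cons.prems(2) by (auto simp: pm_def)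
 have wM: "map lab ?M1 = ?w" "map lab ?M2 = ?w" using Cons.prems(1) by auto
 have p: "perm lab ([o1 x, o2 x] @ ?M1 @ ?M2) ?out = msw [?a] ?w"
 proof -
  have "distinct ([o1 x] @ [o2 x] @ ?M1 @ ?M2)" using Cons.prems(2) by auto
  moreover have "map lab ([o1 x] @ [o2 x] @ ?M1 @ ?M2):Obj C" using o x by (simp add: wM Obj_eq del: map_map)
  ultimately show ?thesis using perm_swap[of "[o1 x]" "[o2 x]" ?M1 ?M2 lab] x by (simp add: msw_def wM del: map_map perm.simps)
 qed
 note E = ev_post[OF T(1) pm]
 have "ev lab ins ots fm (map c (x # xs)) (x # xs) ?out = (msw [?a] ?w ** (Idn C [?a, ?a] ## dw ?w)) ** (d ?a ## Idn C ?w) ** Idn C (?a # ?w)"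
  using x r E(2) T(2) p perm_id[of "c x # ?L" lab] Cons.prems(2,3) by (simp del: perm.simps)
 also have "... = msw [?a] ?w ** (d ?a ## dw ?w)" using o da slide(2)[of "d ?a" "dw ?w"] by simp
 finally have ev: "ev lab ins ots fm (map c (x # xs)) (x # xs) ?out = dw (?a # ?w)" by simp
 have "runs lab ins ots fm (map c (x # xs)) (x # xs) ?out"
  unfolding runs_def
 proof (intro conjI)
  show "distinct (map c (x # xs) @ concat (map ots (x # xs)))" "distinct ?out" using Cons.prems(2) oc x by auto
  show "map lab (map c (x # xs)):Obj C" by (rule Cons.prems(3))
  show "nodes_ok lab ins ots fm (set (x # xs))" using IH(1) x da by (simp add: runs_def nodes_ok_def)
  have "set (ots x) Un (set (map c (x # xs)) - set (ins x)) = set ([o1 x, o2 x] @ ?L)" using x Cons.prems(2) by auto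
  thus "go ins ots (set (map c (x # xs))) (x # xs) (set ?out)" using x E(1) by (simp add: runs_def)
 qed
 thus ?case using ev by simp
qed

end

locale comonoids = dups C S d for C :: "('s list, 'm, 'z) sym_cat_scheme" (structure) and S :: "'s set" and d :: "'s => 'm" +
 fixes e :: "'s => 'm"
 assumes letter: "a:S ==> comonoid [a] (d a) (e a)"
begin

definition "ew w = foldr (%a A. e a ## A) w (Idn C [])"

lemma comonoid_w: "w:Obj C ==> comonoid w (dw w) (ew w)"
proof (induction w)
 case Nil
 thus ?case by (simp add: comonoid_def ew_def)
next
 case (Cons a w)
 hence "w:Obj C" "a:S" by (auto simp: Obj_eq)
 thus ?case using comonoid_ten[OF letter[of a], of w] Cons.IH by (simp add: ew_def)
qed

end

section \<open>The quotient is a Markov category\<close>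

lemma (in category) inverse_unique:
 assumes "is_inverse C f g" "is_inverse C f h" shows "g = h"
proof -
 have f: "f:Arr C" and g: "g:Arr C" "Dom C g = Cod C f" "Cod C g = Dom C f" "g ** f = Idn C (Dom C f)"
  and h: "h:Arr C" "Dom C h = Cod C f" "Cod C h = Dom C f" "f ** h = Idn C (Cod C f)"
  using assms by (auto simp: is_inverse_def Hom_def)
 have "g = (g ** f) ** h" using f g(1-3) h by simp
 thus ?thesis using h f by (simp only: g(4)) simp
qed

lemma (in category) Inv_eq: "is_inverse C f g ==> Inv C f = g"
 unfolding Inv_def using inverse_unique by (intro the_equality) auto

lemma (in category) id_inverse: "X:Obj C ==> is_inverse C (Idn C X) (Idn C X)"
 by (simp add: is_inverse_def Hom_def)

lemma (in strict_smc) symmetric_monoidal: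
 assumes T: "TObj C = (@)" "Unit C = []"
  and I: "!!u v w. u:Obj C ==> v:Obj C ==> w:Obj C ==> Assoc C u v w = Idn C (u @ v @ w)"
   "!!u. u:Obj C ==> LUnit C u = Idn C u" "!!u. u:Obj C ==> RUnit C u = Idn C u"
 shows "symmetric_monoidal_category C"
proof unfold_locales
 have iso: "X:Obj C ==> is_iso C (Idn C X)" for X using id_inverse by (auto simp: is_iso_def)
 show "f:Hom C X X' ==> g:Hom C Y Y' ==> h:Hom C Z Z' ==>
   Assoc C X' Y' Z' ** ((f ## g) ## h) = (f ## (g ## h)) ** Assoc C X Y Z" for f g h X Y Z X' Y' Z'
  by (frule homD, frule homD[of g], frule homD[of h]) (auto simp: I T)
 show "f:Hom C X X' ==> g:Hom C Y Y' ==> Sym C X' Y' ** (f ## g) = (g ## f) ** Sym C X Y" for f g X Y X' Y'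
  using sym_nat[of f g] by (auto simp: Hom_def)
 show "X:Obj C ==> Y:Obj C ==> Z:Obj C ==> Assoc C Y Z X ** Sym C X (Y \<otimes> Z) ** Assoc C X Y Z =
   (Idn C Y ## Sym C X Z) ** Assoc C Y X Z ** (Sym C X Y ## Idn C Z)" for X Y Z by (simp add: T I hex)
qed (auto simp: T I iso_def Hom_def ten_id sym_sym interchange is_iso_def intro!: id_inverse exI)

context ddg
begin

text \<open>A pair is a rewriting step in the empty context: identities around it and no idle
  wires.\<close>

lemma pair_cl: "markov_pair l r ==> FM.cl l = FM.cl r"
proof -
 assume p: "markov_pair l r"
 note a = pair_arr[OF p]
 have "rewriting l r l r" unfolding rewriting_def
  by (rule exI[of _ "Idn DC (Dom DC l)"], rule exI[of _ "Idn DC (Cod DC l)"], rule exI[of _ "[]"]) (use a in simp)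
 hence "mstep l r" using p by (auto simp: mstep_def)
 thus ?thesis using a by (simp add: FM.cl_eq R_iff)
qed

abbreviation "FMC == free_markov G"

sublocale DD: dups DC "Letters G" dp
 by unfold_locales simp

sublocale FC: comonoids FMC "Letters G" "%a. FM.cl (dp a)" "%a. FM.cl (dc a)"
proof
 fix a assume a: "a:Letters G"
 thus "FM.cl (dp a):Arr FMC & Dom FMC (FM.cl (dp a)) = [a] & Cod FMC (FM.cl (dp a)) = [a, a]" by simp
 show "FM.Q.comonoid [a] (FM.cl (dp a)) (FM.cl (dc a))" unfolding FM.Q.comonoid_def
  using a pair_cl[OF mp_coassoc[OF a]] pair_cl[OF mp_counit_left[OF a]] pair_cl[OF mp_counit_right[OF a]] pair_cl[OF mp_cocomm[OF a], symmetric] by simp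
qed

lemma cl_dw: "w:Obj DC ==> FM.cl (DD.dw w) = FC.dw w"
proof (induction w)
 case (Cons a w)
 hence "a:Letters G" "w:Obj DC" by (auto simp: DC_simps(1))
 with Cons.IH show ?case by (simp add: DC.msw_def FM.Q.msw_def flip: FM.cl_cmp FM.cl_ten)
qed simp

lemma dup_cls:
 assumes w: "w:Obj DC"
 shows "is_adiagram G (dup_diagram G w)" "icls (dup_diagram G w) = DD.dw w"
proof -
 let ?n = "length w"
 let ?ns = "map (%i. (ADup G (w ! i), [i], [?n + i, 2 * ?n + i])) [0..<?n]" and ?v = "%e. w ! (e mod ?n)"
 have L: "i < ?n ==> w ! i:Letters G" for i using w by (auto simp: DC_simps(1) in_lists_conv_set)
 have v: "e < 3 * ?n ==> ?v e:Letters G" for e by (rule L) (cases "?n = 0"; simp)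
 have ok: "mk_ok ?ns {..<3 * ?n} ?v" unfolding mk_ok_def using v L dd_arrow[OF L] by auto
 have e: "[?n..<3 * ?n] = map ((+) ?n) [0..<?n] @ map ((+) (2 * ?n)) [0..<?n]" by (auto intro!: nth_equalityI simp: nth_append)
 have ex: "(EX i<?n. x = ?n + i \<or> x = 2 * ?n + i) <-> ?n <= x & x < 3 * ?n" for x
 proof
  assume "?n <= x & x < 3 * ?n"
  thus "EX i<?n. x = ?n + i \<or> x = 2 * ?n + i"
   by (cases "x < 2 * ?n") (auto intro: exI[of _ "x - ?n"] exI[of _ "x - 2 * ?n"])
 qed auto
 have ds: "set [0..<?n] = {e:{..<3 * ?n}. ALL i<length ?ns. e ~: set (snd (snd (?ns ! i)))}"
 proof -
  have "(ALL i<length ?ns. e ~: set (snd (snd (?ns ! i)))) <-> \<not> (?n <= e & e < 3 * ?n)" for e unfolding ex[symmetric] by auto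
  thus ?thesis by auto
 qed
 have cs: "set [?n..<3 * ?n] = {e:{..<3 * ?n}. ALL i<length ?ns. e ~: set (fst (snd (?ns ! i)))}" by (auto simp: not_less)
 have D: "dup_diagram G w = anchor (mk_diagram ?ns {..<3 * ?n} ?v) [0..<?n] [?n..<3 * ?n]" by (simp add: dup_diagram_def Let_def)
 note E = mk_ok_ev[OF ok distinct_upt ds distinct_upt cs]
 show "is_adiagram G (dup_diagram G w)" unfolding D by (rule E(1))
 have vw: "map ?v (map id [0..<?n]) = w" by (auto intro!: nth_equalityI)
 have "DC.ev ?v (%i. fst (snd (?ns ! i))) (%i. snd (snd (?ns ! i))) (%i. gen (fst (?ns ! i))) (map id [0..<?n]) [0..<?n]
   (map ((+) ?n) [0..<?n] @ map ((+) (2 * ?n)) [0..<?n]) = DD.dw (map ?v (map id [0..<?n]))"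
  by (rule DD.ev_dups[THEN conjunct2]) (use w vw in "auto simp: distinct_map")
 thus "icls (dup_diagram G w) = DD.dw w" using E(2)[folded D] by (simp add: e vw[simplified])
qed

lemma FM_str: "Assoc FMC u v w = FM.cl (Idn DC (u @ v @ w))" "LUnit FMC u = FM.cl (Idn DC u)" "RUnit FMC u = FM.cl (Idn DC u)"
 "TObj FMC = (@)" "Unit FMC = []"
 by (simp_all add: FM_simps FM.cl_def)

lemma im_gen: "k:Arrows G ==> HArrow (i_m G) k = FM.cl (gen k)"
 by (simp add: i_m_def FM.cl_def arrow_diagram_cls(2))

lemma FM_Dup: "w:Obj DC ==> Dup FMC w = FC.dw w"
 by (simp add: FM_simps dup_cls(2) FM.cl_def[symmetric] cl_dw)

lemma FM_Disc: "w:Obj DC ==> Disc FMC w = FM.cl (eps w)"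
proof (induction w)
 case (Cons a w)
 hence a: "a:Letters G" "w:Obj DC" by (auto simp: DC_simps(1))
 have "Disc FMC (a # w) = FM.cl (dc a) ##\<^bsub>FMC\<^esub> Disc FMC w" using im_gen[OF dd_arrow(4)[OF a(1)]] by (simp add: FM_simps)
 thus ?case using Cons.IH a by (simp add: eps_def[of "a # w"] eps_def[of w, symmetric])
qed (simp add: FM_simps(15) eps_def FM_simps(5)[symmetric])

lemma eps_append: "u:Obj DC ==> v:Obj DC ==> eps (u @ v) = eps u ##. eps v"
proof (induction u)
 case (Cons a u)
 hence "a:Letters G" "u:Obj DC" by (auto simp: DC_simps(1))
 with Cons show ?case by (simp add: eps_def[of "a # _"] eps_def[symmetric])
qed (simp add: eps_def[of "[]"])

text \<open>Only the arrows of \<open>G\<close> require a template. The property passes through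
  composition, products and symmetries, so generation extends it to all arrows.\<close>

lemma eps_natural: "A:Arr DC ==> FM.cl (eps (Cod DC A) **. A) = FM.cl (eps (Dom DC A))"
proof (induction A rule: gen_induct[consumes 1])
 case (2 u v)
 thus ?case using DC.sym_nat[of "eps u" "eps v"] by (simp add: eps_append)
next
 case (3 g h)
 have "FM.cl (eps (Cod DC h) **. h **. g) = FM.cl (eps (Cod DC h) **. h) **\<^bsub>FMC\<^esub> FM.cl g" using 3(1-3) by simp
 also have "... = FM.cl (eps (Dom DC h)) **\<^bsub>FMC\<^esub> FM.cl g" by (rule arg_cong[where f = "%X. X **\<^bsub>FMC\<^esub> FM.cl g"]) (use 3 in blast)
 also have "... = FM.cl (eps (Dom DC g))" using 3(1-4) by simp
 finally show ?case using 3(1-3) by simp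
next
 case (4 g h)
 have "FM.cl (eps (Cod DC (g ##. h)) **. (g ##. h)) = FM.cl (eps (Cod DC g) **. g) ##\<^bsub>FMC\<^esub> FM.cl (eps (Cod DC h) **. h)"
  using 4(1,2) by (simp add: eps_append DC.interchange)
 also have "... = FM.cl (eps (Dom DC g)) ##\<^bsub>FMC\<^esub> FM.cl (eps (Dom DC h))"
  by (rule arg_cong2[where f = "TArr FMC"]) (use 4 in blast)+
 finally show ?case using 4(1,2) by (simp add: eps_append)
next
 case (5 k)
 show ?case using pair_cl[OF mp_natural[OF 5(1)]] 5(1) by (simp add: gen_arr)
qed simp_all

text \<open>Associators and unitors are classes of identities, and the structure on a word is a
  comonoid built from its letters; the axioms for products are \<open>dw_append\<close> and
  \<open>eps_append\<close>.\<close>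

theorem markov: "markov_category FMC"
proof -
 interpret M: symmetric_monoidal_category FMC by (rule FM.Q.symmetric_monoidal) (simp_all add: FM_str)
 have O: "Obj FMC = Obj DC" by simp
 have com: "X:Obj DC ==> FM.Q.comonoid X (FC.dw X) (FM.cl (eps X))" for X
 proof -
  assume X: "X:Obj DC"
  have "FC.ew X = FM.cl (eps X)" using X
  proof (induction X)
   case (Cons a w)
   hence "a:Letters G" "w:Obj DC" by (auto simp: DC_simps(1))
   with Cons.IH show ?case by (simp add: FC.ew_def eps_def[of "a # w"] eps_def[of w, symmetric])
  qed (simp add: FC.ew_def eps_def)
  thus ?thesis using FC.comonoid_w[of X] X by simp
 qed
 show ?thesis
 proof unfold_locales
  fix X assume "X:Obj FMC"
  hence X: "X:Obj DC" by simp
  note c = com[OF X, unfolded FM.Q.comonoid_def] and s = FM_str FM_Dup[OF X] FM_Disc[OF X]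
  show "Dup FMC X:Hom FMC X (X \<otimes>\<^bsub>FMC\<^esub> X)" "Disc FMC X:Hom FMC X \<one>\<^bsub>FMC\<^esub>" using c by (simp_all add: s Hom_def)
  show "Assoc FMC X X X **\<^bsub>FMC\<^esub> (Dup FMC X ##\<^bsub>FMC\<^esub> Idn FMC X) **\<^bsub>FMC\<^esub> Dup FMC X = (Idn FMC X ##\<^bsub>FMC\<^esub> Dup FMC X) **\<^bsub>FMC\<^esub> Dup FMC X"
   using c X by (simp add: s FM.cl_id[symmetric] del: FM.cl_id)
  show "RUnit FMC X **\<^bsub>FMC\<^esub> (Idn FMC X ##\<^bsub>FMC\<^esub> Disc FMC X) **\<^bsub>FMC\<^esub> Dup FMC X = Idn FMC X"
   "LUnit FMC X **\<^bsub>FMC\<^esub> (Disc FMC X ##\<^bsub>FMC\<^esub> Idn FMC X) **\<^bsub>FMC\<^esub> Dup FMC X = Idn FMC X"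
   using c X by (simp_all add: s FM.cl_id[symmetric] del: FM.cl_id FM.cl_ten)
  show "Sym FMC X X **\<^bsub>FMC\<^esub> Dup FMC X = Dup FMC X" using c by (simp add: s)
  fix Y assume "Y:Obj FMC"
  hence Y: "Y:Obj DC" by simp
  have [simp]: "Inv FMC (FM.cl (Idn DC u)) = FM.cl (Idn DC u)" if "u:Obj DC" for u
   using FM.Q.Inv_eq[OF FM.Q.id_inverse, of u] that by simp
  have "mid_swap FMC X Y = FM.Q.msw X Y" using X Y by (simp add: mid_swap_def FM.Q.msw_def FM_str DC.ten_id)
  thus "Dup FMC (X \<otimes>\<^bsub>FMC\<^esub> Y) = mid_swap FMC X Y **\<^bsub>FMC\<^esub> (Dup FMC X ##\<^bsub>FMC\<^esub> Dup FMC Y)"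
   using X Y FC.dw_append[of X Y] by (simp add: FM_Dup FM_str)
  show "Disc FMC (X \<otimes>\<^bsub>FMC\<^esub> Y) = LUnit FMC \<one>\<^bsub>FMC\<^esub> **\<^bsub>FMC\<^esub> (Disc FMC X ##\<^bsub>FMC\<^esub> Disc FMC Y)"
   using X Y by (simp add: FM_Disc FM_str eps_append)
 next
  fix f X Y assume "f:Hom FMC X Y"
  hence "EX A. A:Hom DC X Y & f = FM.cl A" by (simp only: FM.quot_hom)
  then obtain A where "A:Arr DC" "Dom DC A = X" "Cod DC A = Y" "f = FM.cl A" by (auto simp: Hom_def)
  thus "Disc FMC Y **\<^bsub>FMC\<^esub> f = Disc FMC X" using eps_natural[of A] by (auto simp: FM_Disc)
 qed
qed

lemma rev_word_obj_FM: "rev_word_obj FMC (%a. [a]) v = rev v"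
proof (induction v)
 case (Cons a v)
 thus ?case by (cases v) (simp_all add: FM_str)
qed (simp add: FM_str)

lemma word_obj_FM: "word_obj FMC (%a. [a]) w = w"
 by (simp add: word_obj_def rev_word_obj_FM)

lemma i_m_hom: "is_gm_hom G FMC (i_m G)"
 unfolding is_gm_hom_def using im_gen gen_arr by (simp add: i_m_def[THEN arg_cong, of HLetter] word_obj_FM Hom_def DC_simps(1))

lemma i_m_matches: "matches_dd G FMC (i_m G)"
 unfolding matches_dd_def using dd_arrow by (simp add: i_m_def[THEN arg_cong, of HLetter] im_gen FM_Dup FM_Disc FM.Q.msw_def eps_def DC.ten_id)

end

section \<open>Words in a Markov category\<close>

context category
begin

abbreviation "isom f == is_iso C f"
abbreviation "iv f == Inv C f"

lemma iso_arr: "isom f ==> f:Arr C"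
 by (auto simp: is_iso_def is_inverse_def)

lemma iv [simp]:
 assumes "isom f"
 shows "iv f:Arr C" "Dom C (iv f) = Cod C f" "Cod C (iv f) = Dom C f" "iv f ** f = Idn C (Dom C f)" "f ** iv f = Idn C (Cod C f)" "isom (iv f)"
proof -
 obtain g where g: "is_inverse C f g" using assms by (auto simp: is_iso_def)
 hence e: "iv f = g" by (rule Inv_eq)
 show "iv f:Arr C" "Dom C (iv f) = Cod C f" "Cod C (iv f) = Dom C f" "iv f ** f = Idn C (Dom C f)" "f ** iv f = Idn C (Cod C f)"
  using g unfolding e by (auto simp: is_inverse_def Hom_def)
 have "is_inverse C g f" using g by (auto simp: is_inverse_def Hom_def)
 thus "isom (iv f)" unfolding e by (auto simp: is_iso_def)
qed

lemma iv_cmp [simp]: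
 assumes "isom f" "g:Arr C"
 shows "Cod C g = Dom C f ==> iv f ** f ** g = g" "Cod C g = Cod C f ==> f ** iv f ** g = g"
 using assms iso_arr[OF assms(1)] by (simp_all flip: cmp_assoc)

lemma iso_id [simp]: "X:Obj C ==> isom (Idn C X)" and iv_id [simp]: "X:Obj C ==> iv (Idn C X) = Idn C X"
 using id_inverse Inv_eq by (auto simp: is_iso_def)

lemma isoI: "f:Arr C ==> g:Arr C ==> Dom C g = Cod C f ==> Cod C g = Dom C f ==> g ** f = Idn C (Dom C f) ==> f ** g = Idn C (Cod C f) ==> isom f"
 by (auto simp: is_iso_def is_inverse_def Hom_def)

lemma iso_cmp [simp]:
 assumes "isom f" "isom g" "Cod C f = Dom C g"
 shows "isom (g ** f)"
 by (rule isoI[of _ "iv f ** iv g"]) (use assms iso_arr[OF assms(1)] iso_arr[OF assms(2)] in simp_all)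

lemma cancel_right:
 assumes "g ** f = h ** f" "isom f" "g:Arr C" "h:Arr C" "Dom C g = Cod C f" "Dom C h = Cod C f"
 shows "g = h"
proof -
 have "(g ** f) ** iv f = (h ** f) ** iv f" by (simp only: assms(1))
 thus ?thesis using assms(2-) iso_arr[OF assms(2)] by simp
qed

lemma cancel_left:
 assumes "f ** g = f ** h" "isom f" "g:Arr C" "h:Arr C" "Cod C g = Dom C f" "Cod C h = Dom C f"
 shows "g = h"
proof -
 have "iv f ** (f ** g) = iv f ** (f ** h)" by (simp only: assms(1))
 thus ?thesis using assms(2-) iso_arr[OF assms(2)] by simp
qed

end

locale mkv = markov_category C for C :: "('o, 'm, 'z) markov_cat_scheme" (structure)
begin

lemma Ob [simp]: "\<one>:Obj C" "X:Obj C ==> Y:Obj C ==> X \<otimes> Y:Obj C"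
 using unit_obj tensor_obj by auto

lemma ten [simp]:
 assumes "f:Arr C" "g:Arr C"
 shows "f ## g:Arr C" "Dom C (f ## g) = Dom C f \<otimes> Dom C g" "Cod C (f ## g) = Cod C f \<otimes> Cod C g"
 using tensor_hom[of f "Dom C f" "Cod C f" g "Dom C g" "Cod C g"] assms by (simp_all add: Hom_def)

lemma ten_id [simp]: "X:Obj C ==> Y:Obj C ==> Idn C X ## Idn C Y = Idn C (X \<otimes> Y)"
 by (rule tensor_id)

lemma inter:
 assumes "f:Arr C" "g:Arr C" "f':Arr C" "g':Arr C" "Cod C f = Dom C g" "Cod C f' = Dom C g'"
 shows "(g ## g') ** (f ## f') = (g ** f) ## (g' ** f')"
 using tensor_comp[of f "Dom C f" "Cod C f" g "Cod C g" f' "Dom C f'" "Cod C f'" g' "Cod C g'"] assms by (simp add: Hom_def)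

lemma inter3:
 assumes "f:Arr C" "g:Arr C" "f':Arr C" "g':Arr C" "Cod C f = Dom C g" "Cod C f' = Dom C g'" "h:Arr C" "Cod C h = Dom C f \<otimes> Dom C f'"
 shows "(g ## g') ** (f ## f') ** h = ((g ** f) ## (g' ** f')) ** h"
 using assms by (simp flip: inter)

lemma iso_ten [simp]: "isom f ==> isom g ==> isom (f ## g)"
 by (rule isoI[of _ "iv f ## iv g"]) (simp_all add: inter iso_arr)

abbreviation "a X Y Z == Assoc C X Y Z"

lemma str [simp]:
 "X:Obj C ==> Y:Obj C ==> Z:Obj C ==> isom (a X Y Z)" "X:Obj C ==> Y:Obj C ==> Z:Obj C ==> a X Y Z:Arr C"
 "X:Obj C ==> Y:Obj C ==> Z:Obj C ==> Dom C (a X Y Z) = (X \<otimes> Y) \<otimes> Z" "X:Obj C ==> Y:Obj C ==> Z:Obj C ==> Cod C (a X Y Z) = X \<otimes> Y \<otimes> Z"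
 "X:Obj C ==> isom (LUnit C X)" "X:Obj C ==> LUnit C X:Arr C" "X:Obj C ==> Dom C (LUnit C X) = \<one> \<otimes> X" "X:Obj C ==> Cod C (LUnit C X) = X"
 "X:Obj C ==> isom (RUnit C X)" "X:Obj C ==> RUnit C X:Arr C" "X:Obj C ==> Dom C (RUnit C X) = X \<otimes> \<one>" "X:Obj C ==> Cod C (RUnit C X) = X"
 "X:Obj C ==> Y:Obj C ==> Sym C X Y:Arr C" "X:Obj C ==> Y:Obj C ==> Dom C (Sym C X Y) = X \<otimes> Y" "X:Obj C ==> Y:Obj C ==> Cod C (Sym C X Y) = Y \<otimes> X"
 "X:Obj C ==> Dup C X:Arr C" "X:Obj C ==> Dom C (Dup C X) = X" "X:Obj C ==> Cod C (Dup C X) = X \<otimes> X"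
 "X:Obj C ==> Disc C X:Arr C" "X:Obj C ==> Dom C (Disc C X) = X" "X:Obj C ==> Cod C (Disc C X) = \<one>"
 using assoc_iso assoc_hom lunit_iso lunit_hom runit_iso runit_hom sym_hom dup_hom disc_hom by (simp_all add: Hom_def)

lemma a_nat: "f:Arr C ==> g:Arr C ==> h:Arr C ==>
  a (Cod C f) (Cod C g) (Cod C h) ** ((f ## g) ## h) = (f ## g ## h) ** a (Dom C f) (Dom C g) (Dom C h)"
 and l_nat: "f:Arr C ==> LUnit C (Cod C f) ** (Idn C \<one> ## f) = f ** LUnit C (Dom C f)"
 and r_nat: "f:Arr C ==> RUnit C (Cod C f) ** (f ## Idn C \<one>) = f ** RUnit C (Dom C f)"
 and s_nat: "f:Arr C ==> g:Arr C ==> Sym C (Cod C f) (Cod C g) ** (f ## g) = (g ## f) ** Sym C (Dom C f) (Dom C g)"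
 by (rule assoc_natural lunit_natural runit_natural sym_natural; rule homI; simp)+

lemma whisk:
 assumes "f:Arr C" "g:Arr C" "Cod C f = Dom C g" "X:Obj C"
 shows "Idn C X ## (g ** f) = (Idn C X ## g) ** (Idn C X ## f)" "(g ** f) ## Idn C X = (g ## Idn C X) ** (f ## Idn C X)"
 using assms by (simp_all add: inter)

text \<open>Naturality of the invertible left unitor makes the product with the unit object
  faithful.\<close>

lemma lunit_faithful:
 assumes "Idn C \<one> ## f = Idn C \<one> ## g" "f:Arr C" "g:Arr C" "Dom C f = Dom C g" "Cod C f = Cod C g"
 shows "f = g"
proof (rule cancel_right)
 show "f ** LUnit C (Dom C f) = g ** LUnit C (Dom C f)" using l_nat[OF assms(2)] l_nat[OF assms(3)] assms(1,4,5) by simp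
qed (use assms in simp_all)

lemma runit_faithful:
 assumes "f ## Idn C \<one> = g ## Idn C \<one>" "f:Arr C" "g:Arr C" "Dom C f = Dom C g" "Cod C f = Cod C g"
 shows "f = g"
proof (rule cancel_right)
 show "f ** RUnit C (Dom C f) = g ** RUnit C (Dom C f)" using r_nat[OF assms(2)] r_nat[OF assms(3)] assms(1,4,5) by simp
qed (use assms in simp_all)

text \<open>The two remaining unit triangles follow from the pentagon (Kelly).\<close>

lemma lunit_ten:
 assumes [simp]: "X:Obj C" "Y:Obj C"
 shows "LUnit C (X \<otimes> Y) ** a \<one> X Y = LUnit C X ## Idn C Y"
proof (rule lunit_faithful)
 let ?I = "Idn C \<one>" and ?k = "a \<one> (\<one> \<otimes> X) Y ** (a \<one> \<one> X ## Idn C Y)"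
 have "(?I ## (LUnit C (X \<otimes> Y) ** a \<one> X Y)) ** ?k = (?I ## LUnit C (X \<otimes> Y)) ** a \<one> \<one> (X \<otimes> Y) ** a (\<one> \<otimes> \<one>) X Y"
  using pentagon[of \<one> \<one> X Y] by (simp add: whisk)
 also have "... = (RUnit C \<one> ## Idn C (X \<otimes> Y)) ** a (\<one> \<otimes> \<one>) X Y" using triangle[of \<one> "X \<otimes> Y"] by (simp flip: cmp_assoc)
 also have "... = a \<one> X Y ** ((RUnit C \<one> ## Idn C X) ## Idn C Y)" using a_nat[of "RUnit C \<one>" "Idn C X" "Idn C Y"] by simp
 also have "... = a \<one> X Y ** ((?I ## LUnit C X) ## Idn C Y) ** (a \<one> \<one> X ## Idn C Y)" using triangle[of \<one> X, symmetric] by (simp add: whisk)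
 also have "... = (?I ## LUnit C X ## Idn C Y) ** ?k" using a_nat[of ?I "LUnit C X" "Idn C Y"] by (simp flip: cmp_assoc)
 finally show "?I ## (LUnit C (X \<otimes> Y) ** a \<one> X Y) = ?I ## LUnit C X ## Idn C Y" by (rule cancel_right) simp_all
qed simp_all

lemma runit_ten:
 assumes [simp]: "X:Obj C" "Y:Obj C"
 shows "(Idn C X ## RUnit C Y) ** a X Y \<one> = RUnit C (X \<otimes> Y)"
proof (rule runit_faithful)
 let ?I = "Idn C \<one>"
 have "a X Y \<one> ** (((Idn C X ## RUnit C Y) ** a X Y \<one>) ## ?I) = (Idn C X ## RUnit C Y ## ?I) ** a X (Y \<otimes> \<one>) \<one> ** (a X Y \<one> ## ?I)"
  using a_nat[of "Idn C X" "RUnit C Y" ?I] by (simp add: whisk flip: cmp_assoc)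
 also have "... = (Idn C X ## Idn C Y ## LUnit C \<one>) ** (Idn C X ## a Y \<one> \<one>) ** a X (Y \<otimes> \<one>) \<one> ** (a X Y \<one> ## ?I)"
  using triangle[of Y \<one>, symmetric] by (simp add: whisk del: ten_id)
 also have "... = (Idn C X ## Idn C Y ## LUnit C \<one>) ** a X Y (\<one> \<otimes> \<one>) ** a (X \<otimes> Y) \<one> \<one>" using pentagon[of X Y \<one> \<one>] by simp
 also have "... = a X Y \<one> ** (Idn C (X \<otimes> Y) ## LUnit C \<one>) ** a (X \<otimes> Y) \<one> \<one>"
  using a_nat[of "Idn C X" "Idn C Y" "LUnit C \<one>"] by (simp flip: cmp_assoc)
 also have "... = a X Y \<one> ** (RUnit C (X \<otimes> Y) ## ?I)" using triangle[of "X \<otimes> Y" \<one>] by simp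
 finally show "((Idn C X ## RUnit C Y) ** a X Y \<one>) ## ?I = RUnit C (X \<otimes> Y) ## ?I" by (rule cancel_left) simp_all
qed simp_all

text \<open>The counit laws at the unit object make its discard invertible, so the unit object is terminal.\<close>

lemma disc_unit: "Disc C \<one> = Idn C \<one>"
proof -
 let ?e = "Disc C \<one>" and ?I = "Idn C \<one>" and ?s = "LUnit C \<one> ** iv (RUnit C \<one>)" and ?x = "RUnit C \<one> ** Dup C \<one>"
 have ee: "?e ** ?e = ?e" by (rule disc_natural) (rule disc_hom, simp)
 have "?e ** RUnit C \<one> = RUnit C \<one> ** (?e ## ?I)" using r_nat[of ?e] by simp
 hence c: "(?e ** RUnit C \<one>) ** Dup C \<one> = (RUnit C \<one> ** (?e ## ?I)) ** Dup C \<one>" by simp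
 have "?s ** (?e ** ?x) = LUnit C \<one> ** iv (RUnit C \<one>) ** RUnit C \<one> ** (?e ## ?I) ** Dup C \<one>" using c by simp
 also have "... = ?I" using counit_left[of \<one>] by simp
 finally have s: "?s ** (?e ** ?x) = ?I" .
 have i: "isom ?s" by simp
 have "?s ** (?e ** ?x) = ?s ** iv ?s" using s i by simp
 \<comment> \<open>\<open>?e\<close> is idempotent, and \<open>?s ** ?e ** ?x\<close> is an identity
   with \<open>?s\<close> invertible. Hence \<open>?e\<close> fixes the invertible arrow
   \<open>iv ?s\<close> and is itself an identity.\<close>
 hence x: "?e ** ?x = iv ?s" by (rule cancel_left[OF _ i]) (use i in simp_all)
 have "?e ** iv ?s = (?e ** ?e) ** ?x" unfolding x[symmetric] by simp
 also have "... = ?I ** iv ?s" unfolding ee x using i by simp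
 finally show ?thesis by (rule cancel_right) (use i in simp_all)
qed

text \<open>Naturality of discards at \<open>f\<close>, combined with the discard of the unit being
  an identity.\<close>

lemma terminal: "f:Arr C ==> Cod C f = \<one> ==> f = Disc C (Dom C f)"
 using disc_natural[of f "Dom C f" \<one>] by (simp add: disc_unit Hom_def)

text \<open>Each equation compares two arrows into the terminal unit object.\<close>

lemma unit_laws: "LUnit C \<one> = RUnit C \<one>" "LUnit C \<one> ** Dup C \<one> = Idn C \<one>"
 using terminal[of "LUnit C \<one>"] terminal[of "RUnit C \<one>"] terminal[of "LUnit C \<one> ** Dup C \<one>"] by (simp_all add: disc_unit)

end

section \<open>Coherence isomorphisms between left-bracketed products\<close>

locale words = mkv C for C :: "('o, 'm, 'z) markov_cat_scheme" (structure) +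
 fixes S :: "'s set" and h :: "'s => 'o"
 assumes h [simp]: "x:S ==> h x:Obj C"
begin

definition "Wd = lists S"

lemma Wd [simp]: "[]:Wd" "u @ v:Wd <-> u:Wd & v:Wd" "x # u:Wd <-> x:S & u:Wd"
 by (auto simp: Wd_def)

lemma Wd_induct [consumes 1, case_names Nil snoc]:
 assumes "w:Wd" "Q []" "!!w x. w:Wd ==> x:S ==> Q w ==> Q (w @ [x])"
 shows "Q w"
 using assms(1) by (induction w rule: rev_induct) (auto intro: assms(2,3))

abbreviation "W == word_obj C h"

lemma W_simps: "W [] = \<one>" "W [x] = h x" "w ~= [] ==> W (w @ [x]) = W w \<otimes> h x"
proof -
 assume "w ~= []"
 then obtain y r where "rev w = y # r" by (cases "rev w") auto
 thus "W (w @ [x]) = W w \<otimes> h x" by (simp add: word_obj_def)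
qed (simp_all add: word_obj_def)

lemma W_obj [simp]: "w:Wd ==> W w:Obj C"
 by (induction w rule: Wd_induct) (metis W_simps Ob h append_Nil)+

text \<open>A one-letter word has the product \<open>h x\<close>, not
  \<open>\<one> \<otimes> h x\<close>, so appending a letter to the empty word costs a unitor.
  \<open>kap\<close> hides this case distinction.\<close>

definition "kap w x = (if w = [] then LUnit C (h x) else Idn C (W w \<otimes> h x))"

lemma kap [simp]:
 assumes "w:Wd" "x:S"
 shows "isom (kap w x)" "kap w x:Arr C" "Dom C (kap w x) = W w \<otimes> h x" "Cod C (kap w x) = W (w @ [x])"
 using assms by (auto simp: kap_def W_simps)

text \<open>The recursion runs over the reversed second word, since left-bracketed products grow on
  the right.\<close>

primrec rmu where
 "rmu u [] = RUnit C (W u)"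
| "rmu u (x # r) = kap (u @ rev r) x ** (rmu u r ## Idn C (h x)) ** iv (a (W u) (W (rev r)) (h x)) ** (Idn C (W u) ## iv (kap (rev r) x))"

definition "mu u v = rmu u (rev v)"

lemma mu [simp]:
 assumes "u:Wd" "v:Wd"
 shows "isom (mu u v)" "mu u v:Arr C" "Dom C (mu u v) = W u \<otimes> W v" "Cod C (mu u v) = W (u @ v)"
proof -
 have "isom (mu u v) & mu u v:Arr C & Dom C (mu u v) = W u \<otimes> W v & Cod C (mu u v) = W (u @ v)"
  using assms(2)
 proof (induction v rule: Wd_induct)
  case (snoc v x)
  thus ?case using assms(1) by (simp add: mu_def)
 qed (use assms(1) in "simp add: mu_def W_simps")
 thus "isom (mu u v)" "mu u v:Arr C" "Dom C (mu u v) = W u \<otimes> W v" "Cod C (mu u v) = W (u @ v)" by blast+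
qed

lemma mu_Nil: "mu u [] = RUnit C (W u)"
 by (simp add: mu_def)

text \<open>The recursion equation of \<open>rmu\<close> cleared of inverses, the form in which the
  inductions use it.\<close>

lemma mu_snoc:
 assumes "u:Wd" "v:Wd" "x:S"
 shows "mu u (v @ [x]) ** (Idn C (W u) ## kap v x) ** a (W u) (W v) (h x) = kap (u @ v) x ** (mu u v ## Idn C (h x))"
 using assms mu[of u v] unfolding mu_def by (simp add: inter3)

text \<open>Induction on the last word, with the invertible arrow \<open>?k\<close> cancelled to
  split off its last letter. The step combines naturality of the associator with the pentagon; the
  base case is \<open>runit_ten\<close>.\<close>

lemma mu_assoc:
 assumes [simp]: "u:Wd" "v:Wd" and "w:Wd"
 shows "mu (u @ v) w ** (mu u v ## Idn C (W w)) = mu u (v @ w) ** (Idn C (W u) ## mu v w) ** a (W u) (W v) (W w)"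
 using assms(3)
proof (induction w rule: Wd_induct)
 case Nil
 thus ?case using r_nat[of "mu u v"] runit_ten[of "W u" "W v"] by (simp add: mu_Nil W_simps)
next
 case (snoc w x)
 note [simp] = snoc(1,2)
 let ?U = "Idn C (W u)" and ?V = "Idn C (W v)" and ?w = "Idn C (W w)" and ?x = "Idn C (h x)" and ?wx = "w @ [x]"
 let ?k = "(Idn C (W u \<otimes> W v) ## kap w x) ** a (W u \<otimes> W v) (W w) (h x)"
 show ?case
 proof (rule cancel_right[of _ ?k])
  have "(mu u v ## Idn C (W ?wx)) ** ?k = (Idn C (W (u @ v)) ## kap w x) ** (mu u v ## Idn C (W w \<otimes> h x)) ** a (W u \<otimes> W v) (W w) (h x)"
   by (simp add: inter3)
  also have "... = (Idn C (W (u @ v)) ## kap w x) ** a (W (u @ v)) (W w) (h x) ** ((mu u v ## ?w) ## ?x)"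
   using a_nat[of "mu u v" ?w ?x] by simp
  finally have "mu (u @ v) ?wx ** (mu u v ## Idn C (W ?wx)) ** ?k = (mu (u @ v) ?wx ** (Idn C (W (u @ v)) ## kap w x) ** a (W (u @ v)) (W w) (h x)) ** ((mu u v ## ?w) ## ?x)"
   by simp
  also have "... = (kap (u @ v @ w) x ** (mu (u @ v) w ## ?x)) ** ((mu u v ## ?w) ## ?x)" using mu_snoc[of "u @ v" w x] by simp
  also have "... = kap (u @ v @ w) x ** ((mu (u @ v) w ** (mu u v ## ?w)) ## ?x)" by (simp add: whisk)
  also have "... = (kap (u @ v @ w) x ** (mu u (v @ w) ## ?x)) ** ((?U ## mu v w) ## ?x) ** (a (W u) (W v) (W w) ## ?x)"
   unfolding snoc(3) by (simp add: whisk)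
  also have "... = mu u (v @ ?wx) ** (?U ## kap (v @ w) x) ** a (W u) (W (v @ w)) (h x) ** ((?U ## mu v w) ## ?x) ** (a (W u) (W v) (W w) ## ?x)"
   using mu_snoc[of u "v @ w" x, symmetric] by simp
  also have "a (W u) (W (v @ w)) (h x) ** ((?U ## mu v w) ## ?x) ** (a (W u) (W v) (W w) ## ?x) =
   (?U ## mu v w ## ?x) ** a (W u) (W v \<otimes> W w) (h x) ** (a (W u) (W v) (W w) ## ?x)"
   using cmp_rewrite[OF a_nat[of ?U "mu v w" ?x], of "a (W u) (W v) (W w) ## ?x"] by simp
  also have "(?U ## kap (v @ w) x) ** ... = (?U ## (mu v ?wx ** (?V ## kap w x) ** a (W v) (W w) (h x))) ** a (W u) (W v \<otimes> W w) (h x) ** (a (W u) (W v) (W w) ## ?x)"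
   unfolding mu_snoc[of v w x, simplified] by (simp add: whisk)
  also have "... = (?U ## mu v ?wx) ** (?U ## ?V ## kap w x) ** a (W u) (W v) (W w \<otimes> h x) ** a (W u \<otimes> W v) (W w) (h x)"
   using pentagon[of "W u" "W v" "W w" "h x"] by (simp add: whisk)
  also have "(?U ## ?V ## kap w x) ** a (W u) (W v) (W w \<otimes> h x) ** a (W u \<otimes> W v) (W w) (h x) = a (W u) (W v) (W ?wx) ** ?k"
   using cmp_rewrite[OF a_nat[of ?U ?V "kap w x", symmetric], of "a (W u \<otimes> W v) (W w) (h x)"] by simp
  finally show "(mu (u @ v) ?wx ** (mu u v ## Idn C (W ?wx))) ** ?k = (mu u (v @ ?wx) ** (?U ## mu v ?wx) ** a (W u) (W v) (W ?wx)) ** ?k"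
   by simp
 qed simp_all
qed

text \<open>The base case is the equality of the two unitors at the unit object, the step is the
  triangle \<open>lunit_ten\<close>.\<close>

lemma mu_unit: "v:Wd ==> mu [] v = LUnit C (W v)"
proof (induction v rule: Wd_induct)
 case (snoc v x)
 note [simp] = snoc(1,2)
 show ?case
 proof (rule cancel_right[of _ "(Idn C \<one> ## kap v x) ** a \<one> (W v) (h x)"])
  show "mu [] (v @ [x]) ** (Idn C \<one> ## kap v x) ** a \<one> (W v) (h x) = LUnit C (W (v @ [x])) ** (Idn C \<one> ## kap v x) ** a \<one> (W v) (h x)"
   using mu_snoc[of "[]" v x] snoc(3) lunit_ten[of "W v" "h x"] cmp_rewrite[OF l_nat[of "kap v x"], of "a \<one> (W v) (h x)"] by (simp add: W_simps)
 qed (simp_all add: W_simps)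
qed (simp add: mu_Nil W_simps unit_laws)

lemma mu_single:
 assumes [simp]: "u:Wd" "x:S"
 shows "mu u [x] = kap u x"
proof (rule cancel_right[of _ "RUnit C (W u) ## Idn C (h x)"])
 show "mu u [x] ** (RUnit C (W u) ## Idn C (h x)) = kap u x ** (RUnit C (W u) ## Idn C (h x))"
  using mu_snoc[of u "[]" x] triangle[of "W u" "h x"] by (simp add: kap_def[of "[]"] mu_Nil W_simps)
qed (simp_all add: W_simps)

definition "tn u m v u' m' v' = mu v v' ** (m ## m') ** iv (mu u u')"

definition "typed u m v <-> u:Wd & v:Wd & m:Arr C & Dom C m = W u & Cod C m = W v"

lemma tn:
 assumes "typed u m v" "typed u' m' v'"
 shows "typed (u @ u') (tn u m v u' m' v') (v @ v')" "tn u m v u' m' v' ** mu u u' = mu v v' ** (m ## m')"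
 using assms by (simp_all add: typed_def tn_def)

lemma tn_eqI:
 assumes "typed u m v" "typed u' m' v'" "typed (u @ u') k (v @ v')" "k ** mu u u' = mu v v' ** (m ## m')"
 shows "tn u m v u' m' v' = k"
proof (rule cancel_right)
 show "tn u m v u' m' v' ** mu u u' = k ** mu u u'" using tn[OF assms(1,2)] assms(4) by simp
qed (use tn(1)[OF assms(1,2)] assms in "auto simp: typed_def")

definition "sy u v = mu v u ** Sym C (W u) (W v) ** iv (mu u v)"

lemma sy:
 assumes "u:Wd" "v:Wd"
 shows "typed (u @ v) (sy u v) (v @ u)" "sy u v ** mu u v = mu v u ** Sym C (W u) (W v)"
 using assms by (simp_all add: typed_def sy_def)

text \<open>Arrows are tagged with their end words because different words may have the same product
  in \<open>C\<close>.\<close>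

definition DS :: "('s list, 's list \<times> 'm \<times> 's list) sym_cat" where
 "DS = \<lparr> Obj = lists S, Arr = {(u, m, v). typed u m v}, Dom = fst, Cod = snd \<circ> snd, Idn = (%u. (u, Idn C (W u), u)),
   Cmp = (%(v, n, w) (u, m, v'). (u, n ** m, w)), TObj = (@), TArr = (%(u, m, v) (u', m', v'). (u @ u', tn u m v u' m' v', v @ v')),
   Unit = [], Assoc = (%_ _ _. undefined), LUnit = (%_. undefined), RUnit = (%_. undefined), Sym = (%u v. (u @ v, sy u v, v @ u)) \<rparr>"

lemma DS_simps [simp]: "Obj DS = Wd" "(u, m, v):Arr DS <-> typed u m v" "Dom DS (u, m, v) = u" "Cod DS (u, m, v) = v" "Idn DS u = (u, Idn C (W u), u)"
 "(v, n, w) **\<^bsub>DS\<^esub> (u, m, v') = (u, n ** m, w)" "(u, m, v) ##\<^bsub>DS\<^esub> (u', m', v') = (u @ u', tn u m v u' m' v', v @ v')" "Sym DS u v = (u @ v, sy u v, v @ u)"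
 by (simp_all add: DS_def Wd_def)

lemma typed_id [simp]: "u:Wd ==> typed u (Idn C (W u)) u" and typed_cmp: "typed u m v ==> typed v n w ==> typed u (n ** m) w"
 by (simp_all add: typed_def)

text \<open>Both sides are compared after precomposition with the invertible
  \<open>mu (u @ v) w\<close> and \<open>mu u v\<close>, where \<open>mu_assoc\<close> reduces the
  claim to naturality of the associator.\<close>

lemma tn_assoc:
 assumes "typed u m u'" "typed v n v'" "typed w k w'"
 shows "tn (u @ v) (tn u m u' v n v') (u' @ v') w k w' = tn u m u' (v @ w) (tn v n v' w k w') (v' @ w')"
proof (rule tn_eqI)
 note t = tn[OF assms(1,2)] tn[OF assms(2,3)] and r = tn[OF assms(1) tn(1)[OF assms(2,3)]]
 note [simp] = assms[unfolded typed_def] t(1)[unfolded typed_def] t(3)[unfolded typed_def] r(1)[unfolded typed_def]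
 let ?T = "tn u m u' (v @ w) (tn v n v' w k w') (v' @ w')"
 show "?T ** mu (u @ v) w = mu (u' @ v') w' ** (tn u m u' v n v' ## k)"
 proof (rule cancel_right[of _ "mu u v ## Idn C (W w)"])
  have "(?T ** mu (u @ v) w) ** (mu u v ## Idn C (W w)) = (?T ** mu u (v @ w)) ** (Idn C (W u) ## mu v w) ** a (W u) (W v) (W w)"
   using mu_assoc[of u v w] by simp
  also have "... = mu u' (v' @ w') ** (m ## (tn v n v' w k w' ** mu v w)) ** a (W u) (W v) (W w)" unfolding r(2) by (simp add: inter3)
  also have "... = mu u' (v' @ w') ** (Idn C (W u') ## mu v' w') ** (m ## n ## k) ** a (W u) (W v) (W w)" unfolding t(4) by (simp add: inter3)
  also have "... = (mu u' (v' @ w') ** (Idn C (W u') ## mu v' w') ** a (W u') (W v') (W w')) ** ((m ## n) ## k)" using a_nat[of m n k] by simp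
  also have "... = mu (u' @ v') w' ** ((mu u' v' ** (m ## n)) ## k)" using mu_assoc[of u' v' w'] by (simp add: inter flip: mu_assoc)
  also have "... = (mu (u' @ v') w' ** (tn u m u' v n v' ## k)) ** (mu u v ## Idn C (W w))" unfolding t(2)[symmetric] by (simp add: inter)
  finally show "(?T ** mu (u @ v) w) ** (mu u v ## Idn C (W w)) = (mu (u' @ v') w' ** (tn u m u' v n v' ## k)) ** (mu u v ## Idn C (W w))" .
 qed simp_all
qed (use assms tn(1)[OF assms(1,2)] tn(1)[OF assms(1) tn(1)[OF assms(2,3)]] in simp_all)

text \<open>The hexagon of \<open>C\<close> transported along \<open>mu\<close>: three uses of
  \<open>mu_assoc\<close> bring the symmetries next to the associators of the hexagon.\<close>

lemma sy_hex:
 assumes [simp]: "u:Wd" "v:Wd" "w:Wd"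
 shows "sy u (v @ w) = tn v (Idn C (W v)) v (u @ w) (sy u w) (w @ u) ** tn (u @ v) (sy u v) (v @ u) w (Idn C (W w)) w"
proof -
 note s = sy[of u v, simplified] sy[of u w, simplified] sy[of u "v @ w", simplified]
 note t1 = tn[OF typed_id[OF assms(2)] s(3)] and t2 = tn[OF s(1) typed_id[OF assms(3)]]
 note [simp] = s(1,3,5)[unfolded typed_def] t1(1)[unfolded typed_def] t2(1)[unfolded typed_def]
 let ?U = "Idn C (W u)" and ?V = "Idn C (W v)" and ?w = "Idn C (W w)"
 let ?t1 = "tn v ?V v (u @ w) (sy u w) (w @ u)" and ?t2 = "tn (u @ v) (sy u v) (v @ u) w ?w w"
 have "(?t1 ** ?t2) ** mu (u @ v) w ** (mu u v ## ?w) = ?t1 ** mu (v @ u) w ** ((sy u v ** mu u v) ## ?w)"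
  using cmp_rewrite[OF t2(2), of "mu u v ## ?w"] by (simp add: inter)
 also have "... = ?t1 ** (mu (v @ u) w ** (mu v u ## ?w)) ** (Sym C (W u) (W v) ## ?w)" unfolding s(2) by (simp add: whisk)
 also have "... = (?t1 ** mu v (u @ w)) ** (?V ## mu u w) ** a (W v) (W u) (W w) ** (Sym C (W u) (W v) ## ?w)" unfolding mu_assoc[of v u w, simplified] by simp
 also have "... = mu v (w @ u) ** (?V ## (sy u w ** mu u w)) ** a (W v) (W u) (W w) ** (Sym C (W u) (W v) ## ?w)" unfolding t1(2) by (simp add: inter3)
 also have "... = mu v (w @ u) ** (?V ## mu w u) ** (?V ## Sym C (W u) (W w)) ** a (W v) (W u) (W w) ** (Sym C (W u) (W v) ## ?w)" unfolding s(4) by (simp add: whisk)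
 also have "... = (mu v (w @ u) ** (?V ## mu w u) ** a (W v) (W w) (W u)) ** Sym C (W u) (W v \<otimes> W w) ** a (W u) (W v) (W w)"
  using hexagon[of "W u" "W v" "W w"] by simp
 also have "... = mu (v @ w) u ** (mu v w ## ?U) ** Sym C (W u) (W v \<otimes> W w) ** a (W u) (W v) (W w)" by (simp flip: mu_assoc)
 also have "... = (mu (v @ w) u ** Sym C (W u) (W (v @ w))) ** (?U ## mu v w) ** a (W u) (W v) (W w)"
  using cmp_rewrite[OF s_nat[of ?U "mu v w", symmetric], of "a (W u) (W v) (W w)"] by simp
 also have "... = sy u (v @ w) ** mu (u @ v) w ** (mu u v ## ?w)" unfolding s(6)[symmetric] using mu_assoc[of u v w] by simp
 finally show ?thesis by (intro cancel_right[of "sy u (v @ w)" "mu (u @ v) w ** (mu u v ## ?w)"]) simp_all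
qed

lemma DS: "strict_smc DS S"
proof
 show "A:Arr DS ==> Dom DS A:Obj DS" "A:Arr DS ==> Cod DS A:Obj DS" for A by (cases A; simp add: typed_def)+
 show "u:Obj DS ==> Idn DS u:Hom DS u u" for u by (simp add: Hom_def)
 show "A:Hom DS u v ==> B:Hom DS v w ==> B **\<^bsub>DS\<^esub> A:Hom DS u w" for A B u v w
  by (cases A; cases B) (auto simp: Hom_def intro: typed_cmp)
 show "A:Hom DS u v ==> Idn DS v **\<^bsub>DS\<^esub> A = A" "A:Hom DS u v ==> A **\<^bsub>DS\<^esub> Idn DS u = A" for A u v
  by (cases A; auto simp: Hom_def typed_def)+
 show "A:Hom DS u v ==> B:Hom DS v w ==> D:Hom DS w x ==> (D **\<^bsub>DS\<^esub> B) **\<^bsub>DS\<^esub> A = D **\<^bsub>DS\<^esub> B **\<^bsub>DS\<^esub> A" for A B D u v w x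
  by (cases A; cases B; cases D) (auto simp: Hom_def typed_def)
 show "Obj DS = lists S" by (simp add: Wd_def)
 show "A:Arr DS ==> B:Arr DS ==> A ##\<^bsub>DS\<^esub> B:Arr DS" "A:Arr DS ==> B:Arr DS ==> Dom DS (A ##\<^bsub>DS\<^esub> B) = Dom DS A @ Dom DS B"
  "A:Arr DS ==> B:Arr DS ==> Cod DS (A ##\<^bsub>DS\<^esub> B) = Cod DS A @ Cod DS B" for A B
  by (cases A; cases B; simp add: tn)+
 show "u:Obj DS ==> v:Obj DS ==> Idn DS u ##\<^bsub>DS\<^esub> Idn DS v = Idn DS (u @ v)" for u v by (simp add: tn_def)
 show "f:Arr DS ==> g:Arr DS ==> f':Arr DS ==> g':Arr DS ==> Cod DS f = Dom DS g ==> Cod DS f' = Dom DS g' ==>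
   (g ##\<^bsub>DS\<^esub> g') **\<^bsub>DS\<^esub> (f ##\<^bsub>DS\<^esub> f') = (g **\<^bsub>DS\<^esub> f) ##\<^bsub>DS\<^esub> (g' **\<^bsub>DS\<^esub> f')" for f g f' g'
  by (cases f; cases g; cases f'; cases g') (simp add: tn_def typed_def inter3)
 show "f:Arr DS ==> g:Arr DS ==> h:Arr DS ==> (f ##\<^bsub>DS\<^esub> g) ##\<^bsub>DS\<^esub> h = f ##\<^bsub>DS\<^esub> g ##\<^bsub>DS\<^esub> h" for f g h
  by (cases f; cases g; cases h) (simp add: tn_assoc)
 show "f:Arr DS ==> Idn DS [] ##\<^bsub>DS\<^esub> f = f" for f
  using l_nat[of "fst (snd f)"] by (cases f) (auto simp: mu_unit W_simps typed_def intro!: tn_eqI)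
 show "f:Arr DS ==> f ##\<^bsub>DS\<^esub> Idn DS [] = f" for f
  using r_nat[of "fst (snd f)"] by (cases f) (auto simp: mu_Nil W_simps typed_def intro!: tn_eqI)
 show "u:Obj DS ==> v:Obj DS ==> Sym DS u v:Arr DS" "u:Obj DS ==> v:Obj DS ==> Dom DS (Sym DS u v) = u @ v"
  "u:Obj DS ==> v:Obj DS ==> Cod DS (Sym DS u v) = v @ u" for u v by (simp_all add: sy)
 show "f:Arr DS ==> g:Arr DS ==> Sym DS (Cod DS f) (Cod DS g) **\<^bsub>DS\<^esub> (f ##\<^bsub>DS\<^esub> g) = (g ##\<^bsub>DS\<^esub> f) **\<^bsub>DS\<^esub> Sym DS (Dom DS f) (Dom DS g)" for f g
  using cmp_rewrite[OF s_nat[of "fst (snd f)" "fst (snd g)"], of "iv (mu (fst f) (fst g))"]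
  by (cases f; cases g) (auto simp: tn_def sy_def typed_def)
 show "u:Obj DS ==> v:Obj DS ==> Sym DS v u **\<^bsub>DS\<^esub> Sym DS u v = Idn DS (u @ v)" for u v
  using sym_sym[of "W u" "W v"] by (simp add: sy_def) (simp flip: cmp_assoc)
 show "u:Obj DS ==> v:Obj DS ==> w:Obj DS ==> Sym DS u (v @ w) = (Idn DS v ##\<^bsub>DS\<^esub> Sym DS u w) **\<^bsub>DS\<^esub> (Sym DS u v ##\<^bsub>DS\<^esub> Idn DS w)" for u v w
  by (simp add: sy_hex)
qed

end

section \<open>Existence\<close>

lemma (in ddg) word_iso_simps:
 "word_iso FMC D F (%x. [x]) [] = FUnit F" "word_iso FMC D F (%x. [x]) [x] = Idn D (FObj F [x])"
 "w ~= [] ==> word_iso FMC D F (%x. [x]) (w @ [x]) = FTens F w [x] **\<^bsub>D\<^esub> (word_iso FMC D F (%x. [x]) w ##\<^bsub>D\<^esub> Idn D (FObj F [x]))"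
proof -
 assume "w ~= []"
 then obtain y r where w: "rev w = y # r" by (cases "rev w") auto
 have e: "rev_word_obj FMC (%x. [x]) (y # r) = w" unfolding rev_word_obj_FM w[symmetric] by simp
 show "word_iso FMC D F (%x. [x]) (w @ [x]) = FTens F w [x] **\<^bsub>D\<^esub> (word_iso FMC D F (%x. [x]) w ##\<^bsub>D\<^esub> Idn D (FObj F [x]))"
  unfolding word_iso_def by (simp add: w e)
qed (simp_all add: word_iso_def)

locale target = ddg G + words D "Letters G" "HLetter f"
 for G :: "('s, 'a, 'z) dd_graph_monoid_scheme" and D :: "('o, 'm, 'y) markov_cat_scheme" (structure) and f :: "('s, 'a, 'o, 'm) gm_hom" +
 assumes hom: "is_gm_hom G D f" and dd_f: "matches_dd G D f"
begin

lemma Wd_DC: "Obj DC = Wd"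
 by (simp add: DC_simps(1) Wd_def)

lemma arrow_words: "k:Arrows G ==> ASrc G k:Wd" "k:Arrows G ==> ATgt G k:Wd"
 using fg by (simp_all add: free_graph_monoid_def Wd_def)

lemma f_typed: "k:Arrows G ==> typed (ASrc G k) (HArrow f k) (ATgt G k)"
 using hom arrow_words[of k] by (auto simp: is_gm_hom_def Hom_def typed_def)

sublocale DS: strict_smc DS "Letters G" by (rule DS)

sublocale I: interp G DS "%k. (ASrc G k, HArrow f k, ATgt G k)"
 by unfold_locales (simp_all add: f_typed)

text \<open>The arrow of \<open>D\<close> inside the interpretation; the two tags are the domain and
  codomain of \<open>A\<close>.\<close>

definition "mm A = fst (snd (I.phi A))"

lemma phi:
 assumes "A:Arr DC"
 shows "I.phi A = (Dom DC A, mm A, Cod DC A)" "typed (Dom DC A) (mm A) (Cod DC A)"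
 using I.phi_arr[OF assms] by (cases "I.phi A"; simp add: mm_def)+

lemma mm:
 "A:Arr DC ==> B:Arr DC ==> Cod DC A = Dom DC B ==> mm (B **. A) = mm B ** mm A"
 "u:Wd ==> mm (Idn DC u) = Idn D (W u)" "u:Wd ==> v:Wd ==> mm (Sym DC u v) = sy u v" "k:Arrows G ==> mm (gen k) = HArrow f k"
proof -
 show "A:Arr DC ==> B:Arr DC ==> Cod DC A = Dom DC B ==> mm (B **. A) = mm B ** mm A"
  using I.phi_cmp[of A B] phi[of A] phi[of B] by (simp add: mm_def[of "B **. A"])
 show "u:Wd ==> mm (Idn DC u) = Idn D (W u)" using I.phi_idn[of u] by (simp add: mm_def Wd_DC)
 show "u:Wd ==> v:Wd ==> mm (Sym DC u v) = sy u v" using I.phi_sym[of u v] by (simp add: mm_def Wd_DC)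
 show "k:Arrows G ==> mm (gen k) = HArrow f k" using I.phi_arrow[of k] by (simp add: mm_def)
qed

lemma mm_ten:
 assumes "A:Arr DC" "B:Arr DC"
 shows "mm (A ##. B) ** mu (Dom DC A) (Dom DC B) = mu (Cod DC A) (Cod DC B) ** (mm A ## mm B)"
 using I.phi_ten[OF assms] phi[OF assms(1)] phi[OF assms(2)] tn(2)[OF phi(2)[OF assms(1)] phi(2)[OF assms(2)]] by (simp add: mm_def[of "A ##. B"])

lemma mm_arr [simp]: "A:Arr DC ==> mm A:Arr D" "A:Arr DC ==> Dom D (mm A) = W (Dom DC A)" "A:Arr DC ==> Cod D (mm A) = W (Cod DC A)"
 using phi(2) by (simp_all add: typed_def)

lemma mu_letter: "x:Letters G ==> mu [x] [x] = Idn D (HLetter f x \<otimes> HLetter f x)" "x:Letters G ==> mu [x, x] [x] = Idn D (W [x, x] \<otimes> HLetter f x)"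
 using mu_single[of "[x]" x] mu_single[of "[x, x]" x] by (simp_all add: kap_def W_simps)

lemma W2: "W [x, x] = HLetter f x \<otimes> HLetter f x"
 using W_simps(3)[of "[x]" x] by (simp add: W_simps)

lemma dd_arr: "x:Letters G ==> HArrow f (ADup G x) = Dup D (HLetter f x)" "x:Letters G ==> HArrow f (ADisc G x) = Disc D (HLetter f x)"
 using dd_f by (simp_all add: matches_dd_def)

lemma mm_dd: "x:Letters G ==> mm (dp x) = Dup D (HLetter f x)" "x:Letters G ==> mm (dc x) = Disc D (HLetter f x)"
 using dd_arrow[of x] by (simp_all add: mm(4) dd_arr)

lemma mm_terminal: "A:Arr DC ==> Cod DC A = [] ==> mm A = Disc D (W (Dom DC A))"
 using terminal[of "mm A"] by (simp add: W_simps)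

text \<open>These are the Markov axioms of \<open>D\<close> at the letters. Their associators and
  unitors, invisible in diagrams, are supplied by the values of \<open>mu\<close> on short words.
  The discard template holds because the unit object is terminal.\<close>

lemma pair_mm: "markov_pair l r ==> mm l = mm r"
proof (induction rule: markov_pair.induct)
 case (mp_coassoc x)
 note [simp] = mp_coassoc
 let ?h = "HLetter f x" and ?d = "dp x"
 have W3: "W [x, x, x] = (?h \<otimes> ?h) \<otimes> ?h" using W_simps(3)[of "[x, x]" x] by (simp add: W2)
 have m: "mu [x] [x, x] ** a ?h ?h ?h = Idn D ((?h \<otimes> ?h) \<otimes> ?h)"
  using mu_snoc[of "[x]" "[x]" x] by (simp add: kap_def mu_letter W_simps W2)
 have 1: "mm (Idn DC [x] ##. ?d) = mu [x] [x, x] ** (Idn D ?h ## Dup D ?h)"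
  using mm_ten[of "Idn DC [x]" ?d] mm_arr[of "Idn DC [x] ##. ?d"] by (simp add: mm(2) mm_dd mu_letter W_simps W2)
 have 2: "mm (?d ##. Idn DC [x]) = Dup D ?h ## Idn D ?h"
  using mm_ten[of ?d "Idn DC [x]"] mm_arr[of "?d ##. Idn DC [x]"] by (simp add: mm(2) mm_dd mu_letter W_simps W2)
 have "mu [x] [x, x] ** (Idn D ?h ## Dup D ?h) ** Dup D ?h = (mu [x] [x, x] ** a ?h ?h ?h) ** (Dup D ?h ## Idn D ?h) ** Dup D ?h"
  using coassoc[of ?h] by (simp add: W_simps W2 W3)
 thus ?case using m by (simp add: mm(1) 1 2 mm_dd W_simps W2 W3)
next
 case (mp_counit_left x)
 note [simp] = mp_counit_left
 let ?h = "HLetter f x"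
 have "mm (Idn DC [x] ##. dc x) = RUnit D ?h ** (Idn D ?h ## Disc D ?h)"
  using mm_ten[of "Idn DC [x]" "dc x"] mm_arr[of "Idn DC [x] ##. dc x"] by (simp add: mm(2) mm_dd mu_letter mu_Nil W_simps W2)
 thus ?case using counit_right[of ?h] by (simp add: mm(1,2) mm_dd W_simps)
next
 case (mp_counit_right x)
 note [simp] = mp_counit_right
 let ?h = "HLetter f x"
 have "mm (dc x ##. Idn DC [x]) = LUnit D ?h ** (Disc D ?h ## Idn D ?h)"
  using mm_ten[of "dc x" "Idn DC [x]"] mm_arr[of "dc x ##. Idn DC [x]"] by (simp add: mm(2) mm_dd mu_letter mu_unit W_simps W2)
 thus ?case using counit_left[of ?h] by (simp add: mm(1,2) mm_dd W_simps)
next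
 case (mp_cocomm x)
 thus ?case using cocomm[of "HLetter f x"] by (simp add: mm(1,3) mm_dd sy_def mu_letter W_simps)
next
 case (mp_natural k)
 thus ?case using mm_terminal[of "eps (ATgt G k) **. gen k"] mm_terminal[of "eps (ASrc G k)"] arrow_words[of k] gen_arr[of k] by (simp add: Wd_DC)
qed simp

text \<open>The interpretation respects composition and products, hence every rewriting of a pair in
  context.\<close>

lemma R_mm: "(A, B):R ==> mm A = mm B"
proof -
 have s: "I.phi A = I.phi B" if m: "mstep A B" for A B
 proof -
  obtain l r where p: "markov_pair l r \<or> markov_pair r l" and rw: "rewriting l r A B" using m by (auto simp: mstep_def)
  have lr: "l:Arr DC" "r:Arr DC" "Dom DC l = Dom DC r" "Cod DC l = Cod DC r" "mm l = mm r" using p pair_arr pair_mm by metis+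
  hence "I.phi l = I.phi r" by (simp add: phi)
  thus ?thesis using rw lr(1-4) by (auto simp: rewriting_def I.phi_cmp I.phi_ten)
 qed
 assume "(A, B):R"
 hence "mstep\<^sup>*\<^sup>* A B" by (simp add: R_iff)
 hence "I.phi A = I.phi B" by (induction rule: rtranclp_induct) (auto dest: s)
 thus "mm A = mm B" by (simp add: mm_def)
qed

definition F :: "('s list, ('s, 'a) iso_class set, 'o, 'm) mon_functor" where
 "F = \<lparr> FObj = W, FArr = (%X. mm (SOME A. A:X)), FTens = mu, FUnit = Idn D \<one> \<rparr>"

lemma F_arr: "A:Arr DC ==> FArr F (FM.cl A) = mm A"
proof -
 assume "A:Arr DC"
 hence "(SOME B. B:FM.cl A):FM.cl A" by (rule someI[where P = "%g. g:FM.cl A", OF FM.self_cl])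
 thus ?thesis using R_mm by (simp add: F_def FM.in_cl)
qed

lemma F_simps [simp]: "FObj F = W" "FTens F = mu" "FUnit F = Idn D \<one>"
 by (simp_all add: F_def)

lemma mu_assoc':
 assumes [simp]: "u:Wd" "v:Wd" "w:Wd"
 shows "mu u (v @ w) ** (Idn D (W u) ## mu v w) = mu (u @ v) w ** (mu u v ## Idn D (W w)) ** iv (a (W u) (W v) (W w))"
 using cmp_rewrite[OF mu_assoc[of u v w], of "iv (a (W u) (W v) (W w))"] by simp

text \<open>Rebracketing by \<open>mu_assoc\<close> exposes the inner symmetry, which is interpreted
  by the symmetry of \<open>D\<close>; the associators produced on the way are those written out in
  \<open>mid_swap\<close>.\<close>

lemma mm_msw:
 assumes [simp]: "u:Wd" "v:Wd"
 shows "mm (DC.msw u v) ** mu (u @ u) (v @ v) ** (mu u u ## mu v v) = mu (u @ v) (u @ v) ** (mu u v ## mu u v) ** mid_swap D (W u) (W v)"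
proof -
 let ?U = "W u" and ?V = "W v" and ?s = "Sym D (W u) (W v)"
 let ?iU = "Idn D ?U" and ?iV = "Idn D ?V"
 have [simp]: "u:Obj DC" "v:Obj DC" by (simp_all add: Wd_DC)
 let ?t2 = "mm (Sym DC u v ##. Idn DC v)" and ?t1 = "mm (DC.msw u v)"
 have t2: "?t2 ** mu (u @ v) v = mu (v @ u) v ** (sy u v ## ?iV)" using mm_ten[of "Sym DC u v" "Idn DC v"] by (simp add: mm(2,3))
 have t1: "?t1 ** mu u (u @ v @ v) = mu u (v @ u @ v) ** (?iU ## ?t2)"
  using mm_ten[of "Idn DC u" "Sym DC u v ##. Idn DC v"] by (simp add: DC.msw_def mm(2))
 note s = sy[of u v, unfolded typed_def]
 note [simp] = s(1)[OF assms]
 let ?a = "a ?U ?U (?V \<otimes> ?V)"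
 have "mu (u @ u) (v @ v) ** (mu u u ## mu v v) = (mu (u @ u) (v @ v) ** (mu u u ## Idn D (W (v @ v)))) ** (Idn D (?U \<otimes> ?U) ## mu v v)"
  by (simp add: inter)
 also have "... = mu u (u @ v @ v) ** (?iU ## mu u (v @ v)) ** a ?U ?U (W (v @ v)) ** (Idn D (?U \<otimes> ?U) ## mu v v)"
  unfolding mu_assoc[of u u "v @ v", simplified] by simp
 also have "... = mu u (u @ v @ v) ** (?iU ## (mu u (v @ v) ** (?iU ## mu v v))) ** ?a"
  using a_nat[of ?iU ?iU "mu v v"] by (simp add: whisk)
 finally have X: "?t1 ** mu (u @ u) (v @ v) ** (mu u u ## mu v v) = (?t1 ** mu u (u @ v @ v)) ** (?iU ## (mu u (v @ v) ** (?iU ## mu v v))) ** ?a"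
  by (simp add: DC.msw_def)
 let ?K = "(?iV ## mu u v) ** a ?V ?U ?V ** (?s ## ?iV) ** iv (a ?U ?V ?V)"
 have "?t2 ** mu u (v @ v) ** (?iU ## mu v v) = (?t2 ** mu (u @ v) v) ** (mu u v ## ?iV) ** iv (a ?U ?V ?V)" by (simp add: mu_assoc')
 also have "... = mu (v @ u) v ** ((sy u v ** mu u v) ## ?iV) ** iv (a ?U ?V ?V)" unfolding t2 by (simp add: inter3)
 also have "... = (mu (v @ u) v ** (mu v u ## ?iV)) ** (?s ## ?iV) ** iv (a ?U ?V ?V)" unfolding sy(2)[OF assms] by (simp add: whisk)
 also have "... = mu v (u @ v) ** ?K" unfolding mu_assoc[of v u v, simplified] by simp
 finally have Y: "?t2 ** mu u (v @ v) ** (?iU ## mu v v) = mu v (u @ v) ** ?K" .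
 \<comment> \<open>Naturality of the inverse associator, obtained by cancelling the
   associator.\<close>
 have n: "iv (a ?U ?V (W (u @ v))) ** (?iU ## ?iV ## mu u v) = (Idn D (?U \<otimes> ?V) ## mu u v) ** iv (a ?U ?V (?U \<otimes> ?V))"
  by (rule cancel_right[of _ "a ?U ?V (?U \<otimes> ?V)"]) (use a_nat[of ?iU ?iV "mu u v", symmetric] in simp_all)
 have "(?t1 ** mu u (u @ v @ v)) ** (?iU ## (mu u (v @ v) ** (?iU ## mu v v))) ** ?a = mu u (v @ u @ v) ** (?iU ## (?t2 ** mu u (v @ v) ** (?iU ## mu v v))) ** ?a"
  unfolding t1 by (simp add: inter3)
 also have "... = (mu u (v @ u @ v) ** (?iU ## mu v (u @ v))) ** (?iU ## ?K) ** ?a" unfolding Y by (simp add: whisk)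
 also have "... = mu (u @ v) (u @ v) ** (mu u v ## Idn D (W (u @ v))) ** (iv (a ?U ?V (W (u @ v))) ** (?iU ## ?iV ## mu u v)) **
   (?iU ## a ?V ?U ?V) ** (?iU ## ?s ## ?iV) ** (?iU ## iv (a ?U ?V ?V)) ** ?a"
  unfolding mu_assoc'[of u v "u @ v", simplified] by (simp add: whisk)
 also have "... = mu (u @ v) (u @ v) ** (mu u v ## mu u v) ** mid_swap D ?U ?V" unfolding n by (simp add: mid_swap_def inter3)
 finally show ?thesis unfolding X .
qed

text \<open>The duplicate of a product is given by \<open>dup_tensor\<close>, and
  \<open>mm_msw\<close> matches its interchange with the one of diagrams. One-letter words are
  separate because the first \<open>kap\<close> is a unitor.\<close>

lemma mm_dw:
 assumes "w:Wd"
 shows "mm (DD.dw w) = mu w w ** Dup D (W w)"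
 using assms
proof (induction w rule: Wd_induct)
 case Nil
 thus ?case using unit_laws(2) by (simp add: mm(2) mu_unit W_simps)
next
 case (snoc u x)
 note [simp] = snoc(1,2)
 have [simp]: "u:Obj DC" "[x]:Obj DC" by (simp_all add: Wd_DC)
 have xW: "[x]:Wd" by simp
 have d1: "DD.dw [x] = dp x" by (simp add: DC.msw_def DC.ten_id)
 have e1: "mm (DD.dw [x]) = mu [x] [x] ** Dup D (W [x])" unfolding d1 by (simp add: mm_dd mu_letter W_simps)
 show ?case
 proof (cases "u = []")
  case False
  let ?h = "HLetter f x" and ?U = "W u"
  have k: "mu u [x] = Idn D (?U \<otimes> ?h)" using mu_single[of u x] False by (simp add: kap_def)
  have Wx: "W (u @ [x]) = ?U \<otimes> ?h" by (rule W_simps(3)[OF False])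
  let ?T = "mm (DD.dw u ##. DD.dw [x])"
  have "?T = ?T ** mu u [x]" by (simp add: k Wx del: DD.dw.simps)
  also have "... = mu (u @ u) ([x] @ [x]) ** ((mu u u ** Dup D ?U) ## (mu [x] [x] ** Dup D (W [x])))"
   using mm_ten[of "DD.dw u" "DD.dw [x]"] by (simp add: snoc(3) e1 del: DD.dw.simps)
  also have "... = mu (u @ u) ([x] @ [x]) ** (mu u u ## mu [x] [x]) ** (Dup D ?U ## Dup D ?h)" by (simp add: inter W_simps)
  finally have T: "?T = mu (u @ u) ([x] @ [x]) ** (mu u u ## mu [x] [x]) ** (Dup D ?U ## Dup D ?h)" .
  have "mm (DD.dw (u @ [x])) = mm (DC.msw u [x]) ** ?T" by (simp add: DD.dw_append mm(1) del: DD.dw.simps)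
  also have "... = (mm (DC.msw u [x]) ** mu (u @ u) ([x] @ [x]) ** (mu u u ## mu [x] [x])) ** (Dup D ?U ## Dup D ?h)" unfolding T by (simp add: W_simps)
  also have "... = (mu (u @ [x]) (u @ [x]) ** mid_swap D ?U ?h) ** (Dup D ?U ## Dup D ?h)"
   unfolding mm_msw[OF snoc(1) xW] by (simp add: k Wx W_simps mid_swap_def)
  also have "... = mu (u @ [x]) (u @ [x]) ** Dup D (?U \<otimes> ?h)" using dup_tensor[of ?U ?h] by (simp add: mid_swap_def Wx)
  finally show ?thesis by (simp add: Wx)
 qed (use e1 in simp)
qed

lemma (in ddg) FM_rep:
 assumes "X:Hom FMC u v"
 shows "EX A. A:Arr DC & Dom DC A = u & Cod DC A = v & X = FM.cl A"
proof -
 have "EX A. A:Hom DC u v & X = FM.cl A" using assms by (simp only: FM.quot_hom)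
 thus ?thesis by (auto simp: Hom_def)
qed

theorem markov_functor_F: "markov_functor FMC D F"
proof
 note [simp] = Wd_DC mm FM_str
 show "X:Obj FMC ==> FObj F X:Obj D" for X by simp
 show "X:Hom FMC u v ==> FArr F X:Hom D (FObj F u) (FObj F v)" for X u v by (drule FM_rep) (auto simp: F_arr Hom_def)
 show "u:Obj FMC ==> FArr F (Idn FMC u) = Idn D (FObj F u)" for u by (simp add: F_arr)
 show "X:Hom FMC u v ==> Y:Hom FMC v w ==> FArr F (Y **\<^bsub>FMC\<^esub> X) = FArr F Y ** FArr F X" for X Y u v w
  by (drule FM_rep, drule FM_rep) (auto simp: F_arr)
 show "u:Obj FMC ==> v:Obj FMC ==> FTens F u v:Hom D (FObj F u \<otimes> FObj F v) (FObj F (u \<otimes>\<^bsub>FMC\<^esub> v))"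
  "u:Obj FMC ==> v:Obj FMC ==> is_iso D (FTens F u v)" for u v by (simp_all add: Hom_def)
 show "X:Hom FMC u u' ==> Y:Hom FMC v v' ==> FTens F u' v' ** (FArr F X ## FArr F Y) = FArr F (X ##\<^bsub>FMC\<^esub> Y) ** FTens F u v" for X Y u v u' v'
  by (drule FM_rep, drule FM_rep) (auto simp: F_arr mm_ten)
 show "FUnit F:Hom D \<one> (FObj F \<one>\<^bsub>FMC\<^esub>)" "is_iso D (FUnit F)" by (simp_all add: Hom_def W_simps)
 show "u:Obj FMC ==> v:Obj FMC ==> w:Obj FMC ==> FArr F (Assoc FMC u v w) ** FTens F (u \<otimes>\<^bsub>FMC\<^esub> v) w ** (FTens F u v ## Idn D (FObj F w)) =
   FTens F u (v \<otimes>\<^bsub>FMC\<^esub> w) ** (Idn D (FObj F u) ## FTens F v w) ** Assoc D (FObj F u) (FObj F v) (FObj F w)" for u v w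
  using mu_assoc[of u v w] by (simp add: F_arr)
 show "u:Obj FMC ==> FArr F (LUnit FMC u) ** FTens F \<one>\<^bsub>FMC\<^esub> u ** (FUnit F ## Idn D (FObj F u)) = LUnit D (FObj F u)"
  "u:Obj FMC ==> FArr F (RUnit FMC u) ** FTens F u \<one>\<^bsub>FMC\<^esub> ** (Idn D (FObj F u) ## FUnit F) = RUnit D (FObj F u)" for u
  by (simp_all add: F_arr mu_unit mu_Nil)
 show "u:Obj FMC ==> v:Obj FMC ==> FArr F (Sym FMC u v) ** FTens F u v = FTens F v u ** Sym D (FObj F u) (FObj F v)" for u v
  using sy(2)[of u v] by (simp add: F_arr)
 show "u:Obj FMC ==> FArr F (Dup FMC u) = FTens F u u ** Dup D (FObj F u)" for u
  by (simp add: FM_Dup F_arr mm_dw flip: cl_dw)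
 show "u:Obj FMC ==> FArr F (Disc FMC u) = FUnit F ** Disc D (FObj F u)" for u
  using mm_terminal[of "eps u"] by (simp add: FM_Disc F_arr)
qed

text \<open>For nonempty \<open>w\<close> the structure arrow \<open>mu w [x]\<close> is an
  identity, as \<open>W\<close> is left-bracketed; this is why the functor extends \<open>f\<close>
  on the nose.\<close>

lemma word_iso_F: "w:Wd ==> word_iso FMC D F (%x. [x]) w = Idn D (W w)"
proof (induction w rule: Wd_induct)
 case (snoc w x)
 thus ?case by (cases "w = []") (simp_all add: word_iso_simps mu_single kap_def W_simps)
qed (simp add: word_iso_simps W_simps)

theorem F_extends: "gm_hom_eq G f (functor_gm_hom G FMC D F (i_m G))"
proof -
 have H: "HLetter (i_m G) = (%x. [x])" by (simp add: i_m_def)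
 have "k:Arrows G ==> HArrow f k = Inv D (Idn D (W (ATgt G k))) ** FArr F (HArrow (i_m G) k) ** Idn D (W (ASrc G k))" for k
  using f_typed[of k] arrow_words[of k] gen_arr(1)[of k] by (simp add: im_gen F_arr mm typed_def)
 thus ?thesis unfolding gm_hom_eq_def functor_gm_hom_def H by (simp add: W_simps word_iso_F arrow_words)
qed

end

section \<open>Uniqueness\<close>

locale extension = target G D f + E: markov_functor "free_markov G" D E
 for G :: "('s, 'a, 'z) dd_graph_monoid_scheme" and D :: "('o, 'm, 'y) markov_cat_scheme" (structure)
  and f :: "('s, 'a, 'o, 'm) gm_hom" and E :: "('s list, ('s, 'a) iso_class set, 'o, 'm) mon_functor" +
 assumes ext: "gm_hom_eq G f (functor_gm_hom G (free_markov G) D E (i_m G))"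
begin

abbreviation "wi == word_iso FMC D E (%x. [x])"
abbreviation "h == HLetter f"

lemma i_m_letter: "HLetter (i_m G) = (%x. [x])"
 by (simp add: i_m_def)

lemma E_letter: "x:Letters G ==> FObj E [x] = h x"
 using ext by (simp add: gm_hom_eq_def functor_gm_hom_def i_m_letter)

lemma E_arrow: "k:Arrows G ==> HArrow f k = iv (wi (ATgt G k)) ** FArr E (FM.cl (gen k)) ** wi (ASrc G k)"
 using ext by (simp add: gm_hom_eq_def functor_gm_hom_def i_m_letter im_gen)

lemma Obj_FMC: "Obj FMC = Wd"
 by (simp add: Wd_DC)

lemma E_obj [simp]: "u:Wd ==> FObj E u:Obj D"
 by (rule E.obj) (simp add: Wd_DC)

lemma E_tens [simp]:
 assumes "u:Wd" "v:Wd"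
 shows "isom (FTens E u v)" "FTens E u v:Arr D" "Dom D (FTens E u v) = FObj E u \<otimes> FObj E v" "Cod D (FTens E u v) = FObj E (u @ v)"
 using E.tens_hom[of u v] E.tens_iso[of u v] assms by (simp_all add: Wd_DC FM_str Hom_def)

lemma E_unit [simp]: "isom (FUnit E)" "FUnit E:Arr D" "Dom D (FUnit E) = \<one>" "Cod D (FUnit E) = FObj E []"
 using E.unit_hom E.unit_iso by (auto simp: FM_str)

lemma cl_hom: "A:Arr DC ==> FM.cl A:Hom FMC (Dom DC A) (Cod DC A)"
 by (simp add: Hom_def)

lemma E_arr [simp]:
 assumes "A:Arr DC"
 shows "FArr E (FM.cl A):Arr D" "Dom D (FArr E (FM.cl A)) = FObj E (Dom DC A)" "Cod D (FArr E (FM.cl A)) = FObj E (Cod DC A)"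
 using E.hom[OF cl_hom[OF assms]] by auto

lemma E_id: "u:Wd ==> FArr E (FM.cl (Idn DC u)) = Idn D (FObj E u)"
 using E.ident[of u] by (simp add: Wd_DC)

lemma wi [simp]:
 assumes "w:Wd"
 shows "isom (wi w)" "wi w:Arr D" "Dom D (wi w) = W w" "Cod D (wi w) = FObj E w"
proof -
 have "isom (wi w) & wi w:Arr D & Dom D (wi w) = W w & Cod D (wi w) = FObj E w" using assms
 proof (induction w rule: Wd_induct)
  case (snoc w x)
  thus ?case by (cases "w = []") (simp_all add: word_iso_simps W_simps E_letter)
 qed (simp add: word_iso_simps W_simps)
 thus "isom (wi w)" "wi w:Arr D" "Dom D (wi w) = W w" "Cod D (wi w) = FObj E w" by blast+
qed

text \<open>For the empty word this is the left unit axiom of \<open>E\<close>, otherwise the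
  recursion for \<open>word_iso\<close>.\<close>

lemma wi_kap:
 assumes [simp]: "w:Wd" "x:Letters G"
 shows "wi (w @ [x]) ** kap w x = FTens E w [x] ** (wi w ## Idn D (h x))"
proof (cases "w = []")
 case True
 thus ?thesis using E.lunit[of "[x]"] by (simp add: word_iso_simps kap_def FM_str Wd_DC E_id E_letter)
qed (simp add: word_iso_simps kap_def W_simps E_letter)

text \<open>\<open>wi\<close> is compatible with the monoidal structures of the constructed functor
  and of \<open>E\<close>. The induction on \<open>v\<close> uses the right unit and associativity
  axioms of \<open>E\<close>.\<close>

lemma wi_mu: "v:Wd ==> u:Wd ==> wi (u @ v) ** mu u v = FTens E u v ** (wi u ## wi v)"
proof (induction v rule: Wd_induct)
 case Nil
 note [simp] = Nil
 have "FTens E u [] ** (wi u ## FUnit E) = (FTens E u [] ** (Idn D (FObj E u) ## FUnit E)) ** (wi u ## Idn D \<one>)" by (simp add: inter)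
 also have "... = RUnit D (FObj E u) ** (wi u ## Idn D \<one>)" using E.runit[of u] by (simp add: FM_str Wd_DC E_id)
 finally show ?case using r_nat[of "wi u"] by (simp add: mu_Nil word_iso_simps)
next
 case (snoc v x)
 note [simp] = snoc(1,2,4) E_letter
 let ?k = "(Idn D (W u) ## kap v x) ** a (W u) (W v) (h x)" and ?x = "Idn D (h x)"
 have as: "FTens E (u @ v) [x] ** (FTens E u v ## ?x) = FTens E u (v @ [x]) ** (Idn D (FObj E u) ## FTens E v [x]) ** a (FObj E u) (FObj E v) (h x)"
  using E.assoc[of u v "[x]"] by (simp add: FM_str Wd_DC E_id)
 show ?case
 proof (rule cancel_right[of _ ?k])
  have "(wi (u @ v @ [x]) ** mu u (v @ [x])) ** ?k = (wi ((u @ v) @ [x]) ** kap (u @ v) x) ** (mu u v ## ?x)"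
   using mu_snoc[of u v x] by simp
  also have "... = FTens E (u @ v) [x] ** ((wi (u @ v) ** mu u v) ## ?x)" using cmp_rewrite[OF wi_kap[of "u @ v" x], of "mu u v ## ?x"] by (simp add: whisk)
  also have "... = (FTens E (u @ v) [x] ** (FTens E u v ## ?x)) ** ((wi u ## wi v) ## ?x)" unfolding snoc(3)[OF snoc(4)] by (simp add: whisk)
  also have "... = FTens E u (v @ [x]) ** (Idn D (FObj E u) ## FTens E v [x]) ** (wi u ## wi v ## ?x) ** a (W u) (W v) (h x)"
   unfolding as using a_nat[of "wi u" "wi v" ?x] by simp
  also have "... = FTens E u (v @ [x]) ** (wi u ## (FTens E v [x] ** (wi v ## ?x))) ** a (W u) (W v) (h x)" by (simp add: inter3)
  also have "... = (FTens E u (v @ [x]) ** (wi u ## wi (v @ [x]))) ** ?k" unfolding wi_kap[symmetric, OF snoc(1,2)] by (simp add: inter3)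
  finally show "(wi (u @ v @ [x]) ** mu u (v @ [x])) ** ?k = (FTens E u (v @ [x]) ** (wi u ## wi (v @ [x]))) ** ?k" .
 qed simp_all
qed

text \<open>For an arrow of \<open>G\<close> this is the hypothesis that \<open>E\<close> extends
  \<open>f\<close>; products and symmetries use \<open>wi_mu\<close>, and generation yields the
  rest. Thus \<open>wi\<close> is an isomorphism from the constructed functor to
  \<open>E\<close>.\<close>

lemma wi_natural: "A:Arr DC ==> wi (Cod DC A) ** mm A = FArr E (FM.cl A) ** wi (Dom DC A)"
proof (induction A rule: gen_induct[consumes 1])
 case (1 u)
 thus ?case by (simp add: Wd_DC mm(2) E_id del: FM.cl_id)
next
 case (2 u v)
 hence [simp]: "u:Wd" "v:Wd" by (simp_all add: Wd_DC)
 have s: "FArr E (FM.cl (Sym DC u v)) ** FTens E u v = FTens E v u ** Sym D (FObj E u) (FObj E v)" using E.sym[of u v] by (simp add: Wd_DC)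
 note [simp] = sy(1)[of u v, unfolded typed_def]
 note E_arr[of "Sym DC u v", simplified Wd_DC, simplified, simp]
 show ?case
 proof (rule cancel_right[of _ "mu u v"])
  have "wi (v @ u) ** sy u v ** mu u v = (wi (v @ u) ** mu v u) ** Sym D (W u) (W v)" by (simp add: sy(2))
  also have "... = FTens E v u ** Sym D (FObj E u) (FObj E v) ** (wi u ## wi v)" using s_nat[of "wi u" "wi v"] by (simp add: wi_mu)
  also have "... = FArr E (FM.cl (Sym DC u v)) ** wi (u @ v) ** mu u v" using cmp_rewrite[OF s[symmetric], of "wi u ## wi v"] by (simp add: wi_mu Wd_DC)
  finally show "(wi (Cod DC (Sym DC u v)) ** mm (Sym DC u v)) ** mu u v = (FArr E (FM.cl (Sym DC u v)) ** wi (Dom DC (Sym DC u v))) ** mu u v"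
   by (simp add: mm(3) Wd_DC)
 qed (simp_all add: Wd_DC mm(3))
next
 case (3 g h)
 have [simp]: "Dom DC g:Wd" "Cod DC g:Wd" "Dom DC h:Wd" "Cod DC h:Wd" using 3(1-3) by (simp_all flip: Wd_DC)
 have c: "FArr E (FM.cl (h **. g)) = FArr E (FM.cl h) ** FArr E (FM.cl g)"
  using E.comp[OF cl_hom[OF 3(1)], of "FM.cl h" "Cod DC h"] cl_hom[OF 3(2)] 3(1-3) by simp
 have "wi (Cod DC h) ** mm h ** mm g = (FArr E (FM.cl h) ** wi (Dom DC h)) ** mm g"
  using 3(1-3) 3(5) by (simp flip: cmp_assoc)
 also have "... = FArr E (FM.cl h) ** FArr E (FM.cl g) ** wi (Dom DC g)" using 3(1-4) by simp
 finally show ?case using 3(1-3) by (simp add: c mm(1) del: FM.cl_cmp)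
next
 case (4 g h)
 have [simp]: "Dom DC g:Wd" "Cod DC g:Wd" "Dom DC h:Wd" "Cod DC h:Wd" using 4(1,2) by (simp_all flip: Wd_DC)
 note [simp] = 4(1,2)
 let ?g = "FArr E (FM.cl g)" and ?h = "FArr E (FM.cl h)"
 have t: "FArr E (FM.cl (g ##. h)) ** FTens E (Dom DC g) (Dom DC h) = FTens E (Cod DC g) (Cod DC h) ** (?g ## ?h)"
  using E.tens_natural[OF cl_hom[OF 4(1)] cl_hom[OF 4(2)]] by simp
 note [simp del] = FM.cl_ten
 show ?case
 proof (rule cancel_right[of _ "mu (Dom DC g) (Dom DC h)"])
  have "wi (Cod DC g @ Cod DC h) ** mm (g ##. h) ** mu (Dom DC g) (Dom DC h) = (wi (Cod DC g @ Cod DC h) ** mu (Cod DC g) (Cod DC h)) ** (mm g ## mm h)"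
   by (simp add: mm_ten)
  also have "... = FTens E (Cod DC g) (Cod DC h) ** ((wi (Cod DC g) ** mm g) ## (wi (Cod DC h) ** mm h))" by (simp add: wi_mu inter)
  also have "... = (FTens E (Cod DC g) (Cod DC h) ** (?g ## ?h)) ** (wi (Dom DC g) ## wi (Dom DC h))" unfolding 4(3,4) by (simp add: inter)
  also have "... = FArr E (FM.cl (g ##. h)) ** wi (Dom DC g @ Dom DC h) ** mu (Dom DC g) (Dom DC h)" unfolding t[symmetric] by (simp add: wi_mu)
  finally show "(wi (Cod DC (g ##. h)) ** mm (g ##. h)) ** mu (Dom DC g) (Dom DC h) =
    (FArr E (FM.cl (g ##. h)) ** wi (Dom DC (g ##. h))) ** mu (Dom DC g) (Dom DC h)" by simp
 qed simp_all
next
 case (5 k)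
 thus ?case using arrow_words[of k] gen_arr[of k] E_arr[of "gen k"] E_arrow[of k] by (simp add: mm(4))
qed

end

context target
begin

theorem unique_iso:
 assumes "extension G D f E" "extension G D f E'"
 shows "EX \<theta>. monoidal_natural_iso FMC D E E' \<theta> & (ALL x:Letters G. \<theta> (HLetter (i_m G) x) = Idn D (FObj E (HLetter (i_m G) x))) &
  (ALL \<theta>'. monoidal_natural_iso FMC D E E' \<theta>' & (ALL x:Letters G. \<theta>' (HLetter (i_m G) x) = Idn D (FObj E (HLetter (i_m G) x))) -->
   (ALL X:Obj FMC. \<theta>' X = \<theta> X))"
proof -
 interpret A: extension G D f E by fact
 interpret B: extension G D f E' by fact
 \<comment> \<open>Both functors are isomorphic to the constructed one by their \<open>wi\<close>;
   the composite is an identity at the letters because each \<open>wi [x]\<close> is.\<close>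
 define \<theta> where "\<theta> w = B.wi w ** iv (A.wi w)" for w
 note O = A.Obj_FMC and I = A.i_m_letter
 have th [simp]: "isom (\<theta> w)" "\<theta> w:Arr D" "Dom D (\<theta> w) = FObj E w" "Cod D (\<theta> w) = FObj E' w" if "w:Wd" for w
  using that by (simp_all add: \<theta>_def)
 have thA: "\<theta> w ** A.wi w = B.wi w" if "w:Wd" for w using that by (simp add: \<theta>_def)
 have letter: "\<theta> [x] = Idn D (FObj E [x])" if "x:Letters G" for x
  using that by (simp add: \<theta>_def word_iso_simps A.E_letter B.E_letter)
 have nat: "monoidal_natural_iso FMC D E E' \<theta>"
 proof
  show "X:Obj FMC ==> \<theta> X:Hom D (FObj E X) (FObj E' X)" "X:Obj FMC ==> isom (\<theta> X)" for X by (simp_all add: Hom_def Wd_DC)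
  show "\<theta> Y ** FArr E g = FArr E' g ** \<theta> X" if g: "g:Hom FMC X Y" for g X Y
  proof -
   obtain k where k: "k:Arr DC" "Dom DC k = X" "Cod DC k = Y" "g = FM.cl k" using FM_rep[OF g] by blast
   hence [simp]: "X:Wd" "Y:Wd" "k:Arr DC" by (auto simp flip: Wd_DC)
   note m = mm_arr[OF k(1), unfolded k(2,3)] A.E_arr[OF k(1), unfolded k(2,3)] B.E_arr[OF k(1), unfolded k(2,3)]
   have nA: "A.wi Y ** mm k = FArr E (FM.cl k) ** A.wi X" and nB: "B.wi Y ** mm k = FArr E' (FM.cl k) ** B.wi X"
    using A.wi_natural[OF k(1)] B.wi_natural[OF k(1)] by (simp_all add: k(2,3))
   have "(\<theta> Y ** FArr E g) ** A.wi X = (\<theta> Y ** A.wi Y) ** mm k" using m by (simp add: k(4) nA)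
   also have "... = (FArr E' g ** \<theta> X) ** A.wi X" using m by (simp add: thA nB k(4))
   finally show ?thesis by (rule cancel_right) (use m in "simp_all add: k(4)")
  qed
  show "\<theta> (X \<otimes>\<^bsub>FMC\<^esub> Y) ** FTens E X Y = FTens E' X Y ** (\<theta> X ## \<theta> Y)" if "X:Obj FMC" "Y:Obj FMC" for X Y
  proof -
   from that have [simp]: "X:Wd" "Y:Wd" by (simp_all add: Wd_DC)
   have "(\<theta> (X @ Y) ** FTens E X Y) ** (A.wi X ## A.wi Y) = (\<theta> (X @ Y) ** A.wi (X @ Y)) ** mu X Y" by (simp add: A.wi_mu)
   also have "... = (FTens E' X Y ** (\<theta> X ## \<theta> Y)) ** (A.wi X ## A.wi Y)" by (simp add: inter thA B.wi_mu)
   finally have "\<theta> (X @ Y) ** FTens E X Y = FTens E' X Y ** (\<theta> X ## \<theta> Y)" by (rule cancel_right) simp_all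
   thus ?thesis by (simp add: FM_str)
  qed
  show "\<theta> \<one>\<^bsub>FMC\<^esub> ** FUnit E = FUnit E'" using thA[of "[]"] by (simp add: FM_str word_iso_simps)
 qed
 \<comment> \<open>A monoidal transformation is forced at the empty word by the unit axiom, and at
   \<open>w @ [x]\<close> by its components at \<open>w\<close> and \<open>[x]\<close>, because the
   structure arrows of \<open>E\<close> are invertible.\<close>
 have "\<theta>' w = \<theta> w"
  if n: "monoidal_natural_iso FMC D E E' \<theta>'" and l: "!!x. x:Letters G ==> \<theta>' [x] = Idn D (FObj E [x])" and w: "w:Wd" for \<theta>' w
  using w
 proof (induction w rule: Wd_induct)
  interpret N: monoidal_natural_iso FMC D E E' \<theta> by (rule nat)
  interpret N': monoidal_natural_iso FMC D E E' \<theta>' by (rule n)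
  have [simp]: "\<theta>' w:Arr D" "Dom D (\<theta>' w) = FObj E w" "Cod D (\<theta>' w) = FObj E' w" if "w:Wd" for w
   using N'.hom[of w] that by (simp_all add: Wd_DC Hom_def)
  case Nil
  show ?case by (rule cancel_right[of _ "FUnit E"]) (use N.unit N'.unit in "simp_all add: FM_str")
  case (snoc w x)
  note [simp] = snoc(1,2)
  show ?case
  proof (rule cancel_right[of _ "FTens E w [x]"])
   have o: "w:Obj FMC" "[x]:Obj FMC" by (simp_all add: Wd_DC)
   show "\<theta>' (w @ [x]) ** FTens E w [x] = \<theta> (w @ [x]) ** FTens E w [x]"
    using N.tens[OF o] N'.tens[OF o] unfolding FM_str l[OF snoc(2)] letter[OF snoc(2)] snoc(3) by (rule trans[OF _ sym, rotated])
  qed simp_all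
 qed
 note u = this
 show ?thesis unfolding I O
 proof (intro exI[of _ \<theta>] conjI ballI allI impI; (elim conjE)?)
  fix \<theta>' w
  assume "monoidal_natural_iso FMC D E E' \<theta>'" "ALL x:Letters G. \<theta>' [x] = Idn D (FObj E [x])" "w:Wd"
  thus "\<theta>' w = \<theta> w" by (intro u) auto
 qed (rule nat letter, assumption?)+
qed

end

theorem theorem4p1:
  fixes G :: "('s, 'a) dd_graph_monoid"
  assumes "free_dd_graph_monoid G"
  shows "markov_category (free_markov G) \<and>
    is_gm_hom G (free_markov G) (i_m G) \<and>
    matches_dd G (free_markov G) (i_m G) \<and>
    (\<forall>(D :: ('o, 'm) markov_cat) f.
       markov_category D \<and> is_gm_hom G D f \<and> matches_dd G D f \<longrightarrow>
       (\<exists>F. markov_functor (free_markov G) D F \<and>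
            gm_hom_eq G f (functor_gm_hom G (free_markov G) D F (i_m G))) \<and>
       (\<forall>F F'.
          markov_functor (free_markov G) D F \<and>
          gm_hom_eq G f (functor_gm_hom G (free_markov G) D F (i_m G)) \<and>
          markov_functor (free_markov G) D F' \<and>
          gm_hom_eq G f (functor_gm_hom G (free_markov G) D F' (i_m G)) \<longrightarrow>
          (\<exists>\<theta>. monoidal_natural_iso (free_markov G) D F F' \<theta> \<and>
               (\<forall>a \<in> Letters G. \<theta> (HLetter (i_m G) a) = Idn D (FObj F (HLetter (i_m G) a))) \<and>
               (\<forall>\<theta>'. monoidal_natural_iso (free_markov G) D F F' \<theta>' \<and>
                     (\<forall>a \<in> Letters G. \<theta>' (HLetter (i_m G) a) = Idn D (FObj F (HLetter (i_m G) a))) \<longrightarrow>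
                     (\<forall>X \<in> Obj (free_markov G). \<theta>' X = \<theta> X)))))"
proof -
 interpret ddg G using assms by unfold_locales (simp_all add: free_dd_graph_monoid_def)
 have T: "target G D f" if "markov_category D" "is_gm_hom G D f" "matches_dd G D f" for D :: "('o, 'm) markov_cat" and f
 proof -
  interpret markov_category D by (rule that(1))
  show ?thesis by unfold_locales (use that(2,3) in "auto simp: is_gm_hom_def")
 qed
 have E: "extension G D f F" if "target G D f" "markov_functor FMC D F" "gm_hom_eq G f (functor_gm_hom G FMC D F (i_m G))"
  for D :: "('o, 'm) markov_cat" and f F
  unfolding extension_def extension_axioms_def using that by (intro conjI)
 show ?thesis
 proof (intro conjI allI impI; (elim conjE)?)
  fix D :: "('o, 'm) markov_cat" and f
  assume "markov_category D" "is_gm_hom G D f" "matches_dd G D f"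
  hence t: "target G D f" by (rule T)
  show "EX F. markov_functor FMC D F & gm_hom_eq G f (functor_gm_hom G FMC D F (i_m G))"
   by (intro exI conjI) (rule target.markov_functor_F[OF t], rule target.F_extends[OF t])
  fix F F'
  assume "markov_functor FMC D F" "gm_hom_eq G f (functor_gm_hom G FMC D F (i_m G))"
   "markov_functor FMC D F'" "gm_hom_eq G f (functor_gm_hom G FMC D F' (i_m G))"
  thus "EX \<theta>. monoidal_natural_iso FMC D F F' \<theta> & (ALL x:Letters G. \<theta> (HLetter (i_m G) x) = Idn D (FObj F (HLetter (i_m G) x))) &
   (ALL \<theta>'. monoidal_natural_iso FMC D F F' \<theta>' & (ALL x:Letters G. \<theta>' (HLetter (i_m G) x) = Idn D (FObj F (HLetter (i_m G) x))) -->
    (ALL X:Obj FMC. \<theta>' X = \<theta> X))"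
   by (intro target.unique_iso[OF t] E[OF t])
 qed (rule markov i_m_hom i_m_matches)+
qed

end
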